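(* Let $\Delta$ be a shellable simplicial complex on $[n]$ with $\dim\Delta\le n-3$ and let $F_1,\dots,F_q$ be a shelling of $\Delta$. Then for any field $\mathbb{F}$, $\dim_{\mathbb{F}}H_i(\mathcal{V}^\circ_{\mathcal{A}_\Delta};\mathbb{F})$ equals the number of ordered shelling-trapped decompositions $((\bar\sigma_1,F_{i_1}),\dots,(\bar\sigma_p,F_{i_p}))$ (of subsets of $[n]$) with $i=n+p(2-n)+\sum_{j=1}^p|F_{i_j}|-2$.
   Context: For $S\subseteq[n]$, $U_S=\{u\in\mathbb{R}^n:u_i=u_j\ \forall i,j\in S\}$, $\mathcal{A}_\Delta=\{U_{[n]-F}:F\text{ facet of }\Delta\}$, and $\mathcal{V}^\circ_{\mathcal{A}_\Delta}=\mathbb{S}^{n-1}\cap\bigcup_{H\in\mathcal{A}_\Delta}H$ is the singularity link. A shelling is an ordering $F_1,\dots,F_q$ of all facets such that for each $k\ge2$, $(\bigcup_{i<k}2^{F_i})\cap2^{F_k}$ is pure of dimension $\dim F_k-1$. A wall of a facet is a codimension-one face. Set $G_1=F_1$ and for $i\ge2$ let $G_i$ be the intersection of the walls of $F_i$ lying in the subcomplex generated by $F_1,\dots,F_{i-1}$. For $\tau\subseteq[n]$ write $\bar\tau=[n]-\tau$. An ordered shelling-trapped decomposition of a subset $\bar\tau\subseteq[n]$ is a sequence $((\bar\sigma_1,F_{i_1}),\dots,(\bar\sigma_p,F_{i_p}))$ with $\bar\tau=\bigsqcup_{j=1}^p\bar\sigma_j$ (disjoint union) and facets $F_{i_j}$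 satisfying $G_{i_j}\subseteq\sigma_j\subseteq F_{i_j}$, where $\sigma_j=[n]-\bar\sigma_j$.
   Formalization: Homology is taken to be reduced, and only decompositions with p ≥ 1 are counted; with unreduced homology the claim fails already for a single nonempty facet, where the link is a sphere and nothing accounts for its degree-0 class. *)

theory Defs
  imports "HOL-Analysis.Analysis" "HOL-Homology.Homology"
begin

definition fchain :: "nat \<Rightarrow> 'a topology \<Rightarrow> (((nat \<Rightarrow> real) \<Rightarrow> 'a) \<Rightarrow> 'k::field) \<Rightarrow> bool" where
  "fchain p X c \<longleftrightarrow> finite {s. c s \<noteq> 0} \<and> (\<forall>s. c s \<noteq> 0 \<longrightarrow> singular_simplex p X s)"

definition fchain_boundary :: "nat \<Rightarrow> (((nat \<Rightarrow> real) \<Rightarrow> 'a) \<Rightarrow> 'k::field) \<Rightarrow> (((nat \<Rightarrow> real) \<Rightarrow> 'a) \<Rightarrow> 'k)" where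
  "fchain_boundary p c = (\<lambda>t. \<Sum>s\<in>{s. c s \<noteq> 0}. \<Sum>k\<le>p.
      if singular_face p k s = t then (-1) ^ k * c s else 0)"

definition reduced_fcycles :: "nat \<Rightarrow> 'a topology \<Rightarrow> (((nat \<Rightarrow> real) \<Rightarrow> 'a) \<Rightarrow> 'k::field) set" where
  "reduced_fcycles i X = {c. fchain i X c \<and>
      (if i = 0 then (\<Sum>s\<in>{s. c s \<noteq> 0}. c s) = 0 else fchain_boundary i c = (\<lambda>_. 0))}"

definition fboundaries :: "nat \<Rightarrow> 'a topology \<Rightarrow> (((nat \<Rightarrow> real) \<Rightarrow> 'a) \<Rightarrow> 'k::field) set" where
  "fboundaries i X = {fchain_boundary (Suc i) d | d. fchain (Suc i) X d}"

text \<open>\<open>reduced_homology_dim TYPE('k) X i N\<close>: the reduced singular homology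
  \<open>H~_i(X;'k) = Z~_i / B_i\<close> is a 'k-vector space of dimension N, i.e. there are N cycles
  whose classes form a basis of the quotient.\<close>
definition reduced_homology_dim :: "'k::field itself \<Rightarrow> 'a topology \<Rightarrow> nat \<Rightarrow> nat \<Rightarrow> bool" where
  "reduced_homology_dim (_::'k itself) X i N \<longleftrightarrow>
     (\<exists>S :: (((nat \<Rightarrow> real) \<Rightarrow> 'a) \<Rightarrow> 'k) set.
        finite S \<and> card S = N \<and> S \<subseteq> reduced_fcycles i X \<and>
        (\<forall>a. (\<lambda>t. \<Sum>s\<in>S. a s * s t) \<in> fboundaries i X \<longrightarrow> (\<forall>s\<in>S. a s = 0)) \<and>
        (\<forall>z\<in>reduced_fcycles i X. \<exists>a. (\<lambda>t. z t - (\<Sum>s\<in>S. a s * s t)) \<in> fboundaries i X))"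

definition simplicial_complex :: "'n set set \<Rightarrow> bool" where
  "simplicial_complex D \<longleftrightarrow> D \<noteq> {} \<and> (\<forall>F\<in>D. \<forall>G. G \<subseteq> F \<longrightarrow> G \<in> D)"

definition facets :: "'n set set \<Rightarrow> 'n set set" where
  "facets D = {F\<in>D. \<forall>G\<in>D. F \<subseteq> G \<longrightarrow> G = F}"

definition pure_card :: "'n set set \<Rightarrow> nat \<Rightarrow> bool" where
  "pure_card K d \<longleftrightarrow> (\<forall>H\<in>facets K. card H = d)"

definition shelling :: "'n set set \<Rightarrow> 'n set list \<Rightarrow> bool" where
  "shelling D Fs \<longleftrightarrow> distinct Fs \<and> set Fs = facets D \<and>
     (\<forall>k. 0 < k \<and> k < length Fs \<longrightarrow>
        pure_card ((\<Union>i<k. Pow (Fs ! i)) \<inter> Pow (Fs ! k)) (card (Fs ! k) - 1))"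

definition shelling_G :: "'n set list \<Rightarrow> nat \<Rightarrow> 'n set" where
  "shelling_G Fs i = (if i = 0 then Fs ! 0 else
      Fs ! i \<inter> \<Inter>{W. W \<subseteq> Fs ! i \<and> card W + 1 = card (Fs ! i) \<and> (\<exists>j<i. W \<subseteq> Fs ! j)})"

text \<open>Ordered shelling-trapped decomposition of some subset of the ground set (the subset being
  the union of the first components): list of pairs (sigma-bar_j, index i_j of the facet F_{i_j}).\<close>
definition shelling_trapped_decomp :: "'n set list \<Rightarrow> ('n set \<times> nat) list \<Rightarrow> bool" where
  "shelling_trapped_decomp Fs ds \<longleftrightarrow>
     (\<forall>a<length ds. \<forall>b<length ds. a \<noteq> b \<longrightarrow> fst (ds ! a) \<inter> fst (ds ! b) = {}) \<and>
     (\<forall>(S, j)\<in>set ds. j < length Fs \<and> shelling_G Fs j \<subseteq> - S \<and> - S \<subseteq> Fs ! j)"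

definition U_set :: "'n::finite set \<Rightarrow> (real ^ 'n) set" where
  "U_set S = {u. \<forall>i\<in>S. \<forall>j\<in>S. u $ i = u $ j}"

definition singularity_link :: "'n::finite set set \<Rightarrow> (real ^ 'n) set" where
  "singularity_link D = sphere 0 1 \<inter> (\<Union>F\<in>facets D. U_set (- F))"

end

theory Submission
  imports Defs "HOL-Library.Function_Algebras"
begin

text \<open>Scaled to maximum norm 1, a point of the singularity link is a convex combination of the sign
  vectors of its superlevel sets, which form a flag, and it lies in the arrangement iff some complement
  \<open>[n] - F\<close> of a facet is not split by any member of this flag. So the link is homeomorphic to the
  polyhedron of a complex of flags, and its singular homology is the simplicial one: small singular
  simplices are pushed linearly to the affine simplices on their labels, and the resulting chain maps are
  compared by acyclic carriers.

  The flags without the ground set form a cone with apex the empty set. The others are the ordered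
  partitions of \<open>[n]\<close>, with merging of blocks as boundary, in which some block contains the complement of a
  facet. A shelling divides the upper set of such blocks into the intervals from \<open>[n] - F\<^sub>j\<close> to
  \<open>([n] - F\<^sub>j) \<union> G\<^sub>j\<close>. Splitting off and merging single elements matches all partitions of this kind
  except those whose first block in the upper set is exactly \<open>[n] - F\<^sub>j\<close> and is followed by singletons in a
  fixed order; the union \<open>S\<close> of these last blocks satisfies \<open>G\<^sub>j \<subseteq> [n] - S \<subseteq> F\<^sub>j\<close>, and in front of them stands a
  partition of \<open>[n] - S\<close> with no block in the upper set. All ordered partitions of a nonempty set form an
  acyclic complex up to one class, which relates the partitions with and without such a block, and the
  decompositions are built up one pair \<open>(S, j)\<close> at a time.\<close>

section \<open>Finitely supported chains\<close>

declare plus_fun_apply [simp del] zero_fun_apply [simp del]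

text \<open>Chains are functions with the pointwise group structure. The pointwise rules are
  unfolded only on request, so that equations between chains stay equations between
  functions.\<close>

lemmas fun_apply = plus_fun_apply zero_fun_apply minus_apply uminus_apply

definition supp :: "('b \<Rightarrow> 'k::zero) \<Rightarrow> 'b set" where
  "supp c = {b. c b \<noteq> 0}"

definition scl :: "'k::times \<Rightarrow> ('b \<Rightarrow> 'k) \<Rightarrow> 'b \<Rightarrow> 'k" where
  "scl a c = (\<lambda>t. a * c t)"

definition sgl :: "'b \<Rightarrow> 'b \<Rightarrow> 'k::zero_neq_one" where
  "sgl b = (\<lambda>t. if t = b then 1 else 0)"

text \<open>The linear extension of \<open>f\<close> from basis elements to chains. Chains are plain
  functions, so finiteness of supports appears as a side condition when chains are added.\<close>

definition lext :: "('b \<Rightarrow> 'c \<Rightarrow> 'k::field) \<Rightarrow> ('b \<Rightarrow> 'k) \<Rightarrow> 'c \<Rightarrow> 'k" where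
  "lext f c = (\<lambda>t. \<Sum>b\<in>supp c. c b * f b t)"

lemma sum_fun_apply: "(\<Sum>s\<in>S. f s) t = (\<Sum>s\<in>S. f s t)"
  by (induction S rule: infinite_finite_induct) (simp_all add: fun_apply)

lemma scl_apply: "scl a c t = a * c t"
  by (simp add: scl_def)

lemma scl_simps [simp]:
  fixes c :: "'b \<Rightarrow> 'k::field"
  shows "scl 0 c = 0" "scl 1 c = c" "scl a (0 :: 'b \<Rightarrow> 'k) = 0" "scl a (scl b c) = scl (a * b) c"
    "scl (-1) c = - c"
  by (auto simp: scl_def fun_apply)

lemma scl_add: "scl a (c + d) = scl a c + scl (a::'k::field) d"
  by (auto simp: scl_def fun_apply algebra_simps)

lemma scl_diff: "scl a (c - d) = scl a c - scl (a::'k::field) d"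
  by (auto simp: scl_def fun_apply algebra_simps)

lemma scl_minus: "scl a (- c) = - scl (a::'k::field) c" "scl (- a) c = - scl (a::'k::field) c"
  by (auto simp: scl_def fun_apply algebra_simps)

lemma scl_sum: "scl (a::'k::field) (\<Sum>s\<in>S. f s) = (\<Sum>s\<in>S. scl a (f s))"
  by (induction S rule: infinite_finite_induct) (simp_all add: scl_add)

lemma supp_0 [simp]: "supp 0 = {}" "supp (\<lambda>_. 0) = {}"
  by (auto simp: supp_def fun_apply)

lemma supp_sgl [simp]: "supp (sgl b :: 'b \<Rightarrow> 'k::zero_neq_one) = {b}"
  by (auto simp: supp_def sgl_def)

lemma supp_add: "supp (c + d) \<subseteq> supp c \<union> supp (d :: 'b \<Rightarrow> 'k::field)"
  by (auto simp: supp_def fun_apply)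

lemma supp_diff: "supp (c - d) \<subseteq> supp c \<union> supp (d :: 'b \<Rightarrow> 'k::field)"
  by (auto simp: supp_def fun_apply)

lemma supp_uminus [simp]: "supp (- d) = supp (d :: 'b \<Rightarrow> 'k::field)"
  by (auto simp: supp_def fun_apply)

lemma supp_scl: "supp (scl a c) \<subseteq> supp (c :: 'b \<Rightarrow> 'k::field)"
  by (auto simp: supp_def scl_def)

lemma supp_sum: "supp (\<Sum>s\<in>S. f s :: 'b \<Rightarrow> 'k::field) \<subseteq> (\<Union>s\<in>S. supp (f s))"
proof
  fix t assume "t \<in> supp (\<Sum>s\<in>S. f s)"
  then have "(\<Sum>s\<in>S. f s t) \<noteq> 0" by (simp add: supp_def sum_fun_apply)
  then obtain s where "s \<in> S" "f s t \<noteq> 0" by (meson sum.not_neutral_contains_not_neutral)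
  then show "t \<in> (\<Union>s\<in>S. supp (f s))" by (auto simp: supp_def fun_apply)
qed

lemma finite_supp_add [simp]: "finite (supp c) \<Longrightarrow> finite (supp d) \<Longrightarrow> finite (supp (c + d :: 'b \<Rightarrow> 'k::field))"
  by (rule finite_subset[OF supp_add]) blast

lemma finite_supp_diff [simp]: "finite (supp c) \<Longrightarrow> finite (supp d) \<Longrightarrow> finite (supp (c - d :: 'b \<Rightarrow> 'k::field))"
  by (rule finite_subset[OF supp_diff]) blast

lemma finite_supp_scl [simp]: "finite (supp c) \<Longrightarrow> finite (supp (scl a c :: 'b \<Rightarrow> 'k::field))"
  by (rule finite_subset[OF supp_scl])

lemma finite_supp_sum:
  assumes "\<And>s. s \<in> S \<Longrightarrow> finite (supp (f s :: 'b \<Rightarrow> 'k::field))"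
  shows "finite (supp (\<Sum>s\<in>S. f s))"
proof (cases "finite S")
  case True
  then have "finite (\<Union>s\<in>S. supp (f s))" using assms by blast
  then show ?thesis by (rule finite_subset[OF supp_sum])
qed simp

lemma lext_eq_sum:
  assumes "finite A" "supp c \<subseteq> A"
  shows "lext f c t = (\<Sum>b\<in>A. c b * f b t)"
  unfolding lext_def by (rule sum.mono_neutral_left) (use assms in \<open>auto simp: supp_def\<close>)

lemma lext_alt: "lext f c = (\<Sum>b\<in>supp c. scl (c b) (f b))"
  by (auto simp: lext_def scl_def sum_fun_apply)

lemma supp_lext: "supp (lext f c) \<subseteq> (\<Union>b\<in>supp c. supp (f b))"
  unfolding lext_alt using supp_sum supp_scl by fastforce

lemma finite_supp_lext [simp]:
  "finite (supp c) \<Longrightarrow> (\<And>b. b \<in> supp c \<Longrightarrow> finite (supp (f b))) \<Longrightarrow> finite (supp (lext f c))"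
  by (rule finite_subset[OF supp_lext]) blast

lemma lext_sgl [simp]: "lext f (sgl b) = f b"
  by (simp add: lext_alt) (simp add: sgl_def)

lemma lext_0 [simp]: "lext f 0 = 0" "lext (\<lambda>_. 0) c = 0" "lext 0 c = 0"
  by (auto simp: lext_def fun_apply)

lemma lext_add:
  assumes "finite (supp c)" "finite (supp d)"
  shows "lext f (c + d) = lext f c + lext f d"
proof
  fix t
  let ?A = "supp c \<union> supp d"
  have fin: "finite ?A" using assms by auto
  show "lext f (c + d) t = (lext f c + lext f d) t"
    using lext_eq_sum[OF fin, of c f t] lext_eq_sum[OF fin, of d f t] lext_eq_sum[OF fin supp_add, of f t]
    by (simp add: sum.distrib fun_apply algebra_simps)
qed

lemma lext_scl: "lext f (scl a c) = scl a (lext f c)"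
proof (cases "a = 0")
  case False
  then have "supp (scl a c) = supp c" by (auto simp: supp_def scl_def)
  then show ?thesis by (simp add: lext_def scl_def sum_distrib_left mult.assoc)
qed simp

lemma lext_uminus: "lext f (- c) = - lext f c"
  using lext_scl[of f "-1" c] by simp

lemma lext_diff:
  assumes "finite (supp c)" "finite (supp d)"
  shows "lext f (c - d) = lext f c - lext f d"
  using lext_add[of c "-d" f] assms by (simp add: lext_uminus)

lemma lext_sum:
  "(\<And>s. s \<in> S \<Longrightarrow> finite (supp (g s))) \<Longrightarrow> lext f (\<Sum>s\<in>S. g s) = (\<Sum>s\<in>S. lext f (g s))"
proof (induction S rule: infinite_finite_induct)
  case (insert x F)
  have "finite (supp (\<Sum>s\<in>F. g s))" by (rule finite_supp_sum) (use insert in blast)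
  moreover have "lext f (\<Sum>s\<in>F. g s) = (\<Sum>s\<in>F. lext f (g s))" by (rule insert.IH) (use insert in blast)
  moreover have "finite (supp (g x))" using insert by blast
  ultimately show ?case using insert.hyps by (simp add: lext_add)
qed simp_all

text \<open>Together with \<open>lext_cong\<close> this reduces identities between chain maps and
  homotopies to basis elements.\<close>

lemma lext_lext:
  assumes "finite (supp c)" "\<And>b. b \<in> supp c \<Longrightarrow> finite (supp (g b))"
  shows "lext f (lext g c) = lext (\<lambda>b. lext f (g b)) c"
proof -
  have "lext f (lext g c) = (\<Sum>b\<in>supp c. lext f (scl (c b) (g b)))"
    unfolding lext_alt[of g] by (rule lext_sum) (use assms in auto)
  also have "\<dots> = lext (\<lambda>b. lext f (g b)) c"
    by (simp add: lext_scl lext_alt[of "\<lambda>b. lext f (g b)"])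
  finally show ?thesis .
qed

lemma lext_cong: "(\<And>b. b \<in> supp c \<Longrightarrow> f b = g b) \<Longrightarrow> lext f c = lext g c"
  by (auto simp: lext_def fun_apply)

lemma lext_sgl_id: "finite (supp c) \<Longrightarrow> lext sgl c = c"
proof
  fix t assume fin: "finite (supp c)"
  have "lext sgl c t = (\<Sum>b\<in>insert t (supp c). c b * sgl b t)"
    by (rule lext_eq_sum) (use fin in auto)
  also have "\<dots> = (\<Sum>b\<in>insert t (supp c). if b = t then c b else 0)"
    by (rule sum.cong) (auto simp: sgl_def)
  also have "\<dots> = c t" using fin by (subst sum.delta) auto
  finally show "lext sgl c t = c t" .
qed

lemma lext_fun_add: "lext (\<lambda>b. f b + g b) c = lext f c + lext g c"
  by (auto simp: lext_def sum.distrib fun_apply algebra_simps)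

lemma lext_fun_diff: "lext (\<lambda>b. f b - g b) c = lext f c - lext g c"
  by (auto simp: lext_def sum_subtractf fun_apply algebra_simps)

lemma lext_fun_scl: "lext (\<lambda>b. scl a (f b)) c = scl a (lext f c)"
  by (auto simp: lext_def scl_def sum_distrib_left mult.left_commute)

section \<open>Dimensions of quotients of function spaces\<close>

definition lsub :: "('b \<Rightarrow> 'k::field) set \<Rightarrow> bool" where
  "lsub Z \<longleftrightarrow> 0 \<in> Z \<and> (\<forall>x\<in>Z. \<forall>y\<in>Z. \<forall>a. x + scl a y \<in> Z)"

text \<open>The shape of \<open>reduced_homology_dim\<close> for arbitrary \<open>Z\<close> and
  \<open>B\<close>: representatives whose classes form a basis. Every change of complex below is a
  transfer of such a basis.\<close>

definition hdim :: "('b \<Rightarrow> 'k::field) set \<Rightarrow> ('b \<Rightarrow> 'k) set \<Rightarrow> nat \<Rightarrow> bool" where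
  "hdim Z B N \<longleftrightarrow> (\<exists>S. finite S \<and> card S = N \<and> S \<subseteq> Z \<and>
     (\<forall>a. (\<Sum>s\<in>S. scl (a s) s) \<in> B \<longrightarrow> (\<forall>s\<in>S. a s = 0)) \<and>
     (\<forall>z\<in>Z. \<exists>a. z - (\<Sum>s\<in>S. scl (a s) s) \<in> B))"

lemma lsub_0: "lsub Z \<Longrightarrow> 0 \<in> Z"
  by (simp add: lsub_def)

lemma lsub_lin: "lsub Z \<Longrightarrow> x \<in> Z \<Longrightarrow> y \<in> Z \<Longrightarrow> x + scl a y \<in> Z"
  by (simp add: lsub_def)

lemma lsub_add: "lsub Z \<Longrightarrow> x \<in> Z \<Longrightarrow> y \<in> Z \<Longrightarrow> x + y \<in> Z"
  using lsub_lin[of Z x y 1] by simp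

lemma lsub_diff: "lsub Z \<Longrightarrow> x \<in> Z \<Longrightarrow> y \<in> Z \<Longrightarrow> x - y \<in> Z"
  using lsub_lin[of Z x y "-1"] by simp

lemma lsub_scl: "lsub Z \<Longrightarrow> y \<in> Z \<Longrightarrow> scl a y \<in> Z"
  using lsub_lin[of Z 0 y a] lsub_0 by auto

lemma lsub_uminus: "lsub Z \<Longrightarrow> y \<in> Z \<Longrightarrow> - y \<in> Z"
  using lsub_scl[of Z y "-1"] by simp

lemma lsub_sum: "lsub Z \<Longrightarrow> (\<And>s. s \<in> S \<Longrightarrow> f s \<in> Z) \<Longrightarrow> (\<Sum>s\<in>S. f s) \<in> Z"
  by (induction S rule: infinite_finite_induct) (auto simp: lsub_0 lsub_add)

lemma hdimE:
  assumes "hdim Z B N"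
  obtains S where "finite S" "card S = N" "S \<subseteq> Z"
    "\<And>a. (\<Sum>s\<in>S. scl (a s) s) \<in> B \<Longrightarrow> \<forall>s\<in>S. a s = 0"
    "\<And>z. z \<in> Z \<Longrightarrow> \<exists>a. z - (\<Sum>s\<in>S. scl (a s) s) \<in> B"
proof -
  have "\<exists>S. finite S \<and> card S = N \<and> S \<subseteq> Z \<and>
     (\<forall>a. (\<Sum>s\<in>S. scl (a s) s) \<in> B \<longrightarrow> (\<forall>s\<in>S. a s = 0)) \<and>
     (\<forall>z\<in>Z. \<exists>a. z - (\<Sum>s\<in>S. scl (a s) s) \<in> B)"
    using assms unfolding hdim_def .
  then show ?thesis
    apply (elim exE conjE)
    apply (rule that)
        apply assumption
       apply assumption
      apply assumption
     apply (erule allE, erule (1) mp)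
    apply (erule (1) bspec)
    done
qed

text \<open>An isomorphism of quotients is given as a linear relation instead of a map. Lifts and
  connecting homomorphisms are defined only up to a choice, and a relation needs none. Condition
  \<open>iff\<close> yields well-definedness and injectivity together.\<close>

lemma hdim_rel:
  assumes "hdim Z B N" and lin: "\<And>a x x' y y'. R x x' \<Longrightarrow> R y y' \<Longrightarrow> R (x + scl a y) (x' + scl a y')"
    and zero: "R 0 0"
    and tot: "\<And>z. z \<in> Z \<Longrightarrow> \<exists>z'\<in>Z'. R z z'" and sur: "\<And>z'. z' \<in> Z' \<Longrightarrow> \<exists>z\<in>Z. R z z'"
    and iff: "\<And>z z'. z \<in> Z \<Longrightarrow> z' \<in> Z' \<Longrightarrow> R z z' \<Longrightarrow> z \<in> B \<longleftrightarrow> z' \<in> B'"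
    and sub: "lsub Z" "lsub Z'" "lsub B"
  shows "hdim Z' B' N"
proof -
  obtain S where S: "finite S" "card S = N" "S \<subseteq> Z"
    "\<And>a. (\<Sum>s\<in>S. scl (a s) s) \<in> B \<Longrightarrow> \<forall>s\<in>S. a s = 0"
    "\<And>z. z \<in> Z \<Longrightarrow> \<exists>a. z - (\<Sum>s\<in>S. scl (a s) s) \<in> B"
    by (rule hdimE[OF assms(1)]) (rule that, assumption+)
  have "\<forall>s\<in>S. \<exists>z'. z' \<in> Z' \<and> R s z'" using tot S(3) by blast
  then obtain f where f: "\<And>s. s \<in> S \<Longrightarrow> f s \<in> Z' \<and> R s (f s)" by metis
  have Rsum: "R (\<Sum>s\<in>S. scl (a s) s) (\<Sum>s\<in>S. scl (a s) (f s))" for a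
  proof -
    have "T \<subseteq> S \<Longrightarrow> R (\<Sum>s\<in>T. scl (a s) s) (\<Sum>s\<in>T. scl (a s) (f s))" for T
    proof (induction T rule: infinite_finite_induct)
      case (insert x T)
      then have "R ((\<Sum>s\<in>T. scl (a s) s) + scl (a x) x) ((\<Sum>s\<in>T. scl (a s) (f s)) + scl (a x) (f x))"
        using f by (intro lin) auto
      then show ?case unfolding sum.insert[OF insert.hyps(1,2)] by (simp only: add.commute)
    qed (use zero in auto)
    then show ?thesis by blast
  qed
  have Zs: "(\<Sum>s\<in>S. scl (a s) s) \<in> Z" for a
    using S(3) by (intro lsub_sum sub lsub_scl) auto
  have Zs': "(\<Sum>s\<in>S. scl (a s) (f s)) \<in> Z'" for a
    using f by (intro lsub_sum sub lsub_scl) auto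
  have ind: "\<forall>s\<in>S. a s = 0" if "(\<Sum>s\<in>S. scl (a s) (f s)) \<in> B'" for a
  proof -
    have "(\<Sum>s\<in>S. scl (a s) s) \<in> B"
      by (rule iffD2[OF iff[OF Zs[of a] Zs'[of a] Rsum[of a]]]) (rule that)
    then show ?thesis by (rule S(4)[of a])
  qed
  have 0: "0 \<in> B'" using iff[OF lsub_0[OF sub(1)] lsub_0[OF sub(2)] zero] lsub_0[OF sub(3)] by simp
  \<comment> \<open>If two representatives had the same image, the combination with coefficients 1
    and -1 would be 0 and thus lie in \<open>B'\<close>.\<close>
  have inj: "inj_on f S"
  proof (rule inj_onI, rule ccontr)
    fix s t assume st: "s \<in> S" "t \<in> S" "f s = f t" "s \<noteq> t"
    let ?a = "\<lambda>u. if u = s then 1 else if u = t then -1 else 0"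
    have "(\<Sum>u\<in>S. scl (?a u) (f u)) = (\<Sum>u\<in>S. (if u = s then f s else 0) + (if u = t then - f t else 0))"
      by (rule sum.cong) (use st in auto)
    also have "\<dots> = 0" using st S(1) by (simp add: sum.distrib)
    finally have *: "(\<Sum>u\<in>S. scl (?a u) (f u)) = 0" .
    from ind[of ?a, unfolded *, OF 0] st(1) show False by auto
  qed
  have resum: "(\<Sum>u\<in>f ` S. scl (a u) u) = (\<Sum>s\<in>S. scl (a (f s)) (f s))" for a
    using inj by (simp add: sum.reindex)
  show ?thesis
    unfolding hdim_def
  proof (intro exI[of _ "f ` S"] conjI allI impI ballI)
    show "finite (f ` S)" "card (f ` S) = N" "f ` S \<subseteq> Z'"
      using S inj f by (auto simp: card_image)
  next
    fix a u assume "(\<Sum>s\<in>f ` S. scl (a s) s) \<in> B'" "u \<in> f ` S"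
    then show "a u = 0" using ind[of "a \<circ> f"] by (auto simp: resum)
  next
    fix z' assume z': "z' \<in> Z'"
    then obtain z where z: "z \<in> Z" "R z z'" using sur by blast
    from S(5)[OF z(1)] obtain a where a: "z - (\<Sum>s\<in>S. scl (a s) s) \<in> B" ..
    have "R (z - (\<Sum>s\<in>S. scl (a s) s)) (z' - (\<Sum>s\<in>S. scl (a s) (f s)))"
      using lin[OF z(2) Rsum[of a], of "-1"] by simp
    then have "z' - (\<Sum>s\<in>S. scl (a s) (f s)) \<in> B'"
      using a iff[OF lsub_diff[OF sub(1) z(1) Zs[of a]] lsub_diff[OF sub(2) z' Zs'[of a]]] by simp
    moreover have "(\<Sum>s\<in>S. scl (a s) (f s)) = (\<Sum>u\<in>f ` S. scl (a (inv_into S f u)) u)"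
      unfolding resum by (rule sum.cong) (use inj in auto)
    ultimately show "\<exists>a. z' - (\<Sum>s\<in>f ` S. scl (a s) s) \<in> B'"
      by (intro exI[of _ "\<lambda>u. a (inv_into S f u)"]) simp
  qed
qed

lemma hdim_0:
  assumes "\<And>z. z \<in> Z \<Longrightarrow> z \<in> B"
  shows "hdim Z B 0"
  unfolding hdim_def by (rule exI[of _ "{}"]) (use assms in auto)

text \<open>A functional that vanishes on \<open>B\<close> but not on all of \<open>Z\<close>
  accounts for exactly one dimension: \<open>z0\<close> completes a basis of the classes in its
  kernel. Below, the functional is the coefficient of a word of maximal length.\<close>

lemma hdim_Suc:
  assumes "hdim {z \<in> Z. \<phi> z = 0} B N" "lsub Z" "lsub B" "z0 \<in> Z" "\<phi> z0 \<noteq> 0"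
    and \<phi>: "\<And>x y a. \<phi> (x + scl a y) = \<phi> x + a * (\<phi> y :: 'k::field)"
    and B: "\<And>b. b \<in> B \<Longrightarrow> \<phi> b = 0"
  shows "hdim Z B (Suc N)"
proof -
  have \<phi>0: "\<phi> 0 = 0" using B assms(3) lsub_0 by blast
  have \<phi>s: "\<phi> (scl a y) = a * \<phi> y" for a y using \<phi>[of 0 a y] \<phi>0 by simp
  have \<phi>a: "\<phi> (x + y) = \<phi> x + \<phi> y" for x y using \<phi>[of x 1 y] by simp
  have \<phi>sum: "\<phi> (\<Sum>s\<in>S. f s) = (\<Sum>s\<in>S. \<phi> (f s))" for S and f :: "('b \<Rightarrow> 'k) \<Rightarrow> _"
    by (induction S rule: infinite_finite_induct) (simp_all add: \<phi>0 \<phi>a)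
  obtain S where S: "finite S" "card S = N" "S \<subseteq> {z \<in> Z. \<phi> z = 0}"
    "\<And>a. (\<Sum>s\<in>S. scl (a s) s) \<in> B \<Longrightarrow> \<forall>s\<in>S. a s = 0"
    "\<And>z. z \<in> {z \<in> Z. \<phi> z = 0} \<Longrightarrow> \<exists>a. z - (\<Sum>s\<in>S. scl (a s) s) \<in> B"
    by (rule hdimE[OF assms(1)]) (rule that, assumption+)
  have n: "z0 \<notin> S" using S(3) assms(5) by auto
  have sum: "(\<Sum>s\<in>insert z0 S. scl (a s) s) = scl (a z0) z0 + (\<Sum>s\<in>S. scl (a s) s)" for a
    using n S(1) by simp
  show ?thesis unfolding hdim_def
  proof (intro exI[of _ "insert z0 S"] conjI allI impI)
    show "finite (insert z0 S)" "card (insert z0 S) = Suc N" "insert z0 S \<subseteq> Z"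
      using S n assms by auto
  next
    fix a assume a: "(\<Sum>s\<in>insert z0 S. scl (a s) s) \<in> B"
    then have "a z0 * \<phi> z0 + (\<Sum>s\<in>S. a s * \<phi> s) = 0"
      using B[OF a] by (simp add: sum \<phi>a \<phi>s \<phi>sum)
    moreover have "(\<Sum>s\<in>S. a s * \<phi> s) = 0" using S(3) by (intro sum.neutral) auto
    ultimately have a0: "a z0 = 0" using assms(5) by simp
    then show "\<forall>s\<in>insert z0 S. a s = 0" using a S(4)[of a] by (simp add: sum)
  next
    show "\<forall>z\<in>Z. \<exists>a. z - (\<Sum>s\<in>insert z0 S. scl (a s) s) \<in> B"
    proof
      fix z assume z: "z \<in> Z"
      let ?c = "\<phi> z / \<phi> z0"
      have "z - scl ?c z0 \<in> {z \<in> Z. \<phi> z = 0}"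
        using lsub_lin[OF assms(2) z assms(4), of "- ?c"] \<phi>[of z "- ?c" z0] assms(5)
        by (simp add: scl_minus)
      then obtain a where "z - scl ?c z0 - (\<Sum>s\<in>S. scl (a s) s) \<in> B" using S(5) by blast
      moreover have "(\<Sum>s\<in>S. scl ((a(z0 := ?c)) s) s) = (\<Sum>s\<in>S. scl (a s) s)"
        by (rule sum.cong) (use n in auto)
      ultimately show "\<exists>a. z - (\<Sum>s\<in>insert z0 S. scl (a s) s) \<in> B"
        by (intro exI[of _ "a(z0 := ?c)"]) (simp only: sum, simp add: diff_diff_eq)
    qed
  qed
qed

text \<open>The condition on sums \<open>x + y\<close> expresses that the quotient is a direct sum;
  it already forces the two sets of representatives to be disjoint.\<close>

lemma hdim_plus:
  assumes "hdim Z1 B1 N1" "hdim Z2 B2 N2" and sub: "lsub Z1" "lsub Z2" "lsub B1" "lsub B2"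
    and Z: "Z = {x + y | x y. x \<in> Z1 \<and> y \<in> Z2}"
    and iff: "\<And>x y. x \<in> Z1 \<Longrightarrow> y \<in> Z2 \<Longrightarrow> x + y \<in> B \<longleftrightarrow> x \<in> B1 \<and> y \<in> B2"
  shows "hdim Z B (N1 + N2)"
proof -
  obtain S where S: "finite S" "card S = N1" "S \<subseteq> Z1"
    "\<And>a. (\<Sum>s\<in>S. scl (a s) s) \<in> B1 \<Longrightarrow> \<forall>s\<in>S. a s = 0"
    "\<And>z. z \<in> Z1 \<Longrightarrow> \<exists>a. z - (\<Sum>s\<in>S. scl (a s) s) \<in> B1"
    by (rule hdimE[OF assms(1)]) (rule that, assumption+)
  obtain T where T: "finite T" "card T = N2" "T \<subseteq> Z2"
    "\<And>a. (\<Sum>s\<in>T. scl (a s) s) \<in> B2 \<Longrightarrow> \<forall>s\<in>T. a s = 0"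
    "\<And>z. z \<in> Z2 \<Longrightarrow> \<exists>a. z - (\<Sum>s\<in>T. scl (a s) s) \<in> B2"
    by (rule hdimE[OF assms(2)]) (rule that, assumption+)
  have Zs: "(\<Sum>s\<in>S. scl (a s) s) \<in> Z1" for a
    using S(3) by (intro lsub_sum sub lsub_scl) auto
  have Zt: "(\<Sum>s\<in>T. scl (a s) s) \<in> Z2" for a
    using T(3) by (intro lsub_sum sub lsub_scl) auto
  have 0: "0 \<in> B" using iff[OF lsub_0[OF sub(1)] lsub_0[OF sub(2)]] sub by (simp add: lsub_0)
  \<comment> \<open>A common element \<open>s\<close> gives \<open>s + (- s) = 0\<close>, so
    \<open>s\<close> would be in \<open>B1\<close>, against the independence of
    \<open>S\<close>.\<close>
  have disj: "S \<inter> T = {}"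
  proof (rule ccontr)
    assume "S \<inter> T \<noteq> {}"
    then obtain s where s: "s \<in> S" "s \<in> T" by auto
    then have "s + (- s) \<in> B \<longleftrightarrow> s \<in> B1 \<and> - s \<in> B2"
      using S(3) T(3) sub by (intro iff) (auto intro: lsub_uminus)
    then have "s \<in> B1" using 0 by simp
    moreover have "(\<Sum>u\<in>S. scl (if u = s then 1 else 0) u) = (\<Sum>u\<in>S. if u = s then u else 0)"
      by (rule sum.cong) auto
    ultimately have "(\<Sum>u\<in>S. scl (if u = s then 1 else 0) u) \<in> B1"
      using s S(1) by simp
    then show False using S(4)[of "\<lambda>u. if u = s then 1 else 0"] s by auto
  qed
  have sum: "(\<Sum>s\<in>S \<union> T. scl (a s) s) = (\<Sum>s\<in>S. scl (a s) s) + (\<Sum>s\<in>T. scl (a s) s)" for a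
    using disj S(1) T(1) by (simp add: sum.union_disjoint)
  show ?thesis unfolding hdim_def
  proof (intro exI[of _ "S \<union> T"] conjI allI impI)
    show "finite (S \<union> T)" "card (S \<union> T) = N1 + N2"
      using S T disj by (auto simp: card_Un_disjoint)
    have "s \<in> Z" if "s \<in> S" for s
      unfolding Z using that S(3) sub lsub_0 by (intro CollectI exI[of _ s] exI[of _ 0]) auto
    moreover have "s \<in> Z" if "s \<in> T" for s
      unfolding Z using that T(3) sub lsub_0 by (intro CollectI exI[of _ 0] exI[of _ s]) auto
    ultimately show "S \<union> T \<subseteq> Z" by auto
  next
    fix a assume "(\<Sum>s\<in>S \<union> T. scl (a s) s) \<in> B"
    then have *: "(\<Sum>s\<in>S. scl (a s) s) \<in> B1 \<and> (\<Sum>s\<in>T. scl (a s) s) \<in> B2"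
      unfolding sum using iff[OF Zs[of a] Zt[of a]] by simp
    have "\<forall>s\<in>S. a s = 0" "\<forall>s\<in>T. a s = 0"
      using S(4)[OF conjunct1[OF *]] T(4)[OF conjunct2[OF *]] .
    then show "\<forall>s\<in>S \<union> T. a s = 0" by blast
  next
    show "\<forall>z\<in>Z. \<exists>a. z - (\<Sum>s\<in>S \<union> T. scl (a s) s) \<in> B"
    proof
      fix z assume "z \<in> Z"
      then have "\<exists>x y. z = x + y \<and> x \<in> Z1 \<and> y \<in> Z2" unfolding Z mem_Collect_eq .
      then obtain x y where xy: "z = x + y" "x \<in> Z1" "y \<in> Z2" by (elim exE conjE) (rule that)
      from S(5)[OF xy(2)] obtain a where a: "x - (\<Sum>s\<in>S. scl (a s) s) \<in> B1" ..
      from T(5)[OF xy(3)] obtain b where b: "y - (\<Sum>s\<in>T. scl (b s) s) \<in> B2" ..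
      let ?c = "\<lambda>s. if s \<in> S then a s else b s"
      have c: "(\<Sum>s\<in>S. scl (?c s) s) = (\<Sum>s\<in>S. scl (a s) s)"
        "(\<Sum>s\<in>T. scl (?c s) s) = (\<Sum>s\<in>T. scl (b s) s)"
        by (rule sum.cong; use disj in auto)+
      have e: "z - (\<Sum>s\<in>S \<union> T. scl (?c s) s)
           = (x - (\<Sum>s\<in>S. scl (a s) s)) + (y - (\<Sum>s\<in>T. scl (b s) s))"
        unfolding sum xy(1) c by (simp only: algebra_simps)
      have "z - (\<Sum>s\<in>S \<union> T. scl (?c s) s) \<in> B"
        unfolding e using iff[OF lsub_diff[OF sub(1) xy(2) Zs[of a]] lsub_diff[OF sub(2) xy(3) Zt[of b]]] a b by simp
      then show "\<exists>a. z - (\<Sum>s\<in>S \<union> T. scl (a s) s) \<in> B" by (intro exI[of _ ?c])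
    qed
  qed
qed

section \<open>Chain complexes spanned by words\<close>

definition rst :: "'b set \<Rightarrow> ('b \<Rightarrow> 'k::zero) \<Rightarrow> 'b \<Rightarrow> 'k" where
  "rst W c = (\<lambda>x. if x \<in> W then c x else 0)"

lemma supp_rst: "supp (rst W c) = W \<inter> supp c"
  by (auto simp: supp_def rst_def)

lemma finite_supp_rst [simp]: "finite (supp c) \<Longrightarrow> finite (supp (rst W c))"
  by (simp add: supp_rst)

lemma rst_id: "supp c \<subseteq> W \<Longrightarrow> rst W c = c"
  by (rule ext) (auto simp: supp_def rst_def)

lemma rst_rst: "rst V (rst W c) = rst (V \<inter> W) c"
  by (auto simp: rst_def)

lemma rst_0: "rst W (0 :: 'b \<Rightarrow> 'k::zero) = 0"
  by (auto simp: rst_def fun_apply)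

lemma rst_add: "rst W (c + d) = rst W c + rst W (d :: 'b \<Rightarrow> 'k::field)"
  by (auto simp: rst_def fun_apply)

lemma rst_diff: "rst W (c - d) = rst W c - rst W (d :: 'b \<Rightarrow> 'k::field)"
  by (auto simp: rst_def fun_apply)

lemma rst_scl: "rst W (scl a c) = scl a (rst W (c :: 'b \<Rightarrow> 'k::field))"
  by (auto simp: rst_def scl_def)

lemma rst_lext: "rst W (lext f c) = lext (\<lambda>b. rst W (f b)) c"
  by (auto simp: rst_def lext_def)

lemma rst_split: "N \<subseteq> W \<Longrightarrow> rst W c = rst (W - N) c + rst N (c :: 'b \<Rightarrow> 'k::field)"
  by (rule ext) (auto simp: rst_def fun_apply)

lemma rst_eq_0: "W \<inter> supp c = {} \<Longrightarrow> rst W c = 0"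
  by (rule ext) (auto simp: supp_def rst_def fun_apply)

lemma rst_0_supp: "rst W c = (0 :: 'b \<Rightarrow> 'k::zero) \<Longrightarrow> W \<inter> supp c = {}"
  by (auto simp: supp_def rst_def fun_eq_iff fun_apply split: if_splits)

lemma lext_supp_0: "(\<And>b. b \<in> supp c \<Longrightarrow> f b = 0) \<Longrightarrow> lext f c = 0"
  using lext_cong[of c f "\<lambda>_. 0"] by simp

definition cplx :: "('a list \<Rightarrow> 'a list \<Rightarrow> 'k::field) \<Rightarrow> 'a list set \<Rightarrow> bool" where
  "cplx bd W \<longleftrightarrow> (\<forall>y. finite (supp (bd y))) \<and> (\<forall>y x. x \<in> supp (bd y) \<longrightarrow> Suc (length x) = length y) \<and>
     (\<forall>y\<in>W. rst W (lext bd (rst W (bd y))) = 0)"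

definition chn :: "'a list set \<Rightarrow> nat \<Rightarrow> ('a list \<Rightarrow> 'k::field) set" where
  "chn W i = {c. finite (supp c) \<and> supp c \<subseteq> {w \<in> W. length w = i}}"

text \<open>The boundary of the subquotient spanned by \<open>W\<close>: terms outside \<open>W\<close> are dropped.\<close>

definition dd :: "('a list \<Rightarrow> 'a list \<Rightarrow> 'k::field) \<Rightarrow> 'a list set \<Rightarrow> ('a list \<Rightarrow> 'k) \<Rightarrow> 'a list \<Rightarrow> 'k" where
  "dd bd W c = lext (\<lambda>y. rst W (bd y)) c"

definition cyc :: "('a list \<Rightarrow> 'a list \<Rightarrow> 'k::field) \<Rightarrow> 'a list set \<Rightarrow> nat \<Rightarrow> ('a list \<Rightarrow> 'k) set" where
  "cyc bd W i = {c \<in> chn W i. dd bd W c = 0}"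

definition bnd :: "('a list \<Rightarrow> 'a list \<Rightarrow> 'k::field) \<Rightarrow> 'a list set \<Rightarrow> nat \<Rightarrow> ('a list \<Rightarrow> 'k) set" where
  "bnd bd W i = dd bd W ` chn W (Suc i)"

abbreviation hd_dim :: "('a list \<Rightarrow> 'a list \<Rightarrow> 'k::field) \<Rightarrow> 'a list set \<Rightarrow> nat \<Rightarrow> nat \<Rightarrow> bool" where
  "hd_dim bd W i n \<equiv> hdim (cyc bd W i) (bnd bd W i) n"

definition acyc :: "('a list \<Rightarrow> 'a list \<Rightarrow> 'k::field) \<Rightarrow> 'a list set \<Rightarrow> bool" where
  "acyc bd W \<longleftrightarrow> (\<forall>i. cyc bd W i \<subseteq> bnd bd W i)"

text \<open>Closure is asked relative to \<open>W\<close> only, because \<open>W\<close> may itself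
  be a quotient in which further boundary terms are dropped.\<close>

definition subcplx :: "('a list \<Rightarrow> 'a list \<Rightarrow> 'k::field) \<Rightarrow> 'a list set \<Rightarrow> 'a list set \<Rightarrow> bool" where
  "subcplx bd N W \<longleftrightarrow> N \<subseteq> W \<and> (\<forall>y\<in>N. \<forall>x\<in>W. bd y x \<noteq> 0 \<longrightarrow> x \<in> N)"

lemma cplx_fin: "cplx bd W \<Longrightarrow> finite (supp (bd y))"
  by (simp add: cplx_def)

lemma cplx_len: "cplx bd W \<Longrightarrow> bd y x \<noteq> 0 \<Longrightarrow> Suc (length x) = length y"
  by (simp add: cplx_def supp_def)

lemma chn_fin: "c \<in> chn W i \<Longrightarrow> finite (supp c)"
  by (simp add: chn_def)

lemma chn_mem: "c \<in> chn W i \<Longrightarrow> w \<in> supp c \<Longrightarrow> w \<in> W \<and> length w = i"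
  by (auto simp: chn_def)

lemma chn_supp: "c \<in> chn W i \<Longrightarrow> supp c \<subseteq> W"
  by (auto simp: chn_def)

lemma chnI: "finite (supp c) \<Longrightarrow> (\<And>w. w \<in> supp c \<Longrightarrow> w \<in> W \<and> length w = i) \<Longrightarrow> c \<in> chn W i"
  by (auto simp: chn_def)

lemma chn_mono: "c \<in> chn N i \<Longrightarrow> N \<subseteq> W \<Longrightarrow> c \<in> chn W i"
  by (auto simp: chn_def)

lemma chn_sgl: "w \<in> W \<Longrightarrow> sgl w \<in> chn W (length w)"
  by (auto simp: chn_def)

lemma chn_rst: "c \<in> chn W i \<Longrightarrow> Q \<subseteq> W \<Longrightarrow> rst Q c \<in> chn Q i"
  by (auto simp: chn_def supp_rst)

lemma lsub_chn: "lsub (chn W i)"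
  unfolding lsub_def
proof (intro conjI ballI allI)
  fix x y :: "'a list \<Rightarrow> 'b" and a assume xy: "x \<in> chn W i" "y \<in> chn W i"
  have "supp (x + scl a y) \<subseteq> supp x \<union> supp y" using supp_add supp_scl by fastforce
  then show "x + scl a y \<in> chn W i" using xy by (auto simp: chn_def)
qed (auto simp: chn_def)

lemma dd_add: "finite (supp c) \<Longrightarrow> finite (supp d) \<Longrightarrow> dd bd W (c + d) = dd bd W c + dd bd W d"
  by (simp add: dd_def lext_add)

lemma dd_diff: "finite (supp c) \<Longrightarrow> finite (supp d) \<Longrightarrow> dd bd W (c - d) = dd bd W c - dd bd W d"
  by (simp add: dd_def lext_diff)

lemma dd_scl: "dd bd W (scl a c) = scl a (dd bd W c)"
  by (simp add: dd_def lext_scl)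

lemma dd_0 [simp]: "dd bd W 0 = 0"
  by (simp add: dd_def)

lemma dd_alt: "dd bd W c = rst W (lext bd c)"
  by (simp add: dd_def rst_lext)

lemma dd_chn:
  assumes "cplx bd W" "c \<in> chn V (Suc i)"
  shows "dd bd W c \<in> chn W i"
proof (rule chnI)
  show "finite (supp (dd bd W c))"
    unfolding dd_alt by (intro finite_supp_rst finite_supp_lext chn_fin[OF assms(2)] cplx_fin[OF assms(1)])
  fix w assume "w \<in> supp (dd bd W c)"
  then have w: "w \<in> W" "w \<in> supp (lext bd c)" by (auto simp: dd_alt supp_rst)
  then obtain b where b: "b \<in> supp c" "w \<in> supp (bd b)" using supp_lext[of bd c] by blast
  then have "Suc (length w) = length b" using assms(1) by (auto simp: cplx_def)
  then show "w \<in> W \<and> length w = i" using chn_mem[OF assms(2) b(1)] w by simp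
qed

lemma dd_chn_0:
  assumes "cplx bd W" "c \<in> chn V 0"
  shows "dd bd W c = 0"
  unfolding dd_def
proof (rule lext_supp_0)
  fix b assume "b \<in> supp c"
  then have "length b = 0" using chn_mem[OF assms(2)] by blast
  then have "bd b x = 0" for x using cplx_len[OF assms(1), of b x] by auto
  then have "supp (bd b) = {}" by (auto simp: supp_def)
  then show "rst W (bd b) = 0" by (intro rst_eq_0) auto
qed

lemma dd_dd:
  assumes "cplx bd W" "c \<in> chn W i"
  shows "dd bd W (dd bd W c) = 0"
proof -
  have "dd bd W (dd bd W c) = lext (\<lambda>b. lext (\<lambda>y. rst W (bd y)) (rst W (bd b))) c"
    unfolding dd_def by (rule lext_lext) (use chn_fin[OF assms(2)] cplx_fin[OF assms(1)] in auto)
  also have "\<dots> = 0"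
    by (rule lext_supp_0) (use assms chn_mem[OF assms(2)] in \<open>auto simp: cplx_def rst_lext\<close>)
  finally show ?thesis .
qed

lemma lsub_cyc: "lsub (cyc bd W i)"
  unfolding lsub_def cyc_def
proof (intro conjI ballI allI CollectI)
  show "(0 :: 'a list \<Rightarrow> 'b) \<in> chn W i" by (rule lsub_0[OF lsub_chn])
  fix x y :: "'a list \<Rightarrow> 'b" and a assume xy: "x \<in> {c \<in> chn W i. dd bd W c = 0}" "y \<in> {c \<in> chn W i. dd bd W c = 0}"
  then show "x + scl a y \<in> chn W i" using lsub_lin[OF lsub_chn] by blast
  show "dd bd W (x + scl a y) = 0"
    using xy chn_fin[of x W i] chn_fin[of y W i] by (simp add: dd_add dd_scl)
qed simp

lemma lsub_bnd: "lsub (bnd bd W i)"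
  unfolding lsub_def bnd_def
proof (intro conjI ballI allI)
  show "0 \<in> dd bd W ` chn W (Suc i)"
    by (rule image_eqI[of _ _ 0]) (simp_all add: lsub_0[OF lsub_chn])
  fix x y :: "'a list \<Rightarrow> 'b" and a assume "x \<in> dd bd W ` chn W (Suc i)" "y \<in> dd bd W ` chn W (Suc i)"
  then obtain e f where ef: "x = dd bd W e" "y = dd bd W f" "e \<in> chn W (Suc i)" "f \<in> chn W (Suc i)" by blast
  show "x + scl a y \<in> dd bd W ` chn W (Suc i)"
    by (rule image_eqI[of _ _ "e + scl a f"])
      (use ef lsub_lin[OF lsub_chn] in \<open>simp_all add: dd_add dd_scl chn_fin\<close>)
qed

lemma bnd_cyc: "cplx bd W \<Longrightarrow> b \<in> bnd bd W i \<Longrightarrow> b \<in> cyc bd W i"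
  unfolding bnd_def cyc_def using dd_chn dd_dd by blast

lemma bndI: "e \<in> chn W (Suc i) \<Longrightarrow> dd bd W e \<in> bnd bd W i"
  by (simp add: bnd_def)

lemma bndE: "b \<in> bnd bd W i \<Longrightarrow> (\<And>e. e \<in> chn W (Suc i) \<Longrightarrow> b = dd bd W e \<Longrightarrow> P) \<Longrightarrow> P"
  by (auto simp: bnd_def)

lemma cycI: "c \<in> chn W i \<Longrightarrow> dd bd W c = 0 \<Longrightarrow> c \<in> cyc bd W i"
  by (simp add: cyc_def)

lemma cycD: "c \<in> cyc bd W i \<Longrightarrow> c \<in> chn W i \<and> dd bd W c = 0"
  by (simp add: cyc_def)

lemma acycD: "acyc bd W \<Longrightarrow> c \<in> cyc bd W i \<Longrightarrow> c \<in> bnd bd W i"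
  by (auto simp: acyc_def)

lemma subcplx_rst: "subcplx bd N W \<Longrightarrow> y \<in> N \<Longrightarrow> rst W (bd y) = rst N (bd y)"
  by (rule ext) (auto simp: rst_def subcplx_def)

lemma dd_sub:
  assumes "subcplx bd N W" "c \<in> chn N i"
  shows "dd bd W c = dd bd N c"
  unfolding dd_def
proof (rule lext_cong)
  fix b assume "b \<in> supp c"
  then have "b \<in> N" using chn_mem[OF assms(2)] by blast
  then show "rst W (bd b) = rst N (bd b)" by (rule subcplx_rst[OF assms(1)])
qed

lemma dd_quot:
  assumes "subcplx bd N W" "c \<in> chn W i"
  shows "rst (W - N) (dd bd W c) = dd bd (W - N) (rst (W - N) c)"
proof -
  have NW: "N \<subseteq> W" using assms by (simp add: subcplx_def)
  have "c = rst (W - N) c + rst N c"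
    using rst_split[OF NW, of c] rst_id[OF chn_supp[OF assms(2)]] by simp
  then have "dd bd W c = dd bd W (rst (W - N) c) + dd bd W (rst N c)"
    using dd_add[of "rst (W - N) c" "rst N c" bd W] chn_fin[OF assms(2)] by simp
  moreover have "dd bd W (rst N c) = dd bd N (rst N c)"
    by (rule dd_sub[OF assms(1) chn_rst[OF assms(2) NW]])
  moreover have "rst (W - N) (dd bd N (rst N c)) = 0" by (auto simp: dd_alt rst_def fun_apply)
  moreover have "rst (W - N) (dd bd W (rst (W - N) c)) = dd bd (W - N) (rst (W - N) c)"
    by (auto simp: dd_alt rst_def)
  ultimately show ?thesis by (simp add: rst_add)
qed

section \<open>Subcomplexes, quotients and pieces of the long exact sequence\<close>

lemma cplx_sub:
  assumes "cplx bd W" "subcplx bd N W"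
  shows "cplx bd N"
  unfolding cplx_def
proof (intro conjI allI ballI impI)
  fix y assume y: "y \<in> N"
  have 1: "rst N (bd y) = rst W (bd y)" using subcplx_rst[OF assms(2) y] by simp
  have "rst N (lext bd (rst N (bd y))) = rst N (rst W (lext bd (rst W (bd y))))"
    unfolding 1 using assms(2) by (auto simp: rst_rst subcplx_def Int_absorb2)
  also have "\<dots> = 0" using assms y by (auto simp: cplx_def subcplx_def rst_0)
  finally show "rst N (lext bd (rst N (bd y))) = 0" .
qed (use assms in \<open>auto simp: cplx_def\<close>)

lemma cplx_quot:
  assumes "cplx bd W" "subcplx bd N W"
  shows "cplx bd (W - N)"
  unfolding cplx_def
proof (intro conjI allI ballI impI)
  fix y assume y: "y \<in> W - N"
  have NW: "N \<subseteq> W" using assms by (simp add: subcplx_def)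
  have yy: "sgl y \<in> chn W (length y)" using y by (intro chn_sgl) auto
  have s: "rst (W - N) (sgl y) = (sgl y :: _ \<Rightarrow> 'b)" by (rule rst_id) (use y in auto)
  have "rst (W - N) (lext bd (rst (W - N) (bd y))) = dd bd (W - N) (dd bd (W - N) (sgl y))"
    by (simp add: dd_alt)
  also have "\<dots> = dd bd (W - N) (rst (W - N) (dd bd W (sgl y)))"
    using dd_quot[OF assms(2) yy] s by simp
  also have "\<dots> = 0"
  proof (cases "length y")
    case 0
    then have "dd bd W (sgl y) = 0" using dd_chn_0[OF assms(1)] yy by simp
    then show ?thesis by (simp add: rst_0)
  next
    case (Suc j)
    then have "dd bd W (sgl y) \<in> chn W j" using dd_chn[OF assms(1)] yy by metis
    from dd_quot[OF assms(2) this] show ?thesis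
      using dd_dd[OF assms(1) yy] by (simp add: rst_0)
  qed
  finally show "rst (W - N) (lext bd (rst (W - N) (bd y))) = 0" .
qed (use assms in \<open>auto simp: cplx_def\<close>)

text \<open>The homology sequence of a pair with acyclic \<open>N\<close>: projection to the
  quotient is an isomorphism, and the relation is this projection read backwards.\<close>

lemma hd_dim_quot:
  fixes bd :: "'a list \<Rightarrow> 'a list \<Rightarrow> 'k::field"
  assumes W: "cplx bd W" and N: "subcplx bd N W" and ac: "acyc bd N" and h: "hd_dim bd (W - N) i n"
  shows "hd_dim bd W i n"
proof (rule hdim_rel[OF h, where R = "\<lambda>z z'. z = rst (W - N) z'"])
  have NW: "N \<subseteq> W" using N by (simp add: subcplx_def)
  \<comment> \<open>A cycle that vanishes in the quotient is a cycle of \<open>N\<close>, hence a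
    boundary there.\<close>
  have small: "c \<in> bnd bd N j" if "c \<in> chn W j" "dd bd W c = 0" "rst (W - N) c = 0" for c j
  proof -
    have "supp c \<subseteq> N" using rst_0_supp[OF that(3)] chn_supp[OF that(1)] by auto
    then have c: "c \<in> chn N j" using that(1) by (auto simp: chn_def)
    then have "c \<in> cyc bd N j" using dd_sub[OF N c] that by (simp add: cycI)
    then show ?thesis by (rule acycD[OF ac])
  qed
  have bN: "c \<in> chn N j \<and> dd bd W c = 0" if "c \<in> bnd bd N j" for c j
    using bnd_cyc[OF cplx_sub[OF W N] that] dd_sub[OF N] by (auto simp: cyc_def)
  show "x + scl a y = rst (W - N) (x' + scl a y')"
    if "x = rst (W - N) x'" "y = rst (W - N) y'" for a :: 'k and x x' y y'
    using that by (simp add: rst_add rst_scl)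
  show "(0 :: 'a list \<Rightarrow> 'k) = rst (W - N) 0" by (simp add: rst_0)
  show "\<exists>z'\<in>cyc bd W i. z = rst (W - N) z'" if z: "z \<in> cyc bd (W - N) i" for z
  proof -
    have zc: "z \<in> chn (W - N) i" "dd bd (W - N) z = 0" using cycD[OF z] by auto
    have zW: "z \<in> chn W i" by (rule chn_mono[OF zc(1)]) auto
    have zr: "rst (W - N) z = z" by (rule rst_id[OF chn_supp[OF zc(1)]])
    \<comment> \<open>The boundary of a lift of \<open>z\<close> is a cycle of \<open>N\<close>. A
      chain of \<open>N\<close> with the same boundary corrects the lift to a cycle; in degree 0
      there is nothing to correct.\<close>
    have "\<exists>e \<in> chn N i. dd bd W e = dd bd W z"
    proof (cases i)
      case 0
      then show ?thesis using dd_chn_0[OF W] zW lsub_0[OF lsub_chn] by (metis dd_0)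
    next
      case (Suc j)
      have "dd bd W z \<in> bnd bd N j"
        using dd_chn[OF W] zW Suc dd_dd[OF W zW] dd_quot[OF N zW] zr zc by (intro small) auto
      then show ?thesis using dd_sub[OF N] Suc by (metis bndE)
    qed
    then obtain e where e: "e \<in> chn N i" "dd bd W e = dd bd W z" by blast
    have er: "rst (W - N) e = 0" by (rule rst_eq_0) (use chn_supp[OF e(1)] in auto)
    have "z - e \<in> cyc bd W i"
      by (rule cycI) (use e zW chn_mono[OF e(1) NW] in \<open>simp_all add: dd_diff chn_fin lsub_diff[OF lsub_chn]\<close>)
    moreover have "z = rst (W - N) (z - e)" using er zr by (simp add: rst_diff)
    ultimately show ?thesis by blast
  qed
  show "\<exists>z\<in>cyc bd (W - N) i. z = rst (W - N) z'" if z': "z' \<in> cyc bd W i" for z'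
  proof -
    have "rst (W - N) z' \<in> cyc bd (W - N) i"
      using cycD[OF z'] dd_quot[OF N, of z' i] by (intro cycI chn_rst[of _ W]) (auto simp: rst_0)
    then show ?thesis by blast
  qed
  show "z \<in> bnd bd (W - N) i \<longleftrightarrow> z' \<in> bnd bd W i"
    if z: "z \<in> cyc bd (W - N) i" and z': "z' \<in> cyc bd W i" and r: "z = rst (W - N) z'" for z z'
  proof
    assume "z \<in> bnd bd (W - N) i"
    then obtain e where e: "e \<in> chn (W - N) (Suc i)" "z = dd bd (W - N) e" by (rule bndE)
    have eW: "e \<in> chn W (Suc i)" by (rule chn_mono[OF e(1)]) auto
    have er: "rst (W - N) e = e" by (rule rst_id[OF chn_supp[OF e(1)]])
    have dW: "dd bd W e \<in> chn W i" by (rule dd_chn[OF W eW])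
    have "z' - dd bd W e \<in> bnd bd N i"
    proof (rule small)
      show "z' - dd bd W e \<in> chn W i" using cycD[OF z'] dW lsub_diff[OF lsub_chn] by blast
      show "dd bd W (z' - dd bd W e) = 0"
        using cycD[OF z'] dd_dd[OF W eW] chn_fin[OF dW] chn_fin[OF conjunct1[OF cycD[OF z']]] by (simp add: dd_diff)
      show "rst (W - N) (z' - dd bd W e) = 0"
        using dd_quot[OF N eW] er e r by (simp add: rst_diff)
    qed
    then obtain f where f: "f \<in> chn N (Suc i)" "z' - dd bd W e = dd bd N f" by (rule bndE)
    have "z' = dd bd W (e + f)"
      using f dd_sub[OF N f(1)] eW by (simp add: dd_add chn_fin algebra_simps)
    moreover have "e + f \<in> chn W (Suc i)" using eW chn_mono[OF f(1) NW] lsub_add[OF lsub_chn] by blast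
    ultimately show "z' \<in> bnd bd W i" using bndI by metis
  next
    assume "z' \<in> bnd bd W i"
    then obtain e where e: "e \<in> chn W (Suc i)" "z' = dd bd W e" by (rule bndE)
    then have "z = dd bd (W - N) (rst (W - N) e)" using r dd_quot[OF N e(1)] by simp
    moreover have "rst (W - N) e \<in> chn (W - N) (Suc i)" by (rule chn_rst[OF e(1)]) auto
    ultimately show "z \<in> bnd bd (W - N) i" using bndI by metis
  qed
qed (rule lsub_cyc lsub_bnd)+

text \<open>The connecting homomorphism of the pair, bijective because \<open>W\<close> is acyclic.
  A cycle \<open>z\<close> of \<open>N\<close> is related to \<open>z'\<close> when it is homologous
  in \<open>N\<close> to the boundary of \<open>z'\<close> taken in \<open>W\<close>.\<close>

lemma hd_dim_connect:
  fixes bd :: "'a list \<Rightarrow> 'a list \<Rightarrow> 'k::field"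
  assumes W: "cplx bd W" and N: "subcplx bd N W" and ac: "acyc bd W" and h: "hd_dim bd N i n"
  shows "hd_dim bd (W - N) (Suc i) n"
proof (rule hdim_rel[OF h, where R = "\<lambda>z z'. z' \<in> chn (W - N) (Suc i) \<and> z - dd bd W z' \<in> bnd bd N i"])
  have NW: "N \<subseteq> W" using N by (simp add: subcplx_def)
  note cN = cplx_sub[OF W N]
  have rc: "rst N c = c" if "c \<in> chn W j" "rst (W - N) c = 0" for c j
    using rst_split[OF NW, of c] rst_id[OF chn_supp[OF that(1)]] that(2) by simp
  have up: "c \<in> chn W j" if "c \<in> chn (W - N) j" for c j by (rule chn_mono[OF that]) auto
  have rz: "rst (W - N) c = c" if "c \<in> chn (W - N) j" for c j
    by (rule rst_id[OF chn_supp[OF that]])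
  have r0: "rst (W - N) c = 0" if "c \<in> chn N j" for c j
    by (rule rst_eq_0) (use chn_supp[OF that] in auto)
  have dz: "dd bd W z \<in> cyc bd N i" if z: "z \<in> cyc bd (W - N) (Suc i)" for z
  proof -
    have zW: "z \<in> chn W (Suc i)" using cycD[OF z] up by blast
    have d: "dd bd W z \<in> chn W i" by (rule dd_chn[OF W zW])
    have "rst (W - N) (dd bd W z) = 0" using dd_quot[OF N zW] cycD[OF z] rz[of z "Suc i"] by simp
    then have "dd bd W z \<in> chn N i" using chn_rst[OF d NW] rc[OF d] by simp
    moreover have "dd bd N (dd bd W z) = 0" using dd_sub[OF N calculation] dd_dd[OF W zW] by simp
    ultimately show ?thesis by (rule cycI)
  qed
  show "x' + scl a y' \<in> chn (W - N) (Suc i) \<and> x + scl a y - dd bd W (x' + scl a y') \<in> bnd bd N i"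
    if "x' \<in> chn (W - N) (Suc i) \<and> x - dd bd W x' \<in> bnd bd N i"
      "y' \<in> chn (W - N) (Suc i) \<and> y - dd bd W y' \<in> bnd bd N i" for a :: 'k and x x' y y'
  proof
    show "x' + scl a y' \<in> chn (W - N) (Suc i)" using that lsub_lin[OF lsub_chn] by blast
    have eq: "x + scl a y - dd bd W (x' + scl a y') = (x - dd bd W x') + scl a (y - dd bd W y')"
      using that(1,2)[THEN conjunct1, THEN chn_fin] by (simp add: dd_add dd_scl scl_diff)
    show "x + scl a y - dd bd W (x' + scl a y') \<in> bnd bd N i"
      unfolding eq by (rule lsub_lin[OF lsub_bnd conjunct2[OF that(1)] conjunct2[OF that(2)]])
  qed
  show "(0 :: 'a list \<Rightarrow> 'k) \<in> chn (W - N) (Suc i) \<and> 0 - dd bd W 0 \<in> bnd bd N i"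
    unfolding dd_0 diff_0_right by (rule conjI[OF lsub_0[OF lsub_chn] lsub_0[OF lsub_bnd]])
  show "\<exists>z'\<in>cyc bd (W - N) (Suc i). z' \<in> chn (W - N) (Suc i) \<and> z - dd bd W z' \<in> bnd bd N i"
    if z: "z \<in> cyc bd N i" for z
  proof -
    have zN: "z \<in> chn N i" using cycD[OF z] by simp
    have "z \<in> cyc bd W i" using cycD[OF z] dd_sub[OF N zN] chn_mono[OF zN NW] by (simp add: cycI)
    then obtain e where e: "e \<in> chn W (Suc i)" "z = dd bd W e" using acycD[OF ac] by (metis bndE)
    let ?z = "rst (W - N) e" and ?n = "rst N e"
    have ez: "e = ?z + ?n" using rst_split[OF NW, of e] rst_id[OF chn_supp[OF e(1)]] by simp
    have n: "?n \<in> chn N (Suc i)" by (rule chn_rst[OF e(1) NW])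
    have zz: "?z \<in> chn (W - N) (Suc i)" by (rule chn_rst[OF e(1)]) auto
    have "dd bd (W - N) ?z = rst (W - N) z" using dd_quot[OF N e(1)] e(2) by simp
    then have "?z \<in> cyc bd (W - N) (Suc i)" using r0[OF zN] zz by (simp add: cycI)
    moreover have "z = dd bd W ?z + dd bd N ?n"
      using e dd_add[of ?z ?n bd W] ez n zz dd_sub[OF N n] by (metis chn_fin)
    then have "z - dd bd W ?z \<in> bnd bd N i" using bndI[OF n, of bd] by simp
    ultimately show ?thesis using zz by blast
  qed
  show "\<exists>z\<in>cyc bd N i. z' \<in> chn (W - N) (Suc i) \<and> z - dd bd W z' \<in> bnd bd N i"
    if z': "z' \<in> cyc bd (W - N) (Suc i)" for z'
    by (rule bexI[OF _ dz[OF z']]) (use cycD[OF z'] lsub_0[OF lsub_bnd] in simp)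
  show "z \<in> bnd bd N i \<longleftrightarrow> z' \<in> bnd bd (W - N) (Suc i)"
    if z: "z \<in> cyc bd N i" and z': "z' \<in> cyc bd (W - N) (Suc i)"
      and r: "z' \<in> chn (W - N) (Suc i) \<and> z - dd bd W z' \<in> bnd bd N i" for z z'
  proof -
    have "z \<in> bnd bd N i \<longleftrightarrow> dd bd W z' \<in> bnd bd N i"
      using r lsub_diff[OF lsub_bnd, of z bd N i "z - dd bd W z'"]
        lsub_add[OF lsub_bnd, of "z - dd bd W z'" bd N i "dd bd W z'"] by auto
    also have "\<dots> \<longleftrightarrow> z' \<in> bnd bd (W - N) (Suc i)"
    proof
      assume "dd bd W z' \<in> bnd bd N i"
      then obtain f where f: "f \<in> chn N (Suc i)" "dd bd W z' = dd bd N f" by (rule bndE)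
      have fW: "f \<in> chn W (Suc i)" by (rule chn_mono[OF f(1) NW])
      have zW: "z' \<in> chn W (Suc i)" using r up by blast
      have "z' - f \<in> cyc bd W (Suc i)"
        using f dd_sub[OF N f(1)] fW zW by (intro cycI) (simp_all add: dd_diff chn_fin lsub_diff[OF lsub_chn])
      then obtain e where e: "e \<in> chn W (Suc (Suc i))" "z' - f = dd bd W e" using acycD[OF ac] by (metis bndE)
      have "rst (W - N) (z' - f) = z'" using r0[OF f(1)] rz[of z' "Suc i"] r by (simp add: rst_diff)
      then have "z' = dd bd (W - N) (rst (W - N) e)" using dd_quot[OF N e(1)] e(2) by simp
      moreover have "rst (W - N) e \<in> chn (W - N) (Suc (Suc i))" by (rule chn_rst[OF e(1)]) auto
      ultimately show "z' \<in> bnd bd (W - N) (Suc i)" using bndI by metis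
    next
      assume "z' \<in> bnd bd (W - N) (Suc i)"
      then obtain e where e: "e \<in> chn (W - N) (Suc (Suc i))" "z' = dd bd (W - N) e" by (rule bndE)
      have eW: "e \<in> chn W (Suc (Suc i))" by (rule up[OF e(1)])
      have dW: "dd bd W e \<in> chn W (Suc i)" by (rule dd_chn[OF W eW])
      \<comment> \<open>The boundary of \<open>e\<close> in \<open>W\<close> is \<open>z'\<close>
        plus a part in \<open>N\<close>. Since the boundary squares to zero, the boundary of
        \<open>z'\<close> is that of a chain of \<open>N\<close>.\<close>
      let ?n = "rst N (dd bd W e)"
      have n: "?n \<in> chn N (Suc i)" by (rule chn_rst[OF dW NW])
      have "dd bd W e = rst (W - N) (dd bd W e) + ?n"
        using rst_split[OF NW, of "dd bd W e"] rst_id[OF chn_supp[OF dW]] by simp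
      also have "rst (W - N) (dd bd W e) = z'" using dd_quot[OF N eW] rz[OF e(1)] e(2) by simp
      finally have "dd bd W (dd bd W e) = dd bd W z' + dd bd N ?n"
        using dd_add[of z' ?n bd W] r n dd_sub[OF N n] by (metis chn_fin)
      then have "dd bd W z' = - dd bd N ?n" using dd_dd[OF W eW] by (simp add: eq_neg_iff_add_eq_0)
      then show "dd bd W z' \<in> bnd bd N i" using bndI[OF n, of bd] lsub_uminus[OF lsub_bnd] by metis
    qed
    finally show ?thesis .
  qed
qed (rule lsub_cyc lsub_bnd)+

lemma hd_dim_plus:
  fixes bd :: "'a list \<Rightarrow> 'a list \<Rightarrow> 'k::field"
  assumes W: "cplx bd (V \<union> W)" and V: "subcplx bd V (V \<union> W)" and sW: "subcplx bd W (V \<union> W)"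
    and disj: "V \<inter> W = {}" and h: "hd_dim bd V i m" "hd_dim bd W i n"
  shows "hd_dim bd (V \<union> W) i (m + n)"
proof (rule hdim_plus[OF h lsub_cyc lsub_cyc lsub_bnd lsub_bnd])
  have dV: "dd bd (V \<union> W) c = dd bd V c" if "c \<in> chn V j" for c j by (rule dd_sub[OF V that])
  have dW: "dd bd (V \<union> W) c = dd bd W c" if "c \<in> chn W j" for c j by (rule dd_sub[OF sW that])
  have upV: "c \<in> chn (V \<union> W) j" if "c \<in> chn V j" for c :: "'a list \<Rightarrow> 'k" and j by (rule chn_mono[OF that]) auto
  have upW: "c \<in> chn (V \<union> W) j" if "c \<in> chn W j" for c :: "'a list \<Rightarrow> 'k" and j by (rule chn_mono[OF that]) auto
  have rV: "rst V c \<in> chn V j" if "c \<in> chn (V \<union> W) j" for c :: "'a list \<Rightarrow> 'k" and j by (rule chn_rst[OF that]) auto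
  have rW: "rst W c \<in> chn W j" if "c \<in> chn (V \<union> W) j" for c :: "'a list \<Rightarrow> 'k" and j by (rule chn_rst[OF that]) auto
  have split: "c = rst V c + rst W c" if "c \<in> chn (V \<union> W) j" for c :: "'a list \<Rightarrow> 'k" and j
    using rst_split[of W "V \<union> W" c] rst_id[OF chn_supp[OF that]] disj by (simp add: Un_Diff Diff_triv)
  have VV: "rst V c = c \<and> rst W c = 0" if "supp c \<subseteq> V" for c :: "'a list \<Rightarrow> 'k"
    using rst_id[OF that] rst_eq_0[of W c] that disj by auto
  have WW: "rst W c = c \<and> rst V c = 0" if "supp c \<subseteq> W" for c :: "'a list \<Rightarrow> 'k"
    using rst_id[OF that] rst_eq_0[of V c] that disj by auto
  have suppd: "supp (dd bd U c) \<subseteq> U" for U c by (simp add: dd_alt supp_rst)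
  have dsplit: "dd bd (V \<union> W) (x + y) = dd bd V x + dd bd W y" if "x \<in> chn V j" "y \<in> chn W j" for x y j
    using that dd_add[OF chn_fin[OF that(1)] chn_fin[OF that(2)], of bd] dV dW by simp
  have zero: "x = 0 \<and> y = 0" if "x + y = 0" "supp x \<subseteq> V" "supp y \<subseteq> W" for x y :: "'a list \<Rightarrow> 'k"
    using rst_add[of V x y] rst_add[of W x y] VV[OF that(2)] WW[OF that(3)] that(1) by (simp add: rst_0)
  show "cyc bd (V \<union> W) i = {x + y |x y. x \<in> cyc bd V i \<and> y \<in> cyc bd W i}"
  proof (intro equalityI subsetI)
    fix z assume "z \<in> cyc bd (V \<union> W) i"
    then have z: "z \<in> chn (V \<union> W) i" "dd bd (V \<union> W) z = 0" using cycD by blast+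
    have "dd bd V (rst V z) + dd bd W (rst W z) = 0"
      using dsplit[OF rV[OF z(1)] rW[OF z(1)]] split[OF z(1)] z(2) by simp
    from zero[OF this suppd suppd] have "rst V z \<in> cyc bd V i" "rst W z \<in> cyc bd W i"
      using rV[OF z(1)] rW[OF z(1)] by (simp_all add: cycI)
    then show "z \<in> {x + y |x y. x \<in> cyc bd V i \<and> y \<in> cyc bd W i}" using split[OF z(1)] by blast
  next
    fix z assume "z \<in> {x + y |x y. x \<in> cyc bd V i \<and> y \<in> cyc bd W i}"
    then obtain x y where xy: "z = x + y" "x \<in> cyc bd V i" "y \<in> cyc bd W i" by blast
    then show "z \<in> cyc bd (V \<union> W) i"
      using cycD[OF xy(2)] cycD[OF xy(3)] dsplit[of x i y] lsub_add[OF lsub_chn upV upW] by (simp add: cycI)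
  qed
  show "x + y \<in> bnd bd (V \<union> W) i \<longleftrightarrow> x \<in> bnd bd V i \<and> y \<in> bnd bd W i"
    if xy: "x \<in> cyc bd V i" "y \<in> cyc bd W i" for x y
  proof
    assume "x + y \<in> bnd bd (V \<union> W) i"
    then obtain e where e: "e \<in> chn (V \<union> W) (Suc i)" "x + y = dd bd (V \<union> W) e" by (rule bndE)
    have "x + y = dd bd V (rst V e) + dd bd W (rst W e)"
      using dsplit[OF rV[OF e(1)] rW[OF e(1)]] split[OF e(1)] e(2) by simp
    then have "(x - dd bd V (rst V e)) + (y - dd bd W (rst W e)) = 0" by (simp add: algebra_simps)
    from zero[OF this order_trans[OF supp_diff Un_least[OF chn_supp[OF conjunct1[OF cycD[OF xy(1)]]] suppd]]
        order_trans[OF supp_diff Un_least[OF chn_supp[OF conjunct1[OF cycD[OF xy(2)]]] suppd]]]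
    have "x = dd bd V (rst V e)" "y = dd bd W (rst W e)" by simp_all
    then show "x \<in> bnd bd V i \<and> y \<in> bnd bd W i"
      using bndI[OF rV[OF e(1)], of bd] bndI[OF rW[OF e(1)], of bd] by simp
  next
    assume "x \<in> bnd bd V i \<and> y \<in> bnd bd W i"
    then obtain e f where ef: "e \<in> chn V (Suc i)" "x = dd bd V e" "f \<in> chn W (Suc i)" "y = dd bd W f"
      by (metis bndE)
    then show "x + y \<in> bnd bd (V \<union> W) i"
      using dsplit[OF ef(1,3)] bndI[OF lsub_add[OF lsub_chn upV[OF ef(1)] upW[OF ef(3)]], of bd] by simp
  qed
qed

lemma hd_dim_0:
  assumes "\<And>w. w \<in> W \<Longrightarrow> length w \<noteq> i"
  shows "hd_dim bd W i 0"
proof (rule hdim_0)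
  fix z assume "z \<in> cyc bd W i"
  then have "supp z = {}" using assms chn_mem[of z W i] cycD[of z bd W i] by blast
  then have "z = 0" by (auto simp: supp_def fun_eq_iff fun_apply)
  then show "z \<in> bnd bd W i" by (simp add: lsub_0[OF lsub_bnd])
qed

lemma hd_dim_Union:
  fixes bd :: "'a list \<Rightarrow> 'a list \<Rightarrow> 'k::field"
  assumes "finite T" and W: "cplx bd (\<Union>t\<in>T. C t)"
    and inc: "\<And>s t x y. s \<in> T \<Longrightarrow> t \<in> T \<Longrightarrow> y \<in> C s \<Longrightarrow> x \<in> C t \<Longrightarrow> bd y x \<noteq> 0 \<Longrightarrow> s = t"
    and disj: "\<And>s t. s \<in> T \<Longrightarrow> t \<in> T \<Longrightarrow> s \<noteq> t \<Longrightarrow> C s \<inter> C t = {}"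
    and h: "\<And>t. t \<in> T \<Longrightarrow> hd_dim bd (C t) i (n t)"
  shows "hd_dim bd (\<Union>t\<in>T. C t) i (\<Sum>t\<in>T. n t)"
proof -
  have "hd_dim bd (\<Union>t\<in>S. C t) i (\<Sum>t\<in>S. n t)" if "finite S" "S \<subseteq> T" for S
    using that
  proof (induction S)
    case empty
    show ?case using hd_dim_0[of "{}" i bd] by simp
  next
    case (insert t S)
    have tS: "insert t S \<subseteq> T" by (rule insert.prems)
    then have tT: "t \<in> T" "S \<subseteq> T" by auto
    have sub: "subcplx bd (\<Union>(C ` S')) (\<Union>(C ` S''))" if "S' \<subseteq> S''" "S'' \<subseteq> T" for S' S''
      unfolding subcplx_def
    proof (intro conjI ballI impI)
      show "\<Union>(C ` S') \<subseteq> \<Union>(C ` S'')" using that by blast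
      fix y x assume y: "y \<in> \<Union>(C ` S')" and x: "x \<in> \<Union>(C ` S'')" and yx: "bd y x \<noteq> 0"
      obtain s t where st: "s \<in> S'" "y \<in> C s" "t \<in> S''" "x \<in> C t" using y x by (elim UN_E)
      have "s = t" by (rule inc[OF _ _ st(2,4) yx]) (use st that in auto)
      then show "x \<in> \<Union>(C ` S')" using st by auto
    qed
    have c: "cplx bd (\<Union>(C ` insert t S))" by (rule cplx_sub[OF W sub[OF tS order_refl]])
    have "hd_dim bd (C t \<union> \<Union>(C ` S)) i (n t + (\<Sum>t\<in>S. n t))"
    proof (rule hd_dim_plus)
      show "cplx bd (C t \<union> \<Union>(C ` S))" using c by simp
      show "subcplx bd (C t) (C t \<union> \<Union>(C ` S))" using sub[of "{t}" "insert t S"] tS by simp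
      show "subcplx bd (\<Union>(C ` S)) (C t \<union> \<Union>(C ` S))" using sub[of S "insert t S"] tS by auto
      show "C t \<inter> \<Union>(C ` S) = {}" using disj[OF tT(1)] tT insert.hyps(2) by fastforce
      show "hd_dim bd (C t) i (n t)" by (rule h[OF tT(1)])
      show "hd_dim bd (\<Union>(C ` S)) i (\<Sum>t\<in>S. n t)" by (rule insert.IH[OF tT(2)])
    qed
    then show ?case using insert.hyps by simp
  qed
  then show ?thesis using assms(1) by blast
qed

text \<open>An isomorphism of complexes up to a shift \<open>s\<close> of the degree and a unit
  \<open>\<epsilon>\<close>; appending a fixed suffix to all words gives such a shift.\<close>

lemma hd_dim_relabel:
  fixes bd :: "'a list \<Rightarrow> 'a list \<Rightarrow> 'k::field" and bd' :: "'b list \<Rightarrow> 'b list \<Rightarrow> 'k"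
  assumes f: "bij_betw f V W" and len: "\<And>x. x \<in> V \<Longrightarrow> length (f x) = length x + s"
    and bd: "\<And>x y. x \<in> V \<Longrightarrow> y \<in> V \<Longrightarrow> bd' (f y) (f x) = \<epsilon> * bd y x" and \<epsilon>: "\<epsilon> \<noteq> 0"
    and h: "hd_dim bd V i n"
  shows "hd_dim bd' W (i + s) n"
proof -
  define g where "g = inv_into V f"
  have fW: "f x \<in> W" "g (f x) = x" if "x \<in> V" for x
    using f that by (auto simp: g_def bij_betw_def)
  have gV: "g x \<in> V" "f (g x) = x" if "x \<in> W" for x
    using f that by (auto simp: g_def bij_betw_def f_inv_into_f inv_into_into)
  define F where "F c = (\<lambda>x. if x \<in> W then c (g x) else 0)" for c :: "'a list \<Rightarrow> 'k"
  define G where "G c = (\<lambda>x. if x \<in> V then c (f x) else 0)" for c :: "'b list \<Rightarrow> 'k"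
  have suppF: "supp (F c) = f ` (V \<inter> supp c)" for c
  proof (intro equalityI subsetI)
    fix x assume "x \<in> supp (F c)"
    then have "x \<in> W" "c (g x) \<noteq> 0" by (auto simp: F_def supp_def split: if_splits)
    then show "x \<in> f ` (V \<inter> supp c)" using gV[of x] by (intro image_eqI[of _ _ "g x"]) (auto simp: supp_def)
  qed (auto simp: F_def supp_def fW)
  have suppG: "supp (G c) = g ` (W \<inter> supp c)" for c
  proof (intro equalityI subsetI)
    fix x assume "x \<in> supp (G c)"
    then have "x \<in> V" "c (f x) \<noteq> 0" by (auto simp: G_def supp_def split: if_splits)
    then show "x \<in> g ` (W \<inter> supp c)" using fW[of x] by (intro image_eqI[of _ _ "f x"]) (auto simp: supp_def)
  qed (auto simp: G_def supp_def gV)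
  have chF: "F c \<in> chn W (j + s)" if "c \<in> chn V j" for c j
    using chn_fin[OF that] chn_mem[OF that] fW(1) len by (intro chnI) (auto simp: suppF)
  have chG: "G c \<in> chn V j" if "c \<in> chn W (j + s)" for c j
  proof (rule chnI)
    show "finite (supp (G c))" using chn_fin[OF that] by (simp add: suppG)
    fix x assume "x \<in> supp (G c)"
    then obtain w where w: "x = g w" "w \<in> W" "w \<in> supp c" by (auto simp: suppG)
    then show "x \<in> V \<and> length x = j" using gV[of w] len[of "g w"] chn_mem[OF that w(3)] by auto
  qed
  have FG: "F (G c) = c" if "c \<in> chn W j" for c j
    using chn_supp[OF that] by (auto simp: F_def G_def gV supp_def fun_eq_iff)
  have GF: "G (F c) = c" if "c \<in> chn V j" for c j
    using chn_supp[OF that] by (auto simp: F_def G_def fW supp_def fun_eq_iff)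
  have dF: "dd bd' W (F c) = scl \<epsilon> (F (dd bd V c))" if c: "c \<in> chn V j" for c j
  proof
    fix x
    show "dd bd' W (F c) x = scl \<epsilon> (F (dd bd V c)) x"
    proof (cases "x \<in> W")
      case True
      have inj: "inj_on f (V \<inter> supp c)" using f by (auto simp: bij_betw_def inj_on_def)
      have "dd bd' W (F c) x = (\<Sum>b\<in>f ` (V \<inter> supp c). F c b * bd' b x)"
        unfolding dd_alt using True by (simp add: rst_def lext_def suppF)
      also have "\<dots> = (\<Sum>b\<in>V \<inter> supp c. c b * bd' (f b) (f (g x)))"
        unfolding sum.reindex[OF inj] by (rule sum.cong) (auto simp: F_def fW gV True)
      also have "\<dots> = (\<Sum>b\<in>V \<inter> supp c. \<epsilon> * (c b * bd b (g x)))"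
        by (rule sum.cong) (use bd[OF gV(1)[OF True]] in auto)
      also have "V \<inter> supp c = supp c" using chn_supp[OF c] by auto
      also have "(\<Sum>b\<in>supp c. \<epsilon> * (c b * bd b (g x))) = scl \<epsilon> (F (dd bd V c)) x"
        using True gV[of x] by (simp add: scl_def F_def dd_alt rst_def lext_def sum_distrib_left)
      finally show ?thesis .
    qed (simp add: dd_alt rst_def scl_def F_def)
  qed
  have F0: "F c = 0 \<longleftrightarrow> c = 0" if "c \<in> chn V j" for c j
  proof
    assume "F c = 0"
    then have "G (F c) = 0" by (auto simp: G_def fun_apply)
    then show "c = 0" using GF[OF that] by simp
  qed (auto simp: F_def fun_apply)
  have supd: "F (dd bd V c) = 0 \<longleftrightarrow> dd bd V c = 0" for c
  proof
    assume *: "F (dd bd V c) = 0"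
    show "dd bd V c = 0"
    proof
      fix x show "dd bd V c x = 0 x"
        using fun_cong[OF *, of "f x"] by (cases "x \<in> V") (auto simp: F_def fW fun_apply dd_alt rst_def)
    qed
  qed (auto simp: F_def fun_apply)
  show ?thesis
  proof (rule hdim_rel[OF h, where R = "\<lambda>z z'. z' = F z"])
    show "x' + scl a y' = F (x + scl a y)" if "x' = F x" "y' = F y" for a :: 'k and x x' y y'
      using that by (auto simp: F_def scl_def fun_apply)
    show "0 = F 0" by (auto simp: F_def fun_apply)
    show "\<exists>z'\<in>cyc bd' W (i + s). z' = F z" if "z \<in> cyc bd V i" for z
      using cycD[OF that] chF dF[of z i] supd[of z] by (intro bexI[of _ "F z"] cycI) auto
    show "\<exists>z\<in>cyc bd V i. z' = F z" if z': "z' \<in> cyc bd' W (i + s)" for z'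
    proof (rule bexI)
      show e: "z' = F (G z')" using FG cycD[OF z'] by metis
      have c: "G z' \<in> chn V i" using chG cycD[OF z'] by blast
      have "scl \<epsilon> (F (dd bd V (G z'))) = 0" using dF[OF c] e cycD[OF z'] by simp
      then have "scl (inverse \<epsilon>) (scl \<epsilon> (F (dd bd V (G z')))) = 0" by simp
      then have "F (dd bd V (G z')) = 0" using \<epsilon> by simp
      then show "G z' \<in> cyc bd V i" using c supd by (simp add: cycI)
    qed
    show "z \<in> bnd bd V i \<longleftrightarrow> z' \<in> bnd bd' W (i + s)"
      if z: "z \<in> cyc bd V i" and z': "z' \<in> cyc bd' W (i + s)" and r: "z' = F z" for z z'
    proof
      assume "z \<in> bnd bd V i"
      then obtain e where e: "e \<in> chn V (Suc i)" "z = dd bd V e" by (rule bndE)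
      have "dd bd' W (scl (inverse \<epsilon>) (F e)) = z'" using dF[OF e(1)] e(2) r \<epsilon> by (simp add: dd_scl)
      moreover have "scl (inverse \<epsilon>) (F e) \<in> chn W (Suc (i + s))"
        using chF[OF e(1)] lsub_scl[OF lsub_chn] by simp
      ultimately show "z' \<in> bnd bd' W (i + s)" using bndI by metis
    next
      assume "z' \<in> bnd bd' W (i + s)"
      then obtain e where e: "e \<in> chn W (Suc (i + s))" "z' = dd bd' W e" by (rule bndE)
      have c: "G e \<in> chn V (Suc i)" using chG[of e "Suc i"] e by simp
      have "z' = scl \<epsilon> (F (dd bd V (G e)))" using dF[OF c] FG[OF e(1)] e(2) by simp
      also have "\<dots> = F (dd bd V (scl \<epsilon> (G e)))" by (rule ext) (simp add: dd_scl F_def scl_apply)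
      finally have "G (F z) = G (F (dd bd V (scl \<epsilon> (G e))))" using r by simp
      moreover have "scl \<epsilon> (G e) \<in> chn V (Suc i)" using c lsub_scl[OF lsub_chn] by blast
      moreover have "G (F (dd bd V c)) = dd bd V c" for c
        by (auto simp: G_def F_def fW dd_alt rst_def)
      ultimately have "z = dd bd V (scl \<epsilon> (G e))" using GF cycD[OF z] by metis
      then show "z \<in> bnd bd V i" using bndI \<open>scl \<epsilon> (G e) \<in> chn V (Suc i)\<close> by metis
    qed
  qed (rule lsub_cyc lsub_bnd)+
qed

section \<open>Acyclic matchings\<close>

text \<open>A perfect matching in the sense of algebraic Morse theory. The incidence matrix between
  \<open>B\<close> and the matched words of \<open>A\<close> is triangular with respect to
  \<open>R\<close>, with units on the diagonal, hence invertible: every cycle can be freed of its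
  part in \<open>A\<close> by a boundary, and no nonzero cycle is supported in
  \<open>B\<close>.\<close>

lemma acyc_matching:
  fixes bd :: "'a list \<Rightarrow> 'a list \<Rightarrow> 'k::field"
  assumes W: "cplx bd (A \<union> B)" and disj: "A \<inter> B = {}" and fin: "finite B"
    and \<mu>: "bij_betw \<mu> B A" and unit: "\<And>b. b \<in> B \<Longrightarrow> bd b (\<mu> b) \<noteq> 0"
    and tri: "\<And>b b'. b \<in> B \<Longrightarrow> b' \<in> B \<Longrightarrow> b \<noteq> b' \<Longrightarrow> bd b' (\<mu> b) \<noteq> 0 \<Longrightarrow> (b, b') \<in> R"
    and R: "wf R"
  shows "acyc bd (A \<union> B)"
  unfolding acyc_def
proof (intro allI subsetI)
  let ?W = "A \<union> B"
  have len: "Suc (length (\<mu> b)) = length b" if "b \<in> B" for b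
    using cplx_len[OF W unit[OF that]] .
  have \<mu>A: "\<mu> b \<in> A" if "b \<in> B" for b using \<mu> that by (auto simp: bij_betw_def)
  have \<mu>inj: "\<mu> b = \<mu> b' \<longleftrightarrow> b = b'" if "b \<in> B" "b' \<in> B" for b b'
    using \<mu> that by (auto simp: bij_betw_def inj_on_def)
  have \<mu>sur: "\<exists>b\<in>B. a = \<mu> b" if "a \<in> A" for a using \<mu> that by (auto simp: bij_betw_def)
  \<comment> \<open>Back substitution along \<open>R\<close>: each \<open>b\<close> is corrected by
    the chains of smaller elements until the part of its boundary in \<open>A\<close> is the single
    word \<open>\<mu> b\<close>.\<close>
  have "\<forall>b\<in>B. \<exists>y\<in>chn B (length b). \<forall>a\<in>A. dd bd ?W y a = sgl (\<mu> b) a"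
  proof
    fix b' assume "b' \<in> B"
    then show "\<exists>y\<in>chn B (length b'). \<forall>a\<in>A. dd bd ?W y a = sgl (\<mu> b') a"
    proof (induction b' rule: wf_induct_rule[OF R])
      case (1 b')
      note b' = \<open>b' \<in> B\<close>
      define T where "T = {b\<in>B. b \<noteq> b' \<and> bd b' (\<mu> b) \<noteq> 0}"
      have TB: "T \<subseteq> B" and finT: "finite T" using fin by (auto simp: T_def)
      have lT: "length b = length b'" if "b \<in> T" for b
        using that len[of b] cplx_len[OF W, of b' "\<mu> b"] by (auto simp: T_def)
      have "\<forall>b\<in>T. \<exists>y\<in>chn B (length b). \<forall>a\<in>A. dd bd ?W y a = sgl (\<mu> b) a"
        using 1 tri b' by (auto simp: T_def)
      then obtain y where y: "\<And>b. b \<in> T \<Longrightarrow> y b \<in> chn B (length b) \<and> (\<forall>a\<in>A. dd bd ?W (y b) a = sgl (\<mu> b) a)"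
        by (auto simp: bchoice_iff Bex_def)
      define \<epsilon> where "\<epsilon> = bd b' (\<mu> b')"
      have \<epsilon>: "\<epsilon> \<noteq> 0" using unit b' by (simp add: \<epsilon>_def)
      define s where "s = (\<Sum>b\<in>T. scl (bd b' (\<mu> b)) (y b))"
      have s: "s \<in> chn B (length b')"
        unfolding s_def using y lT by (intro lsub_sum[OF lsub_chn] lsub_scl[OF lsub_chn]) metis
      define x where "x = scl (inverse \<epsilon>) (sgl b' - s)"
      have x: "x \<in> chn B (length b')"
        unfolding x_def using s chn_sgl[OF b'] by (intro lsub_scl[OF lsub_chn] lsub_diff[OF lsub_chn])
      have ds: "dd bd ?W s = (\<Sum>b\<in>T. scl (bd b' (\<mu> b)) (dd bd ?W (y b)))"
        unfolding s_def dd_def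
      proof (subst lext_sum)
        show "finite (supp (scl (bd b' (\<mu> t)) (y t)))" if "t \<in> T" for t
          using y[OF that] chn_fin[of "y t"] by (intro finite_supp_scl) auto
      qed (simp add: lext_scl)
      have "dd bd ?W x a = sgl (\<mu> b') a" if a: "a \<in> A" for a
      proof -
        obtain b where b: "b \<in> B" "a = \<mu> b" using \<mu>sur[OF a] by blast
        have "dd bd ?W s a = (\<Sum>t\<in>T. bd b' (\<mu> t) * sgl (\<mu> t) a)"
          unfolding ds sum_fun_apply scl_apply using y a by (intro sum.cong) auto
        also have "\<dots> = (\<Sum>t\<in>T. if t = b then bd b' a else 0)"
          by (rule sum.cong) (use b TB \<mu>inj in \<open>auto simp: sgl_def\<close>)
        also have "\<dots> = (if b \<in> T then bd b' a else 0)" using finT by simp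
        finally have "dd bd ?W s a = (if b \<in> T then bd b' a else 0)" .
        moreover have "dd bd ?W (sgl b') a = bd b' a" using a by (simp add: dd_alt rst_def)
        moreover have "dd bd ?W x a = inverse \<epsilon> * (dd bd ?W (sgl b') a - dd bd ?W s a)"
          unfolding x_def using chn_fin[OF s] by (simp add: dd_scl dd_diff scl_apply)
        ultimately show ?thesis
          using b b' \<mu>inj \<epsilon> by (auto simp: T_def \<epsilon>_def sgl_def)
      qed
      then show ?case using x by blast
    qed
  qed
  then obtain y where y: "\<And>b. b \<in> B \<Longrightarrow> y b \<in> chn B (length b) \<and> (\<forall>a\<in>A. dd bd ?W (y b) a = sgl (\<mu> b) a)"
    by (auto simp: bchoice_iff Bex_def)
  fix i and z assume z: "z \<in> cyc bd ?W i"
  then have zc: "z \<in> chn ?W i" "dd bd ?W z = 0" using cycD by blast+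
  define Bi where "Bi = {b\<in>B. length b = Suc i}"
  have finBi: "finite Bi" using fin by (simp add: Bi_def)
  define x where "x = (\<Sum>b\<in>Bi. scl (z (\<mu> b)) (y b))"
  have xB: "x \<in> chn B (Suc i)"
    unfolding x_def
  proof (intro lsub_sum[OF lsub_chn] lsub_scl[OF lsub_chn])
    show "y b \<in> chn B (Suc i)" if "b \<in> Bi" for b using y[of b] that by (simp add: Bi_def)
  qed
  then have x: "x \<in> chn ?W (Suc i)" by (rule chn_mono) auto
  have dx: "dd bd ?W x = (\<Sum>b\<in>Bi. scl (z (\<mu> b)) (dd bd ?W (y b)))"
    unfolding x_def dd_def
  proof (subst lext_sum)
    show "finite (supp (scl (z (\<mu> t)) (y t)))" if "t \<in> Bi" for t
      using y[of t] that chn_fin[of "y t"] by (intro finite_supp_scl) (auto simp: Bi_def)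
  qed (simp add: lext_scl)
  have dxA: "dd bd ?W x a = z a" if a: "a \<in> A" for a
  proof -
    obtain b where b: "b \<in> B" "a = \<mu> b" using \<mu>sur[OF a] by blast
    have "dd bd ?W x a = (\<Sum>t\<in>Bi. z (\<mu> t) * sgl (\<mu> t) a)"
      unfolding dx sum_fun_apply scl_apply using y a by (intro sum.cong) (auto simp: Bi_def)
    also have "\<dots> = (\<Sum>t\<in>Bi. if t = b then z a else 0)"
      by (rule sum.cong) (use b \<mu>inj in \<open>auto simp: sgl_def Bi_def\<close>)
    also have "\<dots> = (if b \<in> Bi then z a else 0)" using finBi by simp
    also have "\<dots> = z a"
    proof (cases "b \<in> Bi")
      case False
      then have "length a \<noteq> i" using len[OF b(1)] b by (auto simp: Bi_def)
      then have "z a = 0" using chn_mem[OF zc(1), of a] by (auto simp: supp_def)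
      then show ?thesis using False by simp
    qed simp
    finally show ?thesis .
  qed
  define w where "w = z - dd bd ?W x"
  have w: "w \<in> chn ?W i" unfolding w_def using zc dd_chn[OF W x] by (intro lsub_diff[OF lsub_chn])
  have dw: "dd bd ?W w = 0"
    unfolding w_def using zc dd_dd[OF W x] chn_fin[OF zc(1)] chn_fin[OF dd_chn[OF W x]] by (simp add: dd_diff)
  have wB: "supp w \<subseteq> B"
    using chn_supp[OF w] dxA by (auto simp: w_def supp_def)
  \<comment> \<open>A nonempty finite support has an element \<open>b\<close> that is maximal for
    \<open>R\<close>. By triangularity no other word of the support has \<open>\<mu> b\<close> in
    its boundary, so the coefficient of \<open>\<mu> b\<close> cannot cancel.\<close>
  have "supp w = {}"
  proof (rule ccontr)
    assume ne: "supp w \<noteq> {}"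
    have fin': "finite (R \<inter> supp w \<times> supp w)" using chn_fin[OF w] by simp
    have "wf (R \<inter> supp w \<times> supp w)" by (rule wf_subset[OF R]) auto
    then have "wf ((R \<inter> supp w \<times> supp w)\<inverse>)"
      using fin' by (simp add: finite_acyclic_wf_converse wf_acyclic)
    then have wfc: "wf ((R \<inter> supp w \<times> supp w)\<inverse>)" .
    obtain c0 where "c0 \<in> supp w" using ne by auto
    then obtain b where b: "b \<in> supp w" "\<And>c. (c, b) \<in> (R \<inter> supp w \<times> supp w)\<inverse> \<Longrightarrow> c \<notin> supp w"
      by (rule wfE_min[OF wfc]) (rule that)
    have mx: "(b, c) \<notin> R" if "c \<in> supp w" for c
    proof
      assume "(b, c) \<in> R"
      then have "(c, b) \<in> (R \<inter> supp w \<times> supp w)\<inverse>" using b(1) that by simp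
      from b(2)[OF this] that show False by simp
    qed
    have bB: "b \<in> B" using b(1) wB by auto
    have "0 = dd bd ?W w (\<mu> b)" using dw by (simp add: fun_apply)
    also have "\<dots> = (\<Sum>c\<in>supp w. w c * bd c (\<mu> b))"
      using \<mu>A[OF bB] by (simp add: dd_alt rst_def lext_def)
    also have "\<dots> = (\<Sum>c\<in>supp w. if c = b then w b * bd b (\<mu> b) else 0)"
    proof (rule sum.cong[OF refl])
      fix c assume c: "c \<in> supp w"
      then have cB: "c \<in> B" using wB by auto
      have "bd c (\<mu> b) = 0" if "c \<noteq> b"
      proof (rule ccontr)
        assume "bd c (\<mu> b) \<noteq> 0"
        from tri[OF bB cB that[symmetric] this] show False using mx[OF c] by simp
      qed
      then show "w c * bd c (\<mu> b) = (if c = b then w b * bd b (\<mu> b) else 0)" by auto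
    qed
    also have "\<dots> = w b * bd b (\<mu> b)" using b(1) chn_fin[OF w] by simp
    finally show False using unit[OF bB] b(1) by (simp add: supp_def)
  qed
  then have "w = 0" by (auto simp: supp_def fun_eq_iff fun_apply)
  then have "z = dd bd ?W x" by (simp add: w_def)
  then show "z \<in> bnd bd ?W i" using bndI[OF x] by simp
qed

text \<open>Adding a word \<open>v\<close> of maximal length either creates a class in its degree or
  kills one below. The cycle \<open>z0\<close> through \<open>v\<close> shows that it creates one:
  modulo \<open>z0\<close>, the word \<open>v\<close> yields no new boundary.\<close>

lemma hd_dim_top:
  fixes bd :: "'a list \<Rightarrow> 'a list \<Rightarrow> 'k::field"
  assumes W: "cplx bd W" and v: "v \<in> W" and top: "\<And>w. w \<in> W \<Longrightarrow> length w \<le> length v"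
    and z0: "z0 \<in> cyc bd W (length v)" "z0 v \<noteq> 0" and h: "hd_dim bd (W - {v}) m n"
  shows "hd_dim bd W m (n + (if m = length v then 1 else 0))"
proof -
  let ?Q = "W - {v}"
  have sub: "subcplx bd ?Q W"
    unfolding subcplx_def
  proof (intro conjI ballI impI)
    fix y x assume "y \<in> ?Q" "x \<in> W" "bd y x \<noteq> 0"
    then show "x \<in> ?Q" using cplx_len[OF W, of y x] top[of y] by auto
  qed auto
  have up: "c \<in> chn W j" if "c \<in> chn ?Q j" for c :: "'a list \<Rightarrow> 'k" and j by (rule chn_mono[OF that]) auto
  have low: "c \<in> chn ?Q j" if "c \<in> chn W j" "c v = 0" for c :: "'a list \<Rightarrow> 'k" and j
    using that by (auto simp: chn_def supp_def)
  have cycQ: "cyc bd ?Q j = {z \<in> cyc bd W j. z v = 0}" for j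
  proof (intro equalityI subsetI CollectI conjI)
    fix z assume "z \<in> cyc bd ?Q j"
    then have z: "z \<in> chn ?Q j" "dd bd ?Q z = 0" using cycD by blast+
    then show "z \<in> cyc bd W j" using up dd_sub[OF sub z(1)] by (simp add: cycI)
    show "z v = 0" using chn_supp[OF z(1)] by (auto simp: supp_def)
  next
    fix z assume "z \<in> {z \<in> cyc bd W j. z v = 0}"
    then have z: "z \<in> chn ?Q j" "dd bd W z = 0" using cycD low by blast+
    then show "z \<in> cyc bd ?Q j" using dd_sub[OF sub z(1)] by (simp add: cycI)
  qed
  have bQ: "bnd bd ?Q j \<subseteq> bnd bd W j" for j
  proof
    fix b assume "b \<in> bnd bd ?Q j"
    then obtain e where e: "e \<in> chn ?Q (Suc j)" "b = dd bd ?Q e" by (rule bndE)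
    then show "b \<in> bnd bd W j" using bndI[OF up[OF e(1)], of bd] dd_sub[OF sub e(1)] by simp
  qed
  have bnd: "bnd bd ?Q j = bnd bd W j" for j
  proof (intro equalityI bQ subsetI)
    fix b assume "b \<in> bnd bd W j"
    then obtain e where e: "e \<in> chn W (Suc j)" "b = dd bd W e" by (rule bndE)
    have "\<exists>e' \<in> chn ?Q (Suc j). dd bd W e' = dd bd W e"
    proof (cases "Suc j = length v")
      case False
      then have "e v = 0" using chn_mem[OF e(1), of v] by (auto simp: supp_def)
      then show ?thesis using low[OF e(1)] by blast
    next
      case True
      \<comment> \<open>Subtracting a multiple of the cycle removes \<open>v\<close> and keeps the
        boundary.\<close>
      let ?e = "e - scl (e v / z0 v) z0"
      have z0': "z0 \<in> chn W (Suc j)" "dd bd W z0 = 0" using cycD[OF z0(1)] True by auto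
      have "?e \<in> chn W (Suc j)" using e z0' by (intro lsub_diff[OF lsub_chn] lsub_scl[OF lsub_chn])
      moreover have "?e v = 0" using z0(2) by (simp add: scl_apply)
      moreover have "dd bd W ?e = dd bd W e"
        using z0' chn_fin[OF e(1)] chn_fin[OF z0'(1)] by (simp add: dd_diff dd_scl)
      ultimately show ?thesis using low by blast
    qed
    then obtain e' where "e' \<in> chn ?Q (Suc j)" "dd bd W e' = dd bd W e" by blast
    then show "b \<in> bnd bd ?Q j" using bndI[of e' ?Q j bd] dd_sub[OF sub, of e'] e(2) by simp
  qed
  show ?thesis
  proof (cases "m = length v")
    case True
    have z0m: "z0 \<in> cyc bd W m" using z0 True by simp
    have "hdim (cyc bd W m) (bnd bd W m) (Suc n)"
    proof (rule hdim_Suc[where \<phi> = "\<lambda>z. z v", OF _ lsub_cyc lsub_bnd z0m z0(2)])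
      show "hdim {z \<in> cyc bd W m. z v = 0} (bnd bd W m) n" using h by (simp add: cycQ bnd)
      show "b v = 0" if "b \<in> bnd bd W m" for b
      proof -
        have "b \<in> cyc bd ?Q m" by (rule bnd_cyc[OF cplx_sub[OF W sub]]) (use that bnd in blast)
        then show ?thesis by (simp add: cycQ)
      qed
    qed (auto simp: scl_apply fun_apply)
    then show ?thesis using True by simp
  next
    case False
    then have "z v = 0" if "z \<in> cyc bd W m" for z
      using chn_mem[OF conjunct1[OF cycD[OF that]], of v] by (auto simp: supp_def)
    then have "cyc bd ?Q m = cyc bd W m" using cycQ by auto
    then show ?thesis using h False by (simp add: bnd)
  qed
qed

section \<open>Alternating sums of faces, for merging, deletion and singular simplices\<close>

definition fbd :: "('a \<Rightarrow> nat) \<Rightarrow> (nat \<Rightarrow> 'a \<Rightarrow> 'a) \<Rightarrow> 'a \<Rightarrow> 'a \<Rightarrow> 'k::field" where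
  "fbd nf d y = (\<Sum>k<nf y. scl ((-1) ^ k) (sgl (d k y)))"

lemma fbd_apply: "fbd nf d y x = (\<Sum>k<nf y. if d k y = x then (-1) ^ k else 0)"
  unfolding fbd_def sum_fun_apply by (rule sum.cong) (auto simp: scl_def sgl_def)

lemma supp_fbd: "supp (fbd nf d y :: 'a \<Rightarrow> 'k::field) \<subseteq> (\<lambda>k. d k y) ` {..<nf y}"
  unfolding fbd_def using supp_sum supp_scl supp_sgl by fastforce

lemma finite_supp_fbd [simp]: "finite (supp (fbd nf d y))"
  by (rule finite_subset[OF supp_fbd]) simp

lemma lext_fbd:
  fixes f :: "'a \<Rightarrow> 'b \<Rightarrow> 'k::field"
  shows "lext f (fbd nf d y) = (\<Sum>k<nf y. scl ((-1) ^ k) (f (d k y)))"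
  unfolding fbd_def
proof (subst lext_sum)
  show "finite (supp (scl ((-1) ^ k) (sgl (d k y)) :: _ \<Rightarrow> 'k))" for k by (intro finite_supp_scl) simp
qed (simp add: lext_scl)

text \<open>The simplicial identity pairs the terms with \<open>j < k\<close> with those with
  \<open>k \<le> j\<close>, and paired terms have opposite signs.\<close>

lemma fbd_fbd:
  assumes nf: "\<And>k. k < nf y \<Longrightarrow> nf (d k y) = nf y - 1"
    and id: "\<And>j k. j < k \<Longrightarrow> k < nf y \<Longrightarrow> d j (d k y) = d (k - 1) (d j y)"
  shows "lext (fbd nf d) (fbd nf d y) = (0 :: 'a \<Rightarrow> 'k::field)"
proof
  fix t
  let ?n = "nf y"
  define F where "F = (\<lambda>(k, j). if d j (d k y) = t then (-1) ^ k * (-1) ^ j else (0::'k))"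
  have "(lext (fbd nf d) (fbd nf d y) :: 'a \<Rightarrow> 'k) t = (\<Sum>k<?n. \<Sum>j<?n - 1. F (k, j))"
    unfolding lext_fbd sum_fun_apply scl_apply fbd_apply
    by (rule sum.cong) (auto simp: nf F_def sum_distrib_left if_distrib intro!: sum.cong)
  also have "\<dots> = sum F ({..<?n} \<times> {..<?n - 1})" by (simp add: sum.cartesian_product F_def)
  also have "{..<?n} \<times> {..<?n - 1} = {(k, j). k < ?n \<and> j < k} \<union> {(k, j). j < ?n - 1 \<and> k \<le> j}" by auto
  also have "sum F \<dots> = sum F {(k, j). k < ?n \<and> j < k} + sum F {(k, j). j < ?n - 1 \<and> k \<le> j}"
  proof (rule sum.union_disjoint)
    show "finite {(k, j). k < ?n \<and> j < k}" by (rule finite_subset[of _ "{..<?n} \<times> {..<?n}"]) auto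
    show "finite {(k, j). j < ?n - 1 \<and> k \<le> j}" by (rule finite_subset[of _ "{..<?n} \<times> {..<?n}"]) auto
  qed auto
  also have "sum F {(k, j). j < ?n - 1 \<and> k \<le> j} = (\<Sum>p\<in>{(k, j). k < ?n \<and> j < k}. - F p)"
  proof (rule sum.reindex_bij_witness[of _ "\<lambda>(k, j). (j, k - 1)" "\<lambda>(k, j). (j + 1, k)"])
    fix p assume p: "p \<in> {(k, j). j < ?n - 1 \<and> k \<le> j}"
    obtain k j where kj: "p = (k, j)" "j < ?n - 1" "k \<le> j" using p by auto
    have "d k (d (Suc j) y) = d j (d k y)" using id[of k "Suc j"] kj by simp
    then show "- F (case p of (k, j) \<Rightarrow> (j + 1, k)) = F p" using kj by (auto simp: F_def mult.commute)
  qed auto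
  also have "sum F {(k, j). k < ?n \<and> j < k} + (\<Sum>p\<in>{(k, j). k < ?n \<and> j < k}. - F p) = 0"
    by (simp add: sum_negf)
  finally show "(lext (fbd nf d) (fbd nf d y) :: 'a \<Rightarrow> 'k) t = 0 t" by (simp add: fun_apply)
qed

section \<open>Ordered set partitions\<close>

fun owp :: "'n set \<Rightarrow> 'n set list \<Rightarrow> bool" where
  "owp V [] \<longleftrightarrow> V = {}"
| "owp V (B # ws) \<longleftrightarrow> B \<noteq> {} \<and> B \<subseteq> V \<and> owp (V - B) ws"

definition mrg :: "nat \<Rightarrow> 'n set list \<Rightarrow> 'n set list" where
  "mrg k ws = take k ws @ (ws ! k \<union> ws ! Suc k) # drop (Suc (Suc k)) ws"

definition wbd :: "'n set list \<Rightarrow> 'n set list \<Rightarrow> 'k::field" where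
  "wbd = fbd (\<lambda>ws. length ws - 1) mrg"

lemma owp_Un: "owp V ws \<Longrightarrow> \<Union>(set ws) = V"
proof (induction ws arbitrary: V)
  case (Cons B ws)
  then have "\<Union>(set ws) = V - B" "B \<subseteq> V" by simp_all
  then show ?case by auto
qed simp

lemma owp_append: "owp V (p @ q) \<longleftrightarrow> \<Union>(set p) \<subseteq> V \<and> owp (\<Union>(set p)) p \<and> owp (V - \<Union>(set p)) q"
proof (induction p arbitrary: V)
  case (Cons B p)
  have e1: "(V - B) - \<Union>(set p) = V - \<Union>(set (B # p))" by auto
  have e2: "\<Union>(set p) \<subseteq> V - B \<and> owp (\<Union>(set p)) p \<and> B \<noteq> {} \<and> B \<subseteq> V \<longleftrightarrow>
     \<Union>(set (B # p)) \<subseteq> V \<and> owp (\<Union>(set (B # p))) (B # p)" (is "?l \<longleftrightarrow> ?r")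
  proof
    assume *: ?l
    then have e: "\<Union>(set (B # p)) - B = \<Union>(set p)" by auto
    have "\<Union>(set (B # p)) \<subseteq> V" using * by auto
    then show ?r using * e by simp
  next
    assume *: ?r
    then have o: "owp (\<Union>(set (B # p)) - B) p" "B \<noteq> {}" "\<Union>(set (B # p)) \<subseteq> V" by simp_all
    from owp_Un[OF o(1)] have e: "\<Union>(set p) = \<Union>(set (B # p)) - B" .
    have "\<Union>(set p) \<subseteq> V - B" "B \<subseteq> V" using o(3) unfolding e by auto
    moreover have "owp (\<Union>(set p)) p" using o(1) by (subst e)
    ultimately show ?l using o(2) by blast
  qed
  have "owp V ((B # p) @ q) \<longleftrightarrow> B \<noteq> {} \<and> B \<subseteq> V \<and> owp (V - B) (p @ q)" by simp
  also have "\<dots> \<longleftrightarrow> (\<Union>(set p) \<subseteq> V - B \<and> owp (\<Union>(set p)) p \<and> B \<noteq> {} \<and> B \<subseteq> V) \<and> owp (V - \<Union>(set (B # p))) q"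
    unfolding Cons.IH e1 by blast
  finally show ?case unfolding e2 by blast
qed simp

lemma owp_merge:
  assumes "owp V (p @ B # C # q)"
  shows "owp V (p @ (B \<union> C) # q)"
proof -
  let ?P = "\<Union>(set p)"
  have eq: "V - ?P - (B \<union> C) = V - ?P - B - C" by auto
  show ?thesis using assms unfolding owp_append owp.simps eq by blast
qed

lemma owp_split:
  assumes "owp V (p @ (B \<union> C) # q)" "B \<noteq> {}" "C \<noteq> {}" "B \<inter> C = {}"
  shows "owp V (p @ B # C # q)"
proof -
  let ?P = "\<Union>(set p)"
  have eq: "V - ?P - (B \<union> C) = V - ?P - B - C" by auto
  show ?thesis using assms unfolding owp_append owp.simps eq by blast
qed

lemma owp_disj:
  assumes "owp V (p @ B # q)"
  shows "B \<noteq> {} \<and> B \<inter> \<Union>(set p) = {} \<and> B \<inter> \<Union>(set q) = {} \<and> \<Union>(set p) \<inter> \<Union>(set q) = {}"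
proof -
  let ?P = "\<Union>(set p)"
  have o: "B \<noteq> {}" "B \<subseteq> V - ?P" "owp (V - ?P - B) q" using assms by (simp_all add: owp_append)
  from owp_Un[OF o(3)] o(1,2) show ?thesis by blast
qed

lemma owp_nonempty:
  assumes "owp V ws" "B \<in> set ws"
  shows "B \<noteq> {} \<and> B \<subseteq> V"
proof -
  obtain p q where "ws = p @ B # q" using assms(2) by (meson split_list)
  then show ?thesis using assms(1) by (auto simp: owp_append)
qed

lemma owp_nth_disj:
  assumes "owp V ws" "i < j" "j < length ws"
  shows "ws ! i \<inter> ws ! j = {} \<and> ws ! i \<noteq> {}"
proof -
  have "ws = take i ws @ ws ! i # drop (Suc i) ws" using assms by (intro id_take_nth_drop) simp
  then have "owp V (take i ws @ ws ! i # drop (Suc i) ws)" using assms by simp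
  from owp_disj[OF this] have d: "ws ! i \<noteq> {}" "ws ! i \<inter> \<Union>(set (drop (Suc i) ws)) = {}" by auto
  have "drop (Suc i) ws ! (j - Suc i) = ws ! j" using assms by simp
  moreover have "j - Suc i < length (drop (Suc i) ws)" using assms by simp
  ultimately have "ws ! j \<in> set (drop (Suc i) ws)" by (metis nth_mem)
  then show ?thesis using d by blast
qed

lemma owp_length:
  assumes "finite V" "owp V ws"
  shows "length ws \<le> card V"
  using assms
proof (induction ws arbitrary: V)
  case (Cons B ws)
  then have "length ws \<le> card (V - B)" "card (V - B) = card V - card B" "card B \<le> card V"
    by (auto simp: card_Diff_subset finite_subset card_mono)
  moreover have "card B > 0" using Cons.prems by (auto simp: card_gt_0_iff finite_subset)
  ultimately show ?case by simp
qed auto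

lemma finite_owp: "finite V \<Longrightarrow> finite {ws. owp V ws}"
  using owp_nonempty owp_length
  by (intro finite_subset[OF _ finite_lists_length_le[of "Pow V" "card V"]]) auto

lemma mrg_append: "mrg (length p) (p @ B # C # q) = p @ (B \<union> C) # q"
  by (simp add: mrg_def nth_append)

lemma nth_decomp2: "Suc k < length ws \<Longrightarrow> ws = take k ws @ ws ! k # ws ! Suc k # drop (Suc (Suc k)) ws"
  by (metis Cons_nth_drop_Suc Suc_lessD id_take_nth_drop)

lemma length_mrg: "Suc k < length ws \<Longrightarrow> length (mrg k ws) = length ws - 1"
  by (simp add: mrg_def)

lemma nth_mrg: "Suc k < length ws \<Longrightarrow> i < length ws - 1 \<Longrightarrow>
  mrg k ws ! i = (if i < k then ws ! i else if i = k then ws ! k \<union> ws ! Suc k else ws ! Suc i)"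
  by (auto simp: mrg_def nth_append min_def nth_Cons')

lemma mrg_mrg: "j < k \<Longrightarrow> Suc k < length ws \<Longrightarrow> mrg j (mrg k ws) = mrg (k - 1) (mrg j ws)"
proof (rule nth_equalityI)
  assume jk: "j < k" "Suc k < length ws"
  then show "length (mrg j (mrg k ws)) = length (mrg (k - 1) (mrg j ws))" by (simp add: length_mrg)
  fix i assume "i < length (mrg j (mrg k ws))"
  then have i: "i < length ws - 2" using jk by (simp add: length_mrg)
  show "mrg j (mrg k ws) ! i = mrg (k - 1) (mrg j ws) ! i"
    using jk i by (cases "k = Suc j") (auto simp: nth_mrg length_mrg less_Suc_eq)
qed

lemma wbd_wbd: "lext wbd (wbd y) = (0 :: 'n set list \<Rightarrow> 'k::field)"
  unfolding wbd_def by (rule fbd_fbd) (auto simp: length_mrg mrg_mrg)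

lemma finite_supp_wbd [simp]: "finite (supp (wbd y))"
  by (simp add: wbd_def)

lemma wbdE:
  assumes "wbd y x \<noteq> (0 :: 'k::field)"
  obtains p B C q where "y = p @ B # C # q" "x = p @ (B \<union> C) # q"
proof -
  have "x \<in> supp (wbd y :: _ \<Rightarrow> 'k)" using assms by (simp add: supp_def)
  then obtain k where k: "k < length y - 1" "x = mrg k y" using supp_fbd unfolding wbd_def by fastforce
  then have "y = take k y @ y ! k # y ! Suc k # drop (Suc (Suc k)) y" by (intro nth_decomp2) auto
  moreover have "x = take k y @ (y ! k \<union> y ! Suc k) # drop (Suc (Suc k)) y" using k by (simp add: mrg_def)
  ultimately show ?thesis by (rule that)
qed

text \<open>Blocks are nonempty and disjoint, so merges at different positions give different words.
  Each incidence number is therefore a single sign and not a sum that might cancel.\<close>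

lemma wbd_merge:
  assumes "owp V (p @ B # C # q)"
  shows "wbd (p @ B # C # q) (p @ (B \<union> C) # q) = ((-1) ^ length p :: 'k::field)"
proof -
  let ?y = "p @ B # C # q" and ?x = "p @ (B \<union> C) # q"
  have *: "k = length p" if k: "k < length ?y - 1" "mrg k ?y = ?x" for k
  proof (rule ccontr)
    assume ne: "k \<noteq> length p"
    have e: "mrg k ?y ! k = mrg (length p) ?y ! k" "mrg k ?y ! length p = mrg (length p) ?y ! length p"
      using k(2) by (simp_all add: mrg_append)
    have disj: "?y ! i \<inter> ?y ! j = {} \<and> ?y ! i \<noteq> {}" if "i < j" "j < length ?y" for i j
      by (rule owp_nth_disj[OF assms that])
    have ne2: "?y ! i \<noteq> {}" if "i < length ?y" for i using owp_nonempty[OF assms] that nth_mem by blast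
    show False
    proof (cases "k < length p")
      case True
      then have "?y ! k \<union> ?y ! Suc k = ?y ! k" using e(1) k(1) nth_mrg[of k ?y k] nth_mrg[of "length p" ?y k] by simp
      then show False using disj[of k "Suc k"] ne2[of "Suc k"] k(1) by auto
    next
      case False
      then have "?y ! length p = ?y ! length p \<union> ?y ! Suc (length p)"
        using ne e(2) k(1) nth_mrg[of k ?y "length p"] nth_mrg[of "length p" ?y "length p"] by simp
      then show False using disj[of "length p" "Suc (length p)"] ne2[of "Suc (length p)"] by auto
    qed
  qed
  have "(wbd ?y ?x :: 'k) = (\<Sum>k<length ?y - 1. if mrg k ?y = ?x then (-1) ^ k else 0)"
    by (simp add: wbd_def fbd_apply)
  also have "\<dots> = (\<Sum>k<length ?y - 1. if k = length p then (-1) ^ k else 0)"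
    by (rule sum.cong) (use * mrg_append[of p B C q] in auto)
  also have "\<dots> = (-1) ^ length p" by simp
  finally show ?thesis .
qed

lemma cplx_wbd: "cplx wbd {ws. owp V ws}"
  unfolding cplx_def
proof (intro conjI allI ballI impI)
  fix y x assume "x \<in> supp (wbd y :: 'a set list \<Rightarrow> 'b)"
  then have "wbd y x \<noteq> (0::'b)" by (simp add: supp_def)
  then show "Suc (length x) = length y" by (rule wbdE) simp
next
  fix y assume y: "y \<in> {ws. owp V ws}"
  have "rst {ws. owp V ws} (wbd y) = (wbd y :: _ \<Rightarrow> 'b)"
  proof (rule rst_id, rule subsetI)
    fix x assume "x \<in> supp (wbd y :: _ \<Rightarrow> 'b)"
    then have "wbd y x \<noteq> (0::'b)" by (simp add: supp_def)
    then show "x \<in> {ws. owp V ws}" by (rule wbdE) (use y owp_merge in auto)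
  qed
  then show "rst {ws. owp V ws} (lext wbd (rst {ws. owp V ws} (wbd y))) = (0 :: _ \<Rightarrow> 'b)"
    by (simp add: wbd_wbd rst_0)
qed simp

section \<open>Acyclicity by toggling a pivot element\<close>

lemma measures_append1: "(x, y) \<in> measures fs \<Longrightarrow> (x, y) \<in> measures (fs @ gs)"
  by (induction fs) auto

lemma measures_append2: "(\<forall>f\<in>set fs. f x = f y) \<Longrightarrow> g x < g y \<Longrightarrow> (x, y) \<in> measures (fs @ [g])"
  by (induction fs) auto

lemma measures_cong: "(\<forall>f\<in>set fs. f x = f x') \<Longrightarrow> (x, y) \<in> measures fs \<longleftrightarrow> (x', y) \<in> measures fs"
  by (induction fs) auto

lemma owp_unique_pos:
  assumes "owp V (p @ B # q)" "p @ B # q = p' @ B' # q'" "a \<in> B" "a \<in> B'"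
  shows "p = p' \<and> B = B' \<and> q = q'"
proof -
  from assms(2) consider r where "p = p' @ r" "r @ B # q = B' # q'" | r where "p @ r = p'" "B # q = r @ B' # q'"
    by (auto simp: append_eq_append_conv2)
  then show ?thesis
  proof cases
    case 1
    show ?thesis
    proof (cases r)
      case (Cons c r')
      then have "B' \<in> set p" using 1 by auto
      then show ?thesis using owp_disj[OF assms(1)] assms(3,4) by blast
    qed (use 1 in auto)
  next
    case 2
    show ?thesis
    proof (cases r)
      case (Cons c r')
      then have "B' \<in> set q" using 2 by auto
      then show ?thesis using owp_disj[OF assms(1)] assms(3,4) by blast
    qed (use 2 in auto)
  qed
qed

text \<open>The matching toggles a pivot \<open>a = \<pi> x\<close>: it is split off its block as a
  singleton placed directly behind, or a singleton \<open>{a}\<close> is merged into the block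
  before it. \<open>A1\<close> excludes a pivot that forms the first block on its own, which could
  not be merged. \<open>A2\<close> and \<open>A3\<close> say that toggling keeps the pivot and the
  statistics \<open>fs\<close>. By \<open>A4\<close> any merge lowers the statistics
  lexicographically or leaves them and the pivot unchanged; in the second case the position of the
  pivot decides, and the matching is triangular.\<close>

lemma toggle_acyc:
  fixes N :: "'n set list set" and \<pi> :: "'n set list \<Rightarrow> 'n"
  assumes N: "cplx (wbd :: _ \<Rightarrow> _ \<Rightarrow> 'k::field) N" and finN: "finite N" and ow: "\<And>x. x \<in> N \<Longrightarrow> owp V x"
    and A1: "\<And>x a. x \<in> N \<Longrightarrow> \<pi> x = a \<Longrightarrow> \<exists>p B q. x = p @ B # q \<and> a \<in> B \<and> (B = {a} \<longrightarrow> p \<noteq> [])"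
    and A2: "\<And>p B q a. p @ B # q \<in> N \<Longrightarrow> \<pi> (p @ B # q) = a \<Longrightarrow> a \<in> B \<Longrightarrow> B \<noteq> {a} \<Longrightarrow>
        p @ (B - {a}) # {a} # q \<in> N \<and> \<pi> (p @ (B - {a}) # {a} # q) = a \<and>
        (\<forall>f\<in>set fs. f (p @ (B - {a}) # {a} # q) = f (p @ B # q))"
    and A3: "\<And>p C q a. p @ C # {a} # q \<in> N \<Longrightarrow> \<pi> (p @ C # {a} # q) = a \<Longrightarrow>
        p @ (C \<union> {a}) # q \<in> N \<and> \<pi> (p @ (C \<union> {a}) # q) = a \<and>
        (\<forall>f\<in>set fs. f (p @ (C \<union> {a}) # q) = f (p @ C # {a} # q))"
    and A4: "\<And>p B C q. p @ B # C # q \<in> N \<Longrightarrow> p @ (B \<union> C) # q \<in> N \<Longrightarrow>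
        (p @ (B \<union> C) # q, p @ B # C # q) \<in> measures fs \<or>
        (\<forall>f\<in>set fs. f (p @ (B \<union> C) # q) = f (p @ B # C # q)) \<and> \<pi> (p @ (B \<union> C) # q) = \<pi> (p @ B # C # q)"
  shows "acyc (wbd :: _ \<Rightarrow> _ \<Rightarrow> 'k) N"
proof -
  define A where "A = {x\<in>N. {\<pi> x} \<notin> set x}"
  define B where "B = {x\<in>N. {\<pi> x} \<in> set x}"
  have AB: "A \<union> B = N" "A \<inter> B = {}" by (auto simp: A_def B_def)
  have BI: "x \<in> B" if "x \<in> N" "\<pi> x = a" "{a} \<in> set x" for x a using that by (simp add: B_def)
  have BD: "x \<in> N" "{\<pi> x} \<in> set x" if "x \<in> B" for x using that by (simp_all add: B_def)
  have AD: "x \<in> N" "{\<pi> x} \<notin> set x" if "x \<in> A" for x using that by (simp_all add: A_def)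
  have upos: "p = p' \<and> D = D' \<and> q = q'" if "p @ D # q \<in> N" "p @ D # q = p' @ D' # q'" "a \<in> D" "a \<in> D'" for p q p' q' D D' a
    by (rule owp_unique_pos[OF ow[OF that(1)] that(2-4)])
  have Bdec: "\<exists>p C q. x = p @ C # {a} # q" if x: "x \<in> B" and a: "\<pi> x = a" for x a
  proof -
    have xN: "x \<in> N" "{a} \<in> set x" using BD[OF x] a by auto
    obtain p D q where d: "x = p @ D # q" "a \<in> D" "D = {a} \<longrightarrow> p \<noteq> []" using A1[OF xN(1) a] by blast
    obtain p' q' where e: "x = p' @ {a} # q'" using xN(2) by (meson split_list)
    have pN: "p @ D # q \<in> N" and pe: "p @ D # q = p' @ {a} # q'" using xN(1) e unfolding d(1) .
    have D: "D = {a}" using upos[OF pN pe d(2)] by simp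
    then have "p \<noteq> []" using d(3) by simp
    then obtain r C where "p = r @ [C]" by (metis rev_exhaust)
    then show ?thesis unfolding d(1) D by auto
  qed
  have BE: "\<exists>p C q. x = p @ C # {a} # q \<and> p @ C # {a} # q \<in> B \<and> p @ C # {a} # q \<in> N \<and> \<pi> (p @ C # {a} # q) = a \<and> a \<notin> C \<and> C \<noteq> {}"
    if x: "x \<in> B" and a: "\<pi> x = a" for x a
  proof -
    obtain p C q where d: "x = p @ C # {a} # q" using Bdec[OF x a] by blast
    have "owp V (p @ C # {a} # q)" using ow[OF BD(1)[OF x]] unfolding d .
    from owp_disj[OF this] have "a \<notin> C" "C \<noteq> {}" by auto
    then show ?thesis using x a BD(1)[OF x] unfolding d by blast
  qed
  \<comment> \<open>The partner is chosen by a relation; it is unique since only one block contains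
    the pivot.\<close>
  define P where "P x y \<longleftrightarrow> (\<exists>p C q a. \<pi> x = a \<and> x = p @ C # {a} # q \<and> y = p @ (C \<union> {a}) # q)" for x y
  define \<mu> where "\<mu> x = (SOME y. P x y)" for x
  have \<mu>: "\<mu> (p @ C # {a} # q) = p @ (C \<union> {a}) # q" if x: "p @ C # {a} # q \<in> N" "\<pi> (p @ C # {a} # q) = a" for p C q a
  proof -
    have "P (p @ C # {a} # q) (p @ (C \<union> {a}) # q)" using x(2) by (auto simp: P_def)
    then have "P (p @ C # {a} # q) (\<mu> (p @ C # {a} # q))" unfolding \<mu>_def by (rule someI)
    then obtain p' C' q' a' where e: "\<pi> (p @ C # {a} # q) = a'" "p @ C # {a} # q = p' @ C' # {a'} # q'"
      "\<mu> (p @ C # {a} # q) = p' @ (C' \<union> {a'}) # q'" unfolding P_def by blast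
    have a: "a' = a" using e(1) x(2) by simp
    have "(p @ [C]) @ {a} # q \<in> N" "(p @ [C]) @ {a} # q = (p' @ [C']) @ {a} # q'" using x e(2) a by simp_all
    from upos[OF this] have "p @ [C] = p' @ [C'] \<and> q = q'" by simp
    then show ?thesis using e(3) a by simp
  qed
  have \<mu>A: "\<mu> x \<in> A \<and> \<pi> (\<mu> x) = \<pi> x \<and> (\<forall>f\<in>set fs. f (\<mu> x) = f x)" if x: "x \<in> B" for x
  proof -
    obtain a where a: "\<pi> x = a" by blast
    obtain p C q where d: "x = p @ C # {a} # q" "p @ C # {a} # q \<in> N" "\<pi> (p @ C # {a} # q) = a" "a \<notin> C" "C \<noteq> {}"
      using BE[OF x a] by blast
    have m: "\<mu> x = p @ (C \<union> {a}) # q" unfolding d(1) by (rule \<mu>[OF d(2,3)])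
    note a3 = A3[OF d(2,3)]
    have "{a} \<notin> set (\<mu> x)"
    proof
      assume "{a} \<in> set (\<mu> x)"
      then obtain p' q' where e: "p @ (C \<union> {a}) # q = p' @ {a} # q'" unfolding m by (meson split_list)
      have "C \<union> {a} = {a}" using upos[OF conjunct1[OF a3] e, of a] by simp
      then show False using d(4,5) by auto
    qed
    then show ?thesis using a3 a m unfolding A_def d(1) by simp
  qed
  \<comment> \<open>Number of blocks from the one with the pivot to the end of the word: the
    tie-breaker after the statistics \<open>fs\<close>.\<close>
  define pos where "pos x = length x - (SOME n. n < length x \<and> \<pi> x \<in> x ! n)" for x
  have pos: "pos (p @ D # q) = Suc (length q)" if x: "p @ D # q \<in> N" "\<pi> (p @ D # q) \<in> D" for p D q
  proof -
    obtain x where xd: "x = p @ D # q" by blast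
    have "length p < length x \<and> \<pi> x \<in> x ! length p" using x unfolding xd by (simp add: nth_append)
    then have s: "(SOME n. n < length x \<and> \<pi> x \<in> x ! n) < length x \<and> \<pi> x \<in> x ! (SOME n. n < length x \<and> \<pi> x \<in> x ! n)"
      by (rule someI)
    obtain n where n: "n = (SOME n. n < length x \<and> \<pi> x \<in> x ! n)" by blast
    have nn: "n < length x" "\<pi> x \<in> x ! n" using s unfolding n by auto
    have "x = take n x @ x ! n # drop (Suc n) x" using nn(1) by (rule id_take_nth_drop)
    then have e: "p @ D # q = take n x @ x ! n # drop (Suc n) x" unfolding xd .
    have "p = take n x" using upos[OF x(1) e x(2)] nn(2) unfolding xd by simp
    then have "length p = n" using nn(1) by (metis length_take min_absorb2 less_imp_le)
    then have "pos x = length x - length p" unfolding pos_def n by simp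
    then show ?thesis unfolding xd by simp
  qed
  have "acyc (wbd :: _ \<Rightarrow> _ \<Rightarrow> 'k) (A \<union> B)"
  proof (rule acyc_matching[where \<mu> = \<mu> and R = "measures (fs @ [pos])"])
    show "cplx (wbd :: _ \<Rightarrow> _ \<Rightarrow> 'k) (A \<union> B)" using N AB by simp
    show "A \<inter> B = {}" by (rule AB)
    show "finite B" using finN by (simp add: B_def)
    show "wf (measures (fs @ [pos]))" by simp
    show "bij_betw \<mu> B A"
    proof (rule bij_betwI')
      fix x y assume x: "x \<in> B" and y: "y \<in> B"
      have "x = y" if e: "\<mu> x = \<mu> y"
      proof -
        obtain a where a: "\<pi> x = a" by blast
        have a': "\<pi> y = a" using \<mu>A[OF x] \<mu>A[OF y] e a by simp
        obtain p C q where d: "x = p @ C # {a} # q" "p @ C # {a} # q \<in> N" "\<pi> (p @ C # {a} # q) = a" "a \<notin> C" "C \<noteq> {}"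
          using BE[OF x a] by blast
        obtain p' C' q' where d': "y = p' @ C' # {a} # q'" "p' @ C' # {a} # q' \<in> N" "\<pi> (p' @ C' # {a} # q') = a" "a \<notin> C'" "C' \<noteq> {}"
          using BE[OF y a'] by blast
        have m: "\<mu> x = p @ (C \<union> {a}) # q" unfolding d(1) by (rule \<mu>[OF d(2,3)])
        have m': "\<mu> y = p' @ (C' \<union> {a}) # q'" unfolding d'(1) by (rule \<mu>[OF d'(2,3)])
        have "p @ (C \<union> {a}) # q = p' @ (C' \<union> {a}) # q'" using m m' e by simp
        from upos[OF conjunct1[OF A3[OF d(2,3)]] this, of a]
        have "p = p'" "C \<union> {a} = C' \<union> {a}" "q = q'" by simp_all
        moreover have "C = C'" using calculation(2) d(4) d'(4) by auto
        ultimately show ?thesis unfolding d(1) d'(1) by simp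
      qed
      then show "(\<mu> x = \<mu> y) = (x = y)" by blast
    next
      fix x assume "x \<in> B" then show "\<mu> x \<in> A" using \<mu>A by blast
    next
      fix y assume y: "y \<in> A"
      obtain a where a: "\<pi> y = a" by blast
      have yN: "y \<in> N" "{a} \<notin> set y" using AD[OF y] a by auto
      obtain p D q where d: "y = p @ D # q" "a \<in> D" using A1[OF yN(1) a] by blast
      have D: "D \<noteq> {a}" using yN(2) unfolding d(1) by auto
      have dN: "p @ D # q \<in> N" "\<pi> (p @ D # q) = a" using yN(1) a unfolding d(1) .
      obtain x where x: "x = p @ (D - {a}) # {a} # q" by blast
      have a2: "p @ (D - {a}) # {a} # q \<in> N" "\<pi> (p @ (D - {a}) # {a} # q) = a" using A2[OF dN d(2) D] by auto
      have "x \<in> B" by (rule BI[of _ a]) (use a2 in \<open>simp_all add: x\<close>)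
      moreover have "D - {a} \<union> {a} = D" using d(2) by auto
      then have "\<mu> x = y" using \<mu>[OF a2] unfolding x d(1) by simp
      ultimately show "\<exists>x\<in>B. y = \<mu> x" by blast
    qed
  next
    fix b assume b: "b \<in> B"
    obtain a where a: "\<pi> b = a" by blast
    obtain p C q where d: "b = p @ C # {a} # q" "p @ C # {a} # q \<in> N" "\<pi> (p @ C # {a} # q) = a"
      using BE[OF b a] by blast
    show "wbd b (\<mu> b) \<noteq> (0::'k)"
      unfolding d(1) \<mu>[OF d(2,3)] using wbd_merge[OF ow[OF d(2)], where 'k = 'k] by simp
  next
    fix b b' assume b: "b \<in> B" and b': "b' \<in> B" and ne: "b \<noteq> b'" and nz: "wbd b' (\<mu> b) \<noteq> (0::'k)"
    obtain p D C q where d: "b' = p @ D # C # q" "\<mu> b = p @ (D \<union> C) # q" using nz by (rule wbdE)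
    note mb = \<mu>A[OF b]
    have dN: "p @ D # C # q \<in> N" using BD(1)[OF b'] unfolding d(1) .
    have mN: "p @ (D \<union> C) # q \<in> N" using AD(1)[OF conjunct1[OF mb]] unfolding d(2) .
    from A4[OF dN mN] show "(b, b') \<in> measures (fs @ [pos])"
    proof
      assume "(p @ (D \<union> C) # q, p @ D # C # q) \<in> measures fs"
      then have "(\<mu> b, b') \<in> measures fs" unfolding d .
      moreover have "\<forall>f\<in>set fs. f b = f (\<mu> b)" using mb by (blast intro: sym)
      ultimately have "(b, b') \<in> measures fs" using measures_cong[of fs b "\<mu> b" b'] by blast
      then show ?thesis by (rule measures_append1)
    next
      assume *: "(\<forall>f\<in>set fs. f (p @ (D \<union> C) # q) = f (p @ D # C # q)) \<and> \<pi> (p @ (D \<union> C) # q) = \<pi> (p @ D # C # q)"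
      have 2: "\<forall>f\<in>set fs. f (\<mu> b) = f b'" "\<pi> (\<mu> b) = \<pi> b'"
        using conjunct1[OF *] conjunct2[OF *] unfolding d .
      obtain a where a: "\<pi> b = a" by blast
      have a': "\<pi> b' = a" using 2(2) conjunct1[OF conjunct2[OF mb]] a by simp
      have eq: "\<forall>f\<in>set fs. f b = f b'"
      proof
        fix f assume f: "f \<in> set fs"
        have "f (\<mu> b) = f b" using mb f by blast
        then show "f b = f b'" using bspec[OF 2(1) f] by (rule trans[OF sym])
      qed
      obtain r E s where e: "b = r @ E # {a} # s" "r @ E # {a} # s \<in> N" "\<pi> (r @ E # {a} # s) = a" "a \<notin> E" "E \<noteq> {}"
        using BE[OF b a] by blast
      have m: "\<mu> b = r @ (E \<union> {a}) # s" unfolding e(1) by (rule \<mu>[OF e(2,3)])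
      have nin: "{a} \<notin> set (\<mu> b)" using AD(2)[OF conjunct1[OF mb]] conjunct1[OF conjunct2[OF mb]] a by simp
      \<comment> \<open>The pivot is the same for \<open>b'\<close> and \<open>\<mu> b\<close>, and
        it forms a block of \<open>b'\<close> but not of \<open>\<mu> b\<close>, so it is one of the
        two merged blocks. If it is the second, then \<open>b' = b\<close>; if it is the first, it
        stands further from the end than the pivot of \<open>b\<close>.\<close>
      have "{a} \<in> set b'" using BD(2)[OF b'] a' by simp
      then have "a \<in> D \<union> C" and aDC: "{a} = D \<or> {a} = C" using nin unfolding d by auto
      have "p @ (D \<union> C) # q = r @ (E \<union> {a}) # s" using d(2) m by simp
      from upos[OF mN this \<open>a \<in> D \<union> C\<close>] have pr: "p = r" "D \<union> C = E \<union> {a}" "q = s" by simp_all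
      have dis: "D \<inter> C = {}" using owp_disj[OF ow[OF dN]] by auto
      from aDC show ?thesis
      proof
        assume C: "{a} = C"
        then have "D = E" using pr(2) dis e(4) by auto
        then have "b = b'" unfolding e(1) d(1) using pr C by simp
        then show ?thesis using ne by simp
      next
        assume D: "{a} = D"
        have 1: "pos b = Suc (length s)"
          unfolding e(1) using pos[of "r @ [E]" "{a}" s] e(2,3) by simp
        have "pos b' = Suc (length (C # q))"
          unfolding d(1) by (rule pos[OF dN]) (use a' D in \<open>auto simp: d(1)[symmetric]\<close>)
        then have "pos b < pos b'" using 1 pr(3) by simp
        with eq show ?thesis by (rule measures_append2)
      qed
    qed
  qed
  then show ?thesis unfolding AB(1) .
qed

text \<open>Length of the longest common prefix of a word with \<open>sng es\<close>: the number of
  leading singletons in the prescribed order.\<close>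

fun cpl :: "'n list \<Rightarrow> 'n set list \<Rightarrow> nat" where
  "cpl (a # es) (B # w) = (if B = {a} then Suc (cpl es w) else 0)"
| "cpl _ _ = 0"

abbreviation sng :: "'n list \<Rightarrow> 'n set list" where
  "sng \<equiv> map (\<lambda>a. {a})"

lemma cpl_Nil2 [simp]: "cpl es [] = 0"
  by (cases es) auto

lemma cpl_sng [simp]: "cpl es (sng es) = length es"
  by (induction es) auto

lemma cpl_less:
  assumes "distinct es" "owp (set es) w" "w \<noteq> sng es"
  shows "cpl es w < length es"
  using assms
proof (induction es arbitrary: w)
  case Nil
  then show ?case by (cases w) auto
next
  case (Cons a es)
  show ?case
  proof (cases w)
    case (Cons B w')
    show ?thesis
    proof (cases "B = {a}")
      case True
      have "owp (set es) w'"
        using Cons.prems Cons True by simp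
      moreover have "w' \<noteq> sng es" using Cons.prems(3) Cons True by simp
      ultimately show ?thesis using Cons.IH[of w'] Cons.prems(1) Cons True by simp
    qed (simp add: Cons)
  qed simp
qed

text \<open>A merged block is never a singleton, so a merge cannot lengthen the sorted
  prefix.\<close>

lemma cpl_merge: "B \<noteq> {} \<Longrightarrow> C \<noteq> {} \<Longrightarrow> B \<inter> C = {} \<Longrightarrow> cpl es (p @ (B \<union> C) # q) \<le> cpl es (p @ B # C # q)"
proof (induction p arbitrary: es)
  case Nil
  have "B \<union> C \<noteq> {a}" for a using Nil by (metis Int_absorb Un_singleton_iff inf_commute)
  then show ?case by (cases es) auto
next
  case (Cons P p)
  then show ?case by (cases es) auto
qed

text \<open>The pivot will be the first element of \<open>es\<close> that is not yet in place. Its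
  block comes after the sorted prefix and, if it is a singleton, not immediately after it, since it
  would then be counted.\<close>

lemma cpl_pivot:
  assumes "distinct es" "owp (set es) w" "w \<noteq> sng es"
  shows "\<exists>p B q. w = p @ B # q \<and> es ! cpl es w \<in> B \<and> cpl es w \<le> length p \<and>
     (B = {es ! cpl es w} \<longrightarrow> cpl es w < length p)"
  using assms
proof (induction es arbitrary: w)
  case Nil
  then show ?case by (cases w) auto
next
  case (Cons a es)
  obtain B w' where w: "w = B # w'" using Cons.prems(2) by (cases w) auto
  show ?case
  proof (cases "B = {a}")
    case True
    have o: "owp (set es) w'" using Cons.prems w True by simp
    have n: "w' \<noteq> sng es" using Cons.prems(3) w True by simp
    obtain p B' q where *: "w' = p @ B' # q" "es ! cpl es w' \<in> B'" "cpl es w' \<le> length p"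
      "B' = {es ! cpl es w'} \<longrightarrow> cpl es w' < length p"
      using Cons.IH[OF _ o n] Cons.prems(1) by auto
    have "w = (B # p) @ B' # q" using w *(1) by simp
    moreover have "cpl (a # es) w = Suc (cpl es w')" using w True by simp
    ultimately show ?thesis using * by (intro exI[of _ "B # p"] exI[of _ B'] exI[of _ q]) simp
  next
    case False
    then have c: "cpl (a # es) w = 0" using w by simp
    have "a \<in> \<Union>(set w)" using owp_Un[OF Cons.prems(2)] by simp
    then obtain B' where B': "B' \<in> set w" "a \<in> B'" by auto
    obtain p q where pq: "w = p @ B' # q" using B'(1) by (meson split_list)
    have "B' = {a} \<longrightarrow> 0 < length p" using pq w False by (cases p) auto
    then have "(a # es) ! cpl (a # es) w \<in> B' \<and> cpl (a # es) w \<le> length p \<and>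
        (B' = {(a # es) ! cpl (a # es) w} \<longrightarrow> cpl (a # es) w < length p)"
      unfolding c using B'(2) by simp
    then show ?thesis using pq by blast
  qed
qed

text \<open>The split happens behind the sorted prefix, and it cannot extend this prefix because
  \<open>B - {a}\<close> comes before the new singleton.\<close>

lemma cpl_up:
  assumes "cpl es (p @ B # q) \<le> length p" "es ! cpl es (p @ B # q) = a" "cpl es (p @ B # q) < length es" "B \<noteq> {a}"
  shows "cpl es (p @ (B - {a}) # {a} # q) = cpl es (p @ B # q)"
  using assms
proof (induction p arbitrary: es)
  case Nil
  then show ?case by (cases es) auto
next
  case (Cons P p)
  show ?case
  proof (cases es)
    case (Cons e es')
    then show ?thesis using Cons.prems Cons.IH[of es'] by (cases "P = {e}") auto
  qed simp
qed

lemma cpl_down: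
  assumes "cpl es (p @ C # {a} # q) \<le> length p" "es ! cpl es (p @ C # {a} # q) = a"
    "cpl es (p @ C # {a} # q) < length es" "C \<noteq> {}" "a \<notin> C"
  shows "cpl es (p @ (C \<union> {a}) # q) = cpl es (p @ C # {a} # q)"
  using assms
proof (induction p arbitrary: es)
  case Nil
  then show ?case by (cases es) (auto split: if_splits)
next
  case (Cons P p)
  show ?case
  proof (cases es)
    case (Cons e es')
    then show ?thesis using Cons.prems Cons.IH[of es'] by (cases "P = {e}") auto
  qed simp
qed

lemma merge_not_sng:
  assumes "B \<noteq> {}" "C \<noteq> {}" "B \<inter> C = {}"
  shows "B \<union> C \<noteq> {a}"
  using assms by (metis Int_absorb Un_singleton_iff inf_commute)

lemma owp_letters: "owp V (p @ B # C # q) \<Longrightarrow> B \<noteq> {} \<and> C \<noteq> {} \<and> B \<inter> C = {}"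
  using owp_nth_disj[of V "p @ B # C # q" "length p" "Suc (length p)"] owp_nonempty[of V "p @ B # C # q" C]
  by (simp add: nth_append)

lemma owp_toggle_up: "owp V (p @ B # q) \<Longrightarrow> a \<in> B \<Longrightarrow> B \<noteq> {a} \<Longrightarrow> owp V (p @ (B - {a}) # {a} # q)"
  using owp_split[of V p "B - {a}" "{a}" q] by (simp add: insert_absorb) blast

abbreviation owps :: "'n set \<Rightarrow> 'n set list set" where
  "owps V \<equiv> {ws. owp V ws}"

lemma subcplx_wbdI:
  assumes "N \<subseteq> W" "\<And>p B C q. p @ B # C # q \<in> N \<Longrightarrow> p @ (B \<union> C) # q \<in> W \<Longrightarrow> p @ (B \<union> C) # q \<in> N"
  shows "subcplx (wbd :: _ \<Rightarrow> _ \<Rightarrow> 'k::field) N W"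
  unfolding subcplx_def
proof (intro conjI ballI impI assms(1))
  fix y x assume y: "y \<in> N" and x: "x \<in> W" and nz: "wbd y x \<noteq> (0::'k)"
  obtain p B C q where d: "y = p @ B # C # q" "x = p @ (B \<union> C) # q" using nz by (rule wbdE)
  show "x \<in> N" using assms(2) y x unfolding d by blast
qed

lemma subcplx_owps: "subcplx (wbd :: _ \<Rightarrow> _ \<Rightarrow> 'k::field) (owps V - {sng es}) (owps V)"
proof (rule subcplx_wbdI)
  fix p B C q assume y: "p @ B # C # q \<in> owps V - {sng es}" and x: "p @ (B \<union> C) # q \<in> owps V"
  have "B \<union> C \<noteq> {a}" for a by (rule merge_not_sng) (use owp_letters[of V p B C q] y in auto)
  then have "p @ (B \<union> C) # q \<noteq> sng es"
    by (metis (no_types, lifting) imageE in_set_conv_decomp list.set_map)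
  then show "p @ (B \<union> C) # q \<in> owps V - {sng es}" using x by blast
qed auto

text \<open>For nonempty \<open>V\<close> the ordered partitions are the simplices of the
  barycentric subdivision of the boundary of a simplex, with \<open>[V]\<close> as the empty
  simplex. Without one chamber this sphere is a ball. The pivot is the first element of
  \<open>es\<close> out of place, and \<open>sng es\<close> is the only word without one.\<close>

lemma acyc_owps:
  assumes V: "finite V" and es: "distinct es" "set es = V"
  shows "acyc (wbd :: _ \<Rightarrow> _ \<Rightarrow> 'k::field) (owps V - {sng es})"
proof (rule toggle_acyc[where \<pi> = "\<lambda>w. es ! cpl es w" and fs = "[cpl es]" and V = V])
  let ?N = "owps V - {sng es}"
  show "cplx (wbd :: _ \<Rightarrow> _ \<Rightarrow> 'k) ?N" by (rule cplx_sub[OF cplx_wbd subcplx_owps])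
  show "finite ?N" using finite_owp[OF V] by simp
  show "owp V x" if "x \<in> ?N" for x using that by simp
  have piv: "\<exists>p B q. x = p @ B # q \<and> a \<in> B \<and> cpl es x \<le> length p \<and> (B = {a} \<longrightarrow> cpl es x < length p)"
    if "x \<in> ?N" "es ! cpl es x = a" for x a
    using cpl_pivot[of es x] that es by auto
  have less: "cpl es x < length es" if "x \<in> ?N" for x using cpl_less[of es x] that es by auto
  have ltN: "x \<in> ?N" if "owp V x" "cpl es x < length es" for x using that by auto
  show "\<exists>p B q. x = p @ B # q \<and> a \<in> B \<and> (B = {a} \<longrightarrow> p \<noteq> [])"
    if x: "x \<in> ?N" and a: "es ! cpl es x = a" for x a
  proof -
    obtain p B q where d: "x = p @ B # q" "a \<in> B" "B = {a} \<longrightarrow> cpl es x < length p" using piv[OF x a] by blast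
    have "B = {a} \<longrightarrow> p \<noteq> []" using d(3) by auto
    then show ?thesis using d(1,2) by blast
  qed
  show "p @ (B - {a}) # {a} # q \<in> ?N \<and> es ! cpl es (p @ (B - {a}) # {a} # q) = a \<and>
        (\<forall>f\<in>set [cpl es]. f (p @ (B - {a}) # {a} # q) = f (p @ B # q))"
    if x: "p @ B # q \<in> ?N" and a: "es ! cpl es (p @ B # q) = a" and aB: "a \<in> B" "B \<noteq> {a}" for p B q a
  proof -
    obtain p' B' q' where d: "p @ B # q = p' @ B' # q'" "a \<in> B'" "cpl es (p @ B # q) \<le> length p'"
      using piv[OF x a] by blast
    have "p = p'" using owp_unique_pos[OF _ d(1) aB(1) d(2)] x by blast
    then have le: "cpl es (p @ B # q) \<le> length p" using d(3) by simp
    have e: "cpl es (p @ (B - {a}) # {a} # q) = cpl es (p @ B # q)"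
      by (rule cpl_up[OF le a less[OF x] aB(2)])
    have "p @ (B - {a}) # {a} # q \<in> ?N"
      by (rule ltN) (use owp_toggle_up[OF _ aB] x less[OF x] e in auto)
    then show ?thesis using e a by simp
  qed
  show "p @ (C \<union> {a}) # q \<in> ?N \<and> es ! cpl es (p @ (C \<union> {a}) # q) = a \<and>
        (\<forall>f\<in>set [cpl es]. f (p @ (C \<union> {a}) # q) = f (p @ C # {a} # q))"
    if x: "p @ C # {a} # q \<in> ?N" and a: "es ! cpl es (p @ C # {a} # q) = a" for p C q a
  proof -
    obtain p' B' q' where d: "p @ C # {a} # q = p' @ B' # q'" "a \<in> B'" "B' = {a} \<longrightarrow> cpl es (p @ C # {a} # q) < length p'"
      using piv[OF x a] by blast
    have "p @ [C] = p' \<and> {a} = B' \<and> q = q'"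
      by (rule owp_unique_pos[of V _ _ _ _ _ _ a]) (use x d in auto)
    then have le: "cpl es (p @ C # {a} # q) \<le> length p" using d(3) by auto
    have o: "owp V (p @ C # {a} # q)" using x by simp
    have C: "C \<noteq> {}" "a \<notin> C" using owp_letters[OF o] by auto
    have e: "cpl es (p @ (C \<union> {a}) # q) = cpl es (p @ C # {a} # q)"
      by (rule cpl_down[OF le a less[OF x] C])
    have "p @ (C \<union> {a}) # q \<in> ?N"
      by (rule ltN) (use owp_merge[OF o] less[OF x] e in auto)
    then show ?thesis using e a by simp
  qed
  show "(p @ (B \<union> C) # q, p @ B # C # q) \<in> measures [cpl es] \<or>
        (\<forall>f\<in>set [cpl es]. f (p @ (B \<union> C) # q) = f (p @ B # C # q)) \<and>
        es ! cpl es (p @ (B \<union> C) # q) = es ! cpl es (p @ B # C # q)"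
    if y: "p @ B # C # q \<in> ?N" for p B C q
  proof -
    have "cpl es (p @ (B \<union> C) # q) \<le> cpl es (p @ B # C # q)"
      by (rule cpl_merge) (use owp_letters[of V p B C q] y in auto)
    then show ?thesis by (auto simp: le_less)
  qed
qed

section \<open>Ordered partitions with a block in an upper set\<close>

text \<open>An arbitrary but fixed enumeration, the same for all words with the same remaining
  set.\<close>

definition lst :: "'n::finite set \<Rightarrow> 'n list" where
  "lst X = (SOME es. distinct es \<and> set es = X)"

lemma lst: "distinct (lst X)" "set (lst X) = X"
proof -
  have "\<exists>es. distinct es \<and> set es = X" using finite_distinct_list[of X] by auto
  then have "distinct (lst X) \<and> set (lst X) = X" unfolding lst_def by (rule someI_ex)
  then show "distinct (lst X)" "set (lst X) = X" by auto
qed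

lemma length_lst: "length (lst X) = card X"
  by (metis distinct_card lst)

lemma owp_sng: "distinct es \<Longrightarrow> owp (set es) (sng es)"
  by (induction es) auto

text \<open>Here \<open>\<Gamma>\<close> stands for the complements of the faces, \<open>Fb j\<close> for the complement of the \<open>j\<close>-th facet and
  \<open>J B\<close> for the index of the first facet containing the complement of \<open>B\<close>.\<close>

locale shelled =
  fixes \<Gamma> :: "'n::finite set set" and q :: nat and Fb G :: "nat \<Rightarrow> 'n set" and J :: "'n set \<Rightarrow> nat"
  assumes S1: "\<And>B. B \<in> \<Gamma> \<Longrightarrow> J B < q \<and> Fb (J B) \<subseteq> B \<and> B \<subseteq> Fb (J B) \<union> G (J B)"
    and S2: "\<And>j B. j < q \<Longrightarrow> Fb j \<subseteq> B \<Longrightarrow> B \<subseteq> Fb j \<union> G j \<Longrightarrow> B \<in> \<Gamma> \<and> J B = j"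
    and S3: "\<And>j. j < q \<Longrightarrow> G j \<inter> Fb j = {}" "\<And>j. j < q \<Longrightarrow> 2 \<le> card (Fb j)"
    and S4: "\<And>j B. j < q \<Longrightarrow> B \<subset> Fb j \<Longrightarrow> B \<notin> \<Gamma>"
    and S5: "\<And>B C. B \<in> \<Gamma> \<Longrightarrow> B \<subseteq> C \<Longrightarrow> C \<in> \<Gamma>"
    and S6: "\<And>B C. B \<in> \<Gamma> \<Longrightarrow> C \<in> \<Gamma> \<Longrightarrow> B \<subseteq> C \<Longrightarrow> J C \<le> J B"
begin

text \<open>\<open>Gam V\<close> is closed under merging because \<open>\<Gamma>\<close> is an upper
  set, so it is a subcomplex; \<open>Lam V\<close> spans the quotient.\<close>

definition lam :: "'n set list \<Rightarrow> bool" where "lam u \<longleftrightarrow> (\<forall>B\<in>set u. B \<notin> \<Gamma>)"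
definition Gam :: "'n set \<Rightarrow> 'n set list set" where "Gam V = {x. owp V x \<and> \<not> lam x}"
definition Lam :: "'n set \<Rightarrow> 'n set list set" where "Lam V = {x. owp V x \<and> lam x}"

text \<open>The parts of a word of \<open>Gam V\<close> before, at and after its first block in
  \<open>\<Gamma>\<close>.\<close>

definition upre :: "'n set list \<Rightarrow> 'n set list" where "upre x = takeWhile (\<lambda>B. B \<notin> \<Gamma>) x"
definition gg :: "'n set list \<Rightarrow> 'n set" where "gg x = hd (dropWhile (\<lambda>B. B \<notin> \<Gamma>) x)"
definition ww :: "'n set list \<Rightarrow> 'n set list" where "ww x = tl (dropWhile (\<lambda>B. B \<notin> \<Gamma>) x)"

definition Kx :: "'n set \<Rightarrow> 'n set list \<Rightarrow> 'n set" where "Kx V x = (V - \<Union>(set (upre x))) \<inter> G (J (gg x))"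
definition ee :: "'n set \<Rightarrow> 'n set list \<Rightarrow> 'n list" where "ee V x = lst (V - \<Union>(set (upre x)) - Fb (J (gg x)))"
text \<open>Compared lexicographically, \<open>f1\<close>, \<open>f2\<close> and \<open>f3\<close>
  do not increase under merging: size of the union of the prefix, index of the facet, length of the
  sorted part behind. The third is fixed at 0 as long as the pivot comes from
  \<open>Kx V x\<close>.\<close>

definition f1 :: "'n set list \<Rightarrow> nat" where "f1 x = card (\<Union>(set (upre x)))"
definition f2 :: "'n set list \<Rightarrow> nat" where "f2 x = J (gg x)"
definition f3 :: "'n set \<Rightarrow> 'n set list \<Rightarrow> nat" where
  "f3 V x = (if Kx V x \<noteq> {} then 0 else cpl (ee V x) (ww x))"
text \<open>The choice depends on the set \<open>Kx V x\<close> only, so words with the same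
  nonempty set have the same pivot.\<close>

definition piv :: "'n set \<Rightarrow> 'n set list \<Rightarrow> 'n" where
  "piv V x = (if Kx V x \<noteq> {} then SOME a. a \<in> Kx V x else ee V x ! cpl (ee V x) (ww x))"
definition Crit :: "'n set \<Rightarrow> 'n set list set" where
  "Crit V = {x \<in> Gam V. Kx V x = {} \<and> ww x = sng (ee V x)}"

lemma lam_append [simp]: "lam (u @ v) \<longleftrightarrow> lam u \<and> lam v" "lam (B # u) \<longleftrightarrow> B \<notin> \<Gamma> \<and> lam u" "lam []"
  by (auto simp: lam_def)

lemma dec:
  assumes "lam u" "g \<in> \<Gamma>"
  shows "upre (u @ g # w) = u" "gg (u @ g # w) = g" "ww (u @ g # w) = w"
proof -
  have "\<And>x. x \<in> set u \<Longrightarrow> x \<notin> \<Gamma>" using assms(1) by (simp add: lam_def)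
  then show "upre (u @ g # w) = u" "gg (u @ g # w) = g" "ww (u @ g # w) = w"
    using assms(2) by (simp_all add: upre_def gg_def ww_def takeWhile_append2 dropWhile_append2)
qed

lemma vals:
  assumes "lam u" "g \<in> \<Gamma>"
  shows "Kx V (u @ g # w) = (V - \<Union>(set u)) \<inter> G (J g)" "ee V (u @ g # w) = lst (V - \<Union>(set u) - Fb (J g))"
    "f1 (u @ g # w) = card (\<Union>(set u))" "f2 (u @ g # w) = J g"
  using dec[OF assms] by (simp_all add: Kx_def ee_def f1_def f2_def)

lemma not_lamD: "\<not> lam x \<Longrightarrow> \<exists>u g w. x = u @ g # w \<and> lam u \<and> g \<in> \<Gamma>"
  using split_list_first_prop[of x "\<lambda>B. B \<in> \<Gamma>"] by (auto simp: lam_def)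

text \<open>Position of the merge relative to the first block of \<open>\<Gamma>\<close> in the
  merged word. In the prefix both parts are outside \<open>\<Gamma>\<close>, since their union
  is.\<close>

lemma merge_cases:
  assumes y: "\<not> lam (p @ B # C # r)" and x: "p @ (B \<union> C) # r = u @ g # w" "lam u" "g \<in> \<Gamma>"
  obtains (inu) u' where "u = p @ (B \<union> C) # u'" "r = u' @ g # w" "lam (p @ B # C # u')"
    | (ing) "p = u" "B \<union> C = g" "r = w"
    | (inw) p' where "p = u @ g # p'" "w = p' @ (B \<union> C) # r"
proof -
  from x(1) consider s where "p = u @ s" "s @ (B \<union> C) # r = g # w" | s where "p @ s = u" "(B \<union> C) # r = s @ g # w"
    by (auto simp: append_eq_append_conv2)
  then show ?thesis
  proof cases
    case 1
    show ?thesis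
    proof (cases s)
      case Nil
      then show ?thesis using 1 ing by simp
    next
      case (Cons c s')
      then show ?thesis using 1 inw by simp
    qed
  next
    case 2
    show ?thesis
    proof (cases s)
      case Nil
      then show ?thesis using 2 ing by simp
    next
      case (Cons c s')
      then have e: "u = p @ (B \<union> C) # s'" "r = s' @ g # w" using 2 by auto
      have "B \<union> C \<notin> \<Gamma>" using x(2) unfolding e(1) by simp
      then have "B \<notin> \<Gamma>" "C \<notin> \<Gamma>" using S5 by blast+
      then have "lam (p @ B # C # s')" using x(2) unfolding e(1) by simp
      then show ?thesis using e inu by blast
    qed
  qed
qed

text \<open>When no element of \<open>G (J g)\<close> is left, the block \<open>g\<close> must be
  the lower end of its interval.\<close>

lemma Fb_eq: "g \<in> \<Gamma> \<Longrightarrow> (V - U) \<inter> G (J g) = {} \<Longrightarrow> g \<subseteq> V - U \<Longrightarrow> g = Fb (J g)"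
  using S1[of g] by blast

text \<open>Condition \<open>A4\<close> of \<open>toggle_acyc\<close>. A merge in the prefix changes
  nothing; one that produces the first block of \<open>\<Gamma>\<close> shrinks the prefix, lowers
  the index of the facet, or keeps both while the pivot comes from \<open>Kx\<close>; one behind
  this block affects only the sorted part.\<close>

lemma measures_step:
  assumes owy: "owp V (p @ B # C # r)" and y: "\<not> lam (p @ B # C # r)" and x: "\<not> lam (p @ (B \<union> C) # r)"
  shows "(p @ (B \<union> C) # r, p @ B # C # r) \<in> measures [f1, f2, f3 V] \<or>
    (\<forall>f\<in>set [f1, f2, f3 V]. f (p @ (B \<union> C) # r) = f (p @ B # C # r)) \<and>
    piv V (p @ (B \<union> C) # r) = piv V (p @ B # C # r)"
proof -
  obtain u g w where d: "p @ (B \<union> C) # r = u @ g # w" "lam u" "g \<in> \<Gamma>" using not_lamD[OF x] by blast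
  have BC: "B \<noteq> {}" "C \<noteq> {}" "B \<inter> C = {}" using owp_letters[OF owy] by auto
  have owx: "owp V (u @ g # w)" using owp_merge[OF owy] unfolding d(1) .
  show ?thesis
  proof (rule merge_cases[OF y d])
    fix u' assume c: "u = p @ (B \<union> C) # u'" "r = u' @ g # w" "lam (p @ B # C # u')"
    have ye: "p @ B # C # r = (p @ B # C # u') @ g # w" using c by simp
    have U: "\<Union>(set (p @ B # C # u')) = \<Union>(set u)" unfolding c(1) by auto
    note v = vals[OF d(2,3)] vals[OF c(3) d(3)] dec[OF d(2,3)] dec[OF c(3) d(3)]
    show ?thesis unfolding d(1) ye by (simp add: f3_def piv_def v U del: append_assoc append.simps set_append)
  next
    assume c: "p = u" "B \<union> C = g" "r = w"
    show ?thesis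
    proof (cases "B \<in> \<Gamma>")
      case True
      note v = vals[OF d(2,3)] vals[OF d(2) True] dec[OF d(2,3)] dec[OF d(2) True]
      have le: "J g \<le> J B" by (rule S6[OF True d(3)]) (use c in auto)
      have gV: "g \<subseteq> V - \<Union>(set u)" using owx by (simp add: owp_append)
      \<comment> \<open>Otherwise \<open>g\<close> is the lower end of its interval, and its proper
        part \<open>B\<close> would be in \<open>\<Gamma>\<close> although it lies strictly inside
        the complement of a facet.\<close>
      have "(V - \<Union>(set u)) \<inter> G (J g) \<noteq> {}" if "J g = J B"
      proof
        assume "(V - \<Union>(set u)) \<inter> G (J g) = {}"
        then have gF: "g = Fb (J g)" by (rule Fb_eq[OF d(3) _ gV])
        have "B \<subset> g" using c BC by auto
        then have "B \<subset> Fb (J g)" using gF by simp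
        then show False using S4[of "J g" B] S1[OF d(3)] True by blast
      qed
      note K = this
      have ye: "p @ B # C # r = u @ B # C # w" using c by simp
      show ?thesis
      proof (cases "J g = J B")
        case True
        then show ?thesis unfolding d(1) ye using K[OF True] by (simp add: f3_def piv_def v)
      next
        case False
        then have "J g < J B" using le by simp
        then show ?thesis unfolding d(1) ye by (simp add: v)
      qed
    next
      case False
      obtain u2 g2 w2 where y2: "p @ B # C # r = u2 @ g2 # w2" "lam u2" "g2 \<in> \<Gamma>" using not_lamD[OF y] by blast
      have "upre (p @ B # C # r) = u2" using dec[OF y2(2,3)] y2(1) by simp
      \<comment> \<open>Since \<open>B\<close> is outside \<open>\<Gamma>\<close>, the prefix before
        the merge includes \<open>B\<close> too, and its union is strictly larger.\<close>
      moreover have "upre (p @ B # C # r) = u @ B # upre (C # w)"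
        using d(2) False c unfolding upre_def lam_def by (simp add: takeWhile_append2)
      ultimately have u2: "u2 = u @ B # upre (C # w)" by simp
      have "B \<inter> \<Union>(set u) = {}" using owp_disj[OF owy] c by auto
      moreover obtain b where b: "b \<in> B" using BC(1) by auto
      ultimately have "b \<notin> \<Union>(set u)" by blast
      moreover have "b \<in> \<Union>(set u2)" "\<Union>(set u) \<subseteq> \<Union>(set u2)" unfolding u2 using b by auto
      ultimately have "\<Union>(set u) \<subset> \<Union>(set u2)" by blast
      then have "card (\<Union>(set u)) < card (\<Union>(set u2))" by (intro psubset_card_mono) auto
      then have "f1 (p @ (B \<union> C) # r) < f1 (p @ B # C # r)"
        unfolding d(1) y2(1) using vals(3)[OF d(2,3)] vals(3)[OF y2(2,3)] by simp
      then show ?thesis by simp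
    qed
  next
    fix p' assume c: "p = u @ g # p'" "w = p' @ (B \<union> C) # r"
    have ye: "p @ B # C # r = u @ g # p' @ B # C # r" using c by simp
    note v = vals[OF d(2,3)] dec[OF d(2,3)]
    have "cpl (ee V (u @ g # w)) (p' @ (B \<union> C) # r) \<le> cpl (ee V (u @ g # w)) (p' @ B # C # r)"
      by (rule cpl_merge[OF BC])
    then show ?thesis unfolding d(1) ye unfolding c(2) by (auto simp: f3_def piv_def v le_less)
  qed
qed

lemma Crit_Gam: "Crit V \<subseteq> Gam V" by (auto simp: Crit_def)

text \<open>The dimension bound enters here: each \<open>Fb j\<close> has at least two elements, and
  every member of \<open>\<Gamma>\<close> contains one of these sets.\<close>

lemma singleton_Gam: "{a} \<notin> \<Gamma>"
proof
  assume "{a} \<in> \<Gamma>"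
  from S1[OF this] have "Fb (J {a}) \<subseteq> {a}" "J {a} < q" by blast+
  then show False using S3(2)[of "J {a}"] card_mono[of "{a}" "Fb (J {a})"] by simp
qed

lemma lam_sng [simp]: "lam (sng es)"
  using singleton_Gam by (auto simp: lam_def)

lemma CritD:
  assumes "x \<in> Crit V"
  shows "\<exists>u j. x = u @ Fb j # sng (lst (V - \<Union>(set u) - Fb j)) \<and> lam u \<and> j < q \<and> owp V x \<and>
     Fb j \<in> \<Gamma> \<and> J (Fb j) = j \<and> (V - \<Union>(set u)) \<inter> G j = {} \<and> Fb j \<subseteq> V - \<Union>(set u)"
proof -
  have x: "owp V x" "\<not> lam x" "Kx V x = {}" "ww x = sng (ee V x)" using assms by (auto simp: Crit_def Gam_def)
  obtain u g w where d: "x = u @ g # w" "lam u" "g \<in> \<Gamma>" using not_lamD[OF x(2)] by blast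
  have K: "(V - \<Union>(set u)) \<inter> G (J g) = {}" using x(3) vals(1)[OF d(2,3)] d(1) by simp
  have gV: "g \<subseteq> V - \<Union>(set u)" using x(1) d(1) by (simp add: owp_append)
  have gF: "g = Fb (J g)" by (rule Fb_eq[OF d(3) K gV])
  have w: "w = sng (lst (V - \<Union>(set u) - Fb (J g)))" using x(4) vals(2)[OF d(2,3)] dec(3)[OF d(2,3)] d(1) by simp
  have "x = u @ Fb (J g) # sng (lst (V - \<Union>(set u) - Fb (J g)))" using d(1) gF w by simp
  then show ?thesis using d x(1) K gV gF S1[OF d(3)] by (intro exI[of _ u] exI[of _ "J g"]) simp
qed

lemma CritI:
  assumes "lam u" "j < q" "owp V (u @ Fb j # sng (lst (V - \<Union>(set u) - Fb j)))" "(V - \<Union>(set u)) \<inter> G j = {}"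
  shows "u @ Fb j # sng (lst (V - \<Union>(set u) - Fb j)) \<in> Crit V"
proof -
  have F: "Fb j \<in> \<Gamma>" "J (Fb j) = j" using S2[OF assms(2), of "Fb j"] by auto
  show ?thesis using assms vals[OF assms(1) F(1)] dec[OF assms(1) F(1)] F by (simp add: Crit_def Gam_def)
qed

text \<open>Only a block of the prefix can be split: the proper parts of \<open>Fb j\<close> are
  outside \<open>\<Gamma>\<close>, so splitting this block would leave \<open>Gam V\<close>, and the
  blocks behind it are singletons. Hence the split word has the same facet and the same union of the
  prefix.\<close>

lemma Crit_split:
  assumes x: "p @ (B \<union> C) # r \<in> Crit V" and y: "p @ B # C # r \<in> Gam V"
  shows "\<exists>u u' j. p @ (B \<union> C) # r = u @ Fb j # sng (lst (V - \<Union>(set u) - Fb j)) \<and>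
    p @ B # C # r = u' @ Fb j # sng (lst (V - \<Union>(set u) - Fb j)) \<and> \<Union>(set u') = \<Union>(set u) \<and> lam u \<and> lam u' \<and> j < q \<and>
    (V - \<Union>(set u)) \<inter> G j = {}"
proof -
  obtain u j where d: "p @ (B \<union> C) # r = u @ Fb j # sng (lst (V - \<Union>(set u) - Fb j))" "lam u" "j < q"
     "owp V (p @ (B \<union> C) # r)" "Fb j \<in> \<Gamma>" "J (Fb j) = j" "(V - \<Union>(set u)) \<inter> G j = {}"
    using CritD[OF x] by blast
  have yl: "\<not> lam (p @ B # C # r)" and owy: "owp V (p @ B # C # r)" using y by (auto simp: Gam_def)
  have BC: "B \<noteq> {}" "C \<noteq> {}" "B \<inter> C = {}" using owp_letters[OF owy] by auto
  show ?thesis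
  proof (rule merge_cases[OF yl d(1,2,5)])
    fix u' assume c: "u = p @ (B \<union> C) # u'" "r = u' @ Fb j # sng (lst (V - \<Union>(set u) - Fb j))" "lam (p @ B # C # u')"
    have U: "\<Union>(set (p @ B # C # u')) = \<Union>(set u)" unfolding c(1) by auto
    have ye: "p @ B # C # r = (p @ B # C # u') @ Fb j # sng (lst (V - \<Union>(set u) - Fb j))" using c(2) by simp
    show ?thesis
      by (intro exI[of _ u] exI[of _ "p @ B # C # u'"] exI[of _ j] conjI) (fact d(1) ye U d(2) c(3) d(3) d(7))+
  next
    assume c: "p = u" "B \<union> C = Fb j" "r = sng (lst (V - \<Union>(set u) - Fb j))"
    have "B \<subset> Fb j" "C \<subset> Fb j" using c(2) BC by auto
    then have "B \<notin> \<Gamma>" "C \<notin> \<Gamma>" using S4[OF d(3)] by auto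
    then have "lam (p @ B # C # r)" using c d(2) by simp
    then show ?thesis using yl by simp
  next
    fix p' assume c: "p = u @ Fb j # p'" "sng (lst (V - \<Union>(set u) - Fb j)) = p' @ (B \<union> C) # r"
    have "B \<union> C \<in> set (sng (lst (V - \<Union>(set u) - Fb j)))" unfolding c(2) by simp
    then obtain a where "B \<union> C = {a}" by auto
    then show ?thesis using merge_not_sng[OF BC] by blast
  qed
qed

lemma Gam_owps: "subcplx (wbd :: _ \<Rightarrow> _ \<Rightarrow> 'k::field) (Gam V) (owps V)"
proof (rule subcplx_wbdI)
  fix p B C r assume y: "p @ B # C # r \<in> Gam V" and x: "p @ (B \<union> C) # r \<in> owps V"
  have "\<not> lam (p @ (B \<union> C) # r)" using y S5[of B "B \<union> C"] S5[of C "B \<union> C"] by (auto simp: Gam_def)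
  then show "p @ (B \<union> C) # r \<in> Gam V" using x by (simp add: Gam_def)
qed (auto simp: Gam_def)

lemma cplx_Gam: "cplx (wbd :: _ \<Rightarrow> _ \<Rightarrow> 'k::field) (Gam V)"
  by (rule cplx_sub[OF cplx_wbd Gam_owps])

text \<open>By \<open>Crit_split\<close> only critical words can be merged to critical ones, so the
  noncritical words are closed under the boundary.\<close>

lemma sub_Crit: "subcplx (wbd :: _ \<Rightarrow> _ \<Rightarrow> 'k::field) (Gam V - Crit V) (Gam V)"
proof (rule subcplx_wbdI)
  fix p B C r assume y: "p @ B # C # r \<in> Gam V - Crit V" and x: "p @ (B \<union> C) # r \<in> Gam V"
  have "p @ (B \<union> C) # r \<notin> Crit V"
  proof
    assume xc: "p @ (B \<union> C) # r \<in> Crit V"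
    have yG: "p @ B # C # r \<in> Gam V" using y by simp
    obtain u u' j where d: "p @ B # C # r = u' @ Fb j # sng (lst (V - \<Union>(set u) - Fb j))" "\<Union>(set u') = \<Union>(set u)"
      "lam u'" "j < q" "(V - \<Union>(set u)) \<inter> G j = {}"
      using Crit_split[OF xc yG] by (elim exE conjE) (rule that)
    have "owp V (u' @ Fb j # sng (lst (V - \<Union>(set u') - Fb j)))" using yG d(1,2) by (simp add: Gam_def)
    from CritI[OF d(3,4) this] have "p @ B # C # r \<in> Crit V" using d by simp
    then show False using y by simp
  qed
  then show "p @ (B \<union> C) # r \<in> Gam V - Crit V" using x by simp
qed auto

end

section \<open>The matching on noncritical words\<close>

context shelled
begin

text \<open>The list \<open>ee\<close> in terms of the prefix and of \<open>g\<close>; it visibly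
  does not change when the word behind \<open>g\<close> does.\<close>

definition EE :: "'n set \<Rightarrow> 'n set list \<Rightarrow> 'n set \<Rightarrow> 'n list" where
  "EE V u g = lst (V - \<Union>(set u) - Fb (J g))"

lemma EE_sng: "w \<noteq> sng (EE V u g) \<Longrightarrow> owp (set (EE V u g)) w \<Longrightarrow> cpl (EE V u g) w < length (EE V u g)"
  unfolding EE_def by (rule cpl_less[OF lst(1)])

lemma EE_pivot:
  assumes "owp (set (EE V u g)) w" "w \<noteq> sng (EE V u g)"
  shows "\<exists>p B r. w = p @ B # r \<and> EE V u g ! cpl (EE V u g) w \<in> B \<and> cpl (EE V u g) w \<le> length p \<and>
     (B = {EE V u g ! cpl (EE V u g) w} \<longrightarrow> cpl (EE V u g) w < length p)"
  using assms unfolding EE_def by (rule cpl_pivot[OF lst(1)])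

text \<open>Noncritical words of the first kind: some element of \<open>G (J g)\<close> is free,
  whatever follows \<open>g\<close>.\<close>

lemma N_I1:
  assumes "lam u" "g \<in> \<Gamma>" "owp V (u @ g # w)" "(V - \<Union>(set u)) \<inter> G (J g) \<noteq> {}"
  shows "u @ g # w \<in> Gam V - Crit V" "piv V (u @ g # w) = (SOME a. a \<in> (V - \<Union>(set u)) \<inter> G (J g))"
    "f1 (u @ g # w) = card (\<Union>(set u))" "f2 (u @ g # w) = J g" "f3 V (u @ g # w) = 0"
  using assms(3,4) vals[OF assms(1,2)] dec[OF assms(1,2)] assms(1,2)
  by (simp_all add: Gam_def Crit_def piv_def f3_def)

text \<open>Noncritical words of the second kind: no such element is free, and the word behind
  \<open>g\<close> is not completely sorted.\<close>

lemma N_I2: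
  assumes "lam u" "g \<in> \<Gamma>" "owp V (u @ g # w)" "(V - \<Union>(set u)) \<inter> G (J g) = {}" "w \<noteq> sng (EE V u g)"
  shows "u @ g # w \<in> Gam V - Crit V" "piv V (u @ g # w) = EE V u g ! cpl (EE V u g) w"
    "f1 (u @ g # w) = card (\<Union>(set u))" "f2 (u @ g # w) = J g" "f3 V (u @ g # w) = cpl (EE V u g) w"
  using assms(3,4,5) vals[OF assms(1,2)] dec[OF assms(1,2)] assms(1,2)
  by (simp_all add: Gam_def Crit_def piv_def f3_def EE_def)

lemma N_cases:
  assumes x: "x \<in> Gam V - Crit V" and a: "piv V x = a"
  obtains (c1) u g w where "x = u @ g # w" "lam u" "g \<in> \<Gamma>" "owp V (u @ g # w)" "a \<in> (V - \<Union>(set u)) \<inter> G (J g)"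
  | (c2) u g w where "x = u @ g # w" "lam u" "g \<in> \<Gamma>" "owp V (u @ g # w)" "(V - \<Union>(set u)) \<inter> G (J g) = {}"
     "owp (set (EE V u g)) w" "w \<noteq> sng (EE V u g)" "EE V u g ! cpl (EE V u g) w = a"
proof -
  have o: "owp V x" "\<not> lam x" using x by (auto simp: Gam_def)
  obtain u g w where d: "x = u @ g # w" "lam u" "g \<in> \<Gamma>" using not_lamD[OF o(2)] by blast
  have od: "owp V (u @ g # w)" using o(1) unfolding d(1) .
  show ?thesis
  proof (cases "(V - \<Union>(set u)) \<inter> G (J g) = {}")
    case True
    have gV: "g \<subseteq> V - \<Union>(set u)" using od by (simp add: owp_append)
    have gF: "g = Fb (J g)" by (rule Fb_eq[OF d(3) True gV])
    have "owp (V - \<Union>(set u) - g) w" using od by (simp add: owp_append)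
    then have ow: "owp (set (EE V u g)) w" using gF by (simp add: EE_def lst)
    have w: "w \<noteq> sng (EE V u g)"
    proof
      assume "w = sng (EE V u g)"
      then have "x \<in> Crit V"
        using od True d(2,3) vals[OF d(2,3)] dec[OF d(2,3)] unfolding d(1) by (simp add: Crit_def Gam_def EE_def)
      then show False using x by simp
    qed
    have "EE V u g ! cpl (EE V u g) w = a" using N_I2(2)[OF d(2,3) od True w] a unfolding d(1) by simp
    then show ?thesis using c2[OF d od True ow w] by simp
  next
    case False
    have "(SOME a. a \<in> (V - \<Union>(set u)) \<inter> G (J g)) \<in> (V - \<Union>(set u)) \<inter> G (J g)"
      using False by (metis (mono_tags) ex_in_conv someI_ex)
    moreover have "a = (SOME a. a \<in> (V - \<Union>(set u)) \<inter> G (J g))"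
      using N_I1(2)[OF d(2,3) od False] a unfolding d(1) by simp
    ultimately have "a \<in> (V - \<Union>(set u)) \<inter> G (J g)" by (simp only:)
    then show ?thesis using c1[OF d od] by simp
  qed
qed

lemma in_rest:
  assumes "owp V (u @ g # w)" "a \<in> V - \<Union>(set u)" "a \<notin> g"
  shows "\<exists>w1 D w2. w = w1 @ D # w2 \<and> a \<in> D"
proof -
  have "owp (V - \<Union>(set u) - g) w" using assms(1) by (simp add: owp_append)
  from owp_Un[OF this] have "a \<in> \<Union>(set w)" using assms by auto
  then obtain D where "D \<in> set w" "a \<in> D" by auto
  then show ?thesis by (meson split_list)
qed

text \<open>A free element of \<open>G (J g)\<close> can be moved into or out of \<open>g\<close>,
  or toggled behind it, without a change of prefix and facet. Without free elements the pivot is the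
  first misplaced element behind \<open>g\<close>, and the argument for all ordered partitions is
  repeated on this part of the word.\<close>

lemma acyc_N: "acyc (wbd :: _ \<Rightarrow> _ \<Rightarrow> 'k::field) (Gam V - Crit V)"
proof (rule toggle_acyc[where \<pi> = "piv V" and fs = "[f1, f2, f3 V]" and V = V])
  let ?N = "Gam V - Crit V"
  show "cplx (wbd :: _ \<Rightarrow> _ \<Rightarrow> 'k) ?N" by (rule cplx_sub[OF cplx_Gam sub_Crit])
  show "finite ?N" by (rule finite_subset[OF _ finite_owp[of V]]) (auto simp: Gam_def)
  show "owp V x" if "x \<in> ?N" for x using that by (simp add: Gam_def)
  show "\<exists>p B q. x = p @ B # q \<and> a \<in> B \<and> (B = {a} \<longrightarrow> p \<noteq> [])" if x: "x \<in> ?N" and a: "piv V x = a" for x a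
    using x a
  proof (cases rule: N_cases)
    case (c1 u g w)
    show ?thesis
    proof (cases "a \<in> g")
      case True
      have "g \<noteq> {a}" using c1(3) singleton_Gam by auto
      then show ?thesis using c1(1) True by blast
    next
      case False
      obtain w1 D w2 where w: "w = w1 @ D # w2" "a \<in> D" using in_rest[OF c1(4) _ False] c1(5) by auto
      have "x = (u @ g # w1) @ D # w2" unfolding c1(1) w(1) by simp
      then show ?thesis using w(2) by blast
    qed
  next
    case (c2 u g w)
    obtain p D r where d: "w = p @ D # r" "EE V u g ! cpl (EE V u g) w \<in> D"
      using EE_pivot[OF c2(6,7)] by (elim exE conjE) (rule that)
    have "x = (u @ g # p) @ D # r" unfolding c2(1) d(1) by simp
    then show ?thesis using d(2) c2(8) by blast
  qed
  show "p @ (B - {a}) # {a} # r \<in> ?N \<and> piv V (p @ (B - {a}) # {a} # r) = a \<and>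
        (\<forall>f\<in>set [f1, f2, f3 V]. f (p @ (B - {a}) # {a} # r) = f (p @ B # r))"
    if x: "p @ B # r \<in> ?N" and a: "piv V (p @ B # r) = a" and aB: "a \<in> B" "B \<noteq> {a}" for p B r a
  proof -
    have ox: "owp V (p @ B # r)" using x by (simp add: Gam_def)
    have oy: "owp V (p @ (B - {a}) # {a} # r)" by (rule owp_toggle_up[OF ox aB])
    show ?thesis using x a
    proof (cases rule: N_cases)
      case (c1 u g w)
      have K: "(V - \<Union>(set u)) \<inter> G (J g) \<noteq> {}" using c1(5) by auto
      note old = N_I1[OF c1(2,3,4) K]
      show ?thesis
      proof (cases "a \<in> g")
        case True
        have e: "p = u" "B = g" "r = w" using owp_unique_pos[OF ox c1(1) aB(1) True] by simp_all
        \<comment> \<open>A pivot in \<open>G (J g)\<close> is outside \<open>Fb (J g)\<close>, so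
          removing it from \<open>g\<close> stays above the lower end of the interval.\<close>
        have "g - {a} \<in> \<Gamma> \<and> J (g - {a}) = J g" using S1[OF c1(3)] S3(1)[of "J g"] c1(5) by (intro S2) auto
        then have g': "g - {a} \<in> \<Gamma>" "J (g - {a}) = J g" by auto
        have oy': "owp V (u @ (g - {a}) # ({a} # w))" using oy unfolding e .
        note new = N_I1[OF c1(2) g'(1) oy', unfolded g'(2), OF K]
        show ?thesis using new old a unfolding c1(1) e by simp
      next
        case False
        obtain w1 D w2 where w: "w = w1 @ D # w2" "a \<in> D" using in_rest[OF c1(4) _ False] c1(5) by auto
        have "p @ B # r = (u @ g # w1) @ D # w2" unfolding c1(1) w(1) by simp
        from owp_unique_pos[OF ox this aB(1) w(2)] have e: "p = u @ g # w1" "B = D" "r = w2" by simp_all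
        have y: "p @ (B - {a}) # {a} # r = u @ g # (w1 @ (B - {a}) # {a} # r)" unfolding e by simp
        note new = N_I1[OF c1(2,3) oy[unfolded y] K]
        show ?thesis using new old a unfolding y unfolding c1(1) by simp
      qed
    next
      case (c2 u g w)
      note old = N_I2[OF c2(2,3,4,5,7)]
      let ?E = "EE V u g"
      obtain p' D r' where d: "w = p' @ D # r'" "?E ! cpl ?E w \<in> D" "cpl ?E w \<le> length p'"
        using EE_pivot[OF c2(6,7)] by (elim exE conjE) (rule that)
      have "p @ B # r = (u @ g # p') @ D # r'" unfolding c2(1) d(1) by simp
      from owp_unique_pos[OF ox this aB(1)] have e: "p = u @ g # p'" "B = D" "r = r'" using d(2) c2(8) by simp_all
      have y: "p @ (B - {a}) # {a} # r = u @ g # (p' @ (B - {a}) # {a} # r)" unfolding e by simp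
      have wE: "w = p' @ B # r" using d(1) e by simp
      have less: "cpl ?E w < length ?E" by (rule EE_sng[OF c2(7,6)])
      have eq: "cpl ?E (p' @ (B - {a}) # {a} # r) = cpl ?E w"
        unfolding wE by (rule cpl_up) (use d(3) c2(8) less aB wE in auto)
      \<comment> \<open>The toggled word is not critical either, since its sorted prefix is as short
        as before.\<close>
      have ne: "p' @ (B - {a}) # {a} # r \<noteq> sng ?E"
      proof
        assume *: "p' @ (B - {a}) # {a} # r = sng ?E"
        have "cpl ?E (p' @ (B - {a}) # {a} # r) = length ?E" unfolding * by simp
        then show False using eq less by simp
      qed
      note new = N_I2[OF c2(2,3) oy[unfolded y] c2(5) ne]
      show ?thesis using new old a eq c2(8) unfolding y unfolding c2(1) by simp
    qed
  qed
  show "p @ (C \<union> {a}) # r \<in> ?N \<and> piv V (p @ (C \<union> {a}) # r) = a \<and>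
        (\<forall>f\<in>set [f1, f2, f3 V]. f (p @ (C \<union> {a}) # r) = f (p @ C # {a} # r))"
    if x: "p @ C # {a} # r \<in> ?N" and a: "piv V (p @ C # {a} # r) = a" for p C r a
  proof -
    have ox: "owp V (p @ C # {a} # r)" using x by (simp add: Gam_def)
    have oy: "owp V (p @ (C \<union> {a}) # r)" by (rule owp_merge[OF ox])
    have ox': "owp V ((p @ [C]) @ {a} # r)" using ox by simp
    have C: "C \<noteq> {}" "a \<notin> C" using owp_letters[OF ox] by auto
    show ?thesis using x a
    proof (cases rule: N_cases)
      case (c1 u g w)
      have K: "(V - \<Union>(set u)) \<inter> G (J g) \<noteq> {}" using c1(5) by auto
      note old = N_I1[OF c1(2,3,4) K]
      have ag: "a \<notin> g"
      proof
        assume ag: "a \<in> g"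
        have "(p @ [C]) @ {a} # r = u @ g # w" using c1(1) by simp
        from owp_unique_pos[OF ox' this _ ag] have "g = {a}" by simp
        then show False using c1(3) singleton_Gam by simp
      qed
      obtain w1 D w2 where w: "w = w1 @ D # w2" "a \<in> D" using in_rest[OF c1(4) _ ag] c1(5) by auto
      have "(p @ [C]) @ {a} # r = (u @ g # w1) @ D # w2" using c1(1) unfolding w(1) by simp
      from owp_unique_pos[OF ox' this _ w(2)] have e: "p @ [C] = u @ g # w1" "D = {a}" "r = w2" by simp_all
      show ?thesis
      proof (cases w1 rule: rev_cases)
        case Nil
        then have pu: "p = u" "C = g" using e by simp_all
        \<comment> \<open>Adding the pivot stays below the upper end
          \<open>Fb (J g) \<union> G (J g)\<close>.\<close>
        have "g \<union> {a} \<in> \<Gamma> \<and> J (g \<union> {a}) = J g" using S1[OF c1(3)] c1(5) by (intro S2) auto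
        then have g': "g \<union> {a} \<in> \<Gamma>" "J (g \<union> {a}) = J g" by auto
        have oy': "owp V (u @ (g \<union> {a}) # r)" using oy unfolding pu .
        note new = N_I1[OF c1(2) g'(1) oy', unfolded g'(2), OF K]
        show ?thesis using new old a unfolding c1(1) unfolding pu by simp
      next
        case (snoc w1' C')
        then have pu: "p = u @ g # w1'" "C = C'" using e by simp_all
        have y: "p @ (C \<union> {a}) # r = u @ g # (w1' @ (C \<union> {a}) # r)" unfolding pu by simp
        note new = N_I1[OF c1(2,3) oy[unfolded y] K]
        show ?thesis using new old a unfolding y unfolding c1(1) by simp
      qed
    next
      case (c2 u g w)
      note old = N_I2[OF c2(2,3,4,5,7)]
      let ?E = "EE V u g"
      obtain p' D r' where d: "w = p' @ D # r'" "?E ! cpl ?E w \<in> D" "D = {?E ! cpl ?E w} \<longrightarrow> cpl ?E w < length p'"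
        using EE_pivot[OF c2(6,7)] by (elim exE conjE) (rule that)
      have aD: "a \<in> D" using d(2) c2(8) by simp
      have "(p @ [C]) @ {a} # r = (u @ g # p') @ D # r'" using c2(1) unfolding d(1) by simp
      from owp_unique_pos[OF ox' this _ aD] have e: "p @ [C] = u @ g # p'" "D = {a}" "r = r'" by simp_all
      have lt: "cpl ?E w < length p'" using d(3) e(2) c2(8) by simp
      then obtain p'' C' where p'': "p' = p'' @ [C']" by (cases p' rule: rev_cases) auto
      have pu: "p = u @ g # p''" "C' = C" using e(1) p'' by simp_all
      have y: "p @ (C \<union> {a}) # r = u @ g # (p'' @ (C \<union> {a}) # r)" unfolding pu by simp
      have wE: "w = p'' @ C # {a} # r" using d(1) e p'' pu by simp
      have less: "cpl ?E w < length ?E" by (rule EE_sng[OF c2(7,6)])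
      have eq: "cpl ?E (p'' @ (C \<union> {a}) # r) = cpl ?E w"
        unfolding wE by (rule cpl_down) (use lt p'' c2(8) less C wE in auto)
      have ne: "p'' @ (C \<union> {a}) # r \<noteq> sng ?E"
      proof
        assume *: "p'' @ (C \<union> {a}) # r = sng ?E"
        have "cpl ?E (p'' @ (C \<union> {a}) # r) = length ?E" unfolding * by simp
        then show False using eq less by simp
      qed
      note new = N_I2[OF c2(2,3) oy[unfolded y] c2(5) ne]
      show ?thesis using new old a eq c2(8) unfolding y unfolding c2(1) by simp
    qed
  qed
  show "(p @ (B \<union> C) # r, p @ B # C # r) \<in> measures [f1, f2, f3 V] \<or>
        (\<forall>f\<in>set [f1, f2, f3 V]. f (p @ (B \<union> C) # r) = f (p @ B # C # r)) \<and>
        piv V (p @ (B \<union> C) # r) = piv V (p @ B # C # r)"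
    if y: "p @ B # C # r \<in> ?N" and x: "p @ (B \<union> C) # r \<in> ?N" for p B C r
    by (rule measures_step) (use x y in \<open>auto simp: Gam_def\<close>)
qed

text \<open>A pair \<open>(S, j)\<close> describes the end of a critical word: the block
  \<open>Fb j\<close> followed by singletons, with union \<open>S\<close>. For
  \<open>V = UNIV\<close> this is exactly the condition on a member of a decomposition.\<close>

definition TT :: "'n set \<Rightarrow> ('n set \<times> nat) set" where
  "TT V = {(S, j). S \<subseteq> V \<and> j < q \<and> Fb j \<subseteq> S \<and> S \<inter> G j = {}}"

definition suf :: "'n set \<Rightarrow> nat \<Rightarrow> 'n set list" where
  "suf S j = Fb j # sng (lst (S - Fb j))"

text \<open>The critical words of one pair; only the prefix, a word on \<open>V - S\<close> without
  blocks in \<open>\<Gamma>\<close>, is free.\<close>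

definition CC :: "'n set \<Rightarrow> 'n set \<times> nat \<Rightarrow> 'n set list set" where
  "CC V = (\<lambda>(S, j). (\<lambda>u. u @ suf S j) ` Lam (V - S))"

lemma finite_TT: "finite (TT V)"
  by (rule finite_subset[of _ "UNIV \<times> {..<q}"]) (auto simp: TT_def)

lemma Fb_Gam: "j < q \<Longrightarrow> Fb j \<in> \<Gamma>" "j < q \<Longrightarrow> J (Fb j) = j"
  using S2[of j "Fb j"] by auto

lemma LamD: "u \<in> Lam U \<Longrightarrow> owp U u \<and> lam u \<and> \<Union>(set u) = U"
  using owp_Un by (auto simp: Lam_def)

lemma owp_suf:
  assumes "(S, j) \<in> TT V" "u \<in> Lam (V - S)"
  shows "owp V (u @ suf S j)"
proof -
  have S: "S \<subseteq> V" "j < q" "Fb j \<subseteq> S" using assms(1) by (auto simp: TT_def)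
  have u: "owp (V - S) u" "\<Union>(set u) = V - S" using LamD[OF assms(2)] by auto
  have "V - (V - S) = S" using S by auto
  moreover have "Fb j \<noteq> {}" using S3(2)[OF S(2)] by auto
  moreover have "owp (S - Fb j) (sng (lst (S - Fb j)))" using owp_sng[of "lst (S - Fb j)"] by (simp add: lst)
  ultimately show ?thesis using u S unfolding owp_append u(2) suf_def by auto
qed

lemma CC_det:
  assumes "(S, j) \<in> TT V" "x \<in> CC V (S, j)"
  shows "V - \<Union>(set (upre x)) = S \<and> J (gg x) = j"
proof -
  have S: "S \<subseteq> V" "j < q" using assms(1) by (auto simp: TT_def)
  obtain u where u: "x = u @ suf S j" "u \<in> Lam (V - S)" using assms(2) by (auto simp: CC_def)
  have "upre x = u" "gg x = Fb j" using dec[of u "Fb j"] LamD[OF u(2)] Fb_Gam[OF S(2)] unfolding u(1) suf_def by auto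
  then show ?thesis using LamD[OF u(2)] Fb_Gam[OF S(2)] S(1) by auto
qed

lemma CC_memI:
  assumes "lam u" "owp V (u @ suf S j)" "S = V - \<Union>(set u)"
  shows "u @ suf S j \<in> CC V (S, j)"
proof -
  have "owp (\<Union>(set u)) u" "\<Union>(set u) \<subseteq> V" using assms(2) by (auto simp: owp_append)
  then have "u \<in> Lam (V - S)" using assms by (simp add: Lam_def double_diff)
  then show ?thesis by (auto simp: CC_def)
qed

lemma Crit_eq: "Crit V = (\<Union>t\<in>TT V. CC V t)"
proof (intro equalityI subsetI)
  fix x assume "x \<in> Crit V"
  from CritD[OF this] obtain u j where d: "x = u @ Fb j # sng (lst (V - \<Union>(set u) - Fb j))" "lam u" "j < q" "owp V x"
    "(V - \<Union>(set u)) \<inter> G j = {}" "Fb j \<subseteq> V - \<Union>(set u)" by (elim exE conjE) (rule that)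
  have x: "x = u @ suf (V - \<Union>(set u)) j" unfolding d(1) suf_def ..
  have "x \<in> CC V (V - \<Union>(set u), j)" unfolding x by (rule CC_memI[OF d(2) d(4)[unfolded x] refl])
  moreover have "(V - \<Union>(set u), j) \<in> TT V" using d by (auto simp: TT_def)
  ultimately show "x \<in> (\<Union>t\<in>TT V. CC V t)" by blast
next
  fix x assume "x \<in> (\<Union>t\<in>TT V. CC V t)"
  then obtain S j where S: "(S, j) \<in> TT V" "x \<in> CC V (S, j)" by auto
  obtain u where u: "x = u @ suf S j" "u \<in> Lam (V - S)" using S(2) by (auto simp: CC_def)
  have e: "V - \<Union>(set u) = S" using LamD[OF u(2)] S(1) by (auto simp: TT_def)
  show "x \<in> Crit V"
    using CritI[of u j V] owp_suf[OF S(1) u(2)] LamD[OF u(2)] S(1) unfolding e u(1) suf_def by (auto simp: TT_def)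
qed

end

text \<open>A merge that reaches into the suffix would make a block equal to its union with its
  predecessor, which is impossible for nonempty disjoint blocks.\<close>

lemma wbd_suffix:
  assumes o: "owp V (y @ r)"
  shows "wbd (y @ r) (x @ r) = (wbd y x :: 'k::field)"
proof (cases "wbd y x = (0::'k)")
  case True
  have "wbd (y @ r) (x @ r) = (0::'k)"
  proof (rule ccontr)
    assume "wbd (y @ r) (x @ r) \<noteq> (0::'k)"
    then obtain p B C s where d: "y @ r = p @ B # C # s" "x @ r = p @ (B \<union> C) # s" by (rule wbdE)
    have ol: "owp V (p @ B # C # s)" using o unfolding d(1) .
    have BC: "B \<noteq> {}" "C \<noteq> {}" "B \<inter> C = {}" using owp_letters[OF ol] by auto
    have d2: "x @ r = (p @ [B \<union> C]) @ s" "y @ r = (p @ [B, C]) @ s" using d by simp_all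
    have no: False if "y = p @ B # C # t" "x = p @ (B \<union> C) # t" for t
    proof -
      have oy: "owp (\<Union>(set y)) (p @ B # C # t)" using o unfolding owp_append that(1)[symmetric] by simp
      show False using wbd_merge[OF oy, where 'k = 'k] True unfolding that by simp
    qed
    from d2(1) consider t where "x = (p @ [B \<union> C]) @ t" "t @ r = s" | t where "x @ t = p @ [B \<union> C]" "r = t @ s"
      unfolding append_eq_append_conv2[of x r "p @ [B \<union> C]" s] by auto
    then show False
    proof cases
      case 1
      then have "y = p @ B # C # t" "x = p @ (B \<union> C) # t" using d2(2) by auto
      then show False by (rule no)
    next
      case 2
      have y: "y @ t = p @ [B, C]" using d2(2) 2(2) by simp
      show False
      proof (cases t rule: rev_cases)
        case Nil
        then show False using no[of "[]"] y 2(1) by simp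
      next
        case (snoc t' D)
        then have "D = B \<union> C" "D = C" using y 2(1) by (auto dest: arg_cong[where f = last])
        then show False using BC by auto
      qed
    qed
  qed
  then show ?thesis using True by simp
next
  case False
  then obtain p B C s where d: "y = p @ B # C # s" "x = p @ (B \<union> C) # s" by (rule wbdE)
  have "owp V (p @ B # C # s @ r)" using o unfolding d(1) by simp
  moreover have "owp (\<Union>(set y)) (p @ B # C # s)" using o unfolding owp_append d(1)[symmetric] by simp
  ultimately show ?thesis
    unfolding d using wbd_merge[of V p B C "s @ r", where 'k = 'k] wbd_merge[of _ p B C s, where 'k = 'k] by simp
qed

section \<open>Counting decompositions and the recursion for the dimensions\<close>

context shelled
begin

text \<open>Decompositions read recursively, to fit the induction on words: the next pair lives on
  what the earlier ones leave of \<open>V\<close>.\<close>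

fun dcp :: "'n set \<Rightarrow> ('n set \<times> nat) list \<Rightarrow> bool" where
  "dcp V [] \<longleftrightarrow> True"
| "dcp V (t # ds) \<longleftrightarrow> t \<in> TT V \<and> dcp (V - fst t) ds"

text \<open>The 2 counts the block \<open>Fb j\<close> itself and the shift of the connecting
  homomorphism. Each element of \<open>S - Fb j\<close> contributes a block, so against
  \<open>card V\<close> only \<open>card (Fb j)\<close> is lost.\<close>

definition wt :: "('n set \<times> nat) list \<Rightarrow> int" where
  "wt ds = (\<Sum>t\<leftarrow>ds. 2 - int (card (Fb (snd t))))"

definition NL :: "'n set \<Rightarrow> nat \<Rightarrow> nat" where
  "NL V m = card {ds. dcp V ds \<and> int m = int (card V) + wt ds}"

text \<open>The outermost pair is not preceded by a connecting homomorphism, hence the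
  \<open>- 1\<close>. The empty list is excluded because a word of \<open>Gam V\<close> has at least
  one block in \<open>\<Gamma>\<close>.\<close>

definition NG :: "'n set \<Rightarrow> nat \<Rightarrow> nat" where
  "NG V m = card {ds. ds \<noteq> [] \<and> dcp V ds \<and> int m = int (card V) + wt ds - 1}"

lemma wt_simps [simp]: "wt [] = 0" "wt (t # ds) = 2 - int (card (Fb (snd t))) + wt ds"
  by (simp_all add: wt_def)

lemma TT_card:
  assumes "t \<in> TT V"
  shows "int (card V) - int (card (Fb (snd t))) = int (card (V - fst t)) + int (card (fst t - Fb (snd t)))"
    "fst t \<subseteq> V" "fst t \<noteq> {}" "snd t < q"
proof -
  have t: "fst t \<subseteq> V" "snd t < q" "Fb (snd t) \<subseteq> fst t" using assms by (auto simp: TT_def)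
  show "fst t \<subseteq> V" "snd t < q" by (fact t)+
  show "fst t \<noteq> {}" using S3(2)[OF t(2)] t(3) by auto
  have "card (fst t) \<le> card V" "card (Fb (snd t)) \<le> card (fst t)" using t by (auto intro: card_mono)
  then show "int (card V) - int (card (Fb (snd t))) = int (card (V - fst t)) + int (card (fst t - Fb (snd t)))"
    using t by (simp add: card_Diff_subset of_nat_diff)
qed

text \<open>Degrees are natural numbers and the formula is over the integers; the bound shows that
  no decomposition is lost by truncated subtraction. The value is at least 2 once a pair is
  present.\<close>

lemma dcp_ge: "dcp V ds \<Longrightarrow> (if ds = [] then 0 else 2) \<le> int (card V) + wt ds"
proof (induction ds arbitrary: V)
  case (Cons t ds)
  then have t: "t \<in> TT V" and ds: "dcp (V - fst t) ds" by auto
  have "0 \<le> int (card (V - fst t)) + wt ds" using Cons.IH[OF ds] by (auto split: if_splits)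
  then show ?case using TT_card(1)[OF t] by simp
qed simp

lemma finite_dcp: "finite {ds. dcp V ds}"
proof (induction "card V" arbitrary: V rule: less_induct)
  case less
  have "{ds. dcp V ds} \<subseteq> insert [] (\<Union>t\<in>TT V. (#) t ` {ds. dcp (V - fst t) ds})"
  proof
    fix ds assume "ds \<in> {ds. dcp V ds}"
    then show "ds \<in> insert [] (\<Union>t\<in>TT V. (#) t ` {ds. dcp (V - fst t) ds})" by (cases ds) auto
  qed
  moreover have "finite {ds. dcp (V - fst t) ds}" if t: "t \<in> TT V" for t
  proof (rule less)
    show "card (V - fst t) < card V" using TT_card(2,3)[OF t] by (intro psubset_card_mono) auto
  qed
  ultimately show ?case using finite_TT by (meson finite_UN_I finite_imageI finite_insert finite_subset)
qed

text \<open>The contribution of one pair to \<open>NG\<close>. The number \<open>s\<close> is the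
  length of the suffix \<open>suf\<close>, by which all degrees are shifted; the case
  \<open>m < s\<close> guards the truncated difference.\<close>

definition nt :: "'n set \<Rightarrow> nat \<Rightarrow> 'n set \<times> nat \<Rightarrow> nat" where
  "nt V m t = (let s = 1 + card (fst t - Fb (snd t)) in if m < s then 0 else NL (V - fst t) (m - s))"

lemma NG_sum: "NG V m = (\<Sum>t\<in>TT V. nt V m t)"
proof -
  define A where "A t = {ds. dcp (V - fst t) ds \<and> int m = int (card V) + wt (t # ds) - 1}" for t
  have "{ds. ds \<noteq> [] \<and> dcp V ds \<and> int m = int (card V) + wt ds - 1} = (\<Union>t\<in>TT V. (#) t ` A t)"
  proof (intro equalityI subsetI)
    fix ds assume "ds \<in> {ds. ds \<noteq> [] \<and> dcp V ds \<and> int m = int (card V) + wt ds - 1}"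
    then show "ds \<in> (\<Union>t\<in>TT V. (#) t ` A t)" by (cases ds) (auto simp: A_def)
  qed (auto simp: A_def)
  then have "NG V m = card (\<Union>t\<in>TT V. (#) t ` A t)" by (simp add: NG_def)
  also have "\<dots> = (\<Sum>t\<in>TT V. card ((#) t ` A t))"
  proof (rule card_UN_disjoint[OF finite_TT])
    show "\<forall>t\<in>TT V. finite ((#) t ` A t)"
      by (intro ballI finite_imageI finite_subset[OF _ finite_dcp]) (auto simp: A_def)
  qed auto
  also have "\<dots> = (\<Sum>t\<in>TT V. nt V m t)"
  proof (rule sum.cong[OF refl])
    fix t assume t: "t \<in> TT V"
    have c: "card ((#) t ` A t) = card (A t)" by (simp add: card_image)
    define s where "s = 1 + card (fst t - Fb (snd t))"
    have eq: "int m = int (card V) + wt (t # ds) - 1 \<longleftrightarrow> int m = int s + (int (card (V - fst t)) + wt ds)" for ds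
    proof -
      have "int (card V) + wt (t # ds) - 1 = int s + (int (card (V - fst t)) + wt ds)"
        using TT_card(1)[OF t] by (simp add: s_def)
      then show ?thesis by (simp only:)
    qed
    show "card ((#) t ` A t) = nt V m t"
    proof (cases "m < s")
      case True
      have "A t = {}"
      proof (rule ccontr)
        assume "A t \<noteq> {}"
        then obtain ds where ds: "dcp (V - fst t) ds" "int m = int s + (int (card (V - fst t)) + wt ds)"
          unfolding A_def eq by blast
        then show False using dcp_ge[OF ds(1)] True by (auto split: if_splits)
      qed
      then show ?thesis using True unfolding c nt_def s_def[symmetric] Let_def by simp
    next
      case False
      then have "int m = int s + x \<longleftrightarrow> int (m - s) = x" for x by (auto simp: of_nat_diff)
      then have "A t = {ds. dcp (V - fst t) ds \<and> int (m - s) = int (card (V - fst t)) + wt ds}"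
        unfolding A_def eq by simp
      then show ?thesis using False unfolding c nt_def s_def[symmetric] Let_def by (simp add: NL_def)
    qed
  qed
  finally show ?thesis .
qed

text \<open>The empty decomposition stands for the class of the partition into singletons, in degree
  \<open>card V\<close>; the nonempty ones come from \<open>Gam V\<close> with the degree raised by
  one.\<close>

lemma NL_NG: "NL V m = (if m = 0 then 0 else NG V (m - 1)) + (if m = card V then 1 else 0)"
proof -
  let ?A = "{ds. ds \<noteq> [] \<and> dcp V ds \<and> int m = int (card V) + wt ds}"
  have "{ds. dcp V ds \<and> int m = int (card V) + wt ds} = ?A \<union> (if m = card V then {[]} else {})" by auto
  moreover have fin: "finite ?A" by (rule finite_subset[OF _ finite_dcp[of V]]) auto
  moreover have "card (?A \<union> (if m = card V then {[]} else {})) = card ?A + card (if m = card V then {[] :: ('n set \<times> nat) list} else {})"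
    by (rule card_Un_disjoint[OF fin]) auto
  ultimately have "NL V m = card ?A + card (if m = card V then {[] :: ('n set \<times> nat) list} else {})"
    unfolding NL_def by (simp only:)
  then have "NL V m = card ?A + (if m = card V then 1 else 0)"
    by (simp split: if_splits)
  moreover have "card ?A = (if m = 0 then 0 else NG V (m - 1))"
  proof (cases m)
    case 0
    have "?A = {}"
    proof (rule ccontr)
      assume "?A \<noteq> {}"
      then obtain ds where ds: "ds \<noteq> []" "dcp V ds" "int m = int (card V) + wt ds" by blast
      then show False using dcp_ge[OF ds(2)] 0 by simp
    qed
    then show ?thesis using 0 by (metis card.empty)
  next
    case (Suc k)
    have "int m = x \<longleftrightarrow> int k = x - 1" for x using Suc by auto
    then show ?thesis using Suc by (simp add: NG_def)
  qed
  ultimately show ?thesis by simp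
qed

lemma Lam_diff: "Lam V = owps V - Gam V"
  by (auto simp: Lam_def Gam_def)

lemma cplx_Lam: "cplx (wbd :: _ \<Rightarrow> _ \<Rightarrow> 'k::field) (Lam V)"
  unfolding Lam_diff by (rule cplx_quot[OF cplx_wbd Gam_owps])

text \<open>The words of \<open>CC V t\<close> are those of \<open>Lam (V - fst t)\<close> followed
  by a fixed suffix, whose length is the shift of degree.\<close>

lemma hd_CC:
  assumes t: "t \<in> TT V" and h: "\<And>m. hd_dim (wbd :: _ \<Rightarrow> _ \<Rightarrow> 'k::field) (Lam (V - fst t)) m (NL (V - fst t) m)"
  shows "hd_dim (wbd :: _ \<Rightarrow> _ \<Rightarrow> 'k::field) (CC V t) m (nt V m t)"
proof -
  obtain S j where Sj: "t = (S, j)" by (cases t)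
  define s where "s = 1 + card (S - Fb j)"
  have ls: "length (suf S j) = s" by (simp add: suf_def s_def length_lst)
  have CC: "CC V t = (\<lambda>u. u @ suf S j) ` Lam (V - S)" by (simp add: CC_def Sj)
  show ?thesis
  proof (cases "m < s")
    case True
    then have "nt V m t = 0" by (simp add: nt_def Sj s_def)
    moreover have "hd_dim (wbd :: _ \<Rightarrow> _ \<Rightarrow> 'k) (CC V t) m 0"
      by (rule hd_dim_0) (use True ls in \<open>auto simp: CC\<close>)
    ultimately show ?thesis by simp
  next
    case False
    have "hd_dim (wbd :: _ \<Rightarrow> _ \<Rightarrow> 'k) (CC V t) (m - s + s) (NL (V - S) (m - s))"
    proof (rule hd_dim_relabel[where f = "\<lambda>u. u @ suf S j" and \<epsilon> = 1 and V = "Lam (V - S)"])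
      show "bij_betw (\<lambda>u. u @ suf S j) (Lam (V - S)) (CC V t)" unfolding CC by (auto simp: bij_betw_def inj_on_def)
      show "length (u @ suf S j) = length u + s" for u by (simp add: ls)
      show "wbd (y @ suf S j) (x @ suf S j) = 1 * (wbd y x :: 'k)" if "y \<in> Lam (V - S)" for x y
        using wbd_suffix[OF owp_suf[of S j V y]] t that Sj by simp
      show "hd_dim (wbd :: _ \<Rightarrow> _ \<Rightarrow> 'k) (Lam (V - S)) (m - s) (NL (V - S) (m - s))" using h Sj by simp
    qed simp
    moreover have "nt V m t = NL (V - S) (m - s)" using False by (simp add: nt_def Sj s_def)
    ultimately show ?thesis using False by simp
  qed
qed

text \<open>By \<open>Crit_split\<close> no merge connects critical words of different pairs, so the
  critical quotient is a direct sum over the pairs.\<close>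

lemma hd_Gam:
  assumes h: "\<And>t m. t \<in> TT V \<Longrightarrow> hd_dim (wbd :: _ \<Rightarrow> _ \<Rightarrow> 'k::field) (Lam (V - fst t)) m (NL (V - fst t) m)"
  shows "hd_dim (wbd :: _ \<Rightarrow> _ \<Rightarrow> 'k) (Gam V) m (NG V m)"
proof (rule hd_dim_quot[OF cplx_Gam sub_Crit acyc_N])
  have e: "Gam V - (Gam V - Crit V) = Crit V" using Crit_Gam by (auto simp: double_diff)
  have cC: "cplx (wbd :: _ \<Rightarrow> _ \<Rightarrow> 'k) (Crit V)" using cplx_quot[OF cplx_Gam sub_Crit, of V] unfolding e .
  show "hd_dim (wbd :: _ \<Rightarrow> _ \<Rightarrow> 'k) (Gam V - (Gam V - Crit V)) m (NG V m)"
    unfolding e unfolding Crit_eq NG_sum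
  proof (rule hd_dim_Union[OF finite_TT])
    show "cplx (wbd :: _ \<Rightarrow> _ \<Rightarrow> 'k) (\<Union>t\<in>TT V. CC V t)" using cC unfolding Crit_eq .
    show "hd_dim (wbd :: _ \<Rightarrow> _ \<Rightarrow> 'k) (CC V t) m (nt V m t)" if "t \<in> TT V" for t
      by (rule hd_CC[OF that h[OF that]])
    have det: "V - \<Union>(set (upre x)) = fst t \<and> J (gg x) = snd t" if "t \<in> TT V" "x \<in> CC V t" for t x
      using CC_det[of "fst t" "snd t" V x] that by simp
    show "CC V s \<inter> CC V t = {}" if "s \<in> TT V" "t \<in> TT V" "s \<noteq> t" for s t
    proof (rule ccontr)
      assume "CC V s \<inter> CC V t \<noteq> {}"
      then obtain x where "x \<in> CC V s" "x \<in> CC V t" by auto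
      then have "fst s = fst t" "snd s = snd t" using det[OF that(1), of x] det[OF that(2), of x] by auto
      then show False using that(3) by (simp add: prod_eq_iff)
    qed
    show "s = t" if s: "s \<in> TT V" and t: "t \<in> TT V" and y: "y \<in> CC V s" and x: "x \<in> CC V t" and nz: "wbd y x \<noteq> (0::'k)" for s t x y
    proof -
      obtain p B C r where d: "y = p @ B # C # r" "x = p @ (B \<union> C) # r" using nz by (rule wbdE)
      have "x \<in> Crit V" "y \<in> Gam V" using s t x y Crit_Gam unfolding Crit_eq by blast+
      from Crit_split[OF this[unfolded d]]
      obtain u u' j where e: "x = u @ Fb j # sng (lst (V - \<Union>(set u) - Fb j))" "y = u' @ Fb j # sng (lst (V - \<Union>(set u) - Fb j))"
        "\<Union>(set u') = \<Union>(set u)" "lam u" "lam u'" "j < q" unfolding d[symmetric] by (elim exE conjE) (rule that)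
      have "upre x = u" "gg x = Fb j" "upre y = u'" "gg y = Fb j"
        unfolding e(1,2) using dec[OF e(4) Fb_Gam(1)[OF e(6)]] dec[OF e(5) Fb_Gam(1)[OF e(6)]] by simp_all
      then have "fst s = fst t" "snd s = snd t" using det[OF s y] det[OF t x] e(3) by auto
      then show ?thesis by (simp add: prod_eq_iff)
    qed
  qed
qed

text \<open>Let \<open>v\<close> be the partition into singletons. Without \<open>v\<close>,
  \<open>Lam V\<close> is the quotient of an acyclic complex by \<open>Gam V\<close>, and the
  connecting homomorphism shifts the homology of \<open>Gam V\<close> up by one; restoring
  \<open>v\<close> adds one class in degree \<open>card V\<close>.\<close>

lemma hd_Lam:
  assumes h: "\<And>m. hd_dim (wbd :: _ \<Rightarrow> _ \<Rightarrow> 'k::field) (Gam V) m (NG V m)"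
  shows "hd_dim (wbd :: _ \<Rightarrow> _ \<Rightarrow> 'k) (Lam V) m (NL V m)"
proof -
  define v where "v = sng (lst V)"
  let ?W = "owps V - {v}"
  have cW: "cplx (wbd :: _ \<Rightarrow> _ \<Rightarrow> 'k) ?W" unfolding v_def by (rule cplx_sub[OF cplx_wbd subcplx_owps])
  have sW: "subcplx (wbd :: _ \<Rightarrow> _ \<Rightarrow> 'k) ?W (owps V)" unfolding v_def by (rule subcplx_owps)
  have aW: "acyc (wbd :: _ \<Rightarrow> _ \<Rightarrow> 'k) ?W" unfolding v_def by (rule acyc_owps) (auto simp: lst)
  have vo: "owp V v" using owp_sng[of "lst V"] by (simp add: v_def lst)
  have lv: "length v = card V" by (simp add: v_def length_lst)
  have vL: "v \<in> Lam V" using vo by (simp add: Lam_def v_def)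
  have vG: "v \<notin> Gam V" by (simp add: Gam_def v_def)
  have sG: "subcplx (wbd :: _ \<Rightarrow> _ \<Rightarrow> 'k) (Gam V) ?W"
    using Gam_owps[of V, where 'k = 'k] vG by (auto simp: subcplx_def Gam_def)
  have e: "?W - Gam V = Lam V - {v}" by (auto simp: Lam_diff)
  have 1: "hd_dim (wbd :: _ \<Rightarrow> _ \<Rightarrow> 'k) (Lam V - {v}) m (if m = 0 then 0 else NG V (m - 1))"
  proof (cases m)
    case 0
    have "length w \<noteq> 0" if "w \<in> Lam V - {v}" for w
    proof
      assume "length w = 0"
      then have "w = []" "V = {}" using that by (auto simp: Lam_def)
      then have "v = w" using lv by simp
      then show False using that by simp
    qed
    then show ?thesis using hd_dim_0[of "Lam V - {v}" 0] 0 by simp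
  next
    case (Suc k)
    then show ?thesis using hd_dim_connect[OF cW sG aW h[of k]] unfolding e by simp
  qed
  \<comment> \<open>The boundary of \<open>v\<close> is a cycle of the acyclic complex, hence the
    boundary of some \<open>y\<close> that avoids \<open>v\<close>. The desired cycle is the image
    of \<open>v - y\<close> in the quotient; for empty \<open>V\<close> it is \<open>v\<close>
    itself.\<close>
  have "\<exists>z0\<in>cyc (wbd :: _ \<Rightarrow> _ \<Rightarrow> 'k) (Lam V) (length v). z0 v \<noteq> 0"
  proof (cases "length v")
    case 0
    have "(sgl v :: _ \<Rightarrow> 'k) \<in> chn (Lam V) (length v)" by (rule chn_sgl[OF vL])
    then have "sgl v \<in> cyc (wbd :: _ \<Rightarrow> _ \<Rightarrow> 'k) (Lam V) (length v)"
      using dd_chn_0[OF cplx_Lam] 0 by (intro cycI) auto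
    moreover have "(sgl v :: _ \<Rightarrow> 'k) v \<noteq> 0" by (simp add: sgl_def)
    ultimately show ?thesis by blast
  next
    case (Suc k)
    let ?d = "dd (wbd :: _ \<Rightarrow> _ \<Rightarrow> 'k)"
    have sv: "(sgl v :: _ \<Rightarrow> 'k) \<in> chn (owps V) (Suc k)" using chn_sgl[of v "owps V"] vo Suc by simp
    have dv: "?d (owps V) (sgl v) \<in> chn (owps V) k" by (rule dd_chn[OF cplx_wbd sv])
    have "?d (owps V) (sgl v) v = 0" using chn_mem[OF dv, of v] Suc by (auto simp: supp_def)
    then have dW: "?d (owps V) (sgl v) \<in> chn ?W k" using dv by (auto simp: chn_def supp_def)
    have "?d ?W (?d (owps V) (sgl v)) = 0"
      using dd_sub[OF sW dW] dd_dd[OF cplx_wbd sv] by simp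
    then have "?d (owps V) (sgl v) \<in> cyc wbd ?W k" by (rule cycI[OF dW])
    then obtain y where y: "y \<in> chn ?W (Suc k)" "?d (owps V) (sgl v) = ?d ?W y" using acycD[OF aW] by (metis bndE)
    have yo: "y \<in> chn (owps V) (Suc k)" by (rule chn_mono[OF y(1)]) auto
    have zo: "sgl v - y \<in> chn (owps V) (Suc k)" by (rule lsub_diff[OF lsub_chn sv yo])
    let ?z = "rst (Lam V) (sgl v - y)"
    have "?z \<in> chn (Lam V) (Suc k)" by (rule chn_rst[OF zo]) (auto simp: Lam_def)
    moreover have "?d (Lam V) ?z = 0"
    proof -
      have "?d (owps V) (sgl v - y) = 0"
        using dd_sub[OF sW y(1)] y(2) dd_diff[OF chn_fin[OF sv] chn_fin[OF yo], of wbd "owps V"] by simp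
      then show ?thesis using dd_quot[OF Gam_owps zo] unfolding Lam_diff by (simp add: rst_0)
    qed
    moreover have "?z v \<noteq> 0"
    proof -
      have "y v = 0" using chn_mem[OF y(1), of v] by (auto simp: supp_def)
      then show ?thesis using vL by (simp add: rst_def sgl_def fun_apply)
    qed
    ultimately show ?thesis using Suc cycI by metis
  qed
  then obtain z0 where z0: "z0 \<in> cyc (wbd :: _ \<Rightarrow> _ \<Rightarrow> 'k) (Lam V) (length v)" "z0 v \<noteq> 0" by blast
  have "hd_dim (wbd :: _ \<Rightarrow> _ \<Rightarrow> 'k) (Lam V) m ((if m = 0 then 0 else NG V (m - 1)) + (if m = length v then 1 else 0))"
  proof (rule hd_dim_top[OF cplx_Lam vL _ z0 1])
    show "length w \<le> length v" if "w \<in> Lam V" for w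
      using owp_length[of V w] that lv by (simp add: Lam_def)
  qed
  then show ?thesis unfolding lv NL_NG .
qed

text \<open>Simultaneous induction on the size of \<open>V\<close>: \<open>Gam V\<close> depends on
  \<open>Lam\<close> of smaller sets, and \<open>Lam V\<close> on \<open>Gam V\<close>.\<close>

theorem hd_dim_Gam:
  "hd_dim (wbd :: _ \<Rightarrow> _ \<Rightarrow> 'k::field) (Gam V) m (NG V m)"
proof -
  have "(\<forall>m. hd_dim (wbd :: _ \<Rightarrow> _ \<Rightarrow> 'k) (Gam V) m (NG V m)) \<and> (\<forall>m. hd_dim (wbd :: _ \<Rightarrow> _ \<Rightarrow> 'k) (Lam V) m (NL V m))"
  proof (induction "card V" arbitrary: V rule: less_induct)
    case less
    have "hd_dim (wbd :: _ \<Rightarrow> _ \<Rightarrow> 'k) (Lam (V - fst t)) m (NL (V - fst t) m)" if t: "t \<in> TT V" for t m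
    proof -
      have "card (V - fst t) < card V" using TT_card(2,3)[OF t] by (intro psubset_card_mono) auto
      from less[OF this] show ?thesis by blast
    qed
    then have G: "hd_dim (wbd :: _ \<Rightarrow> _ \<Rightarrow> 'k) (Gam V) m (NG V m)" for m by (rule hd_Gam)
    then show ?case using hd_Lam by blast
  qed
  then show ?thesis by blast
qed

end

section \<open>Acyclic carriers\<close>

definition del :: "nat \<Rightarrow> 'a list \<Rightarrow> 'a list" where
  "del k l = take k l @ drop (Suc k) l"

text \<open>The augmented boundary of ordered simplices: the boundary of a list of length 1 is the
  empty list, so the lowest degree needs no separate treatment.\<close>

definition ldel :: "'a list \<Rightarrow> 'a list \<Rightarrow> 'k::field" where
  "ldel = fbd length del"

lemma length_del: "k < length l \<Longrightarrow> length (del k l) = length l - 1"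
  by (simp add: del_def)

lemma nth_del: "k < length l \<Longrightarrow> i < length l - 1 \<Longrightarrow> del k l ! i = (if i < k then l ! i else l ! Suc i)"
  by (auto simp: del_def nth_append min_def)

lemma set_del: "set (del k l) \<subseteq> set l"
  by (auto simp: del_def dest: in_set_takeD in_set_dropD)

lemma del_del: "j < k \<Longrightarrow> k < length l \<Longrightarrow> del j (del k l) = del (k - 1) (del j l)"
  by (rule nth_equalityI) (auto simp: length_del nth_del)

lemma ldel_ldel: "lext ldel (ldel y) = (0 :: 'a list \<Rightarrow> 'k::field)"
  unfolding ldel_def by (rule fbd_fbd) (auto simp: length_del del_del)

lemma finite_supp_ldel [simp]: "finite (supp (ldel y))"
  by (simp add: ldel_def)

lemma ldel_supp: "x \<in> supp (ldel y :: _ \<Rightarrow> 'k::field) \<Longrightarrow> \<exists>k<length y. x = del k y"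
  unfolding ldel_def using supp_fbd by fastforce

lemma ldel_supp_set:
  assumes "x \<in> supp (ldel y :: _ \<Rightarrow> 'k::field)"
  shows "set x \<subseteq> set y \<and> Suc (length x) = length y"
proof -
  obtain k where k: "k < length y" "x = del k y" using ldel_supp[OF assms] by blast
  show ?thesis unfolding k(2) using set_del[of k y] length_del[OF k(1)] k(1) by simp
qed

lemma ldel_Nil [simp]: "ldel [] = 0"
  by (simp add: ldel_def fbd_def)

text \<open>The boundary of a cone with apex \<open>a\<close> over \<open>l\<close>.\<close>

lemma ldel_Cons: "ldel (a # l) = sgl l - lext (\<lambda>x. sgl (a # x)) (ldel l :: _ \<Rightarrow> 'k::field)"
proof -
  have "ldel (a # l) = (\<Sum>k<Suc (length l). scl ((-1) ^ k) (sgl (del k (a # l)) :: _ \<Rightarrow> 'k))"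
    by (simp add: ldel_def fbd_def)
  also have "\<dots> = sgl l + (\<Sum>k<length l. scl ((-1) ^ Suc k) (sgl (a # del k l)))"
    unfolding sum.lessThan_Suc_shift by (simp add: del_def)
  also have "(\<Sum>k<length l. scl ((-1) ^ Suc k) (sgl (a # del k l) :: _ \<Rightarrow> 'k)) = - lext (\<lambda>x. sgl (a # x)) (ldel l)"
    unfolding ldel_def lext_fbd by (simp add: scl_minus sum_negf)
  finally show ?thesis by (simp only: diff_conv_add_uminus)
qed

lemma cplx_ldel: "cplx ldel UNIV"
  unfolding cplx_def
proof (intro conjI allI ballI impI)
  fix y x assume "x \<in> supp (ldel y :: 'a list \<Rightarrow> 'b)"
  from ldel_supp[OF this] show "Suc (length x) = length y" by (auto simp: length_del)
next
  fix y :: "'a list"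
  have "rst UNIV c = c" for c :: "'a list \<Rightarrow> 'b" by (auto simp: rst_def)
  then show "rst UNIV (lext ldel (rst UNIV (ldel y))) = (0 :: _ \<Rightarrow> 'b)" by (simp add: ldel_ldel)
qed simp

lemma subcplx_ldelI:
  assumes "N \<subseteq> W" "\<And>k l. l \<in> N \<Longrightarrow> k < length l \<Longrightarrow> del k l \<in> W \<Longrightarrow> del k l \<in> N"
  shows "subcplx (ldel :: _ \<Rightarrow> _ \<Rightarrow> 'k::field) N W"
  unfolding subcplx_def
proof (intro conjI ballI impI assms(1))
  fix y x assume y: "y \<in> N" and x: "x \<in> W" and nz: "ldel y x \<noteq> (0::'k)"
  have "x \<in> supp (ldel y :: _ \<Rightarrow> 'k)" using nz by (simp add: supp_def)
  from ldel_supp[OF this] obtain k where "k < length y" "x = del k y" by blast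
  then show "x \<in> N" using assms(2) y x by blast
qed

lemma lext_chn:
  assumes "finite (supp c)" "\<And>b. b \<in> supp c \<Longrightarrow> f b \<in> chn W n"
  shows "lext f c \<in> chn W n"
  unfolding lext_alt by (intro lsub_sum[OF lsub_chn] lsub_scl[OF lsub_chn] assms)

definition cacyc :: "'k::field itself \<Rightarrow> 'a list set \<Rightarrow> bool" where
  "cacyc (_::'k itself) T \<longleftrightarrow> (\<forall>n. \<forall>c\<in>chn T n. lext ldel c = (0 :: _ \<Rightarrow> 'k) \<longrightarrow> (\<exists>e\<in>chn T (Suc n). lext ldel e = c))"

text \<open>Prepending \<open>v\<close> contracts the complex of all lists in
  \<open>\<sigma>\<close>, repetitions included.\<close>

lemma cone_all:
  assumes "v \<in> \<sigma>"
  shows "cacyc TYPE('k::field) {l. set l \<subseteq> \<sigma>}"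
  unfolding cacyc_def
proof (intro allI ballI impI)
  fix n and c :: "'a list \<Rightarrow> 'k" assume c: "c \<in> chn {l. set l \<subseteq> \<sigma>} n" and z: "lext ldel c = 0"
  let ?h = "\<lambda>l. sgl (v # l) :: 'a list \<Rightarrow> 'k"
  have fin: "finite (supp c)" by (rule chn_fin[OF c])
  have "lext ?h c \<in> chn {l. set l \<subseteq> \<sigma>} (Suc n)"
  proof (rule lext_chn[OF fin])
    fix b assume "b \<in> supp c"
    then have "set b \<subseteq> \<sigma>" "length b = n" using chn_mem[OF c] by auto
    then show "?h b \<in> chn {l. set l \<subseteq> \<sigma>} (Suc n)"
      using chn_sgl[of "v # b" "{l. set l \<subseteq> \<sigma>}"] assms by simp
  qed
  moreover have "lext ldel (lext ?h c) = c"
  proof -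
    have "lext ldel (lext ?h c) = lext (\<lambda>l. lext ldel (?h l)) c"
      by (rule lext_lext[OF fin]) simp
    also have "\<dots> = lext (\<lambda>l. sgl l - lext ?h (ldel l)) c"
      by (rule lext_cong) (simp only: lext_sgl ldel_Cons)
    also have "\<dots> = c - lext ?h (lext ldel c)"
      unfolding lext_fun_diff lext_sgl_id[OF fin] by (subst lext_lext[OF fin]) simp_all
    finally show ?thesis by (simp add: z)
  qed
  ultimately show "\<exists>e\<in>chn {l. set l \<subseteq> \<sigma>} (Suc n). lext ldel e = c" by blast
qed

text \<open>Strictly increasing lists are contracted by prepending the least element
  \<open>v\<close>. Lists that already contain \<open>v\<close> are sent to 0; they begin with
  \<open>v\<close>, so their only face without \<open>v\<close> is the tail, and the contraction
  identity still holds.\<close>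

lemma cone_sorted:
  fixes v :: "'a::order"
  assumes v: "v \<in> \<sigma>" "\<And>w. w \<in> \<sigma> \<Longrightarrow> v \<le> w"
  shows "cacyc TYPE('k::field) {l. set l \<subseteq> \<sigma> \<and> sorted_wrt (<) l}"
  unfolding cacyc_def
proof (intro allI ballI impI)
  let ?T = "{l. set l \<subseteq> \<sigma> \<and> sorted_wrt (<) l}"
  fix n and c :: "'a list \<Rightarrow> 'k" assume c: "c \<in> chn ?T n" and z: "lext ldel c = 0"
  let ?h = "\<lambda>l. (if v \<in> set l then 0 else sgl (v # l)) :: 'a list \<Rightarrow> 'k"
  have fin: "finite (supp c)" by (rule chn_fin[OF c])
  have finh: "finite (supp (?h l))" for l by simp
  have id: "lext ldel (?h l) = sgl l - lext ?h (ldel l)" if l: "l \<in> ?T" for l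
  proof (cases "v \<in> set l")
    case False
    have "lext ?h (ldel l) = lext (\<lambda>l. sgl (v # l)) (ldel l)"
    proof (rule lext_cong)
      fix b assume "b \<in> supp (ldel l :: _ \<Rightarrow> 'k)"
      from ldel_supp_set[OF this] have "set b \<subseteq> set l" by simp
      then show "?h b = sgl (v # b)" using False by auto
    qed
    then show ?thesis using False by (simp only: if_False ldel_Cons lext_sgl)
  next
    case True
    obtain x l' where x: "l = x # l'" using True by (cases l) auto
    have "x = v"
    proof (rule ccontr)
      assume "x \<noteq> v"
      then have "v \<in> set l'" using True x by simp
      then have "x < v" using l x by simp
      moreover have "v \<le> x" using v(2) l x by simp
      ultimately show False by simp
    qed
    then have lv: "l = v # l'" and nv: "v \<notin> set l'" using x l by auto
    have "lext ?h (ldel l) = ?h l' - lext ?h (lext (\<lambda>x. sgl (v # x)) (ldel l'))"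
      unfolding lv ldel_Cons by (subst lext_diff) simp_all
    also have "lext ?h (lext (\<lambda>x. sgl (v # x)) (ldel l')) = lext (\<lambda>x. lext ?h (sgl (v # x))) (ldel l' :: _ \<Rightarrow> 'k)"
      by (rule lext_lext) simp_all
    also have "\<dots> = 0" by simp
    finally show ?thesis using True nv lv by simp
  qed
  have "lext ?h c \<in> chn ?T (Suc n)"
  proof (rule lext_chn[OF fin])
    fix b assume "b \<in> supp c"
    then have b: "b \<in> ?T" "length b = n" using chn_mem[OF c] by auto
    show "?h b \<in> chn ?T (Suc n)"
    proof (cases "v \<in> set b")
      case False
      have "v < w" if "w \<in> set b" for w
        using v(2)[of w] b(1) that False by (metis (no_types, lifting) mem_Collect_eq order_le_imp_less_or_eq subsetD)
      then have "v # b \<in> ?T" using b(1) v(1) by simp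
      then show ?thesis using chn_sgl[of "v # b" ?T] b(2) False by simp
    qed (simp add: lsub_0[OF lsub_chn])
  qed
  moreover have "lext ldel (lext ?h c) = c"
  proof -
    have "lext ldel (lext ?h c) = lext (\<lambda>l. lext ldel (?h l)) c"
      by (rule lext_lext[OF fin]) (rule finh)
    also have "\<dots> = lext (\<lambda>l. sgl l - lext ?h (ldel l)) c"
      by (rule lext_cong, rule id) (use chn_supp[OF c] in blast)
    also have "\<dots> = c - lext ?h (lext ldel c)"
      unfolding lext_fun_diff lext_sgl_id[OF fin] by (subst lext_lext[OF fin]) simp_all
    finally show ?thesis by (simp add: z)
  qed
  ultimately show "\<exists>e\<in>chn ?T (Suc n). lext ldel e = c" by blast
qed

text \<open>The method of acyclic carriers, by induction on the length. \<open>comp\<close> makes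
  the right-hand side a cycle of \<open>T (set l)\<close>, and acyclicity provides
  \<open>D l\<close>. One statement serves two purposes: with \<open>u = 0\<close>,
  \<open>\<delta> = 0\<close> and \<open>\<epsilon> = 1\<close> it builds a chain map, with
  \<open>u = f - id\<close>, \<open>\<delta> = 1\<close> and \<open>\<epsilon> = -1\<close> a
  homotopy to the identity.\<close>

lemma extend_carrier:
  fixes u :: "'a list \<Rightarrow> 'b list \<Rightarrow> 'k::field" and T :: "'a set \<Rightarrow> 'b list set"
  assumes L: "\<And>l k. l \<in> L \<Longrightarrow> k < length l \<Longrightarrow> del k l \<in> L"
    and mono: "\<And>\<sigma> \<tau>. \<sigma> \<subseteq> \<tau> \<Longrightarrow> T \<sigma> \<subseteq> T \<tau>"
    and ac: "\<And>l. l \<in> L \<Longrightarrow> l \<noteq> [] \<Longrightarrow> cacyc TYPE('k) (T (set l))"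
    and u: "\<And>l m. l \<in> L \<Longrightarrow> length l = Suc m \<Longrightarrow> u l \<in> chn (T (set l)) (m + \<delta>)"
    and dz: "dz \<in> chn (T {}) \<delta>" "lext ldel dz = u []"
    and comp: "\<And>l. l \<in> L \<Longrightarrow> l \<noteq> [] \<Longrightarrow> lext ldel (u l) + scl \<epsilon> (lext u (ldel l)) = 0"
  shows "\<exists>D. D [] = dz \<and> (\<forall>l\<in>L. length l \<le> N \<longrightarrow> D l \<in> chn (T (set l)) (length l + \<delta>) \<and>
      lext ldel (D l) = u l + scl \<epsilon> (lext D (ldel l)))"
proof (induction N)
  case 0
  show ?case using dz by (intro exI[of _ "\<lambda>_. dz"]) auto
next
  case (Suc N)
  then obtain D where Dz: "D [] = dz" and D: "\<And>l. l \<in> L \<Longrightarrow> length l \<le> N \<Longrightarrow> D l \<in> chn (T (set l)) (length l + \<delta>)"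
      "\<And>l. l \<in> L \<Longrightarrow> length l \<le> N \<Longrightarrow> lext ldel (D l) = u l + scl \<epsilon> (lext D (ldel l))" by blast
  have ex: "\<exists>e\<in>chn (T (set l)) (length l + \<delta>). lext ldel e = u l + scl \<epsilon> (lext D (ldel l))"
    if l: "l \<in> L" "length l = Suc N" for l
  proof -
    have sub: "b \<in> L \<and> length b = N \<and> set b \<subseteq> set l" if "b \<in> supp (ldel l :: _ \<Rightarrow> 'k)" for b
      using ldel_supp[OF that] L[OF l(1)] l(2) set_del by (fastforce simp: length_del)
    let ?c = "u l + scl \<epsilon> (lext D (ldel l))"
    have Dc: "lext D (ldel l) \<in> chn (T (set l)) (N + \<delta>)"
    proof (rule lext_chn)
      fix b assume "b \<in> supp (ldel l :: _ \<Rightarrow> 'k)"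
      note b = sub[OF this]
      then have "D b \<in> chn (T (set b)) (N + \<delta>)" using D(1)[of b] by simp
      then show "D b \<in> chn (T (set l)) (N + \<delta>)" by (rule chn_mono) (use b mono in blast)
    qed simp
    have ul: "u l \<in> chn (T (set l)) (N + \<delta>)" by (rule u[OF l])
    have cc: "?c \<in> chn (T (set l)) (N + \<delta>)" by (rule lsub_lin[OF lsub_chn ul Dc])
    have finD: "finite (supp (D b))" if "b \<in> supp (ldel l :: _ \<Rightarrow> 'k)" for b
      using chn_fin[OF D(1)] sub[OF that] by blast
    have "lext ldel (lext D (ldel l)) = lext (\<lambda>b. lext ldel (D b)) (ldel l)"
      by (rule lext_lext) (use finD in auto)
    also have "\<dots> = lext (\<lambda>b. u b + scl \<epsilon> (lext D (ldel b))) (ldel l)"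
      by (rule lext_cong) (use D(2) sub in auto)
    also have "\<dots> = lext u (ldel l) + scl \<epsilon> (lext (\<lambda>b. lext D (ldel b)) (ldel l))"
      by (simp add: lext_fun_add lext_fun_scl)
    also have "lext (\<lambda>b. lext D (ldel b)) (ldel l) = lext D (lext ldel (ldel l) :: _ \<Rightarrow> 'k)"
      by (rule lext_lext[symmetric]) simp_all
    finally have "lext ldel (lext D (ldel l)) = lext u (ldel l)" by (simp add: ldel_ldel)
    moreover have "lext ldel ?c = lext ldel (u l) + scl \<epsilon> (lext ldel (lext D (ldel l)))"
      by (subst lext_add) (simp_all add: lext_scl chn_fin[OF ul] chn_fin[OF Dc])
    ultimately have "lext ldel ?c = lext ldel (u l) + scl \<epsilon> (lext u (ldel l))" by (simp only:)
    also have "\<dots> = 0" by (rule comp[OF l(1)]) (use l(2) in auto)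
    finally have "lext ldel ?c = 0" .
    moreover have "cacyc TYPE('k) (T (set l))" by (rule ac[OF l(1)]) (use l(2) in auto)
    ultimately have "\<exists>e\<in>chn (T (set l)) (Suc (N + \<delta>)). lext ldel e = ?c" using cc unfolding cacyc_def by blast
    then show ?thesis using l(2) by simp
  qed
  define P where "P l e \<longleftrightarrow> e \<in> chn (T (set l)) (length l + \<delta>) \<and> lext ldel e = u l + scl \<epsilon> (lext D (ldel l))" for l e
  define D' where "D' l = (if length l \<le> N then D l else (SOME e. P l e))" for l
  have P: "P l (D' l)" if l: "l \<in> L" "length l = Suc N" for l
  proof -
    have "\<exists>e. P l e" using ex[OF l] by (auto simp: P_def)
    then have "P l (SOME e. P l e)" by (rule someI_ex)
    then show ?thesis using l(2) by (simp add: D'_def)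
  qed
  have c: "lext D' (ldel l) = lext D (ldel l :: _ \<Rightarrow> 'k)" if "length l \<le> Suc N" for l
  proof (rule lext_cong)
    fix b assume "b \<in> supp (ldel l :: _ \<Rightarrow> 'k)"
    from ldel_supp[OF this] have "length b \<le> N" using that by (auto simp: length_del)
    then show "D' b = D b" by (simp add: D'_def)
  qed
  show ?case
  proof (intro exI[of _ D'] conjI ballI impI)
    show "D' [] = dz" by (simp add: D'_def Dz)
    fix l assume l: "l \<in> L" "length l \<le> Suc N"
    show "D' l \<in> chn (T (set l)) (length l + \<delta>)"
    proof (cases "length l \<le> N")
      case True then show ?thesis using D(1)[OF l(1)] by (simp add: D'_def)
    next
      case False then show ?thesis using P[OF l(1)] l(2) by (simp add: P_def)
    qed
    show "lext ldel (D' l) = u l + scl \<epsilon> (lext D' (ldel l))"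
      unfolding c[OF l(2)]
    proof (cases "length l \<le> N")
      case True then show "lext ldel (D' l) = u l + scl \<epsilon> (lext D (ldel l))" using D(2)[OF l(1)] by (simp add: D'_def)
    next
      case False then show "lext ldel (D' l) = u l + scl \<epsilon> (lext D (ldel l))" using P[OF l(1)] l(2) by (simp add: P_def)
    qed
  qed
qed

text \<open>A chain map carried by \<open>T\<close> is homotopic to the identity, so it changes a
  cycle by a boundary only. The bounding chain is located merely in carriers of lists of
  \<open>L\<close>; each application places these in its own complex.\<close>

lemma carrier_homotopic_id:
  fixes f :: "'a list \<Rightarrow> 'a list \<Rightarrow> 'k::field"
  assumes L: "\<And>l k. l \<in> L \<Longrightarrow> k < length l \<Longrightarrow> del k l \<in> L"
    and T: "\<And>\<sigma> \<tau>. \<sigma> \<subseteq> \<tau> \<Longrightarrow> T \<sigma> \<subseteq> T \<tau>" "\<And>l. l \<in> L \<Longrightarrow> l \<in> T (set l)"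
    and ac: "\<And>l. l \<in> L \<Longrightarrow> l \<noteq> [] \<Longrightarrow> cacyc TYPE('k) (T (set l))"
    and f: "\<And>l. l \<in> L \<Longrightarrow> f l \<in> chn (T (set l)) (length l)" "f [] = sgl []"
      "\<And>l. l \<in> L \<Longrightarrow> lext ldel (f l) = lext f (ldel l)"
    and c: "c \<in> chn L n" "lext ldel c = 0"
  shows "\<exists>e. finite (supp e) \<and> (\<forall>w\<in>supp e. length w = Suc n \<and> (\<exists>l\<in>L. w \<in> T (set l))) \<and> lext f c - c = lext ldel e"
proof -
  let ?u = "\<lambda>l. f l - sgl l"
  have "\<exists>D. D [] = 0 \<and> (\<forall>l\<in>L. length l \<le> n \<longrightarrow> D l \<in> chn (T (set l)) (length l + 1) \<and>
      lext ldel (D l) = ?u l + scl (-1) (lext D (ldel l)))"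
  proof (rule extend_carrier[where L = L and T = T and u = ?u and \<delta> = 1 and \<epsilon> = "-1" and dz = 0 and N = n, OF L T(1) ac])
    show "?u l \<in> chn (T (set l)) (m + 1)" if l: "l \<in> L" "length l = Suc m" for l m
      using lsub_diff[OF lsub_chn f(1)[OF l(1)] chn_sgl[OF T(2)[OF l(1)]]] l(2) by simp
    show "(0 :: 'a list \<Rightarrow> 'k) \<in> chn (T {}) 1" by (rule lsub_0[OF lsub_chn])
    show "lext ldel 0 = f [] - sgl []" by (simp add: f(2))
    show "lext ldel (?u l) + scl (-1) (lext ?u (ldel l)) = 0" if l: "l \<in> L" for l
      using f(3)[OF l] chn_fin[OF f(1)[OF l]] by (simp add: lext_diff lext_fun_diff lext_sgl_id)
  qed
  then obtain D where D: "\<And>l. l \<in> L \<Longrightarrow> length l \<le> n \<Longrightarrow> D l \<in> chn (T (set l)) (length l + 1)"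
     "\<And>l. l \<in> L \<Longrightarrow> length l \<le> n \<Longrightarrow> lext ldel (D l) = ?u l - lext D (ldel l)" by auto
  have fin: "finite (supp c)" by (rule chn_fin[OF c(1)])
  have m: "b \<in> L \<and> length b = n" if "b \<in> supp c" for b using chn_mem[OF c(1) that] .
  have Db: "D b \<in> chn (T (set b)) (Suc n)" if "b \<in> supp c" for b using D(1)[of b] m[OF that] by simp
  show ?thesis
  proof (intro exI[of _ "lext D c"] conjI ballI)
    show "finite (supp (lext D c))" by (rule finite_supp_lext[OF fin]) (rule chn_fin[OF Db])
    fix w assume "w \<in> supp (lext D c)"
    then obtain b where b: "b \<in> supp c" "w \<in> supp (D b)" using supp_lext[of D c] by blast
    show "length w = Suc n" "\<exists>l\<in>L. w \<in> T (set l)" using chn_mem[OF Db[OF b(1)] b(2)] m[OF b(1)] by auto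
  next
    have "lext ldel (lext D c) = lext (\<lambda>b. lext ldel (D b)) c"
      by (rule lext_lext[OF fin]) (rule chn_fin[OF Db])
    also have "\<dots> = lext (\<lambda>b. ?u b - lext D (ldel b)) c"
      by (rule lext_cong) (use D(2) m in auto)
    also have "\<dots> = lext f c - c - lext D (lext ldel c)"
      unfolding lext_fun_diff lext_sgl_id[OF fin] by (subst lext_lext[OF fin]) simp_all
    finally show "lext f c - c = lext ldel (lext D c)" by (simp add: c(2))
  qed
qed

section \<open>Subdivision and prisms with field coefficients\<close>

definition sbd :: "nat \<Rightarrow> ((nat \<Rightarrow> real) \<Rightarrow> 'a) \<Rightarrow> ((nat \<Rightarrow> real) \<Rightarrow> 'a) \<Rightarrow> 'k::field" where
  "sbd p = fbd (\<lambda>_. Suc p) (singular_face p)"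

lemma fchain_boundary_lext: "fchain_boundary p c = lext (sbd p) c"
proof
  fix t
  have "fchain_boundary p c t = (\<Sum>s\<in>supp c. \<Sum>k<Suc p. if singular_face p k s = t then (-1) ^ k * c s else 0)"
    by (simp add: fchain_boundary_def supp_def lessThan_Suc_atMost)
  also have "\<dots> = lext (sbd p) c t"
    unfolding lext_def sbd_def fbd_apply sum_distrib_left by (intro sum.cong) auto
  finally show "fchain_boundary p c t = lext (sbd p) c t" .
qed

lemma fchain_iff: "fchain p X c \<longleftrightarrow> finite (supp c) \<and> (\<forall>s\<in>supp c. singular_simplex p X s)"
  by (auto simp: fchain_def supp_def)

lemma finite_supp_sbd [simp]: "finite (supp (sbd p s))"
  by (simp add: sbd_def)

lemma sbd_supp: "t \<in> supp (sbd p s :: _ \<Rightarrow> 'k::field) \<Longrightarrow> \<exists>k\<le>p. t = singular_face p k s"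
  unfolding sbd_def using supp_fbd by (fastforce simp: less_Suc_eq_le)

lemma lsub_fchain: "lsub (Collect (fchain p X))"
  unfolding lsub_def
proof (intro conjI ballI allI)
  fix x y :: "_ \<Rightarrow> 'b" and a assume xy: "x \<in> Collect (fchain p X)" "y \<in> Collect (fchain p X)"
  have "supp (x + scl a y) \<subseteq> supp x \<union> supp y" using supp_add supp_scl by fastforce
  moreover from this have "finite (supp (x + scl a y))" using xy by (auto simp: fchain_iff intro: finite_subset)
  ultimately show "x + scl a y \<in> Collect (fchain p X)" using xy by (auto simp: fchain_iff)
qed (simp add: fchain_iff)

lemma fchain_lext:
  assumes "finite (supp c)" "\<And>b. b \<in> supp c \<Longrightarrow> fchain p X (f b)"
  shows "fchain p X (lext f c)"
proof -
  have "lext f c \<in> Collect (fchain p X)"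
    unfolding lext_alt by (intro lsub_sum[OF lsub_fchain] lsub_scl[OF lsub_fchain]) (use assms in auto)
  then show ?thesis by simp
qed

lemma fchain_sgl: "singular_simplex p X s \<Longrightarrow> fchain p X (sgl s)"
  by (simp add: fchain_iff)

section \<open>Base change from integral chains to field coefficients\<close>

definition fr :: "('b \<Rightarrow>\<^sub>0 int) \<Rightarrow> 'b \<Rightarrow> 'k::field" where
  "fr x = (\<lambda>t. of_int (Poly_Mapping.lookup x t))"

lemma supp_fr: "supp (fr x :: _ \<Rightarrow> 'k::field) \<subseteq> Poly_Mapping.keys x"
  by (auto simp: supp_def fr_def in_keys_iff)

lemma finite_supp_fr [simp]: "finite (supp (fr x))"
  by (rule finite_subset[OF supp_fr]) simp

lemma fr_0 [simp]: "fr 0 = 0"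
  by (rule ext) (simp add: fr_def fun_apply)

lemma fr_diff: "fr (x - y) = fr x - fr y"
  by (rule ext) (simp add: fr_def fun_apply lookup_minus)

lemma fr_add: "fr (x + y) = fr x + fr y"
  by (rule ext) (simp add: fr_def fun_apply lookup_add)

lemma fr_of: "fr (frag_of b) = sgl b"
  by (rule ext) (simp add: fr_def sgl_def lookup_frag_of)

lemma fr_cmul: "fr (frag_cmul a x) = scl (of_int a) (fr x)"
  by (rule ext) (simp add: fr_def scl_def)

lemma fr_sum: "fr (sum f S) = (\<Sum>s\<in>S. fr (f s))"
  by (induction S rule: infinite_finite_induct) (simp_all add: fr_add)

text \<open>An additive operator on integral chains is determined by the generators, so after base
  change it becomes a linear extension. Boundary, subdivision and chain homotopy are transferred in
  this way.\<close>

lemma fr_hom: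
  assumes "F 0 = 0" "\<And>x y. F (x - y) = F x - F y"
  shows "(fr (F x) :: _ \<Rightarrow> 'k::field) = lext (\<lambda>b. fr (F (frag_of b))) (fr x)"
proof (rule frag_induction[of x UNIV])
  show "(fr (F 0) :: _ \<Rightarrow> 'k) = lext (\<lambda>b. fr (F (frag_of b))) (fr 0)" by (simp add: assms(1))
  show "(fr (F (frag_of b)) :: _ \<Rightarrow> 'k) = lext (\<lambda>b. fr (F (frag_of b))) (fr (frag_of b))" for b by (simp add: fr_of)
  fix a b
  assume "(fr (F a) :: _ \<Rightarrow> 'k) = lext (\<lambda>b. fr (F (frag_of b))) (fr a)" "(fr (F b) :: _ \<Rightarrow> 'k) = lext (\<lambda>b. fr (F (frag_of b))) (fr b)"
  then show "(fr (F (a - b)) :: _ \<Rightarrow> 'k) = lext (\<lambda>b. fr (F (frag_of b))) (fr (a - b))"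
    by (simp only: assms(2) fr_diff lext_diff[OF finite_supp_fr finite_supp_fr])
qed simp

lemma fr_boundary_of: "fr (chain_boundary (Suc p) (frag_of s)) = sbd (Suc p) s"
proof -
  have "fr (chain_boundary (Suc p) (frag_of s)) = (\<Sum>k\<le>Suc p. scl (of_int ((-1) ^ k)) (sgl (singular_face (Suc p) k s)))"
    by (simp only: chain_boundary_of fr_sum fr_cmul fr_of if_False nat.simps)
  also have "\<dots> = sbd (Suc p) s"
    unfolding sbd_def fbd_def lessThan_Suc_atMost by simp
  finally show ?thesis .
qed

lemma fr_boundary: "fr (chain_boundary (Suc p) x) = lext (sbd (Suc p)) (fr x)"
  by (subst fr_hom) (simp_all add: chain_boundary_diff fr_boundary_of)

lemma fchain_fr: "singular_chain p X x \<Longrightarrow> fchain p X (fr x)"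
  unfolding fchain_iff singular_chain_def using supp_fr by fastforce

lemma iterated_sd_chain: "singular_chain p X c \<Longrightarrow> singular_chain p X ((singular_subdivision p ^^ m) c)"
  by (induction m) (auto simp: singular_chain_singular_subdivision)

lemma iterated_sd_boundary:
  "singular_chain (Suc p) X c \<Longrightarrow> chain_boundary (Suc p) ((singular_subdivision (Suc p) ^^ m) c)
     = (singular_subdivision p ^^ m) (chain_boundary (Suc p) c)"
  using chain_boundary_singular_subdivision[of "Suc p" X] iterated_sd_chain[of "Suc p" X c]
  by (induction m) simp_all

definition SD :: "nat \<Rightarrow> nat \<Rightarrow> ((nat \<Rightarrow> real) \<Rightarrow> 'a) \<Rightarrow> ((nat \<Rightarrow> real) \<Rightarrow> 'a) \<Rightarrow> 'k::field" where
  "SD m p s = fr ((singular_subdivision p ^^ m) (frag_of s))"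

lemma fchain_SD: "singular_simplex p X s \<Longrightarrow> fchain p X (SD m p s)"
  unfolding SD_def by (intro fchain_fr iterated_sd_chain) (simp add: singular_chain_of)

lemma finite_supp_SD [simp]: "finite (supp (SD m p s))"
  by (simp add: SD_def)

lemma SD_0: "singular_simplex 0 X s \<Longrightarrow> SD m 0 s = sgl s"
proof -
  assume s: "singular_simplex 0 X s"
  have "(singular_subdivision 0 ^^ m) (frag_of s) = frag_of s"
    using s by (induction m) (auto simp: singular_subdivision_zero singular_chain_of)
  then show ?thesis by (simp add: SD_def fr_of)
qed

lemma SD_fr: "fr ((singular_subdivision p ^^ m) x) = lext (SD m p) (fr x)"
  unfolding SD_def by (rule fr_hom) (simp_all add: singular_subdivision_power_diff)

lemma SD_boundary:
  assumes "singular_simplex (Suc p) X s"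
  shows "lext (sbd (Suc p)) (SD m (Suc p) s) = lext (SD m p) (sbd (Suc p) s)"
proof -
  have "lext (sbd (Suc p)) (SD m (Suc p) s) = fr (chain_boundary (Suc p) ((singular_subdivision (Suc p) ^^ m) (frag_of s)))"
    unfolding SD_def fr_boundary ..
  also have "\<dots> = fr ((singular_subdivision p ^^ m) (chain_boundary (Suc p) (frag_of s)))"
    using iterated_sd_boundary[of p X "frag_of s" m] assms by (simp add: singular_chain_of)
  also have "\<dots> = lext (SD m p) (sbd (Suc p) s)" unfolding SD_fr fr_boundary_of ..
  finally show ?thesis .
qed

text \<open>One homotopy for all spaces: it sends chains in any \<open>X\<close> to chains in
  \<open>X\<close>. Degree 0 is stated separately because the term from lower degree is absent
  there.\<close>

lemma SD_homotopy:
  obtains H :: "nat \<Rightarrow> ((nat \<Rightarrow> real) \<Rightarrow> 'a) \<Rightarrow> ((nat \<Rightarrow> real) \<Rightarrow> 'a) \<Rightarrow> 'k::field" where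
    "\<And>p X s. singular_simplex p X s \<Longrightarrow> fchain (Suc p) X (H p s)"
    "\<And>X s. singular_simplex 0 X s \<Longrightarrow> lext (sbd (Suc 0)) (H 0 s) = SD m 0 s - sgl s"
    "\<And>p X s. singular_simplex (Suc p) X s \<Longrightarrow>
       lext (sbd (Suc (Suc p))) (H (Suc p) s) + lext (H p) (sbd (Suc p) s) = SD m (Suc p) s - sgl s"
proof -
  obtain h where h: "\<And>p. h p 0 = (0 :: 'a chain)" "\<And>p c1 c2. h p (c1 - c2) = h p c1 - h p c2"
    "\<And>p X c. singular_chain p X c \<Longrightarrow> singular_chain (Suc p) X (h p c)"
    "\<And>p X c. singular_chain p X c \<Longrightarrow> chain_boundary (Suc p) (h p c) + h (p - Suc 0) (chain_boundary p c)
                   = (singular_subdivision p ^^ m) c - c"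
    by (rule chain_homotopic_iterated_singular_subdivision[of m]) (rule that, assumption+)
  define H where "H p s = (fr (h p (frag_of s)) :: _ \<Rightarrow> 'k)" for p s
  have H: "fr (h p x) = lext (H p) (fr x)" for p x unfolding H_def by (rule fr_hom) (simp_all add: h)
  show ?thesis
  proof (rule that[of H])
    show "fchain (Suc p) X (H p s)" if "singular_simplex p X s" for p X s
      unfolding H_def by (intro fchain_fr h(3)) (use that in \<open>simp add: singular_chain_of\<close>)
    show "lext (sbd (Suc 0)) (H 0 s) = SD m 0 s - sgl s" if s: "singular_simplex 0 X s" for X s
    proof -
      have sc: "singular_chain 0 X (frag_of s)" using s by (simp add: singular_chain_of)
      have "chain_boundary (Suc 0) (h 0 (frag_of s)) = (singular_subdivision 0 ^^ m) (frag_of s) - frag_of s"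
        using h(4)[OF sc] by (simp add: chain_boundary_def h(1))
      then have "fr (chain_boundary (Suc 0) (h 0 (frag_of s))) = (SD m 0 s - sgl s :: _ \<Rightarrow> 'k)"
        by (simp only: fr_diff SD_def fr_of)
      then show ?thesis by (simp only: fr_boundary H_def)
    qed
    show "lext (sbd (Suc (Suc p))) (H (Suc p) s) + lext (H p) (sbd (Suc p) s) = SD m (Suc p) s - sgl s"
      if s: "singular_simplex (Suc p) X s" for p X s
    proof -
      have sc: "singular_chain (Suc p) X (frag_of s)" using s by (simp add: singular_chain_of)
      have "fr (chain_boundary (Suc (Suc p)) (h (Suc p) (frag_of s)) + h p (chain_boundary (Suc p) (frag_of s)))
          = (SD m (Suc p) s - sgl s :: _ \<Rightarrow> 'k)"
        using h(4)[OF sc] by (simp only: fr_diff SD_def fr_of diff_Suc_1 One_nat_def[symmetric])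
      then show ?thesis by (simp only: fr_boundary fr_add H fr_of lext_sgl)
    qed
  qed
qed

text \<open>Each simplex has its own sufficient number of subdivisions; a finite set admits a common
  one.\<close>

lemma SD_small:
  assumes C: "\<And>U. U \<in> \<C> \<Longrightarrow> openin X U" "topspace X \<subseteq> \<Union>\<C>"
    and fin: "finite S" and S: "\<And>p s. (p, s) \<in> S \<Longrightarrow> singular_simplex p X s"
  obtains m where "\<And>p s t. (p, s) \<in> S \<Longrightarrow> t \<in> supp (SD m p s :: _ \<Rightarrow> 'k::field) \<Longrightarrow> \<exists>U\<in>\<C>. t ` standard_simplex p \<subseteq> U"
proof -
  have "\<exists>n. \<forall>m\<ge>n. \<forall>f\<in>Poly_Mapping.keys ((singular_subdivision (fst x) ^^ m) (frag_of (snd x))).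
      \<exists>U\<in>\<C>. f ` standard_simplex (fst x) \<subseteq> U" if x: "x \<in> S" for x
  proof -
    have "singular_chain (fst x) X (frag_of (snd x))" using S[of "fst x" "snd x"] x by (simp add: singular_chain_of)
    then obtain n where n: "\<And>m f. n \<le> m \<Longrightarrow> f \<in> Poly_Mapping.keys ((singular_subdivision (fst x) ^^ m) (frag_of (snd x))) \<Longrightarrow>
        \<exists>V\<in>\<C>. f \<in> standard_simplex (fst x) \<rightarrow> V"
      using sufficient_iterated_singular_subdivision_exists[OF C] by blast
    show ?thesis
    proof (intro exI[of _ n] allI impI ballI)
      fix m f assume "n \<le> m" "f \<in> Poly_Mapping.keys ((singular_subdivision (fst x) ^^ m) (frag_of (snd x)))"
      from n[OF this] show "\<exists>U\<in>\<C>. f ` standard_simplex (fst x) \<subseteq> U" by (auto simp: image_subset_iff_funcset)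
    qed
  qed
  then obtain n where n: "\<And>x m f. x \<in> S \<Longrightarrow> n x \<le> m \<Longrightarrow> f \<in> Poly_Mapping.keys ((singular_subdivision (fst x) ^^ m) (frag_of (snd x))) \<Longrightarrow>
      \<exists>U\<in>\<C>. f ` standard_simplex (fst x) \<subseteq> U" by metis
  obtain m where m: "\<And>x. x \<in> S \<Longrightarrow> n x \<le> m" using fin by (metis finite_imageI finite_nat_set_iff_bounded_le imageI)
  show ?thesis
  proof (rule that[of m])
    fix p s t assume s: "(p, s) \<in> S" and t: "t \<in> supp (SD m p s :: _ \<Rightarrow> 'k)"
    have "t \<in> Poly_Mapping.keys ((singular_subdivision p ^^ m) (frag_of s))" by (rule subsetD[OF supp_fr t[unfolded SD_def]])
    then show "\<exists>U\<in>\<C>. t ` standard_simplex p \<subseteq> U" using n[of "(p, s)" m t, OF s m[OF s]] by simp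
  qed
qed

section \<open>The prism operator for straight-line homotopies\<close>

definition dgn :: "nat \<Rightarrow> (nat \<Rightarrow> real) \<Rightarrow> nat \<Rightarrow> real" where
  "dgn k y = (\<lambda>i. if i < k then y i else if i = k then y k + y (Suc k) else y (Suc i))"

text \<open>The \<open>k\<close>-th simplex of the triangulated prism, composed with the
  straight-line homotopy from \<open>s\<close> to \<open>s'\<close>. The vertices up to
  \<open>k\<close> are at time 0 and the later ones at time 1, so the sum of the later coordinates
  is the time.\<close>

definition prs :: "nat \<Rightarrow> nat \<Rightarrow> ((nat \<Rightarrow> real) \<Rightarrow> 'a::real_normed_vector) \<Rightarrow> ((nat \<Rightarrow> real) \<Rightarrow> 'a) \<Rightarrow> (nat \<Rightarrow> real) \<Rightarrow> 'a" where
  "prs p k s s' = restrict (\<lambda>y. (1 - (\<Sum>i=Suc k..Suc p. y i)) *\<^sub>R s (dgn k y) + (\<Sum>i=Suc k..Suc p. y i) *\<^sub>R s' (dgn k y))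
     (standard_simplex (Suc p))"

lemma standard_simplex_ge0: "y \<in> standard_simplex p \<Longrightarrow> 0 \<le> y i"
  by (simp add: standard_simplex_def)

lemma standard_simplexI:
  assumes "\<And>i. 0 \<le> y i" "\<And>i. i > p \<Longrightarrow> y i = 0" "(\<Sum>i\<le>p. y i) = 1"
  shows "y \<in> standard_simplex p"
proof -
  have "y i \<le> 1" for i
  proof (cases "i \<le> p")
    case True
    then have "y i \<le> (\<Sum>i\<le>p. y i)" using assms(1) by (intro member_le_sum) auto
    then show ?thesis using assms(3) by simp
  qed (simp add: assms(2))
  then show ?thesis using assms by (simp add: standard_simplex_def)
qed

lemma dgn_simplex:
  assumes "k \<le> p" "y \<in> standard_simplex (Suc p)"
  shows "dgn k y \<in> standard_simplex p"
proof (rule standard_simplexI)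
  show "0 \<le> dgn k y i" for i using standard_simplex_ge0[OF assms(2)] by (simp add: dgn_def)
  show "dgn k y i = 0" if "i > p" for i using assms that by (simp add: dgn_def standard_simplex_def)
  have "(\<Sum>i\<le>p. dgn k y i) = (\<Sum>i\<in>{..<k}. dgn k y i) + dgn k y k + (\<Sum>i\<in>{Suc k..p}. dgn k y i)"
  proof -
    have e: "{..p} = insert k ({..<k} \<union> {Suc k..p})" using assms(1) by auto
    have "sum (dgn k y) ({..<k} \<union> {Suc k..p}) = sum (dgn k y) {..<k} + sum (dgn k y) {Suc k..p}"
      by (rule sum.union_disjoint) auto
    then show ?thesis unfolding e by simp
  qed
  also have "\<dots> = (\<Sum>i\<in>{..<k}. y i) + (y k + y (Suc k)) + (\<Sum>i\<in>{Suc k..p}. y (Suc i))"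
    by (simp add: dgn_def)
  also have "(\<Sum>i\<in>{Suc k..p}. y (Suc i)) = (\<Sum>i\<in>{Suc (Suc k)..Suc p}. y i)"
    by (rule sum.shift_bounds_cl_Suc_ivl[symmetric])
  also have "(\<Sum>i\<in>{..<k}. y i) + (y k + y (Suc k)) + (\<Sum>i\<in>{Suc (Suc k)..Suc p}. y i) = (\<Sum>i\<le>Suc p. y i)"
  proof -
    have e: "{..Suc p} = insert k (insert (Suc k) ({..<k} \<union> {Suc (Suc k)..Suc p}))" using assms(1) by auto
    have "sum y ({..<k} \<union> {Suc (Suc k)..Suc p}) = sum y {..<k} + sum y {Suc (Suc k)..Suc p}"
      by (rule sum.union_disjoint) auto
    then show ?thesis unfolding e by simp
  qed
  also have "\<dots> = 1" using assms(2) by (simp add: standard_simplex_def)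
  finally show "(\<Sum>i\<le>p. dgn k y i) = 1" .
qed

lemma tail_sum_bounds:
  assumes "y \<in> standard_simplex p"
  shows "0 \<le> (\<Sum>i=k..p. y i)" "(\<Sum>i=k..p. y i) \<le> 1"
proof -
  show "0 \<le> (\<Sum>i=k..p. y i)" using standard_simplex_ge0[OF assms] by (intro sum_nonneg) auto
  have "(\<Sum>i=k..p. y i) \<le> (\<Sum>i\<le>p. y i)" using standard_simplex_ge0[OF assms] by (intro sum_mono2) auto
  then show "(\<Sum>i=k..p. y i) \<le> 1" using assms by (simp add: standard_simplex_def)
qed

lemma tail_sum_face:
  assumes "j \<le> Suc p"
  shows "(\<Sum>i=Suc k..Suc p. simplical_face j y i) = (if j \<le> k then \<Sum>i=k..p. y i else (\<Sum>i=Suc k..p. (y i :: real)))"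
proof (cases "j \<le> k")
  case True
  have "(\<Sum>i=Suc k..Suc p. simplical_face j y i) = (\<Sum>i=k..p. simplical_face j y (Suc i))"
    by (rule sum.shift_bounds_cl_Suc_ivl)
  also have "\<dots> = (\<Sum>i=k..p. y i)" by (rule sum.cong) (use True in \<open>auto simp: simplical_face_def\<close>)
  finally show ?thesis using True by simp
next
  case False
  have e: "{Suc k..Suc p} = insert j ({Suc k..<j} \<union> {Suc j..Suc p})" "{Suc k..p} = {Suc k..<j} \<union> {j..p}"
    using False assms by auto
  have "(\<Sum>i\<in>{Suc k..<j} \<union> {Suc j..Suc p}. simplical_face j y i) =
      (\<Sum>i\<in>{Suc k..<j}. simplical_face j y i) + (\<Sum>i\<in>{Suc j..Suc p}. simplical_face j y i)"
    by (rule sum.union_disjoint) auto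
  also have "(\<Sum>i\<in>{Suc j..Suc p}. simplical_face j y i) = (\<Sum>i\<in>{j..p}. simplical_face j y (Suc i))"
    by (rule sum.shift_bounds_cl_Suc_ivl)
  also have "\<dots> = (\<Sum>i\<in>{j..p}. y i)" by (rule sum.cong) (auto simp: simplical_face_def)
  also have "(\<Sum>i\<in>{Suc k..<j}. simplical_face j y i) = (\<Sum>i\<in>{Suc k..<j}. y i)"
    by (rule sum.cong) (auto simp: simplical_face_def)
  also have "(\<Sum>i\<in>{Suc k..<j}. y i) + (\<Sum>i\<in>{j..p}. y i) = (\<Sum>i\<in>{Suc k..<j} \<union> {j..p}. y i)"
    by (rule sum.union_disjoint[symmetric]) auto
  finally show ?thesis using False unfolding e by (simp add: simplical_face_def)
qed

lemma dgn_face: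
  fixes y :: "nat \<Rightarrow> real"
  shows "j < k \<Longrightarrow> dgn k (simplical_face j y) = simplical_face j (dgn (k - 1) y)"
  "Suc k < j \<Longrightarrow> dgn k (simplical_face j y) = simplical_face (j - 1) (dgn k y)"
  "dgn k (simplical_face k y) = y" "dgn k (simplical_face (Suc k) y) = y"
proof -
  show "dgn k (simplical_face j y) = simplical_face j (dgn (k - 1) y)" if "j < k"
  proof
    fix i
    consider "i < j" | "i = j" | "j < i" "i < k" | "i = k" | "k < i" by linarith
    then show "dgn k (simplical_face j y) i = simplical_face j (dgn (k - 1) y) i"
      using that by cases (cases k; cases i; auto simp: dgn_def simplical_face_def)+
  qed
  show "dgn k (simplical_face j y) = simplical_face (j - 1) (dgn k y)" if "Suc k < j"
  proof
    fix i
    consider "i < k" | "i = k" | "k < i" "i < j - 1" | "i = j - 1" | "j - 1 < i" by linarith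
    then show "dgn k (simplical_face j y) i = simplical_face (j - 1) (dgn k y) i"
      using that by cases (cases i; auto simp: dgn_def simplical_face_def)+
  qed
  show "dgn k (simplical_face k y) = y" "dgn k (simplical_face (Suc k) y) = y"
    by (rule ext, simp add: dgn_def simplical_face_def)+
qed

text \<open>The common face of the prism simplices \<open>k - 1\<close> and \<open>k\<close>. These
  faces cancel in pairs, leaving \<open>mid p 0\<close> and \<open>mid p (Suc p)\<close>, the two
  ends of the homotopy.\<close>

definition mid :: "nat \<Rightarrow> nat \<Rightarrow> ((nat \<Rightarrow> real) \<Rightarrow> 'a::real_normed_vector) \<Rightarrow> ((nat \<Rightarrow> real) \<Rightarrow> 'a) \<Rightarrow> (nat \<Rightarrow> real) \<Rightarrow> 'a" where
  "mid p k s s' = restrict (\<lambda>y. (1 - (\<Sum>i=k..p. y i)) *\<^sub>R s y + (\<Sum>i=k..p. y i) *\<^sub>R s' y) (standard_simplex p)"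

lemma mid_ends:
  assumes "s \<in> extensional (standard_simplex p)" "s' \<in> extensional (standard_simplex p)"
  shows "mid p 0 s s' = s'" "mid p (Suc p) s s' = s"
proof -
  have "(\<Sum>i=0..p. y i) = 1" if "y \<in> standard_simplex p" for y
    using that by (simp add: standard_simplex_def atLeast0AtMost)
  then have "mid p 0 s s' = restrict s' (standard_simplex p)" by (auto simp: mid_def restrict_def)
  then show "mid p 0 s s' = s'" using assms by (simp add: extensional_restrict)
  have "mid p (Suc p) s s' = restrict s (standard_simplex p)" by (auto simp: mid_def restrict_def)
  then show "mid p (Suc p) s s' = s" using assms by (simp add: extensional_restrict)
qed

lemma face_simplex: "j \<le> Suc p \<Longrightarrow> y \<in> standard_simplex p \<Longrightarrow> simplical_face j y \<in> standard_simplex (Suc p)"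
  using simplical_face_in_standard_simplex[of "Suc p" j y] by simp

lemma face_prs_diag:
  assumes "k \<le> p"
  shows "singular_face (Suc p) k (prs p k s s') = mid p k s s'"
    "singular_face (Suc p) (Suc k) (prs p k s s') = mid p (Suc k) s s'"
  using assms by (auto simp: singular_face_def prs_def mid_def restrict_def face_simplex tail_sum_face dgn_face fun_eq_iff simp del: sum.cl_ivl_Suc)

lemma face_prs_low:
  assumes "j < k" "k \<le> Suc p"
  shows "singular_face (Suc (Suc p)) j (prs (Suc p) k s s') = prs p (k - 1) (singular_face (Suc p) j s) (singular_face (Suc p) j s')"
proof
  fix y
  show "singular_face (Suc (Suc p)) j (prs (Suc p) k s s') y = prs p (k - 1) (singular_face (Suc p) j s) (singular_face (Suc p) j s') y"
  proof (cases "y \<in> standard_simplex (Suc p)")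
    case True
    have 1: "simplical_face j y \<in> standard_simplex (Suc (Suc p))" using assms by (intro face_simplex True) auto
    have 2: "dgn (k - 1) y \<in> standard_simplex p" using assms by (intro dgn_simplex True) auto
    have 3: "(\<Sum>i=Suc k..Suc (Suc p). simplical_face j y i) = (\<Sum>i=Suc (k - 1)..Suc p. y i)"
      using assms tail_sum_face[where j = j and p = "Suc p" and k = k and y = y] by simp
    show ?thesis
      using True 1 2 3 by (simp add: singular_face_def prs_def dgn_face(1)[OF assms(1)] del: sum.cl_ivl_Suc)
  qed (simp add: singular_face_def prs_def)
qed

lemma face_prs_high:
  assumes "Suc k < j" "j \<le> Suc (Suc p)"
  shows "singular_face (Suc (Suc p)) j (prs (Suc p) k s s') = prs p k (singular_face (Suc p) (j - 1) s) (singular_face (Suc p) (j - 1) s')"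
proof
  fix y
  show "singular_face (Suc (Suc p)) j (prs (Suc p) k s s') y = prs p k (singular_face (Suc p) (j - 1) s) (singular_face (Suc p) (j - 1) s') y"
  proof (cases "y \<in> standard_simplex (Suc p)")
    case True
    have 1: "simplical_face j y \<in> standard_simplex (Suc (Suc p))" using assms by (intro face_simplex True) auto
    have 2: "dgn k y \<in> standard_simplex p" using assms by (intro dgn_simplex True) auto
    have 3: "(\<Sum>i=Suc k..Suc (Suc p). simplical_face j y i) = (\<Sum>i=Suc k..Suc p. y i)"
      using assms tail_sum_face[where j = j and p = "Suc p" and k = k and y = y] by simp
    show ?thesis
      using True 1 2 3 by (simp add: singular_face_def prs_def dgn_face(2)[OF assms(1)] del: sum.cl_ivl_Suc)
  qed (simp add: singular_face_def prs_def)
qed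

definition prism :: "nat \<Rightarrow> ((nat \<Rightarrow> real) \<Rightarrow> 'a::real_normed_vector) \<Rightarrow> ((nat \<Rightarrow> real) \<Rightarrow> 'a) \<Rightarrow> ((nat \<Rightarrow> real) \<Rightarrow> 'a) \<Rightarrow> 'k::field" where
  "prism p s s' = (\<Sum>k<Suc p. scl ((-1) ^ k) (sgl (prs p k s s')))"

lemma finite_supp_prism [simp]: "finite (supp (prism p s s'))"
  unfolding prism_def by (intro finite_supp_sum finite_supp_scl) simp

text \<open>The bookkeeping of the prism boundary: the diagonal faces telescope to the two ends, and
  the remaining ones are, with opposite sign, the prism simplices over the faces.\<close>

lemma sum_face_pairs:
  fixes F :: "nat \<Rightarrow> nat \<Rightarrow> 'b \<Rightarrow> 'k::field" and M :: "nat \<Rightarrow> 'b \<Rightarrow> 'k"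
  assumes diag: "\<And>k. k \<le> p \<Longrightarrow> F k k = M k" "\<And>k. k \<le> p \<Longrightarrow> F k (Suc k) = M (Suc k)"
    and low: "\<And>j k. j < k \<Longrightarrow> k \<le> p \<Longrightarrow> F k j = Q (k - 1) j"
    and high: "\<And>j k. Suc k < j \<Longrightarrow> j \<le> Suc p \<Longrightarrow> F k j = Q k (j - 1)"
  shows "(\<Sum>k<Suc p. \<Sum>j<Suc (Suc p). scl ((-1) ^ (k + j)) (F k j)) =
    M 0 - M (Suc p) - (\<Sum>k<p. \<Sum>j<Suc p. scl ((-1) ^ (k + j)) (Q k j))"
proof -
  define g where "g = (\<lambda>(k, j). scl ((-1) ^ (k + j)) (F k j))"
  define h where "h = (\<lambda>(k, j). scl ((-1) ^ (k + j)) (Q k j))"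
  define A where "A = {(k, j). k < Suc p \<and> j < k}"
  define B where "B = {(k, j). Suc k < j \<and> j < Suc (Suc p)}"
  define A' where "A' = {(k, j). k < p \<and> j \<le> k}"
  define B' where "B' = {(k, j). k < j \<and> j < Suc p}"
  define D where "D = (\<lambda>k. (k, k)) ` {..<Suc p}"
  define E where "E = (\<lambda>k. (k, Suc k)) ` {..<Suc p}"
  have fin: "finite A" "finite B" "finite A'" "finite B'" "finite D" "finite E"
    by (rule finite_subset[of _ "{..<Suc p} \<times> {..<Suc (Suc p)}"]; auto simp: A_def B_def A'_def B'_def D_def E_def)+
  have I: "{..<Suc p} \<times> {..<Suc (Suc p)} = (A \<union> B) \<union> (D \<union> E)"
    by (auto simp: A_def B_def D_def E_def image_iff)
  have disj: "A \<inter> B = {}" "D \<inter> E = {}" "(A \<union> B) \<inter> (D \<union> E) = {}" "A' \<inter> B' = {}"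
    by (auto simp: A_def B_def D_def E_def A'_def B'_def)
  have I': "{..<p} \<times> {..<Suc p} = A' \<union> B'" by (auto simp: A'_def B'_def)
  have "(\<Sum>k<Suc p. \<Sum>j<Suc (Suc p). scl ((-1) ^ (k + j)) (F k j)) = sum g ({..<Suc p} \<times> {..<Suc (Suc p)})"
    unfolding sum.cartesian_product g_def ..
  also have "\<dots> = (sum g A + sum g B) + (sum g D + sum g E)"
    unfolding I using fin disj by (simp add: sum.union_disjoint)
  also have "sum g A = - sum h A'"
    unfolding sum_negf[symmetric]
  proof (rule sum.reindex_bij_witness[of _ "\<lambda>(k, j). (Suc k, j)" "\<lambda>(k, j). (k - 1, j)"])
    fix a assume a: "a \<in> A"
    then obtain k j where kj: "a = (Suc k, j)" "j < Suc k" "Suc k \<le> p" unfolding A_def by (cases a) (auto simp: gr0_conv_Suc dest!: less_imp_Suc_add)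
    show "- h (case a of (k, j) \<Rightarrow> (k - 1, j)) = g a"
      unfolding kj(1) using low[OF kj(2,3)] by (simp add: g_def h_def scl_minus)
  qed (auto simp: A_def A'_def)
  also have "sum g B = - sum h B'"
    unfolding sum_negf[symmetric]
  proof (rule sum.reindex_bij_witness[of _ "\<lambda>(k, j). (k, Suc j)" "\<lambda>(k, j). (k, j - 1)"])
    fix a assume a: "a \<in> B"
    then obtain k j where kj: "a = (k, Suc j)" "Suc k < Suc j" "Suc j \<le> Suc p" unfolding B_def by (cases a) (auto simp: dest!: less_imp_Suc_add)
    show "- h (case a of (k, j) \<Rightarrow> (k, j - 1)) = g a"
      unfolding kj(1) using high[OF kj(2,3)] by (simp add: g_def h_def scl_minus)
  qed (auto simp: B_def B'_def)
  also have "- sum h A' + - sum h B' = - sum h ({..<p} \<times> {..<Suc p})"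
    unfolding I' using fin disj by (simp add: sum.union_disjoint)
  also have "sum g D + sum g E = (\<Sum>k<Suc p. M k - M (Suc k))"
  proof -
    have "sum g D = (\<Sum>k<Suc p. M k)"
      unfolding D_def by (subst sum.reindex) (auto simp: inj_on_def g_def diag power_add[symmetric] less_Suc_eq_le intro!: sum.cong)
    moreover have "sum g E = (\<Sum>k<Suc p. - M (Suc k))"
      unfolding E_def by (subst sum.reindex) (auto simp: inj_on_def g_def diag scl_minus less_Suc_eq_le intro!: sum.cong)
    ultimately show ?thesis by (simp only: sum.distrib[symmetric] diff_conv_add_uminus)
  qed
  also have "\<dots> = M 0 - M (Suc p)" by (rule sum_lessThan_telescope')
  also have "sum h ({..<p} \<times> {..<Suc p}) = (\<Sum>k<p. \<Sum>j<Suc p. scl ((-1) ^ (k + j)) (Q k j))"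
    unfolding sum.cartesian_product h_def ..
  finally show ?thesis by (simp only: diff_conv_add_uminus add.commute)
qed

lemma lext_sbd_prism:
  "lext (sbd (Suc p)) (prism p s s') = (\<Sum>k<Suc p. \<Sum>j<Suc (Suc p). scl ((-1) ^ (k + j)) (sgl (singular_face (Suc p) j (prs p k s s')) :: _ \<Rightarrow> 'k::field))"
proof -
  have "lext (sbd (Suc p)) (prism p s s') = (\<Sum>k<Suc p. lext (sbd (Suc p)) (scl ((-1) ^ k) (sgl (prs p k s s')) :: _ \<Rightarrow> 'k))"
    unfolding prism_def by (rule lext_sum) (intro finite_supp_scl, simp)
  also have "\<dots> = (\<Sum>k<Suc p. \<Sum>j<Suc (Suc p). scl ((-1) ^ (k + j)) (sgl (singular_face (Suc p) j (prs p k s s'))))"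
    unfolding lext_scl lext_sgl sbd_def fbd_def scl_sum by (simp only: scl_simps power_add)
  finally show ?thesis .
qed

lemma prism_boundary_0:
  assumes "s \<in> extensional (standard_simplex 0)" "s' \<in> extensional (standard_simplex 0)"
  shows "lext (sbd (Suc 0)) (prism 0 s s') = (sgl s' - sgl s :: _ \<Rightarrow> 'k::field)"
proof -
  have "lext (sbd (Suc 0)) (prism 0 s s') = (sgl (mid 0 0 s s') :: _ \<Rightarrow> 'k) - sgl (mid 0 (Suc 0) s s') -
     (\<Sum>k<0. \<Sum>j<Suc 0. scl ((-1) ^ (k + j)) 0)"
    unfolding lext_sbd_prism
    by (rule sum_face_pairs[where M = "\<lambda>k. sgl (mid 0 k s s')" and Q = "\<lambda>_ _. 0"]) (auto simp: face_prs_diag)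
  then show ?thesis using mid_ends[OF assms] by simp
qed

lemma prism_boundary:
  assumes "s \<in> extensional (standard_simplex (Suc p))" "s' \<in> extensional (standard_simplex (Suc p))"
  shows "lext (sbd (Suc (Suc p))) (prism (Suc p) s s') = (sgl s' - sgl s :: _ \<Rightarrow> 'k::field) -
     (\<Sum>j<Suc (Suc p). scl ((-1) ^ j) (prism p (singular_face (Suc p) j s) (singular_face (Suc p) j s')))"
proof -
  let ?Q = "\<lambda>k j. sgl (prs p k (singular_face (Suc p) j s) (singular_face (Suc p) j s')) :: _ \<Rightarrow> 'k"
  have "lext (sbd (Suc (Suc p))) (prism (Suc p) s s') = (sgl (mid (Suc p) 0 s s') :: _ \<Rightarrow> 'k) - sgl (mid (Suc p) (Suc (Suc p)) s s') -
     (\<Sum>k<Suc p. \<Sum>j<Suc (Suc p). scl ((-1) ^ (k + j)) (?Q k j))"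
    unfolding lext_sbd_prism
    by (rule sum_face_pairs[where M = "\<lambda>k. sgl (mid (Suc p) k s s')" and Q = ?Q])
      (simp_all only: face_prs_diag face_prs_low face_prs_high)
  also have "(\<Sum>k<Suc p. \<Sum>j<Suc (Suc p). scl ((-1) ^ (k + j)) (?Q k j)) =
     (\<Sum>j<Suc (Suc p). \<Sum>k<Suc p. scl ((-1) ^ (k + j)) (?Q k j))" by (rule sum.swap)
  also have "\<dots> = (\<Sum>j<Suc (Suc p). scl ((-1) ^ j) (prism p (singular_face (Suc p) j s) (singular_face (Suc p) j s')))"
    unfolding prism_def scl_sum by (simp only: scl_simps power_add mult.commute)
  finally show ?thesis unfolding mid_ends[OF assms] .
qed

lemma singular_simplex_top_of_set:
  "singular_simplex p (top_of_set X) f \<longleftrightarrow>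
     continuous_on (standard_simplex p) f \<and> f ` standard_simplex p \<subseteq> X \<and> f \<in> extensional (standard_simplex p)"
  unfolding singular_simplex_def euclidean_product_topology by (auto simp: continuous_map_in_subtopology)

lemma continuous_on_dgn: "continuous_on S (dgn k)"
proof (rule continuous_on_coordinatewise_then_product)
  fix i
  have c: "continuous_on S (\<lambda>y. y j)" for j :: nat
    by (rule continuous_on_subset[OF continuous_on_product_coordinates]) auto
  show "continuous_on S (\<lambda>y. dgn k y i)"
    by (cases "i < k"; cases "i = k") (auto simp: dgn_def intro: c continuous_on_add)
qed

lemma singular_simplex_prs:
  fixes s :: "(nat \<Rightarrow> real) \<Rightarrow> 'a::real_normed_vector"
  assumes k: "k \<le> p" and s: "singular_simplex p (top_of_set Y) s" and s': "singular_simplex p (top_of_set Z) s'"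
    and X: "\<And>y t. y \<in> standard_simplex p \<Longrightarrow> 0 \<le> t \<Longrightarrow> t \<le> 1 \<Longrightarrow> (1 - t) *\<^sub>R s y + t *\<^sub>R s' y \<in> X"
  shows "singular_simplex (Suc p) (top_of_set X) (prs p k s s')"
  unfolding singular_simplex_top_of_set
proof (intro conjI)
  have d: "dgn k ` standard_simplex (Suc p) \<subseteq> standard_simplex p" using dgn_simplex[OF k] by auto
  have c: "continuous_on (standard_simplex (Suc p)) (\<lambda>y. s (dgn k y))" "continuous_on (standard_simplex (Suc p)) (\<lambda>y. s' (dgn k y))"
    using s s' by (auto simp: singular_simplex_top_of_set intro: continuous_on_compose2[OF _ continuous_on_dgn d])
  have co: "continuous_on (standard_simplex (Suc p)) (\<lambda>y. y j)" for j :: nat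
    by (rule continuous_on_subset[OF continuous_on_product_coordinates]) auto
  have t: "continuous_on (standard_simplex (Suc p)) (\<lambda>y. (\<Sum>i=Suc k..Suc p. y i))"
    by (intro continuous_on_sum co)
  have "continuous_on (standard_simplex (Suc p)) (\<lambda>y. (1 - (\<Sum>i=Suc k..Suc p. y i)) *\<^sub>R s (dgn k y) + (\<Sum>i=Suc k..Suc p. y i) *\<^sub>R s' (dgn k y))"
    by (intro continuous_intros c t)
  then show "continuous_on (standard_simplex (Suc p)) (prs p k s s')"
    unfolding prs_def by (subst continuous_on_cong[OF refl]) auto
  show "prs p k s s' ` standard_simplex (Suc p) \<subseteq> X"
  proof
    fix x assume "x \<in> prs p k s s' ` standard_simplex (Suc p)"
    then obtain y where y: "y \<in> standard_simplex (Suc p)" "x = prs p k s s' y" by auto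
    show "x \<in> X" unfolding y(2) prs_def restrict_apply'[OF y(1)]
      by (rule X[OF dgn_simplex[OF k y(1)] tail_sum_bounds[OF y(1)]])
  qed
qed (simp add: prs_def)

lemma fchain_prism:
  fixes s :: "(nat \<Rightarrow> real) \<Rightarrow> 'a::real_normed_vector"
  assumes s: "singular_simplex p (top_of_set Y) s" and s': "singular_simplex p (top_of_set Z) s'"
    and X: "\<And>y t. y \<in> standard_simplex p \<Longrightarrow> 0 \<le> t \<Longrightarrow> t \<le> 1 \<Longrightarrow> (1 - t) *\<^sub>R s y + t *\<^sub>R s' y \<in> X"
  shows "fchain (Suc p) (top_of_set X) (prism p s s' :: _ \<Rightarrow> 'k::field)"
proof -
  have "(prism p s s' :: _ \<Rightarrow> 'k) \<in> Collect (fchain (Suc p) (top_of_set X))"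
    unfolding prism_def
    by (intro lsub_sum[OF lsub_fchain] lsub_scl[OF lsub_fchain] CollectI fchain_sgl singular_simplex_prs[OF _ s s' X]) auto
  then show ?thesis by simp
qed

section \<open>Affine simplices and vertex labels\<close>

definition lsx :: "'v::finite list \<Rightarrow> (nat \<Rightarrow> real) \<Rightarrow> real ^ 'v" where
  "lsx l = restrict (\<lambda>y. \<Sum>j<length l. y j *\<^sub>R axis (l ! j) 1) (standard_simplex (length l - 1))"

text \<open>The label of a point is a vertex with largest coordinate. Unlike an arbitrary vertex of
  the carrying face, it has a coordinate bounded below, see \<open>vx_ge\<close>.\<close>

definition vx :: "real ^ 'v::finite \<Rightarrow> 'v" where
  "vx x = (SOME v. \<forall>w. x $ w \<le> x $ v)"

definition ev :: "nat \<Rightarrow> nat \<Rightarrow> real" where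
  "ev k = (\<lambda>j. if j = k then 1 else 0)"

definition lab :: "nat \<Rightarrow> ((nat \<Rightarrow> real) \<Rightarrow> real ^ 'v::finite) \<Rightarrow> 'v list" where
  "lab p s = map (\<lambda>k. vx (s (ev k))) [0..<Suc p]"

lemma vx: "x $ w \<le> x $ vx x"
proof -
  have "\<exists>v. \<forall>w. x $ w \<le> x $ v"
  proof -
    have "Max (range (\<lambda>v. x $ v)) \<in> range (\<lambda>v. x $ v)" by (rule Max_in) auto
    then obtain v where v: "Max (range (\<lambda>v. x $ v)) = x $ v" by (rule rangeE)
    have "x $ w \<le> Max (range (\<lambda>v. x $ v))" for w by (rule Max_ge) auto
    then show ?thesis unfolding v by (intro exI[of _ v]) simp
  qed
  then show ?thesis unfolding vx_def by (rule someI2_ex) auto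
qed

lemma ev_simplex [simp]: "ev k \<in> standard_simplex p \<longleftrightarrow> k \<le> p"
  unfolding ev_def by simp

lemma length_lab [simp]: "length (lab p s) = Suc p"
  by (simp add: lab_def)

lemma nth_lab: "k \<le> p \<Longrightarrow> lab p s ! k = vx (s (ev k))"
  by (simp add: lab_def less_Suc_eq_le del: upt_Suc)

lemma set_lab: "set (lab p s) = (\<lambda>k. vx (s (ev k))) ` {..p}"
  by (auto simp: lab_def less_Suc_eq_le simp del: upt_Suc)

lemma face_ev: "simplical_face k (ev j) = ev (if j < k then j else Suc j)"
  by (rule ext) (auto simp: simplical_face_def ev_def)

lemma lab_face: "k \<le> Suc p \<Longrightarrow> lab p (singular_face (Suc p) k s) = del k (lab (Suc p) s)"
  by (rule nth_equalityI)
    (auto simp: length_del nth_del nth_lab singular_face_def face_ev less_Suc_eq_le)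

lemma lsx_face:
  assumes l: "length l = Suc (Suc p)" and k: "k \<le> Suc p"
  shows "singular_face (Suc p) k (lsx l) = lsx (del k l)"
proof
  fix y
  have ld: "length (del k l) = Suc p" using l k by (simp add: length_del)
  show "singular_face (Suc p) k (lsx l) y = lsx (del k l) y"
  proof (cases "y \<in> standard_simplex p")
    case True
    have f: "simplical_face k y \<in> standard_simplex (Suc p)" by (rule face_simplex[OF k True])
    let ?g = "\<lambda>j. simplical_face k y j *\<^sub>R axis (l ! j) (1::real)"
    have "(\<Sum>j<Suc (Suc p). ?g j) = ?g k + (\<Sum>j\<in>{..<Suc (Suc p)} - {k}. ?g j)"
      by (rule sum.remove) (use k in auto)
    also have "?g k = 0" by (simp add: simplical_face_def)
    also have "(\<Sum>j\<in>{..<Suc (Suc p)} - {k}. ?g j) = (\<Sum>j<Suc p. y j *\<^sub>R axis (del k l ! j) 1)"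
    proof (rule sum.reindex_bij_witness[of _ "\<lambda>j. if j < k then j else Suc j" "\<lambda>j. if j < k then j else j - 1"])
      fix j assume j: "j \<in> {..<Suc (Suc p)} - {k}"
      then show "(if (if j < k then j else j - 1) < k then if j < k then j else j - 1 else Suc (if j < k then j else j - 1)) = j"
        "(if j < k then j else j - 1) \<in> {..<Suc p}" using k by auto
      show "y (if j < k then j else j - 1) *\<^sub>R axis (del k l ! (if j < k then j else j - 1)) 1 = ?g j"
        using j k l by (auto simp: simplical_face_def nth_del)
    qed (use k in auto)
    finally show ?thesis using True f l ld by (simp add: singular_face_def lsx_def)
  next
    case False
    then show ?thesis using ld by (simp add: singular_face_def lsx_def)
  qed
qed

lemma lsx_nth:
  assumes "y \<in> standard_simplex (length l - 1)"
  shows "lsx l y $ v = (\<Sum>j<length l. if l ! j = v then y j else 0)"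
  using assms by (auto simp: lsx_def axis_def intro!: sum.cong)

definition psi :: "nat \<Rightarrow> ((nat \<Rightarrow> real) \<Rightarrow> real ^ 'v::finite) \<Rightarrow> 'v list \<Rightarrow> 'k::field" where
  "psi p s = sgl (lab p s)"

definition Phi :: "'v::finite list \<Rightarrow> ((nat \<Rightarrow> real) \<Rightarrow> real ^ 'v) \<Rightarrow> 'k::field" where
  "Phi l = sgl (lsx l)"

lemma finite_supp_psi [simp]: "finite (supp (psi p s))" "finite (supp (Phi l))"
  by (simp_all add: psi_def Phi_def)

lemma psi_sbd: "lext (psi p) (sbd (Suc p) s) = (ldel (lab (Suc p) s) :: _ \<Rightarrow> 'b::field)"
proof -
  have "lext (psi p) (sbd (Suc p) s) = (\<Sum>k<Suc (Suc p). scl ((-1) ^ k) (psi p (singular_face (Suc p) k s) :: _ \<Rightarrow> 'b))"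
    unfolding sbd_def lext_fbd ..
  also have "\<dots> = ldel (lab (Suc p) s)"
    unfolding ldel_def fbd_def length_lab psi_def by (rule sum.cong) (auto simp: lab_face less_Suc_eq_le)
  finally show ?thesis .
qed

lemma psi_chain:
  assumes "finite (supp c)"
  shows "lext ldel (lext (psi (Suc p)) c) = lext (psi p) (lext (sbd (Suc p)) c)"
proof -
  have "lext ldel (lext (psi (Suc p)) c) = lext (\<lambda>s. lext ldel (psi (Suc p) s)) c"
    by (rule lext_lext[OF assms]) simp
  also have "\<dots> = lext (\<lambda>s. lext (psi p) (sbd (Suc p) s)) c"
    unfolding psi_sbd psi_def lext_sgl ..
  also have "\<dots> = lext (psi p) (lext (sbd (Suc p)) c)"
    by (rule lext_lext[OF assms, symmetric]) simp
  finally show ?thesis .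
qed

lemma psi_chain_0:
  assumes "finite (supp c)"
  shows "lext ldel (lext (psi 0) c) = lext (\<lambda>_. sgl []) c"
proof -
  have "lext ldel (lext (psi 0) c) = lext (\<lambda>s. lext ldel (psi 0 s)) c"
    by (rule lext_lext[OF assms]) simp
  also have "\<dots> = lext (\<lambda>_. sgl []) c"
  proof (rule lext_cong)
    fix s :: "(nat \<Rightarrow> real) \<Rightarrow> real ^ 'a"
    have "lab 0 s = [vx (s (ev 0))]" by (simp add: lab_def)
    then show "lext ldel (psi 0 s) = (sgl [] :: _ \<Rightarrow> 'b)" by (simp add: psi_def ldel_Cons)
  qed
  finally show ?thesis .
qed

lemma Phi_ldel:
  assumes "length l = Suc (Suc p)"
  shows "lext Phi (ldel l) = (sbd (Suc p) (lsx l) :: _ \<Rightarrow> 'b::field)"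
proof -
  have "lext Phi (ldel l) = (\<Sum>k<length l. scl ((-1) ^ k) (Phi (del k l) :: _ \<Rightarrow> 'b))"
    unfolding ldel_def lext_fbd ..
  also have "\<dots> = sbd (Suc p) (lsx l)"
    unfolding sbd_def fbd_def Phi_def assms
    by (rule sum.cong) (auto simp: lsx_face[OF assms] less_Suc_eq_le)
  finally show ?thesis .
qed

lemma Phi_chain:
  assumes "finite (supp c)" "\<And>l. l \<in> supp c \<Longrightarrow> length l = Suc (Suc p)"
  shows "lext Phi (lext ldel c) = lext (sbd (Suc p)) (lext Phi c)"
proof -
  have "lext Phi (lext ldel c) = lext (\<lambda>l. lext Phi (ldel l)) c"
    by (rule lext_lext[OF assms(1)]) simp
  also have "\<dots> = lext (\<lambda>l. lext (sbd (Suc p)) (Phi l)) c"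
    by (rule lext_cong) (simp add: Phi_ldel assms(2) Phi_def)
  also have "\<dots> = lext (sbd (Suc p)) (lext Phi c)"
    by (rule lext_lext[OF assms(1), symmetric]) simp
  finally show ?thesis .
qed

text \<open>Labels and affine simplices are both compatible with faces, so the prisms from
  \<open>s\<close> to the affine simplex on its labels form a chain homotopy.\<close>

lemma prism_lab_boundary:
  assumes "s \<in> extensional (standard_simplex (Suc p))"
  shows "lext (sbd (Suc (Suc p))) (prism (Suc p) s (lsx (lab (Suc p) s))) =
    sgl (lsx (lab (Suc p) s)) - sgl s - lext (\<lambda>t. prism p t (lsx (lab p t))) (sbd (Suc p) s :: _ \<Rightarrow> 'k::field)"
proof -
  have e: "lsx (lab (Suc p) s) \<in> extensional (standard_simplex (Suc p))" by (simp add: lsx_def)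
  have "(\<Sum>j<Suc (Suc p). scl ((-1) ^ j) (prism p (singular_face (Suc p) j s) (singular_face (Suc p) j (lsx (lab (Suc p) s))) :: _ \<Rightarrow> 'k))
    = lext (\<lambda>t. prism p t (lsx (lab p t))) (sbd (Suc p) s)"
    unfolding sbd_def lext_fbd by (rule sum.cong) (auto simp: lsx_face lab_face less_Suc_eq_le)
  then show ?thesis using prism_boundary[OF assms e, where 'k = 'k] by (simp only:)
qed

text \<open>The augmentation is written as a linear map onto multiples of the empty list. Reduced
  cycles of degree 0 are then the kernel of a linear extension too, and the map matches
  \<open>ldel\<close> on lists of length 1.\<close>

lemma lext_const_Nil: "lext (\<lambda>_. sgl []) c = (0 :: 'a list \<Rightarrow> 'k::field) \<longleftrightarrow> (\<Sum>s\<in>supp c. c s) = 0"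
proof -
  have e: "lext (\<lambda>_. sgl []) c = scl (\<Sum>s\<in>supp c. c s) (sgl [] :: 'a list \<Rightarrow> 'k)"
    by (rule ext) (simp add: lext_def scl_def sum_distrib_right)
  show ?thesis
  proof
    assume "lext (\<lambda>_. sgl []) c = (0 :: 'a list \<Rightarrow> 'k)"
    then have "scl (\<Sum>s\<in>supp c. c s) (sgl [] :: 'a list \<Rightarrow> 'k) [] = 0" unfolding e by (simp add: fun_apply)
    then show "(\<Sum>s\<in>supp c. c s) = 0" by (simp add: scl_def sgl_def)
  qed (simp add: e)
qed

lemma reduced_fcycles_0:
  "c \<in> reduced_fcycles 0 X \<longleftrightarrow> fchain 0 X c \<and> lext (\<lambda>_. sgl []) c = (0 :: 'a list \<Rightarrow> 'k::field)"
  unfolding lext_const_Nil by (simp add: reduced_fcycles_def supp_def)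

lemma reduced_fcycles_Suc:
  fixes c :: "((nat \<Rightarrow> real) \<Rightarrow> 'b) \<Rightarrow> 'k::field"
  shows "c \<in> reduced_fcycles (Suc p) X \<longleftrightarrow> fchain (Suc p) X c \<and> lext (sbd (Suc p)) c = 0"
proof -
  have "(\<lambda>_. 0) = (0 :: ((nat \<Rightarrow> real) \<Rightarrow> 'b) \<Rightarrow> 'k)" by (rule ext) (simp add: fun_apply)
  then show ?thesis by (simp add: reduced_fcycles_def fchain_boundary_lext)
qed

lemma fchain_reduced_fcycles: "c \<in> reduced_fcycles i X \<Longrightarrow> fchain i X c"
  by (simp add: reduced_fcycles_def)

lemma fboundaries_eq: "fboundaries i X = lext (sbd (Suc i)) ` Collect (fchain (Suc i) X)"
  by (auto simp: fboundaries_def fchain_boundary_lext)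

lemma fboundariesI: "fchain (Suc i) X d \<Longrightarrow> lext (sbd (Suc i)) d \<in> fboundaries i X"
  by (auto simp: fboundaries_eq)

lemma lsub_fboundaries: "lsub (fboundaries i X)"
  unfolding lsub_def fboundaries_eq
proof (intro conjI ballI allI)
  show "0 \<in> lext (sbd (Suc i)) ` Collect (fchain (Suc i) X)"
    by (rule image_eqI[of _ _ 0]) (simp_all add: fchain_iff)
  fix x y :: "_ \<Rightarrow> 'b" and a assume "x \<in> lext (sbd (Suc i)) ` Collect (fchain (Suc i) X)" "y \<in> lext (sbd (Suc i)) ` Collect (fchain (Suc i) X)"
  then obtain e f where ef: "x = lext (sbd (Suc i)) e" "y = lext (sbd (Suc i)) f" "fchain (Suc i) X e" "fchain (Suc i) X f" by blast
  have "e + scl a f \<in> Collect (fchain (Suc i) X)" using ef by (intro lsub_lin[OF lsub_fchain]) auto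
  moreover have "x + scl a y = lext (sbd (Suc i)) (e + scl a f)"
    using ef by (subst lext_add) (simp_all add: fchain_iff lext_scl)
  ultimately show "x + scl a y \<in> lext (sbd (Suc i)) ` Collect (fchain (Suc i) X)" by blast
qed

lemma lsub_reduced_fcycles: "lsub (reduced_fcycles i X :: (_ \<Rightarrow> 'b::field) set)"
  unfolding lsub_def
proof (intro conjI ballI allI)
  show "(0 :: _ \<Rightarrow> 'b) \<in> reduced_fcycles i X"
    by (cases i) (simp_all add: fchain_iff reduced_fcycles_0[where 'a = nat] reduced_fcycles_Suc)
  fix x y :: "_ \<Rightarrow> 'b" and a assume xy: "x \<in> reduced_fcycles i X" "y \<in> reduced_fcycles i X"
  have f: "fchain i X x" "fchain i X y" using xy by (simp_all add: fchain_reduced_fcycles)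
  then have s: "x + scl a y \<in> Collect (fchain i X)" by (intro lsub_lin[OF lsub_fchain]) auto
  have l: "lext g (x + scl a y) = lext g x + scl a (lext g y)" for g :: "_ \<Rightarrow> 'z \<Rightarrow> 'b"
    using f by (subst lext_add) (simp_all add: fchain_iff lext_scl)
  show "x + scl a y \<in> reduced_fcycles i X"
  proof (cases i)
    case 0
    then show ?thesis using xy s l[of "\<lambda>_. sgl ([] :: nat list)"] by (simp add: reduced_fcycles_0[where 'a = nat])
  next
    case (Suc p)
    then show ?thesis using xy s l[of "sbd (Suc p)"] by (simp add: reduced_fcycles_Suc)
  qed
qed

section \<open>Simplicial and singular homology\<close>

definition spt :: "real ^ 'v::finite \<Rightarrow> 'v set" where
  "spt x = {v. x $ v \<noteq> 0}"

definition face_of_simplex :: "'v::finite set \<Rightarrow> (real ^ 'v) set" where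
  "face_of_simplex \<sigma> = {x. (\<forall>v. 0 \<le> x $ v) \<and> (\<Sum>v\<in>UNIV. x $ v) = 1 \<and> spt x \<subseteq> \<sigma>}"

definition polyhedron_of :: "'v::finite set set \<Rightarrow> (real ^ 'v) set" where
  "polyhedron_of K = {x. (\<forall>v. 0 \<le> x $ v) \<and> (\<Sum>v\<in>UNIV. x $ v) = 1 \<and> spt x \<in> K}"

lemma face_of_simplex_mono: "\<sigma> \<subseteq> \<tau> \<Longrightarrow> face_of_simplex \<sigma> \<subseteq> face_of_simplex \<tau>"
  by (auto simp: face_of_simplex_def)

lemma face_of_simplex_convex:
  assumes "x \<in> face_of_simplex \<sigma>" "y \<in> face_of_simplex \<sigma>" "0 \<le> t" "t \<le> 1"
  shows "(1 - t) *\<^sub>R x + t *\<^sub>R y \<in> face_of_simplex \<sigma>"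
proof -
  have "(\<Sum>v\<in>UNIV. ((1 - t) *\<^sub>R x + t *\<^sub>R y) $ v) = (1 - t) * (\<Sum>v\<in>UNIV. x $ v) + t * (\<Sum>v\<in>UNIV. y $ v)"
    by (simp add: sum.distrib sum_distrib_left)
  also have "\<dots> = 1" using assms by (simp add: face_of_simplex_def)
  finally have "(\<Sum>v\<in>UNIV. ((1 - t) *\<^sub>R x + t *\<^sub>R y) $ v) = 1" .
  moreover have "spt ((1 - t) *\<^sub>R x + t *\<^sub>R y) \<subseteq> spt x \<union> spt y" by (auto simp: spt_def)
  ultimately show ?thesis using assms by (auto simp: face_of_simplex_def)
qed

lemma lsx_simplex:
  assumes l: "length l = Suc p"
  shows "singular_simplex p (top_of_set (face_of_simplex (set l))) (lsx l)"
  unfolding singular_simplex_top_of_set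
proof (intro conjI)
  have c: "continuous_on (standard_simplex p) (\<lambda>y. \<Sum>j<Suc p. (y j :: real) *\<^sub>R (axis (l ! j) 1 :: real ^ 'a))"
    by (intro continuous_on_sum continuous_on_scaleR continuous_on_const
        continuous_on_subset[OF continuous_on_product_coordinates subset_UNIV])
  show "continuous_on (standard_simplex p) (lsx l)"
    by (rule continuous_on_eq[OF c]) (simp add: lsx_def l)
  show "lsx l \<in> extensional (standard_simplex p)" by (simp add: lsx_def l)
  show "lsx l ` standard_simplex p \<subseteq> face_of_simplex (set l)"
  proof (rule image_subsetI)
    fix y assume y: "y \<in> standard_simplex p"
    have e: "lsx l y $ v = (\<Sum>j<Suc p. if l ! j = v then y j else 0)" for v
      using lsx_nth[of y l v] y l by simp
    have "0 \<le> lsx l y $ v" for v unfolding e using standard_simplex_ge0[OF y] by (intro sum_nonneg) auto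
    moreover have "(\<Sum>v\<in>UNIV. lsx l y $ v) = 1"
    proof -
      have "(\<Sum>v\<in>UNIV. lsx l y $ v) = (\<Sum>j<Suc p. \<Sum>v\<in>UNIV. if l ! j = v then y j else 0)"
        unfolding e by (rule sum.swap)
      also have "\<dots> = (\<Sum>j\<le>p. y j)" by (simp add: lessThan_Suc_atMost)
      also have "\<dots> = 1" using y by (simp add: standard_simplex_def)
      finally show ?thesis .
    qed
    moreover have "spt (lsx l y) \<subseteq> set l"
    proof
      fix v assume "v \<in> spt (lsx l y)"
      then have "(\<Sum>j<Suc p. if l ! j = v then y j else 0) \<noteq> 0" by (simp only: spt_def e mem_Collect_eq not_False_eq_True)
      then obtain j where "j \<in> {..<Suc p}" "(if l ! j = v then y j else 0) \<noteq> 0" by (rule sum.not_neutral_contains_not_neutral)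
      then show "v \<in> set l" using l by (auto split: if_splits)
    qed
    ultimately show "lsx l y \<in> face_of_simplex (set l)" by (simp add: face_of_simplex_def)
  qed
qed

lemma vx_ge:
  fixes x :: "real ^ 'v::finite"
  assumes "(\<Sum>v\<in>UNIV. x $ v) = 1"
  shows "1 / CARD('v) \<le> x $ vx x"
proof -
  have "1 \<le> (\<Sum>v\<in>(UNIV::'v set). x $ vx x)" unfolding assms[symmetric] by (rule sum_mono) (rule vx)
  then show ?thesis by (simp add: field_simps)
qed

text \<open>A good simplex is linearly homotopic, inside the polyhedron, to the affine simplex on its labels.\<close>

definition good :: "'v::finite set set \<Rightarrow> nat \<Rightarrow> ((nat \<Rightarrow> real) \<Rightarrow> real ^ 'v) \<Rightarrow> bool" where
  "good K p t \<longleftrightarrow> singular_simplex p (top_of_set (polyhedron_of K)) t \<and>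
     (\<forall>y\<in>standard_simplex p. set (lab p t) \<subseteq> spt (t y))"

text \<open>The radius is half of the bound in \<open>vx_ge\<close>: a coordinate that is at least
  \<open>1 / CARD('v)\<close> at one point of the neighbourhood stays positive at all
  others.\<close>

definition star_nbhd :: "'v::finite set set \<Rightarrow> real ^ 'v \<Rightarrow> (real ^ 'v) set" where
  "star_nbhd K x = {y \<in> polyhedron_of K. \<forall>v. \<bar>y $ v - x $ v\<bar> < 1 / (2 * CARD('v))}"

lemma openin_star_nbhd: "openin (top_of_set (polyhedron_of K)) (star_nbhd K (x :: real ^ 'v::finite))"
proof -
  have "open (\<Inter>v\<in>UNIV. {y :: real ^ 'v. \<bar>y $ v - x $ v\<bar> < 1 / (2 * CARD('v))})"
    by (intro open_INT finite ballI open_Collect_less continuous_intros)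
  moreover have "star_nbhd K x = polyhedron_of K \<inter> (\<Inter>v\<in>UNIV. {y. \<bar>y $ v - x $ v\<bar> < 1 / (2 * CARD('v))})"
    by (auto simp: star_nbhd_def)
  ultimately show ?thesis by (auto simp: openin_open)
qed

lemma goodI:
  assumes t: "singular_simplex p (top_of_set (polyhedron_of K)) t"
    and u: "t ` standard_simplex p \<subseteq> star_nbhd K (x :: real ^ 'v::finite)"
  shows "good K p t"
  unfolding good_def
proof (intro conjI ballI t subsetI)
  fix y v assume y: "y \<in> standard_simplex p" and v: "v \<in> set (lab p t)"
  then obtain k where k: "k \<le> p" "v = vx (t (ev k))" by (auto simp: set_lab)
  then have a: "t (ev k) \<in> star_nbhd K x" using u by auto
  then have "1 / CARD('v) \<le> t (ev k) $ v" unfolding k(2) by (intro vx_ge) (simp add: star_nbhd_def polyhedron_of_def)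
  moreover have "\<bar>t (ev k) $ v - x $ v\<bar> < 1 / (2 * CARD('v))" using a by (simp add: star_nbhd_def)
  moreover have "t y \<in> star_nbhd K x" using u y by auto
  then have "\<bar>t y $ v - x $ v\<bar> < 1 / (2 * CARD('v))" by (simp add: star_nbhd_def)
  moreover have "1 / real CARD('v) = 1 / (2 * CARD('v)) + 1 / (2 * CARD('v))" by (simp add: field_simps)
  ultimately have "0 < t y $ v" by linarith
  then show "v \<in> spt (t y)" by (simp add: spt_def)
qed

lemma SD_good:
  fixes K :: "'v::finite set set"
  assumes "finite S" "\<And>p s. (p, s) \<in> S \<Longrightarrow> singular_simplex p (top_of_set (polyhedron_of K)) s"
  obtains m where "\<And>p s t. (p, s) \<in> S \<Longrightarrow> t \<in> supp (SD m p s :: _ \<Rightarrow> 'k::field) \<Longrightarrow> good K p t"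
proof -
  let ?C = "star_nbhd K ` polyhedron_of K"
  have cov: "topspace (top_of_set (polyhedron_of K)) \<subseteq> \<Union> ?C"
  proof
    fix x assume "x \<in> topspace (top_of_set (polyhedron_of K))"
    then have "x \<in> polyhedron_of K" by simp
    moreover from this have "x \<in> star_nbhd K x" by (simp add: star_nbhd_def)
    ultimately show "x \<in> \<Union> ?C" by (intro UnionI[OF imageI])
  qed
  have op: "openin (top_of_set (polyhedron_of K)) U" if "U \<in> ?C" for U
    using that openin_star_nbhd by (elim imageE) simp
  show ?thesis
  proof (rule SD_small[where \<C> = ?C and X = "top_of_set (polyhedron_of K)" and S = S and 'k = 'k])
    fix m assume m: "\<And>p s t. (p, s) \<in> S \<Longrightarrow> t \<in> supp (SD m p s :: _ \<Rightarrow> 'k) \<Longrightarrow> \<exists>U\<in>?C. t ` standard_simplex p \<subseteq> U"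
    show ?thesis
    proof (rule that[of m])
      fix p s t assume s: "(p, s) \<in> S" and t: "t \<in> supp (SD m p s :: _ \<Rightarrow> 'k)"
      have "fchain p (top_of_set (polyhedron_of K)) (SD m p s :: _ \<Rightarrow> 'k)" by (rule fchain_SD[OF assms(2)[OF s]])
      then have "singular_simplex p (top_of_set (polyhedron_of K)) t" using t by (simp add: fchain_iff)
      moreover obtain U where "U \<in> ?C" "t ` standard_simplex p \<subseteq> U" using m[OF s t] by (elim bexE)
      ultimately show "good K p t" by (elim imageE) (simp add: goodI)
    qed
  next
    show "openin (top_of_set (polyhedron_of K)) U" if "U \<in> ?C" for U by (rule op[OF that])
    show "topspace (top_of_set (polyhedron_of K)) \<subseteq> \<Union> ?C" by (rule cov)
    show "finite S" by (rule assms(1))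
    show "singular_simplex p (top_of_set (polyhedron_of K)) s" if "(p, s) \<in> S" for p s by (rule assms(2)[OF that])
  qed
qed

text \<open>The order serves as orientation: each simplex is a chain and has exactly one strictly
  increasing list. The empty simplex is included for the augmentation.\<close>

locale spx =
  fixes K :: "'v::{finite,order} set set"
  assumes down: "\<sigma> \<in> K \<Longrightarrow> \<tau> \<subseteq> \<sigma> \<Longrightarrow> \<tau> \<in> K" and emp: "{} \<in> K"
    and chain: "\<sigma> \<in> K \<Longrightarrow> v \<in> \<sigma> \<Longrightarrow> w \<in> \<sigma> \<Longrightarrow> v \<le> w \<or> w \<le> v"
begin

abbreviation "Pol \<equiv> top_of_set (polyhedron_of K)"

definition Ls :: "'v list set" where "Ls = {l. set l \<in> K \<and> sorted_wrt (<) l}"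

lemma face_Pol: "\<sigma> \<in> K \<Longrightarrow> face_of_simplex \<sigma> \<subseteq> polyhedron_of K"
  by (auto simp: face_of_simplex_def polyhedron_of_def intro: down)

lemma singular_simplex_mono:
  "singular_simplex p (top_of_set A) s \<Longrightarrow> A \<subseteq> B \<Longrightarrow> singular_simplex p (top_of_set B) s"
  unfolding singular_simplex_top_of_set by (meson subset_trans)

lemma lsx_Pol: "set l \<in> K \<Longrightarrow> length l = Suc p \<Longrightarrow> singular_simplex p Pol (lsx l)"
  by (rule singular_simplex_mono[OF lsx_simplex face_Pol])

lemma Pol_spt: "x \<in> polyhedron_of K \<Longrightarrow> spt x \<in> K \<and> x \<in> face_of_simplex (spt x)"
  by (simp add: polyhedron_of_def face_of_simplex_def)

lemma good_lab: "good K p t \<Longrightarrow> y \<in> standard_simplex p \<Longrightarrow> t y \<in> polyhedron_of K \<and> set (lab p t) \<subseteq> spt (t y)"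
proof -
  assume g: "good K p t" and y: "y \<in> standard_simplex p"
  have "t ` standard_simplex p \<subseteq> polyhedron_of K" using g unfolding good_def singular_simplex_top_of_set by (elim conjE)
  then have "t y \<in> polyhedron_of K" by (rule subsetD) (rule imageI[OF y])
  moreover have "set (lab p t) \<subseteq> spt (t y)" using g y by (simp add: good_def)
  ultimately show ?thesis by (rule conjI)
qed

lemma good_lab_K: "good K p t \<Longrightarrow> set (lab p t) \<in> K"
  by (rule down[OF conjunct1[OF Pol_spt[OF conjunct1[OF good_lab[of p t "ev 0"]]]] conjunct2[OF good_lab[of p t "ev 0"]]]) simp_all

text \<open>The labels belong to the support of \<open>t y\<close>, so the segment from
  \<open>t y\<close> to the affine simplex on the labels stays in the closed face that carries
  \<open>t y\<close>.\<close>

lemma good_prism: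
  assumes g: "good K p t"
  shows "fchain (Suc p) Pol (prism p t (lsx (lab p t)) :: _ \<Rightarrow> 'k::field)"
proof (rule fchain_prism)
  show t: "singular_simplex p Pol t" using g by (simp add: good_def)
  show l: "singular_simplex p (top_of_set (face_of_simplex (set (lab p t)))) (lsx (lab p t))"
    by (rule lsx_simplex) simp
  fix y u :: "_" assume y: "y \<in> standard_simplex p" and u: "0 \<le> u" "u \<le> (1::real)"
  note gy = good_lab[OF g y]
  have k: "spt (t y) \<in> K" "t y \<in> face_of_simplex (spt (t y))" using Pol_spt gy by simp_all
  have "lsx (lab p t) y \<in> face_of_simplex (set (lab p t))" using l y by (auto simp: singular_simplex_top_of_set)
  then have ly: "lsx (lab p t) y \<in> face_of_simplex (spt (t y))" by (rule subsetD[OF face_of_simplex_mono[OF conjunct2[OF gy]]])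
  show "(1 - u) *\<^sub>R t y + u *\<^sub>R lsx (lab p t) y \<in> polyhedron_of K"
    by (rule subsetD[OF face_Pol[OF k(1)] face_of_simplex_convex[OF k(2) ly u]])
qed

lemma Lsub_del: "set l \<in> K \<Longrightarrow> set (del k l) \<in> K"
  by (rule down[OF _ set_del])

lemma sorted_del:
  assumes "sorted_wrt (<) l" shows "sorted_wrt (<) (del k l)"
proof (cases "k < length l")
  case True
  then have "sorted_wrt (<) (take k l @ l ! k # drop (Suc k) l)" using assms by (simp add: id_take_nth_drop[symmetric])
  then show ?thesis by (auto simp: del_def sorted_wrt_append)
qed (use assms in \<open>simp add: del_def\<close>)

lemma chain_least:
  assumes "set l \<in> K" "l \<noteq> []"
  shows "\<exists>v\<in>set l. \<forall>w\<in>set l. v \<le> w"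
proof -
  have "set l \<noteq> {} \<longrightarrow> set l \<in> K \<longrightarrow> (\<exists>v\<in>set l. \<forall>w\<in>set l. v \<le> w)"
  proof (induction l)
    case (Cons a l)
    show ?case
    proof (intro impI)
      assume k: "set (a # l) \<in> K"
      show "\<exists>v\<in>set (a # l). \<forall>w\<in>set (a # l). v \<le> w"
      proof (cases "l = []")
        case False
        then obtain v where v: "v \<in> set l" "\<forall>w\<in>set l. v \<le> w" using Cons.IH down[OF k] by auto
        have "a \<le> v \<or> v \<le> a" by (rule chain[OF k]) (use v in auto)
        then show ?thesis
        proof
          assume "a \<le> v"
          then have "\<forall>w\<in>set (a # l). a \<le> w" using v order_trans by auto
          then show ?thesis by (intro bexI[of _ a]) auto
        next
          assume "v \<le> a"
          then have "\<forall>w\<in>set (a # l). v \<le> w" using v by auto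
          then show ?thesis using v by (intro bexI[of _ v]) auto
        qed
      qed simp
    qed
  qed simp
  then show ?thesis using assms by simp
qed

abbreviation "Tsort \<sigma> \<equiv> {l. set l \<subseteq> \<sigma> \<and> sorted_wrt (<) l}"

lemma cacyc_Tsort: "set l \<in> K \<Longrightarrow> l \<noteq> [] \<Longrightarrow> cacyc TYPE('k::field) (Tsort (set l))"
proof -
  assume l: "set l \<in> K" "l \<noteq> []"
  obtain v where v: "v \<in> set l" "\<forall>w\<in>set l. v \<le> w" by (rule bexE[OF chain_least[OF l]])
  show ?thesis by (rule cone_sorted[OF v(1) bspec[OF v(2)]])
qed

text \<open>Passage from arbitrary lists in a simplex to increasing ones, by acyclic carriers.
  Outside the range where the carriers determine it the map is set to 0, so that all supports are
  finite.\<close>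

lemma retraction_exists:
  obtains r :: "'v list \<Rightarrow> 'v list \<Rightarrow> 'k::field" where "r [] = sgl []" "\<And>l. finite (supp (r l))"
    "\<And>l. set l \<in> K \<Longrightarrow> length l \<le> N \<Longrightarrow> r l \<in> chn (Tsort (set l)) (length l)"
    "\<And>l. set l \<in> K \<Longrightarrow> length l \<le> N \<Longrightarrow> lext ldel (r l) = lext r (ldel l)"
proof -
  let ?L = "{l. set l \<in> K}"
  have "\<exists>D. D [] = sgl [] \<and> (\<forall>l\<in>?L. length l \<le> N \<longrightarrow> D l \<in> chn (Tsort (set l)) (length l + 0) \<and>
      lext ldel (D l) = (\<lambda>_. 0 :: _ \<Rightarrow> 'k) l + scl 1 (lext D (ldel l)))"
  proof (rule extend_carrier[where L = ?L and T = Tsort and u = "\<lambda>_. 0" and \<delta> = 0 and \<epsilon> = 1 and dz = "sgl []" and N = N])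
    show "del k l \<in> ?L" if "l \<in> ?L" "k < length l" for l k using that Lsub_del by simp
    show "Tsort \<sigma> \<subseteq> Tsort \<tau>" if "\<sigma> \<subseteq> \<tau>" for \<sigma> \<tau> :: "'v set" using that by auto
    show "cacyc TYPE('k) (Tsort (set l))" if "l \<in> ?L" "l \<noteq> []" for l using that cacyc_Tsort by simp
    show "(0 :: _ \<Rightarrow> 'k) \<in> chn (Tsort (set l)) (m + 0)" for l m by (rule lsub_0[OF lsub_chn])
    show "(sgl [] :: _ \<Rightarrow> 'k) \<in> chn (Tsort {}) 0" using chn_sgl[of "[]" "Tsort {}"] by simp
  qed simp_all
  then obtain D where D: "D [] = (sgl [] :: _ \<Rightarrow> 'k)" "\<And>l. set l \<in> K \<Longrightarrow> length l \<le> N \<Longrightarrow> D l \<in> chn (Tsort (set l)) (length l)"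
    "\<And>l. set l \<in> K \<Longrightarrow> length l \<le> N \<Longrightarrow> lext ldel (D l) = lext D (ldel l)"
    by auto
  define r where "r l = (if set l \<in> K \<and> length l \<le> N then D l else 0)" for l
  show ?thesis
  proof (rule that[of r])
    show "r [] = sgl []" by (simp add: r_def D(1) emp)
    show "finite (supp (r l))" for l using D(2)[of l] by (auto simp: r_def chn_fin)
    fix l assume l: "set l \<in> K" "length l \<le> N"
    show "r l \<in> chn (Tsort (set l)) (length l)" using D(2)[OF l] l by (simp add: r_def)
    have "lext r (ldel l) = lext D (ldel l)"
    proof (rule lext_cong)
      fix b assume "b \<in> supp (ldel l :: _ \<Rightarrow> 'k)"
      then have "set b \<subseteq> set l" "Suc (length b) = length l" using ldel_supp_set by blast+
      then show "r b = D b" using l down[of "set l" "set b"] by (simp add: r_def)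
    qed
    then show "lext ldel (r l) = lext r (ldel l)" using D(3)[OF l] l by (simp add: r_def)
  qed
qed

end

text \<open>Fixes a retraction \<open>r\<close> onto sorted lists, valid up to length
  \<open>N\<close>, and a number \<open>m\<close> of subdivisions. The number is a parameter because
  it depends on the finitely many singular simplices at hand.\<close>

locale retr = spx K for K :: "'v::{finite,order} set set" +
  fixes r :: "'v list \<Rightarrow> 'v list \<Rightarrow> 'k::field" and N m :: nat
  assumes r_Nil: "r [] = sgl []" and r_fin [simp]: "finite (supp (r l))"
    and r_chn: "set l \<in> K \<Longrightarrow> length l \<le> N \<Longrightarrow> r l \<in> chn (Tsort (set l)) (length l)"
    and r_ldel: "set l \<in> K \<Longrightarrow> length l \<le> N \<Longrightarrow> lext ldel (r l) = lext r (ldel l)"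
begin

text \<open>From singular to simplicial chains: subdivide \<open>m\<close> times, take labels, sort.
  Compatibility with the boundary is available only where the subdivision is good.\<close>

definition q :: "nat \<Rightarrow> ((nat \<Rightarrow> real) \<Rightarrow> (real, 'v) vec) \<Rightarrow> 'v list \<Rightarrow> 'k" where
  "q p s = lext r (lext (psi p) (SD m p s))"

definition gd :: "nat \<Rightarrow> ((nat \<Rightarrow> real) \<Rightarrow> (real, 'v) vec) \<Rightarrow> bool" where
  "gd p s \<longleftrightarrow> singular_simplex p Pol s \<and> (\<forall>t\<in>supp (SD m p s :: _ \<Rightarrow> 'k). good K p t)"

lemma q_fin [simp]: "finite (supp (q p s))"
  by (simp add: q_def)

lemma lext_q:
  assumes "finite (supp c)"
  shows "lext (q p) c = lext r (lext (psi p) (lext (SD m p) c))"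
proof -
  have "lext r (lext (psi p) (lext (SD m p) c)) = lext r (lext (\<lambda>s. lext (psi p) (SD m p s)) c)"
    using assms by (simp add: lext_lext)
  also have "\<dots> = lext (q p) c" unfolding q_def by (rule lext_lext[OF assms]) simp
  finally show ?thesis by (rule sym)
qed

lemma r_chain:
  assumes "c \<in> chn {l. set l \<in> K} n" "n \<le> N"
  shows "lext ldel (lext r c) = lext r (lext ldel c)"
proof -
  have f: "finite (supp c)" by (rule chn_fin[OF assms(1)])
  have "lext ldel (lext r c) = lext (\<lambda>l. lext ldel (r l)) c" by (rule lext_lext[OF f]) simp
  also have "\<dots> = lext (\<lambda>l. lext r (ldel l)) c"
    by (rule lext_cong) (use chn_mem[OF assms(1)] assms(2) in \<open>auto simp: r_ldel\<close>)
  also have "\<dots> = lext r (lext ldel c)" by (rule lext_lext[OF f, symmetric]) simp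
  finally show ?thesis .
qed

lemma psi_SD_chn:
  assumes "gd p s"
  shows "(lext (psi p) (SD m p s) :: _ \<Rightarrow> 'k) \<in> chn {l. set l \<in> K} (Suc p)"
proof (rule lext_chn)
  fix t assume "t \<in> supp (SD m p s :: _ \<Rightarrow> 'k)"
  then have "set (lab p t) \<in> K" using assms good_lab_K by (simp add: gd_def)
  then show "(psi p t :: _ \<Rightarrow> 'k) \<in> chn {l. set l \<in> K} (Suc p)"
    using chn_sgl[of "lab p t" "{l. set l \<in> K}", where ?'b = 'k] by (simp add: psi_def)
qed simp

lemma q_ldel:
  assumes "gd (Suc p) s" "Suc (Suc p) \<le> N"
  shows "lext ldel (q (Suc p) s) = lext (q p) (sbd (Suc p) s)"
proof -
  have s: "singular_simplex (Suc p) Pol s" using assms by (simp add: gd_def)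
  have "lext ldel (q (Suc p) s) = lext r (lext ldel (lext (psi (Suc p)) (SD m (Suc p) s)))"
    unfolding q_def by (rule r_chain[OF psi_SD_chn[OF assms(1)] assms(2)])
  also have "\<dots> = lext (q p) (sbd (Suc p) s)"
    by (simp add: psi_chain SD_boundary[OF s] lext_q)
  finally show ?thesis .
qed

lemma q_ldel_0:
  assumes "gd 0 s" "1 \<le> N"
  shows "lext ldel (q 0 s) = sgl []"
proof -
  have s: "singular_simplex 0 Pol s" using assms by (simp add: gd_def)
  have "lext ldel (q 0 s) = lext r (lext ldel (lext (psi 0) (SD m 0 s)))"
    unfolding q_def by (rule r_chain[OF psi_SD_chn[OF assms(1)]]) (use assms(2) in simp)
  also have "\<dots> = sgl []"
    by (subst psi_chain_0) (simp_all add: SD_0[OF s] r_Nil)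
  finally show ?thesis .
qed

text \<open>Subdivision stays inside a face, and so do the labels. A simplex in the face
  \<open>\<sigma>\<close> is therefore sent to sorted lists in \<open>\<sigma>\<close>, as the
  carrier argument requires.\<close>

lemma q_chn:
  assumes g: "gd p s" and s: "singular_simplex p (top_of_set (face_of_simplex \<sigma>)) s" and n: "Suc p \<le> N"
  shows "q p s \<in> chn (Tsort \<sigma>) (Suc p)"
  unfolding q_def
proof (rule lext_chn)
  show "finite (supp (lext (psi p) (SD m p s) :: _ \<Rightarrow> 'k))" by simp
  fix w assume "w \<in> supp (lext (psi p) (SD m p s) :: _ \<Rightarrow> 'k)"
  then obtain t where t: "t \<in> supp (SD m p s :: _ \<Rightarrow> 'k)" "w \<in> supp (psi p t :: _ \<Rightarrow> 'k)" using supp_lext by fastforce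
  then have w: "w = lab p t" by (simp add: psi_def)
  have gt: "good K p t" using g t by (simp add: gd_def)
  have "singular_simplex p (top_of_set (face_of_simplex \<sigma>)) t"
    using fchain_SD[OF s, where 'b = 'k and m = m] t by (simp add: fchain_iff)
  then have "t (ev 0) \<in> face_of_simplex \<sigma>" by (auto simp: singular_simplex_top_of_set)
  then have "set w \<subseteq> \<sigma>" using good_lab[OF gt, of "ev 0"] unfolding w by (auto simp: face_of_simplex_def)
  moreover have "set w \<in> K" unfolding w by (rule good_lab_K[OF gt])
  then have "r w \<in> chn (Tsort (set w)) (Suc p)" using r_chn[of w] n by (simp add: w)
  ultimately show "r w \<in> chn (Tsort \<sigma>) (Suc p)" by (elim chn_mono) auto
qed

lemma Tsort_Ls: "\<sigma> \<in> K \<Longrightarrow> Tsort \<sigma> \<subseteq> Ls"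
  by (auto simp: Ls_def intro: down)

lemma q_Ls: "gd p s \<Longrightarrow> Suc p \<le> N \<Longrightarrow> q p s \<in> chn Ls (Suc p)"
  unfolding q_def
proof (rule lext_chn)
  assume g: "gd p s" and n: "Suc p \<le> N"
  fix w assume "w \<in> supp (lext (psi p) (SD m p s) :: _ \<Rightarrow> 'k)"
  then have w: "set w \<in> K" "length w = Suc p" using chn_mem[OF psi_SD_chn[OF g]] by auto
  then have "r w \<in> chn (Tsort (set w)) (Suc p)" using r_chn[of w] n by simp
  then show "r w \<in> chn Ls (Suc p)" by (rule chn_mono) (rule Tsort_Ls[OF w(1)])
qed simp

lemma Phi_lsx_supp:
  assumes "z \<in> chn Ls (Suc i)"
  shows "fchain i Pol (lext Phi z :: _ \<Rightarrow> 'k)"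
proof (rule fchain_lext[OF chn_fin[OF assms]])
  fix l assume "l \<in> supp z"
  then have "l \<in> Ls" "length l = Suc i" using chn_mem[OF assms] by auto
  then show "fchain i Pol (Phi l :: _ \<Rightarrow> 'k)" unfolding Phi_def by (intro fchain_sgl lsx_Pol) (auto simp: Ls_def)
qed

text \<open>If the realization of a cycle bounds, subdivide the bounding chain until it can be pushed back
  to the complex.\<close>

lemma injective:
  fixes z :: "'v list \<Rightarrow> 'k" and d :: "((nat \<Rightarrow> real) \<Rightarrow> (real, 'v) vec) \<Rightarrow> 'k"
  assumes z: "z \<in> chn Ls (Suc i)" "lext ldel z = 0" and d: "fchain (Suc i) Pol d" "lext Phi z = lext (sbd (Suc i)) d"
    and gd_d: "\<And>s. s \<in> supp d \<Longrightarrow> gd (Suc i) s"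
    and gd_l: "\<And>l p. set l \<in> K \<Longrightarrow> length l = Suc p \<Longrightarrow> p \<le> i \<Longrightarrow> gd p (lsx l)"
    and N: "N = Suc (Suc i)"
  shows "\<exists>e\<in>chn Ls (Suc (Suc i)). z = lext ldel e"
proof -
  \<comment> \<open>Realize a list, then push it back. The result stays in the sorted lists of the
    same simplex, so this map is homotopic to the identity.\<close>
  define f where "f l = (if l = [] then sgl [] else q (length l - 1) (lsx l))" for l
  let ?L = "{l \<in> Ls. length l \<le> Suc i}"
  have z': "z \<in> chn ?L (Suc i)" using z(1) by (auto simp: chn_def)
  have fd: "finite (supp d)" using d by (simp add: fchain_iff)
  have fl: "f l = q p (lsx l)" if "length l = Suc p" for l p using that by (auto simp: f_def)
  have "\<exists>e. finite (supp e) \<and> (\<forall>w\<in>supp e. length w = Suc (Suc i) \<and> (\<exists>l\<in>?L. w \<in> Tsort (set l))) \<and> lext f z - z = lext ldel e"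
  proof (rule carrier_homotopic_id[where T = Tsort and f = f, OF _ _ _ _ _ _ _ z' z(2)])
    show "del k l \<in> ?L" if "l \<in> ?L" "k < length l" for l k using that Lsub_del sorted_del by (auto simp: Ls_def length_del)
    show "Tsort \<sigma> \<subseteq> Tsort \<tau>" if "\<sigma> \<subseteq> \<tau>" for \<sigma> \<tau> :: "'v set" using that by auto
    show "l \<in> Tsort (set l)" if "l \<in> ?L" for l using that by (simp add: Ls_def)
    show "cacyc TYPE('k) (Tsort (set l))" if "l \<in> ?L" "l \<noteq> []" for l
      by (rule cacyc_Tsort) (use that in \<open>simp_all add: Ls_def\<close>)
    show "f [] = sgl []" by (simp add: f_def)
    fix l assume l: "l \<in> ?L"
    show "f l \<in> chn (Tsort (set l)) (length l)"
    proof (cases l)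
      case Nil
      then show ?thesis using chn_sgl[of "[]" "Tsort {}", where ?'b = 'k] by (simp add: f_def)
    next
      case (Cons a l')
      define p where "p = length l'"
      have p: "length l = Suc p" "p \<le> i" using Cons l by (simp_all add: p_def)
      have "q p (lsx l) \<in> chn (Tsort (set l)) (Suc p)"
        using l p N by (intro q_chn gd_l lsx_simplex) (simp_all add: Ls_def)
      then show ?thesis using p fl by simp
    qed
    show "lext ldel (f l) = lext f (ldel l)"
    proof (cases "length l")
      case 0
      then show ?thesis by (simp add: f_def)
    next
      case (Suc p)
      have g: "gd p (lsx l)" using l Suc by (intro gd_l) (simp_all add: Ls_def)
      show ?thesis
      proof (cases p)
        case 0
        then obtain a where "l = [a]" using Suc by (auto simp: length_Suc_conv)
        then have "lext f (ldel l) = sgl []" by (simp add: ldel_Cons f_def)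
        then show ?thesis using q_ldel_0 g N fl[OF Suc] 0 by simp
      next
        case (Suc p')
        have ll: "length l = Suc (Suc p')" using Suc \<open>length l = Suc p\<close> by simp
        have "lext f (ldel l) = lext (\<lambda>b. lext (q p') (Phi b)) (ldel l)"
        proof (rule lext_cong)
          fix b assume "b \<in> supp (ldel l :: _ \<Rightarrow> 'k)"
          then have "length b = Suc p'" using ldel_supp_set[of b l] ll by fastforce
          then show "f b = lext (q p') (Phi b)" by (simp add: fl Phi_def)
        qed
        also have "\<dots> = lext (q p') (lext Phi (ldel l))" by (rule lext_lext[symmetric]) simp_all
        also have "\<dots> = lext ldel (q (Suc p') (lsx l))"
          unfolding Phi_ldel[OF ll] by (rule q_ldel[symmetric]) (use g Suc l ll N in simp_all)
        finally show ?thesis using fl[OF ll] by simp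
      qed
    qed
  qed
  then obtain e where e: "finite (supp e)" "\<And>w. w \<in> supp e \<Longrightarrow> length w = Suc (Suc i) \<and> (\<exists>l\<in>?L. w \<in> Tsort (set l))"
    "lext f z - z = lext ldel e" by (elim exE conjE) (rule that, assumption, erule bspec, assumption+)
  have ec: "e \<in> chn Ls (Suc (Suc i))"
  proof (rule chnI[OF e(1)])
    fix w assume "w \<in> supp e"
    from e(2)[OF this] obtain l where "length w = Suc (Suc i)" "l \<in> ?L" "w \<in> Tsort (set l)" by (elim conjE bexE)
    then show "w \<in> Ls \<and> length w = Suc (Suc i)" using Tsort_Ls[of "set l"] by (auto simp: Ls_def)
  qed
  \<comment> \<open>The realization of \<open>z\<close> is the boundary of \<open>d\<close>, so
    pushing it back gives the boundary of \<open>lext (q (Suc i)) d\<close>.\<close>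
  have "lext f z = lext (\<lambda>l. lext (q i) (Phi l)) z"
    by (rule lext_cong) (use chn_mem[OF z(1)] in \<open>auto simp: fl Phi_def\<close>)
  also have "\<dots> = lext (q i) (lext Phi z)" by (rule lext_lext[symmetric]) (use chn_fin[OF z(1)] in simp_all)
  also have "\<dots> = lext (\<lambda>s. lext (q i) (sbd (Suc i) s)) d" unfolding d(2) by (rule lext_lext[OF fd]) simp
  also have "\<dots> = lext (\<lambda>s. lext ldel (q (Suc i) s)) d" by (rule lext_cong) (use q_ldel[OF gd_d] N in simp)
  also have "\<dots> = lext ldel (lext (q (Suc i)) d)" by (rule lext_lext[OF fd, symmetric]) simp
  finally have "z = lext ldel (lext (q (Suc i)) d - e)"
    using e(3) e(1) fd by (subst lext_diff) (simp_all add: algebra_simps)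
  moreover have "lext (q (Suc i)) d - e \<in> chn Ls (Suc (Suc i))"
    by (intro lsub_diff[OF lsub_chn] ec lext_chn[OF fd] q_Ls gd_d) (use N in simp_all)
  ultimately show ?thesis by blast
qed

end

lemma diff_telescope: "- (y - z) - (P - y) - (Q - P) = z - (Q :: 'a::ab_group_add)"
  by (simp add: algebra_simps)

context retr begin

text \<open>Three successive homologies lead from \<open>z'\<close> to a realized simplicial cycle:
  subdivision to \<open>y\<close>, the prism to the affine simplices on the labels, and sorting of
  the labels inside each simplex.\<close>

lemma surjective:
  fixes z' :: "((nat \<Rightarrow> real) \<Rightarrow> (real, 'v) vec) \<Rightarrow> 'k"
  assumes z': "z' \<in> reduced_fcycles i Pol" and g: "\<And>s. s \<in> supp z' \<Longrightarrow> gd i s" and N: "N = Suc (Suc i)"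
  shows "\<exists>z\<in>chn Ls (Suc i). lext ldel z = 0 \<and> z' - lext Phi z \<in> fboundaries i Pol"
proof -
  have fz: "fchain i Pol z'" by (rule fchain_reduced_fcycles[OF z'])
  then have fin: "finite (supp z')" and ss: "\<And>s. s \<in> supp z' \<Longrightarrow> singular_simplex i Pol s" by (simp_all add: fchain_iff)
  define y where "y = lext (SD m i) z'"
  have fy: "finite (supp y)" using fin by (simp add: y_def)
  have good_y: "good K i t" if t: "t \<in> supp y" for t
  proof -
    have "t \<in> (\<Union>s\<in>supp z'. supp (SD m i s :: _ \<Rightarrow> 'k))" 
      by (rule subsetD[OF supp_lext t[unfolded y_def]])
    then obtain s where "s \<in> supp z'" "t \<in> supp (SD m i s :: _ \<Rightarrow> 'k)" by (elim UN_E)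
    then show ?thesis using g by (simp add: gd_def)
  qed
  have fcy: "fchain i Pol y" unfolding y_def by (rule fchain_lext[OF fin]) (rule fchain_SD[OF ss])
  obtain H :: "nat \<Rightarrow> ((nat \<Rightarrow> real) \<Rightarrow> (real, 'v) vec) \<Rightarrow> ((nat \<Rightarrow> real) \<Rightarrow> (real, 'v) vec) \<Rightarrow> 'k" where H:
    "\<And>p X s. singular_simplex p X s \<Longrightarrow> fchain (Suc p) X (H p s)"
    "\<And>X s. singular_simplex 0 X s \<Longrightarrow> lext (sbd (Suc 0)) (H 0 s) = SD m 0 s - sgl s"
    "\<And>p X s. singular_simplex (Suc p) X s \<Longrightarrow>
       lext (sbd (Suc (Suc p))) (H (Suc p) s) + lext (H p) (sbd (Suc p) s) = SD m (Suc p) s - sgl s"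
  proof (rule SD_homotopy[where m = m and 'a = "(real, 'v) vec" and 'k = 'k])
    fix H :: "nat \<Rightarrow> ((nat \<Rightarrow> real) \<Rightarrow> (real, 'v) vec) \<Rightarrow> ((nat \<Rightarrow> real) \<Rightarrow> (real, 'v) vec) \<Rightarrow> 'k"
    assume "\<And>p X s. singular_simplex p X s \<Longrightarrow> fchain (Suc p) X (H p s)"
      "\<And>X s. singular_simplex 0 X s \<Longrightarrow> lext (sbd (Suc 0)) (H 0 s) = SD m 0 s - sgl s"
      "\<And>p X s. singular_simplex (Suc p) X s \<Longrightarrow>
         lext (sbd (Suc (Suc p))) (H (Suc p) s) + lext (H p) (sbd (Suc p) s) = SD m (Suc p) s - sgl s"
    then show thesis by (rule that[of H])
  qed
  have cy: "y \<in> reduced_fcycles i Pol \<and> y - z' \<in> fboundaries i Pol"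
  proof (cases i)
    case 0
    have "y = lext sgl z'" unfolding y_def 
    proof (rule lext_cong)
      fix s assume "s \<in> supp z'"
      then have "singular_simplex 0 Pol s" using ss 0 by simp
      then show "SD m i s = (sgl s :: _ \<Rightarrow> 'k)" unfolding 0 by (rule SD_0)
    qed
    then have "y = z'" using fin by (simp add: lext_sgl_id)
    then show ?thesis using z' lsub_0[OF lsub_fboundaries] by simp
  next
    case (Suc p)
    have z0: "lext (sbd (Suc p)) z' = 0" using z' Suc by (simp add: reduced_fcycles_Suc)
    have "lext (sbd (Suc p)) y = lext (\<lambda>s. lext (sbd (Suc p)) (SD m (Suc p) s)) z'"
      unfolding y_def Suc by (rule lext_lext[OF fin]) simp
    also have "\<dots> = lext (\<lambda>s. lext (SD m p) (sbd (Suc p) s)) z'"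
      
    proof (rule lext_cong)
      fix s assume "s \<in> supp z'"
      then have "singular_simplex (Suc p) Pol s" using ss Suc by simp
      then show "lext (sbd (Suc p)) (SD m (Suc p) s) = lext (SD m p) (sbd (Suc p) s :: _ \<Rightarrow> 'k)" by (rule SD_boundary)
    qed
    also have "\<dots> = lext (SD m p) (lext (sbd (Suc p)) z')" by (rule lext_lext[OF fin, symmetric]) simp
    finally have 1: "y \<in> reduced_fcycles i Pol" using fcy Suc z0 by (simp add: reduced_fcycles_Suc)
    have fH: "fchain (Suc i) Pol (H i s)" if "s \<in> supp z'" for s by (rule H(1)[OF ss[OF that]])
    have "lext (sbd (Suc i)) (lext (H i) z') = lext (\<lambda>s. lext (sbd (Suc i)) (H i s)) z'"
      by (rule lext_lext[OF fin]) (use fH in \<open>simp add: fchain_iff\<close>)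
    also have "\<dots> = lext (\<lambda>s. (SD m i s - sgl s) - lext (H p) (sbd (Suc p) s)) z'"
      
    proof (rule lext_cong)
      fix s assume "s \<in> supp z'"
      then have "singular_simplex (Suc p) Pol s" using ss Suc by simp
      from H(3)[OF this] show "lext (sbd (Suc i)) (H i s) = (SD m i s - sgl s) - lext (H p) (sbd (Suc p) s)"
        unfolding Suc by (simp only: eq_diff_eq)
    qed
    also have "\<dots> = (y - z') - lext (\<lambda>s. lext (H p) (sbd (Suc p) s)) z'"
      by (simp add: lext_fun_diff lext_sgl_id[OF fin] y_def)
    also have "lext (\<lambda>s. lext (H p) (sbd (Suc p) s)) z' = lext (H p) (lext (sbd (Suc p)) z')"
      by (rule lext_lext[OF fin, symmetric]) simp
    finally have "lext (sbd (Suc i)) (lext (H i) z') = y - z'" by (simp only: z0 lext_0 diff_zero)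
    then have "y - z' \<in> fboundaries i Pol" using fboundariesI[OF fchain_lext[of z' "Suc i" Pol "H i", OF fin fH]] by (simp only:)
    then show ?thesis using 1 by simp
  qed
  define c where "c = lext (psi i) y"
  have b2: "lext Phi c - y \<in> fboundaries i Pol"
  proof -
    let ?P = "\<lambda>p t. prism p t (lsx (lab p t)) :: _ \<Rightarrow> 'k"
    have fP: "fchain (Suc i) Pol (lext (?P i) y)" by (rule fchain_lext[OF fy]) (rule good_prism[OF good_y])
    have ext: "t \<in> extensional (standard_simplex i)" if "t \<in> supp y" for t
      using good_y[OF that] unfolding good_def singular_simplex_top_of_set by simp
    have "lext Phi c = lext (\<lambda>t. lext Phi (psi i t)) y" unfolding c_def by (rule lext_lext[OF fy]) simp
    then have Pc: "lext Phi c = lext (\<lambda>t. sgl (lsx (lab i t))) y" by (simp only: psi_def lext_sgl Phi_def)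
    have "lext (sbd (Suc i)) (lext (?P i) y) = lext (\<lambda>t. lext (sbd (Suc i)) (?P i t)) y"
      by (rule lext_lext[OF fy]) simp
    also have "\<dots> = lext Phi c - y"
    proof (cases i)
      case 0
      have "lext (\<lambda>t. lext (sbd (Suc i)) (?P i t)) y = lext (\<lambda>t. sgl (lsx (lab i t)) - sgl t) y"
        by (rule lext_cong) (use 0 ext in \<open>simp add: prism_boundary_0 lsx_def\<close>)
      then show ?thesis by (simp only: Pc lext_fun_diff lext_sgl_id[OF fy])
    next
      case (Suc p)
      have "lext (\<lambda>t. lext (sbd (Suc i)) (?P i t)) y = lext (\<lambda>t. sgl (lsx (lab i t)) - sgl t - lext (?P p) (sbd (Suc p) t)) y"
        by (rule lext_cong) (use Suc ext in \<open>simp add: prism_lab_boundary\<close>)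
      also have "\<dots> = lext Phi c - y - lext (\<lambda>t. lext (?P p) (sbd (Suc p) t)) y"
        by (simp only: Pc lext_fun_diff lext_sgl_id[OF fy])
      also have "lext (\<lambda>t. lext (?P p) (sbd (Suc p) t)) y = lext (?P p) (lext (sbd (Suc p)) y)"
        by (rule lext_lext[OF fy, symmetric]) simp
      also have "lext (sbd (Suc p)) y = 0" using cy Suc by (simp add: reduced_fcycles_Suc)
      finally show ?thesis by (simp only: lext_0 diff_zero)
    qed
    finally show ?thesis using fboundariesI[OF fP] by (simp only:)
  qed
  have cc: "c \<in> chn {l. set l \<in> K} (Suc i)"
    unfolding c_def
  proof (rule lext_chn[OF fy])
    fix t assume "t \<in> supp y"
    then have "set (lab i t) \<in> K" using good_lab_K[OF good_y] by simp
    then show "(psi i t :: _ \<Rightarrow> 'k) \<in> chn {l. set l \<in> K} (Suc i)"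
      using chn_sgl[of "lab i t" "{l. set l \<in> K}", where ?'b = 'k] by (simp add: psi_def)
  qed
  have c0: "lext ldel c = 0"
  proof (cases i)
    case 0
    have "lext ldel c = (lext (\<lambda>_. sgl []) y :: 'v list \<Rightarrow> 'k)" unfolding c_def 0 by (rule psi_chain_0[OF fy])
    then show ?thesis using cy 0 by (simp add: reduced_fcycles_0[where 'a = 'v])
  next
    case (Suc p)
    have "lext ldel c = lext (psi p) (lext (sbd (Suc p)) y)" unfolding c_def Suc by (rule psi_chain[OF fy])
    then show ?thesis using cy Suc by (simp add: reduced_fcycles_Suc)
  qed
  define z where "z = lext r c"
  have zc: "z \<in> chn Ls (Suc i)"
    unfolding z_def
  proof (rule lext_chn[OF chn_fin[OF cc]])
    fix l assume "l \<in> supp c"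
    then have l: "set l \<in> K" "length l = Suc i" using chn_mem[OF cc] by auto
    then have "r l \<in> chn (Tsort (set l)) (Suc i)" using r_chn[of l] N by simp
    then show "r l \<in> chn Ls (Suc i)" by (rule chn_mono) (rule Tsort_Ls[OF l(1)])
  qed
  have z0: "lext ldel z = 0" unfolding z_def using r_chain[OF cc] N c0 by simp
  \<comment> \<open>The lists in \<open>c\<close> need not be sorted, so the identity is not carried
    by sorted lists; the larger carrier of all lists in a simplex is acyclic as well.\<close>
  let ?L = "{l. set l \<in> K \<and> length l \<le> N}" and ?T = "\<lambda>\<sigma>. {l :: 'v list. set l \<subseteq> \<sigma>}"
  have cL: "c \<in> chn ?L (Suc i)" using cc N by (auto simp: chn_def)
  have "\<exists>e. finite (supp e) \<and> (\<forall>w\<in>supp e. length w = Suc (Suc i) \<and> (\<exists>l\<in>?L. w \<in> ?T (set l))) \<and> lext r c - c = lext ldel e"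
  proof (rule carrier_homotopic_id[where T = ?T and f = r, OF _ _ _ _ _ _ _ cL c0])
    show "del k l \<in> ?L" if "l \<in> ?L" "k < length l" for l k using that Lsub_del by (auto simp: length_del)
    show "?T \<sigma> \<subseteq> ?T \<tau>" if "\<sigma> \<subseteq> \<tau>" for \<sigma> \<tau> using that by auto
    show "l \<in> ?T (set l)" for l by simp
    show "cacyc TYPE('k) (?T (set l))" if "l \<in> ?L" "l \<noteq> []" for l
      by (rule cone_all[of "hd l"]) (use that in simp)
    show "r [] = sgl []" by (rule r_Nil)
    show "r l \<in> chn (?T (set l)) (length l)" if "l \<in> ?L" for l
      by (rule chn_mono[OF r_chn]) (use that in auto)
    show "lext ldel (r l) = lext r (ldel l)" if "l \<in> ?L" for l
      by (rule r_ldel) (use that in auto)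
  qed
  then obtain e where e: "finite (supp e)" "\<forall>w\<in>supp e. length w = Suc (Suc i) \<and> (\<exists>l\<in>?L. w \<in> ?T (set l))"
    "lext r c - c = lext ldel e" by (elim exE conjE) (rule that, assumption+)
  have el: "set w \<in> K \<and> length w = Suc (Suc i)" if w: "w \<in> supp e" for w
  proof -
    obtain l where "length w = Suc (Suc i)" "l \<in> ?L" "w \<in> ?T (set l)" using bspec[OF e(2) w] by (elim conjE bexE)
    then show ?thesis using down[of "set l" "set w"] by simp
  qed
  have "lext Phi z - lext Phi c = lext Phi (lext ldel e)"
    unfolding e(3)[symmetric] z_def by (rule lext_diff[symmetric]) (use chn_fin[OF cc] in simp_all)
  also have "\<dots> = lext (sbd (Suc i)) (lext Phi e)" by (rule Phi_chain[OF e(1)]) (use el in simp)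
  also have "\<dots> \<in> fboundaries i Pol"
  proof (rule fboundariesI[OF fchain_lext[OF e(1)]])
    fix w assume "w \<in> supp e"
    then show "fchain (Suc i) Pol (Phi w :: _ \<Rightarrow> 'k)" unfolding Phi_def using el by (intro fchain_sgl lsx_Pol) simp_all
  qed
  finally have b3: "lext Phi z - lext Phi c \<in> fboundaries i Pol" .
  have "- (y - z') - (lext Phi c - y) - (lext Phi z - lext Phi c) \<in> fboundaries i Pol"
    by (rule lsub_diff[OF lsub_fboundaries lsub_diff[OF lsub_fboundaries
          lsub_uminus[OF lsub_fboundaries conjunct2[OF cy]] b2] b3])
  moreover have "- (y - z') - (lext Phi c - y) - (lext Phi z - lext Phi c) = z' - lext Phi z"
    by (rule diff_telescope)
  ultimately have "z' - lext Phi z \<in> fboundaries i Pol" by (simp only:)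
  then show ?thesis using zc z0 by blast
qed

end

lemma reduced_homology_dim_iff:
  "reduced_homology_dim TYPE('k::field) X i n \<longleftrightarrow> hdim (reduced_fcycles i X :: (_ \<Rightarrow> 'k) set) (fboundaries i X) n"
proof -
  have 1: "(\<lambda>t. \<Sum>s\<in>S. a s * s t) = (\<Sum>s\<in>S. scl (a s) s)" for S and a :: "(((nat \<Rightarrow> real) \<Rightarrow> 'a) \<Rightarrow> 'k) \<Rightarrow> 'k"
    by (rule ext) (simp add: sum_fun_apply scl_def)
  have 2: "(\<lambda>t. z t - (\<Sum>s\<in>S. a s * s t)) = z - (\<Sum>s\<in>S. scl (a s) s)" for S z and a :: "(((nat \<Rightarrow> real) \<Rightarrow> 'a) \<Rightarrow> 'k) \<Rightarrow> 'k"
    unfolding 1[symmetric] by (rule ext) (simp add: fun_apply)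
  show ?thesis unfolding reduced_homology_dim_def hdim_def 1 2 ..
qed

context spx begin

lemma dd_Ls: "c \<in> chn Ls n \<Longrightarrow> dd ldel Ls c = (lext ldel c :: _ \<Rightarrow> 'k::field)"
proof -
  assume c: "c \<in> chn Ls n"
  have "subcplx (ldel :: _ \<Rightarrow> _ \<Rightarrow> 'k) Ls UNIV"
    by (rule subcplx_ldelI) (auto simp: Ls_def Lsub_del sorted_del)
  then have "dd ldel UNIV c = dd ldel Ls c" by (rule dd_sub[OF _ c])
  then show ?thesis unfolding dd_def[of ldel UNIV] by (simp add: rst_def)
qed

lemma retr_exists:
  obtains r :: "'v list \<Rightarrow> 'v list \<Rightarrow> 'k::field" where "retr K r N"
proof -
  obtain r :: "'v list \<Rightarrow> 'v list \<Rightarrow> 'k" where r: "r [] = sgl []" "\<And>l. finite (supp (r l))"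
    "\<And>l. set l \<in> K \<Longrightarrow> length l \<le> N \<Longrightarrow> r l \<in> chn (Tsort (set l)) (length l)"
    "\<And>l. set l \<in> K \<Longrightarrow> length l \<le> N \<Longrightarrow> lext ldel (r l) = lext r (ldel l)"
    by (rule retraction_exists[where N = N]) (rule that, assumption+)
  show ?thesis by (rule that[of r], unfold_locales) (fact r)+
qed

text \<open>A list of length \<open>Suc i\<close> is a simplex of dimension \<open>i\<close>. The
  isomorphism is induced by \<open>Phi\<close>; the relation asks that \<open>z'\<close> be
  homologous to the realization of \<open>z\<close>.\<close>

theorem simplicial_singular:
  assumes "hd_dim (ldel :: _ \<Rightarrow> _ \<Rightarrow> 'k::field) Ls (Suc i) n"
  shows "reduced_homology_dim TYPE('k) Pol i n"
proof -
  obtain r :: "'v list \<Rightarrow> 'v list \<Rightarrow> 'k" where r: "retr K r (Suc (Suc i))"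
    by (rule retr_exists) (rule that, assumption+)
  let ?B = "fboundaries i Pol :: (_ \<Rightarrow> 'k) set"
  let ?R = "\<lambda>z z'. z \<in> chn Ls (Suc i) \<and> z' - lext Phi z \<in> ?B"
  note sub = lsub_fboundaries[of i Pol, where 'b = 'k]
  have inj: "z \<in> bnd ldel Ls (Suc i)" if z: "z \<in> chn Ls (Suc i)" "lext ldel z = 0" and b: "lext Phi z \<in> ?B" for z
  proof -
    obtain d :: "_ \<Rightarrow> 'k" where d: "fchain (Suc i) Pol d" "lext Phi z = lext (sbd (Suc i)) d"
      using b unfolding fboundaries_eq by blast
    \<comment> \<open>Pushing back has to work for \<open>d\<close> and also for the affine
      simplices up to dimension \<open>i\<close>. Both are finite in number, so one \<open>m\<close>
      serves.\<close>
    let ?A = "{l. set l \<subseteq> UNIV \<and> length l \<le> Suc i} \<inter> {l. set l \<in> K \<and> l \<noteq> []}"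
    let ?S = "Pair (Suc i) ` supp d \<union> (\<lambda>l. (length l - 1, lsx l)) ` ?A"
    have fS: "finite ?S" using d(1) finite_lists_length_le[of "UNIV :: 'v set" "Suc i"] by (simp add: fchain_iff)
    have S: "singular_simplex p Pol s" if "(p, s) \<in> ?S" for p s
      using that
    proof
      assume "(p, s) \<in> Pair (Suc i) ` supp d"
      then show ?thesis using d(1) by (auto simp: fchain_iff)
    next
      assume "(p, s) \<in> (\<lambda>l. (length l - 1, lsx l)) ` ?A"
      then obtain l where "p = length l - 1" "s = lsx l" "l \<in> ?A" by blast
      then show ?thesis using lsx_Pol[of l p] by (cases l) auto
    qed
    obtain m where m: "\<And>p s t. (p, s) \<in> ?S \<Longrightarrow> t \<in> supp (SD m p s :: _ \<Rightarrow> 'k) \<Longrightarrow> good K p t"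
      by (rule SD_good[OF fS, where 'k = 'k]) (rule S, assumption, rule that, assumption)
    interpret retr K r "Suc (Suc i)" m by (rule r)
    have gd: "gd p s" if "(p, s) \<in> ?S" for p s using S[OF that] m[OF that] by (simp add: gd_def)
    have "\<exists>e\<in>chn Ls (Suc (Suc i)). z = lext ldel e"
    proof (rule injective[OF z d])
      show "gd (Suc i) s" if "s \<in> supp d" for s by (rule gd) (use that in simp)
      show "gd p (lsx l)" if "set l \<in> K" "length l = Suc p" "p \<le> i" for l p
        by (rule gd, rule UnI2, rule image_eqI[of _ _ l]) (use that in auto)
    qed simp
    then obtain e where e: "e \<in> chn Ls (Suc (Suc i))" "z = lext ldel e" by (rule bexE)
    show ?thesis unfolding e(2) dd_Ls[OF e(1), symmetric] by (rule bndI[OF e(1)])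
  qed
  have sur: "\<exists>z\<in>chn Ls (Suc i). lext ldel z = 0 \<and> z' - lext Phi z \<in> ?B" if z': "z' \<in> reduced_fcycles i Pol" for z' :: "_ \<Rightarrow> 'k"
  proof -
    have f: "fchain i Pol z'" by (rule fchain_reduced_fcycles[OF z'])
    let ?S = "Pair i ` supp z'"
    have fS: "finite ?S" using f by (simp add: fchain_iff)
    have S: "singular_simplex p Pol s" if "(p, s) \<in> ?S" for p s using that f by (auto simp: fchain_iff)
    obtain m where m: "\<And>p s t. (p, s) \<in> ?S \<Longrightarrow> t \<in> supp (SD m p s :: _ \<Rightarrow> 'k) \<Longrightarrow> good K p t"
      by (rule SD_good[OF fS, where 'k = 'k]) (rule S, assumption, rule that, assumption)
    interpret retr K r "Suc (Suc i)" m by (rule r)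
    show ?thesis
    proof (rule surjective[OF z'])
      show "gd i s" if "s \<in> supp z'" for s
        using S[of i s] m[of i s] that by (simp add: gd_def)
    qed simp
  qed
  have Phi_fchain: "fchain i Pol (lext Phi z)" if "z \<in> chn Ls (Suc i)" for z :: "_ \<Rightarrow> 'k"
    using retr.Phi_lsx_supp[OF r that] .
  have "hdim (cyc ldel Ls (Suc i)) (bnd ldel Ls (Suc i) :: (_ \<Rightarrow> 'k) set) n" by (rule assms)
  then have "hdim (reduced_fcycles i Pol) ?B n"
  proof (rule hdim_rel[where R = ?R])
    fix z assume z: "z \<in> cyc (ldel :: _ \<Rightarrow> _ \<Rightarrow> 'k) Ls (Suc i)"
    then have zc: "z \<in> chn Ls (Suc i)" by (simp add: cycD)
    then have z0: "lext ldel z = 0" using cycD[OF z] dd_Ls[OF zc] by simp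
    have fin: "finite (supp z)" by (rule chn_fin[OF zc])
    have "lext Phi z \<in> reduced_fcycles i Pol"
    proof (cases i)
      case 0
      have "lext (\<lambda>_. sgl []) (lext Phi z) = lext (\<lambda>l. lext (\<lambda>_. sgl []) (Phi l :: _ \<Rightarrow> 'k)) z"
        by (rule lext_lext[OF fin]) simp
      also have "\<dots> = (lext ldel z :: 'v list \<Rightarrow> 'k)"
      proof (rule lext_cong)
        fix l assume "l \<in> supp z"
        then have "length l = 1" using chn_mem[OF zc] 0 by simp
        then obtain a where "l = [a]" by (auto simp: length_Suc_conv)
        then show "lext (\<lambda>_. sgl []) (Phi l :: _ \<Rightarrow> 'k) = (ldel l :: 'v list \<Rightarrow> 'k)" by (simp add: Phi_def ldel_Cons)
      qed
      finally show ?thesis using Phi_fchain[OF zc] z0 0 by (simp add: reduced_fcycles_0[where 'a = 'v])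
    next
      case (Suc p)
      have "lext (sbd (Suc p)) (lext Phi z) = lext Phi (lext ldel z)"
        by (rule Phi_chain[OF fin, symmetric]) (use chn_mem[OF zc] Suc in simp)
      then show ?thesis using Phi_fchain[OF zc] z0 Suc by (simp add: reduced_fcycles_Suc)
    qed
    then show "\<exists>z'\<in>reduced_fcycles i Pol. ?R z z'" using zc lsub_0[OF sub] by (intro bexI[of _ "lext Phi z"]) simp_all
    fix z' assume "?R z z'"
    then have zz: "z' - lext Phi z \<in> ?B" by simp
    have "z \<in> bnd ldel Ls (Suc i) \<longleftrightarrow> lext Phi z \<in> ?B"
    proof
      assume "z \<in> bnd ldel Ls (Suc i)"
      then obtain e where e: "e \<in> chn Ls (Suc (Suc i))" "z = dd ldel Ls e" by (rule bndE)
      have "lext Phi z = lext (sbd (Suc i)) (lext Phi e)"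
        unfolding e(2) dd_Ls[OF e(1)] by (rule Phi_chain[OF chn_fin[OF e(1)]]) (use chn_mem[OF e(1)] in simp)
      then show "lext Phi z \<in> ?B" using fboundariesI[OF retr.Phi_lsx_supp[OF r e(1)]] by simp
    qed (rule inj[OF zc z0])
    also have "\<dots> \<longleftrightarrow> z' \<in> ?B"
    proof
      assume "lext Phi z \<in> ?B"
      from lsub_add[OF sub zz this] show "z' \<in> ?B" by (simp only: diff_add_cancel)
    next
      assume "z' \<in> ?B"
      from lsub_diff[OF sub this zz] show "lext Phi z \<in> ?B" by (simp only: diff_diff_eq2 add_diff_cancel_left')
    qed
    finally show "z \<in> bnd ldel Ls (Suc i) \<longleftrightarrow> z' \<in> ?B" .
  next
    fix z' :: "_ \<Rightarrow> 'k" assume "z' \<in> reduced_fcycles i Pol"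
    from sur[OF this] obtain z where z: "z \<in> chn Ls (Suc i)" "lext ldel z = 0" "z' - lext Phi z \<in> ?B" by (elim bexE conjE)
    then show "\<exists>z\<in>cyc ldel Ls (Suc i). ?R z z'" using dd_Ls[OF z(1)] by (intro bexI[of _ z] cycI) simp_all
  next
    fix a and x x' y y' :: "_ \<Rightarrow> 'k" assume xy: "?R x x'" "?R y y'"
    have "lext Phi (x + scl a y) = lext Phi x + scl a (lext Phi y)"
      using xy chn_fin[of x Ls "Suc i"] chn_fin[of y Ls "Suc i"] by (subst lext_add) (simp_all add: lext_scl)
    then have "x' + scl a y' - lext Phi (x + scl a y) = (x' - lext Phi x) + scl a (y' - lext Phi y)"
      by (simp only: scl_diff algebra_simps)
    moreover have "(x' - lext Phi x) + scl a (y' - lext Phi y) \<in> ?B" by (rule lsub_lin[OF sub]) (use xy in simp_all)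
    moreover have "x + scl a y \<in> chn Ls (Suc i)" by (rule lsub_lin[OF lsub_chn]) (use xy in simp_all)
    ultimately show "?R (x + scl a y) (x' + scl a y')" by (simp only: simp_thms)
  next
    show "?R 0 0" using lsub_0[OF lsub_chn] lsub_0[OF sub] by simp
  qed (rule lsub_cyc lsub_reduced_fcycles lsub_bnd)+
  then show ?thesis by (simp only: reduced_homology_dim_iff)
qed

end

section \<open>Triangulation of the singularity link\<close>

definition psh :: "nat \<Rightarrow> ('a \<Rightarrow> 'b) \<Rightarrow> (((nat \<Rightarrow> real) \<Rightarrow> 'a) \<Rightarrow> 'k::field) \<Rightarrow> ((nat \<Rightarrow> real) \<Rightarrow> 'b) \<Rightarrow> 'k" where
  "psh p f c = lext (\<lambda>s. sgl (simplex_map p f s)) c"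

lemma finite_supp_psh [simp]: "finite (supp c) \<Longrightarrow> finite (supp (psh p f c))"
  by (simp add: psh_def)

lemma face_simplex_map:
  "k \<le> Suc p \<Longrightarrow> singular_face (Suc p) k (simplex_map (Suc p) f s) = simplex_map p f (singular_face (Suc p) k s)"
  by (rule ext) (auto simp: singular_face_def simplex_map_def restrict_def face_simplex)

lemma psh_sbd: "psh p f (sbd (Suc p) s) = (sbd (Suc p) (simplex_map (Suc p) f s) :: _ \<Rightarrow> 'k::field)"
proof -
  have "psh p f (sbd (Suc p) s) = (\<Sum>k<Suc (Suc p). scl ((-1) ^ k) (sgl (simplex_map p f (singular_face (Suc p) k s)) :: _ \<Rightarrow> 'k))"
    unfolding psh_def sbd_def lext_fbd ..
  also have "\<dots> = sbd (Suc p) (simplex_map (Suc p) f s)"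
    unfolding sbd_def fbd_def by (rule sum.cong) (auto simp: face_simplex_map less_Suc_eq_le)
  finally show ?thesis .
qed

lemma psh_chain:
  assumes "finite (supp c)"
  shows "lext (sbd (Suc p)) (psh (Suc p) f c) = psh p f (lext (sbd (Suc p)) c)"
proof -
  have "lext (sbd (Suc p)) (psh (Suc p) f c) = lext (\<lambda>s. lext (sbd (Suc p)) (sgl (simplex_map (Suc p) f s))) c"
    unfolding psh_def by (rule lext_lext[OF assms]) simp
  also have "\<dots> = lext (\<lambda>s. lext (\<lambda>s. sgl (simplex_map p f s)) (sbd (Suc p) s)) c"
    by (simp only: lext_sgl psh_sbd[unfolded psh_def])
  also have "\<dots> = psh p f (lext (sbd (Suc p)) c)"
    unfolding psh_def by (rule lext_lext[OF assms, symmetric]) simp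
  finally show ?thesis .
qed

lemma fchain_psh:
  assumes "continuous_map X Y f" "fchain p X c"
  shows "fchain p Y (psh p f c)"
  unfolding psh_def
proof (rule fchain_lext)
  fix s assume "s \<in> supp c"
  then have "singular_simplex p X s" using assms(2) by (simp add: fchain_iff)
  then show "fchain p Y (sgl (simplex_map p f s) :: _ \<Rightarrow> 'c)"
    by (intro fchain_sgl singular_simplex_simplex_map[OF _ assms(1)])
qed (use assms(2) in \<open>simp add: fchain_iff\<close>)

lemma psh_inverse:
  assumes "\<And>x. x \<in> topspace X \<Longrightarrow> g (f x) = x" "fchain p X c"
  shows "psh p g (psh p f c) = c"
proof -
  have fin: "finite (supp c)" using assms(2) by (simp add: fchain_iff)
  have "psh p g (psh p f c) = lext (\<lambda>s. lext (\<lambda>s. sgl (simplex_map p g s)) (sgl (simplex_map p f s))) c"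
    unfolding psh_def by (rule lext_lext[OF fin]) simp
  also have "\<dots> = lext sgl c"
  proof (rule lext_cong)
    fix s assume "s \<in> supp c"
    then have s: "singular_simplex p X s" using assms(2) by (simp add: fchain_iff)
    have "simplex_map p g (simplex_map p f s) = s"
    proof
      fix y
      show "simplex_map p g (simplex_map p f s) y = s y"
      proof (cases "y \<in> standard_simplex p")
        case True
        then have "s y \<in> topspace X" using s unfolding singular_simplex_def by (auto simp: continuous_map_def Pi_iff)
        then show ?thesis using True assms(1) by (simp add: simplex_map_def)
      next
        case False
        then show ?thesis using s by (simp add: simplex_map_def singular_simplex_def extensional_def)
      qed
    qed
    then show "lext (\<lambda>s. sgl (simplex_map p g s)) (sgl (simplex_map p f s)) = (sgl s :: _ \<Rightarrow> 'c)" by simp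
  qed
  also have "\<dots> = c" by (rule lext_sgl_id[OF fin])
  finally show ?thesis .
qed

lemma psh_cycle:
  assumes "continuous_map X Y f" "c \<in> reduced_fcycles i X"
  shows "psh i f c \<in> reduced_fcycles i Y"
proof -
  have c: "fchain i X c" by (rule fchain_reduced_fcycles[OF assms(2)])
  then have fin: "finite (supp c)" by (simp add: fchain_iff)
  note fc = fchain_psh[OF assms(1) c]
  show ?thesis
  proof (cases i)
    case 0
    have "lext (\<lambda>_. sgl []) (psh i f c) = lext (\<lambda>s. lext (\<lambda>_. sgl []) (sgl (simplex_map i f s))) c"
      unfolding psh_def by (rule lext_lext[OF fin]) simp
    then have "lext (\<lambda>_. sgl []) (psh i f c) = (lext (\<lambda>_. sgl []) c :: nat list \<Rightarrow> 'c)" by simp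
    then show ?thesis using fc assms(2) 0 by (simp add: reduced_fcycles_0[where 'a = nat])
  next
    case (Suc p)
    have "lext (sbd (Suc p)) (psh (Suc p) f c) = psh p f (lext (sbd (Suc p)) c)" by (rule psh_chain[OF fin])
    then show ?thesis using fc assms(2) Suc by (simp add: reduced_fcycles_Suc psh_def)
  qed
qed

lemma psh_boundary:
  assumes "continuous_map X Y f" "c \<in> fboundaries i X"
  shows "psh i f c \<in> fboundaries i Y"
proof -
  obtain d where d: "fchain (Suc i) X d" "c = lext (sbd (Suc i)) d" using assms(2) unfolding fboundaries_eq by blast
  have "psh i f c = lext (sbd (Suc i)) (psh (Suc i) f d)"
    unfolding d(2) by (rule psh_chain[symmetric]) (use d(1) in \<open>simp add: fchain_iff\<close>)
  then show ?thesis using fboundariesI[OF fchain_psh[OF assms(1) d(1)]] by simp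
qed

lemma homeomorphic_reduced_homology:
  assumes h: "homeomorphic_maps X Y f g" and r: "reduced_homology_dim TYPE('k::field) X i n"
  shows "reduced_homology_dim TYPE('k) Y i n"
proof -
  have f: "continuous_map X Y f" and g: "continuous_map Y X g"
    and gf: "\<And>x. x \<in> topspace X \<Longrightarrow> g (f x) = x" and fg: "\<And>y. y \<in> topspace Y \<Longrightarrow> f (g y) = y"
    using h by (auto simp: homeomorphic_maps_def)
  let ?R = "\<lambda>z z'. finite (supp z) \<and> z' = (psh i f z :: _ \<Rightarrow> 'k)"
  have inv: "psh i g (psh i f z) = z" if "z \<in> reduced_fcycles i X" for z :: "_ \<Rightarrow> 'k"
    by (rule psh_inverse[of X g f, OF gf fchain_reduced_fcycles[OF that]])
  have "hdim (reduced_fcycles i Y :: (_ \<Rightarrow> 'k) set) (fboundaries i Y) n"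
    using r unfolding reduced_homology_dim_iff
  proof (rule hdim_rel[where R = ?R])
    fix z :: "_ \<Rightarrow> 'k" assume z: "z \<in> reduced_fcycles i X"
    then have fin: "finite (supp z)" using fchain_reduced_fcycles[OF z] by (simp add: fchain_iff)
    show "\<exists>z'\<in>reduced_fcycles i Y. ?R z z'" using fin psh_cycle[OF f z] by (intro bexI[of _ "psh i f z"]) simp_all
    fix z' assume "?R z z'"
    then have z': "z' = psh i f z" by simp
    show "z \<in> fboundaries i X \<longleftrightarrow> z' \<in> fboundaries i Y"
    proof
      assume "z \<in> fboundaries i X"
      then show "z' \<in> fboundaries i Y" unfolding z' by (rule psh_boundary[OF f])
    next
      assume "z' \<in> fboundaries i Y"
      from psh_boundary[OF g this] show "z \<in> fboundaries i X" unfolding z' inv[OF z] .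
    qed
  next
    fix z' :: "_ \<Rightarrow> 'k" assume z': "z' \<in> reduced_fcycles i Y"
    have "z' = psh i f (psh i g z')" by (rule psh_inverse[of Y f g, OF fg fchain_reduced_fcycles[OF z'], symmetric])
    moreover have "psh i g z' \<in> reduced_fcycles i X" by (rule psh_cycle[OF g z'])
    moreover from this have "finite (supp (psh i g z'))" using fchain_reduced_fcycles[of "psh i g z'"] by (simp add: fchain_iff)
    ultimately show "\<exists>z\<in>reduced_fcycles i X. ?R z z'" by (intro bexI[of _ "psh i g z'"]) simp_all
  next
    fix a and x x' y y' :: "_ \<Rightarrow> 'k" assume xy: "?R x x'" "?R y y'"
    then have "psh i f (x + scl a y) = x' + scl a y'" unfolding psh_def by (subst lext_add) (simp_all add: lext_scl)
    then show "?R (x + scl a y) (x' + scl a y')" using xy by simp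
  next
    show "?R 0 0" by (simp add: psh_def)
  qed (rule lsub_reduced_fcycles lsub_fboundaries)+
  then show ?thesis unfolding reduced_homology_dim_iff .
qed

section \<open>Flags of superlevel sets as coordinates on the link\<close>

lemma compact_face_of_simplex: "compact (face_of_simplex (\<sigma> :: 'v::finite set))"
proof -
  have e: "face_of_simplex \<sigma> = (\<Inter>v\<in>UNIV. {x. 0 \<le> x $ v}) \<inter> {x. (\<Sum>v\<in>UNIV. x $ v) = 1} \<inter> (\<Inter>v\<in>-\<sigma>. {x. x $ v = 0})"
    by (auto simp: face_of_simplex_def spt_def)
  have "closed (face_of_simplex \<sigma>)" unfolding e
    by (intro closed_Int closed_INT ballI closed_Collect_le closed_Collect_eq continuous_intros)
  moreover have "bounded (face_of_simplex \<sigma>)"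
  proof (rule bounded_subset[OF bounded_cbox[of 0 1]], rule subsetI)
    fix x assume x: "x \<in> face_of_simplex \<sigma>"
    have "x $ v \<le> 1" for v
    proof -
      have "x $ v \<le> (\<Sum>v\<in>UNIV. x $ v)" by (rule member_le_sum) (use x in \<open>auto simp: face_of_simplex_def\<close>)
      then show ?thesis using x by (simp add: face_of_simplex_def)
    qed
    then show "x \<in> cbox 0 1" using x by (simp add: mem_box_cart face_of_simplex_def)
  qed
  ultimately show ?thesis by (simp add: compact_eq_bounded_closed)
qed

lemma (in spx) compact_Pol: "compact (polyhedron_of K)"
proof -
  have "polyhedron_of K = (\<Union>\<sigma>\<in>K. face_of_simplex \<sigma>)"
  proof
    show "polyhedron_of K \<subseteq> (\<Union>\<sigma>\<in>K. face_of_simplex \<sigma>)" using Pol_spt by fast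
    show "(\<Union>\<sigma>\<in>K. face_of_simplex \<sigma>) \<subseteq> polyhedron_of K" using face_Pol by fast
  qed
  moreover have "compact (\<Union>\<sigma>\<in>K. face_of_simplex \<sigma>)" by (rule compact_UN) (simp_all add: compact_face_of_simplex)
  ultimately show ?thesis by simp
qed

text \<open>The combination of indicator functions with weights \<open>x\<close>; on a flag, the
  layer-cake form of a function.\<close>

definition hh :: "real ^ 'n set \<Rightarrow> 'n::finite \<Rightarrow> real" where
  "hh x i = (\<Sum>A | i \<in> A. x $ A)"

definition setchain :: "'n set set \<Rightarrow> bool" where
  "setchain \<sigma> \<longleftrightarrow> (\<forall>A\<in>\<sigma>. \<forall>B\<in>\<sigma>. A \<subseteq> B \<or> B \<subseteq> A)"

text \<open>Since the support is a chain, its members that do not contain \<open>A\<close> have a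
  largest one, and a point of \<open>A\<close> outside it attains the minimum.\<close>

lemma hh_Min:
  fixes x :: "real ^ 'n::finite set"
  assumes pos: "\<And>B. 0 \<le> x $ B" and ch: "setchain (spt x)" and A: "A \<noteq> {}"
  shows "(\<Sum>B | A \<subseteq> B. x $ B) = Min (hh x ` A)"
proof (rule sym, rule Min_eqI)
  show "finite (hh x ` A)" by simp
  show "(\<Sum>B | A \<subseteq> B. x $ B) \<le> y" if "y \<in> hh x ` A" for y
    using that by (auto simp: hh_def intro!: sum_mono2 pos)
  let ?S = "{B \<in> spt x. \<not> A \<subseteq> B}"
  have "\<exists>i\<in>A. \<forall>B\<in>?S. i \<notin> B"
  proof (cases "?S = {}")
    case True
    then show ?thesis using A by blast
  next
    case False
    obtain M where M: "M \<in> ?S" "\<forall>B\<in>?S. M \<subseteq> B \<longrightarrow> M = B"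
      using finite_has_maximal[of ?S] False by auto
    then obtain i where i: "i \<in> A" "i \<notin> M" by blast
    have "i \<notin> B" if "B \<in> ?S" for B
    proof -
      have "B \<subseteq> M \<or> M \<subseteq> B" using ch that M(1) by (simp add: setchain_def)
      then have "B \<subseteq> M" using M(2) that by blast
      then show ?thesis using i by blast
    qed
    then show ?thesis using i by blast
  qed
  then obtain i where i: "i \<in> A" "\<And>B. B \<in> spt x \<Longrightarrow> \<not> A \<subseteq> B \<Longrightarrow> i \<notin> B" by blast
  have "hh x i = (\<Sum>B | A \<subseteq> B. x $ B)"
    unfolding hh_def by (rule sum.mono_neutral_right) (use i in \<open>auto simp: spt_def\<close>)
  then show "(\<Sum>B | A \<subseteq> B. x $ B) \<in> hh x ` A" using i(1) by (metis imageI)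
qed

text \<open>The sum of the weights over all supersets of a set is determined by \<open>hh\<close>,
  or by the total weight in case of the empty set. The single weights follow by descending from the
  full set.\<close>

lemma hh_inj:
  fixes x y :: "real ^ 'n::finite set"
  assumes x: "\<And>B. 0 \<le> x $ B" "setchain (spt x)" and y: "\<And>B. 0 \<le> y $ B" "setchain (spt y)"
    and s: "(\<Sum>B\<in>UNIV. x $ B) = (\<Sum>B\<in>UNIV. y $ B)" and h: "hh x = hh y"
  shows "x = y"
proof -
  have up: "(\<Sum>B | A \<subseteq> B. x $ B) = (\<Sum>B | A \<subseteq> B. y $ B)" for A
    using s hh_Min[OF x, of A] hh_Min[OF y, of A] h by (cases "A = {}") simp_all
  have "x $ A = y $ A" for A
  proof (induction "card (- A)" arbitrary: A rule: less_induct)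
    case less
    have "(\<Sum>B | A \<subset> B. x $ B) = (\<Sum>B | A \<subset> B. y $ B)"
    proof (rule sum.cong[OF refl])
      fix B assume "B \<in> {B. A \<subset> B}"
      then have "card (- B) < card (- A)" by (intro psubset_card_mono) auto
      then show "x $ B = y $ B" by (rule less)
    qed
    moreover have "(\<Sum>B | A \<subseteq> B. z $ B) = z $ A + (\<Sum>B | A \<subset> B. z $ B)" for z :: "real ^ 'n set"
    proof -
      have "{B. A \<subseteq> B} = insert A {B. A \<subset> B}" by auto
      then show ?thesis by simp
    qed
    ultimately show ?case using up[of A] by simp
  qed
  then show ?thesis by (simp add: vec_eq_iff)
qed

text \<open>Peels off the smallest positive value of \<open>h\<close> on the set where
  \<open>h\<close> is positive. The weight left at the end goes to the empty set, whose indicator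
  function is 0.\<close>

lemma layer_cake:
  fixes h :: "'n::finite \<Rightarrow> real"
  assumes "\<And>i. 0 \<le> h i" "\<And>i. h i \<le> c" "0 \<le> c"
  shows "\<exists>x :: real ^ 'n set. (\<forall>B. 0 \<le> x $ B) \<and> (\<Sum>B\<in>UNIV. x $ B) = c \<and> hh x = h \<and>
    (\<forall>B\<in>spt x. \<exists>s. 0 < s \<and> s \<le> c \<and> B = {i. s \<le> h i})"
  using assms
proof (induction "card {i. 0 < h i}" arbitrary: h c rule: less_induct)
  case less
  show ?case
  proof (cases "{i. 0 < h i} = {}")
    case True
    then have h0: "h i = 0" for i using less.prems(1)[of i] by (metis (mono_tags) empty_Collect_eq order_le_less)
    have "hh (axis {} c :: real ^ 'n set) = h"
      by (rule ext) (auto simp: hh_def axis_def h0 intro!: sum.neutral)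
    moreover have "\<exists>s. 0 < s \<and> s \<le> c \<and> B = {i. s \<le> h i}" if "B \<in> spt (axis {} c :: real ^ 'n set)" for B
    proof -
      have "B = {}" "c \<noteq> 0" using that by (auto simp: spt_def axis_def split: if_splits)
      then show ?thesis using less.prems(3) h0 by (intro exI[of _ c]) auto
    qed
    ultimately show ?thesis using less.prems(3)
      by (intro exI[of _ "axis {} c"]) (auto simp: axis_def)
  next
    case False
    define A where "A = {i. 0 < h i}"
    define m where "m = Min (h ` A)"
    have A: "finite (h ` A)" "h ` A \<noteq> {}" using False by (auto simp: A_def)
    have "m \<in> h ` A" unfolding m_def by (rule Min_in[OF A])
    then obtain a where a: "0 < h a" "m = h a" by (auto simp: A_def)
    have mle: "m \<le> h i" if "i \<in> A" for i unfolding m_def using that A by (intro Min_le) auto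
    define h' where "h' i = (if i \<in> A then h i - m else 0)" for i
    have "{i. 0 < h' i} \<subset> {i. 0 < h i}" using a by (auto simp: h'_def A_def split: if_splits)
    then have cd: "card {i. 0 < h' i} < card {i. 0 < h i}" by (intro psubset_card_mono) auto
    have mc: "m \<le> c" using a less.prems(2) by simp
    have "\<And>i. 0 \<le> h' i" "\<And>i. h' i \<le> c - m" "0 \<le> c - m" using mle less.prems mc by (auto simp: h'_def)
    from less.hyps[OF cd this] obtain x :: "real ^ 'n set" where x: "\<forall>B. 0 \<le> x $ B" "(\<Sum>B\<in>UNIV. x $ B) = c - m" "hh x = h'"
      "\<forall>B\<in>spt x. \<exists>s. 0 < s \<and> s \<le> c - m \<and> B = {i. s \<le> h' i}" by (elim exE conjE)
    let ?x = "x + axis A m"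
    have "\<forall>B. 0 \<le> ?x $ B" using x(1) a by (auto simp: axis_def)
    moreover have "(\<Sum>B\<in>UNIV. ?x $ B) = c" using x(2) by (simp add: sum.distrib axis_def)
    moreover have "hh ?x = h"
    proof
      fix i
      have "hh ?x i = hh x i + (\<Sum>B | i \<in> B. axis A m $ B)" by (simp add: hh_def sum.distrib)
      also have "(\<Sum>B | i \<in> B. axis A m $ B) = (if i \<in> A then m else 0)" by (simp add: axis_def sum.delta)
      also have "hh x i + (if i \<in> A then m else 0) = h i" using x(3) less.prems(1)[of i] by (auto simp: h'_def A_def)
      finally show "hh ?x i = h i" .
    qed
    moreover have "\<exists>s. 0 < s \<and> s \<le> c \<and> B = {i. s \<le> h i}" if "B \<in> spt ?x" for B
    proof (cases "B = A")
      case True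
      have "A = {i. m \<le> h i}" using mle a by (auto simp: A_def)
      then show ?thesis using True a mc by blast
    next
      case False
      then have "B \<in> spt x" using that by (simp add: spt_def axis_def)
      then obtain s where s: "0 < s" "s \<le> c - m" "B = {i. s \<le> h' i}" using x(4) by (elim ballE exE conjE) auto
      have "{i. s \<le> h' i} = {i. s + m \<le> h i}" using s(1) a by (auto simp: h'_def A_def)
      then show ?thesis using s a by (intro exI[of _ "s + m"]) auto
    qed
    ultimately show ?thesis by blast
  qed
qed

text \<open>The chains of subsets triangulating the singularity link: a unit vector corresponds to the flag
  of its superlevel sets, so the empty set and the ground set do not occur together, and a coordinate is
  constant on the complement of a facet iff no member of the flag splits this complement.\<close>

definition Kc :: "'n::finite set set \<Rightarrow> 'n set set set" where
  "Kc D = {\<sigma>. setchain \<sigma> \<and> \<not> ({} \<in> \<sigma> \<and> UNIV \<in> \<sigma>) \<and> (\<exists>F\<in>facets D. \<forall>A\<in>\<sigma>. - F \<subseteq> A \<or> - F \<inter> A = {})}"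

text \<open>For total weight 1 this is the combination of the vectors that are 1 on \<open>A\<close>
  and -1 off \<open>A\<close>.\<close>

definition Wm :: "real ^ 'n::finite set \<Rightarrow> real ^ 'n" where
  "Wm x = (\<chi> i. 2 * hh x i - 1)"

definition gm :: "real ^ 'n::finite set \<Rightarrow> real ^ 'n" where
  "gm x = inverse (norm (Wm x)) *\<^sub>R Wm x"

lemma spx_Kc:
  assumes "facets D \<noteq> {}"
  shows "spx (Kc D)"
proof
  show "\<tau> \<in> Kc D" if st: "\<sigma> \<in> Kc D" "\<tau> \<subseteq> \<sigma>" for \<sigma> \<tau>
  proof -
    have s: "setchain \<sigma>" "\<not> ({} \<in> \<sigma> \<and> UNIV \<in> \<sigma>)" using that(1) by (simp_all add: Kc_def)
    obtain F where F: "F \<in> facets D" "\<forall>A\<in>\<sigma>. - F \<subseteq> A \<or> - F \<inter> A = {}" 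
      using st(1) unfolding Kc_def mem_Collect_eq by (elim conjE bexE)
    have "\<forall>A\<in>\<tau>. - F \<subseteq> A \<or> - F \<inter> A = {}" by (rule ballI) (rule bspec[OF F(2) subsetD[OF that(2)]])
    moreover have "setchain \<tau>" unfolding setchain_def
    proof (intro ballI)
      fix A B assume "A \<in> \<tau>" "B \<in> \<tau>"
      then have "A \<in> \<sigma>" "B \<in> \<sigma>" using that(2) by auto
      then show "A \<subseteq> B \<or> B \<subseteq> A" using s(1) by (simp add: setchain_def)
    qed
    moreover have "\<not> ({} \<in> \<tau> \<and> UNIV \<in> \<tau>)" using s(2) that(2) by auto
    ultimately show ?thesis unfolding Kc_def using F(1) by (intro CollectI conjI bexI[of _ F])
  qed
  show "{} \<in> Kc D" using assms by (auto simp: Kc_def setchain_def)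
  show "v \<subseteq> w \<or> w \<subseteq> v" if "\<sigma> \<in> Kc D" "v \<in> \<sigma>" "w \<in> \<sigma>" for \<sigma> v w
    using that by (simp add: Kc_def setchain_def)
qed

lemma Pol_Kc:
  assumes "x \<in> polyhedron_of (Kc D)"
  shows "\<And>B. 0 \<le> x $ B" "(\<Sum>B\<in>UNIV. x $ B) = 1" "setchain (spt x)" "\<not> ({} \<in> spt x \<and> UNIV \<in> spt x)"
    "\<exists>F\<in>facets D. \<forall>A\<in>spt x. - F \<subseteq> A \<or> - F \<inter> A = {}"
  using assms by (simp_all add: polyhedron_of_def Kc_def)

lemma hh_bounds:
  assumes "\<And>B. 0 \<le> x $ B" "(\<Sum>B\<in>UNIV. x $ B) = 1"
  shows "0 \<le> hh x i" "hh x i \<le> 1"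
proof -
  show "0 \<le> hh x i" unfolding hh_def by (intro sum_nonneg assms)
  have "hh x i \<le> (\<Sum>B\<in>UNIV. x $ B)" unfolding hh_def by (intro sum_mono2) (auto simp: assms(1))
  then show "hh x i \<le> 1" by (simp only: assms(2))
qed

lemma Wm_bound:
  assumes "x \<in> polyhedron_of (Kc D)"
  shows "\<bar>Wm x $ i\<bar> \<le> 1"
  using hh_bounds[OF Pol_Kc(1,2)[OF assms], of i] by (simp add: Wm_def abs_le_iff)

text \<open>An element of the smallest member of the flag has \<open>hh\<close> equal to 1. If that
  member is empty, the full set does not occur, and an element outside the largest member has
  \<open>hh\<close> equal to 0. Together with \<open>Wm_bound\<close> the maximum norm is exactly
  1.\<close>

lemma Wm_attains:
  assumes x: "x \<in> polyhedron_of (Kc D)"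
  obtains i where "\<bar>Wm x $ i\<bar> = 1"
proof -
  note P = Pol_Kc[OF x]
  have ne: "spt x \<noteq> {}"
  proof
    assume "spt x = {}"
    then have "x $ B = 0" for B by (auto simp: spt_def)
    then show False using P(2) by simp
  qed
  show ?thesis
  proof (cases "{} \<in> spt x")
    case False
    obtain A where A: "A \<in> spt x" "\<forall>B\<in>spt x. B \<subseteq> A \<longrightarrow> A = B" using finite_has_minimal[of "spt x"] ne by auto
    then obtain i where i: "i \<in> A" using False by (cases "A = {}") auto
    have "i \<in> B" if "B \<in> spt x" for B
    proof -
      have "A \<subseteq> B \<or> B \<subseteq> A" using P(3) A(1) that by (simp add: setchain_def)
      then have "A \<subseteq> B" using A(2) that by blast
      then show ?thesis using i by blast
    qed
    then have "hh x i = (\<Sum>B\<in>UNIV. x $ B)" unfolding hh_def by (intro sum.mono_neutral_left) (auto simp: spt_def)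
    then show ?thesis using P(2) by (intro that[of i]) (simp add: Wm_def)
  next
    case True
    then have "UNIV \<notin> spt x" using P(4) by simp
    obtain A where A: "A \<in> spt x" "\<forall>B\<in>spt x. A \<subseteq> B \<longrightarrow> A = B" using finite_has_maximal[of "spt x"] ne by auto
    then obtain i where i: "i \<notin> A" using \<open>UNIV \<notin> spt x\<close> by (cases "A = UNIV") auto
    have "i \<notin> B" if "B \<in> spt x" for B
    proof -
      have "A \<subseteq> B \<or> B \<subseteq> A" using P(3) A(1) that by (simp add: setchain_def)
      then have "B \<subseteq> A" using A(2) that by blast
      then show ?thesis using i by blast
    qed
    then have "hh x i = 0" unfolding hh_def by (intro sum.neutral) (auto simp: spt_def)
    then show ?thesis by (intro that[of i]) (simp add: Wm_def)
  qed
qed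

lemma Wm_norm_pos:
  assumes "x \<in> polyhedron_of (Kc D)"
  shows "0 < norm (Wm x)"
proof -
  obtain i where "\<bar>Wm x $ i\<bar> = 1" by (rule Wm_attains[OF assms])
  then have "Wm x \<noteq> 0" by auto
  then show ?thesis by simp
qed

text \<open>Equal images mean that \<open>Wm x\<close> and \<open>Wm y\<close> lie on one ray; both
  have maximum norm 1, so they coincide and \<open>hh_inj\<close> applies.\<close>

lemma gm_inj: "inj_on gm (polyhedron_of (Kc D))"
proof (rule inj_onI)
  fix x y assume x: "x \<in> polyhedron_of (Kc D)" and y: "y \<in> polyhedron_of (Kc D)" and g: "gm x = gm y"
  define a where "a = inverse (norm (Wm x))"
  define b where "b = inverse (norm (Wm y))"
  have pos: "0 < a" "0 < b" using Wm_norm_pos[OF x] Wm_norm_pos[OF y] by (simp_all add: a_def b_def)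
  have e: "a * Wm x $ i = b * Wm y $ i" for i
    using arg_cong[OF g, of "\<lambda>v. v $ i"] by (simp add: gm_def a_def b_def)
  have e': "a * \<bar>Wm x $ i\<bar> = b * \<bar>Wm y $ i\<bar>" for i
    using arg_cong[OF e[of i], of abs] pos by (simp add: abs_mult)
  obtain i where i: "\<bar>Wm x $ i\<bar> = 1" by (rule Wm_attains[OF x])
  obtain j where j: "\<bar>Wm y $ j\<bar> = 1" by (rule Wm_attains[OF y])
  have "a = b * \<bar>Wm y $ i\<bar>" using e'[of i] i by simp
  also have "\<dots> \<le> b * 1" by (rule mult_left_mono[OF Wm_bound[OF y]]) (use pos in simp)
  finally have "a \<le> b" by simp
  have "b = a * \<bar>Wm x $ j\<bar>" using e'[of j] j by simp
  also have "\<dots> \<le> a * 1" by (rule mult_left_mono[OF Wm_bound[OF x]]) (use pos in simp)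
  finally have "a = b" using \<open>a \<le> b\<close> by simp
  then have "Wm x $ i = Wm y $ i" for i using e[of i] pos by simp
  then have "hh x = hh y" by (intro ext) (simp add: Wm_def)
  then show "x = y"
    using Pol_Kc(1-3)[OF x] Pol_Kc(1-3)[OF y] by (intro hh_inj) simp_all
qed

lemma gm_continuous: "continuous_on (polyhedron_of (Kc D)) gm"
proof -
  have "continuous_on S Wm" for S :: "(real ^ 'a set) set"
    unfolding Wm_def[abs_def] hh_def by (intro continuous_intros)
  moreover have "\<forall>x\<in>polyhedron_of (Kc D). norm (Wm x) \<noteq> 0" using Wm_norm_pos by fastforce
  ultimately show ?thesis unfolding gm_def[abs_def] by (intro continuous_intros) auto
qed

lemma gm_into:
  assumes x: "x \<in> polyhedron_of (Kc D)"
  shows "gm x \<in> singularity_link D"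
proof -
  obtain F where F: "F \<in> facets D" "\<forall>A\<in>spt x. - F \<subseteq> A \<or> - F \<inter> A = {}" using Pol_Kc(5)[OF x] by blast
  have e: "hh x i = hh x j" if "i \<in> - F" "j \<in> - F" for i j
  proof -
    have "hh x i = (\<Sum>B\<in>UNIV. if i \<in> B then x $ B else 0)" for i by (simp add: hh_def sum.If_cases)
    moreover have "(if i \<in> B then x $ B else 0) = (if j \<in> B then x $ B else 0)" for B
    proof (cases "B \<in> spt x")
      case True
      then have "- F \<subseteq> B \<or> - F \<inter> B = {}" using F(2) by blast
      then have "i \<in> B \<longleftrightarrow> j \<in> B" using that by blast
      then show ?thesis by simp
    qed (simp add: spt_def)
    ultimately show ?thesis by simp
  qed
  have "gm x \<in> U_set (- F)"
    unfolding U_set_def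
  proof (intro CollectI ballI)
    fix i j assume "i \<in> - F" "j \<in> - F"
    from e[OF this] show "gm x $ i = gm x $ j" by (simp add: gm_def Wm_def)
  qed
  moreover have "norm (gm x) = 1" using Wm_norm_pos[OF x] by (simp add: gm_def)
  ultimately show ?thesis using F(1) by (auto simp: singularity_link_def)
qed

lemma gm_onto:
  assumes u: "u \<in> singularity_link D"
  shows "\<exists>x\<in>polyhedron_of (Kc D). gm x = u"
proof -
  obtain F where F: "F \<in> facets D" "u \<in> U_set (- F)" and nu: "norm u = 1" using u by (auto simp: singularity_link_def)
  define M where "M = Max (range (\<lambda>i. \<bar>u $ i\<bar>))"
  have le: "\<bar>u $ i\<bar> \<le> M" for i unfolding M_def by (rule Max_ge) auto
  have "M \<in> range (\<lambda>i. \<bar>u $ i\<bar>)" unfolding M_def by (rule Max_in) auto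
  then obtain i0 where i0: "M = \<bar>u $ i0\<bar>" by (rule rangeE)
  have M: "0 < M"
  proof (rule ccontr)
    assume "\<not> 0 < M"
    then have "u $ i = 0" for i using le[of i] by simp
    then have "u = 0" by (simp add: vec_eq_iff)
    then show False using nu by simp
  qed
  \<comment> \<open>Scaling to maximum norm 1, followed by the affine change from
    \<open>[-1, 1]\<close> to \<open>[0, 1]\<close> that inverts the formula of
    \<open>Wm\<close>.\<close>
  define h where "h i = (u $ i / M + 1) / 2" for i
  have b: "\<bar>u $ i / M\<bar> \<le> 1" for i using le[of i] M by (simp add: abs_divide)
  have h: "0 \<le> h i" "h i \<le> 1" for i
  proof -
    have a: "0 \<le> (t + 1) / 2 \<and> (t + 1) / 2 \<le> 1" if "\<bar>t\<bar> \<le> 1" for t :: real using that by (auto simp: abs_le_iff)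
    show "0 \<le> h i" "h i \<le> 1" using a[OF b[of i]] unfolding h_def by (rule conjunct1, rule conjunct2)
  qed
  have "u $ i0 = M \<or> u $ i0 = - M" using i0 by (auto simp: abs_if split: if_splits)
  then have h0: "h i0 = 0 \<or> h i0 = 1" using M by (auto simp: h_def)
  obtain x :: "real ^ 'a set" where x: "\<forall>B. 0 \<le> x $ B" "(\<Sum>B\<in>UNIV. x $ B) = 1" "hh x = h"
    "\<forall>B\<in>spt x. \<exists>s. 0 < s \<and> s \<le> 1 \<and> B = {i. s \<le> h i}"
    using layer_cake[of h 1, OF h(1) h(2) zero_le_one] by (elim exE conjE)
  have sub: "\<exists>s. 0 < s \<and> s \<le> 1 \<and> B = {i. s \<le> h i}" if "B \<in> spt x" for B using bspec[OF x(4) that] .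
  have "setchain (spt x)"
    unfolding setchain_def
  proof (intro ballI)
    fix A B assume "A \<in> spt x" "B \<in> spt x"
    then obtain s t where "A = {i. s \<le> h i}" "B = {i. t \<le> h i}" using sub[of A] sub[of B] by auto
    then show "A \<subseteq> B \<or> B \<subseteq> A" by (cases "s \<le> t") auto
  qed
  \<comment> \<open>At \<open>i0\<close> the value of \<open>h\<close> is 0 or 1. The value 1
    excludes the empty superlevel set, the value 0 the full one.\<close>
  moreover have "\<not> ({} \<in> spt x \<and> UNIV \<in> spt x)"
  proof
    assume "{} \<in> spt x \<and> UNIV \<in> spt x"
    then obtain s t where s: "s \<le> 1" "{} = {i. s \<le> h i}" and t: "0 < t" "UNIV = {i. t \<le> h i}"
      using sub[of "{}"] sub[of UNIV] by (elim conjE exE) auto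
    have "\<not> s \<le> h i0" using s(2) by blast
    moreover have "t \<le> h i0" using t(2) by blast
    ultimately show False using h0 s(1) t(1) by auto
  qed
  \<comment> \<open>Since \<open>u\<close> is constant on the complement of \<open>F\<close>, no
    superlevel set splits it.\<close>
  moreover have "\<forall>A\<in>spt x. - F \<subseteq> A \<or> - F \<inter> A = {}"
  proof
    fix A assume "A \<in> spt x"
    then obtain s where A: "A = {i. s \<le> h i}" using sub[of A] by auto
    have e: "h i = h j" if "i \<in> - F" "j \<in> - F" for i j
    proof -
      have "u $ i = u $ j" using F(2) that unfolding U_set_def by blast
      then show ?thesis by (simp add: h_def)
    qed
    have "i \<in> A \<longleftrightarrow> j \<in> A" if "i \<in> - F" "j \<in> - F" for i j
      by (simp only: A mem_Collect_eq e[OF that])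
    then show "- F \<subseteq> A \<or> - F \<inter> A = {}" by blast
  qed
  ultimately have xP: "x \<in> polyhedron_of (Kc D)" using x(1,2) F(1) by (auto simp: polyhedron_of_def Kc_def)
  have "Wm x = inverse M *\<^sub>R u" using M by (simp add: vec_eq_iff Wm_def x(3) h_def field_simps)
  then have "gm x = u" using M nu by (simp add: gm_def)
  then show ?thesis using xP by blast
qed

text \<open>A continuous bijection from a compact space onto a Hausdorff space; the inverse need not
  be written down.\<close>

lemma link_homeomorphic:
  assumes "facets D \<noteq> {}"
  shows "\<exists>g. homeomorphic_maps (top_of_set (polyhedron_of (Kc D))) (top_of_set (singularity_link D)) gm g"
proof -
  have "gm ` polyhedron_of (Kc D) = singularity_link D"
  proof
    show "gm ` polyhedron_of (Kc D) \<subseteq> singularity_link D" by (rule image_subsetI) (rule gm_into)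
    show "singularity_link D \<subseteq> gm ` polyhedron_of (Kc D)"
    proof
      fix u assume "u \<in> singularity_link D"
      from gm_onto[OF this] obtain x where "x \<in> polyhedron_of (Kc D)" "gm x = u" by (rule bexE)
      then show "u \<in> gm ` polyhedron_of (Kc D)" by (intro image_eqI[of _ _ x]) simp_all
    qed
  qed
  from homeomorphism_compact[OF spx.compact_Pol[OF spx_Kc[OF assms]] gm_continuous this gm_inj]
  obtain g where "homeomorphism (polyhedron_of (Kc D)) (singularity_link D) gm g" by (rule exE)
  then show ?thesis by (intro exI[of _ g]) (auto simp: homeomorphic_maps_def homeomorphism_def)
qed

section \<open>Flags and ordered partitions\<close>

text \<open>An ordered partition into \<open>B\<^sub>1, \<dots>, B\<^sub>r\<close> corresponds to the flag of its partial unions; merging two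
  neighbouring blocks deletes a member of the flag.\<close>

fun pun :: "'n set \<Rightarrow> 'n set list \<Rightarrow> 'n set list" where
  "pun P [] = []"
| "pun P (B # x) = (P \<union> B) # pun (P \<union> B) x"

text \<open>Successive differences, which invert \<open>pun\<close> on strictly increasing
  lists.\<close>

fun gps :: "'n set \<Rightarrow> 'n set list \<Rightarrow> 'n set list" where
  "gps P [] = []"
| "gps P (A # l) = (A - P) # gps A l"

lemma length_pun [simp]: "length (pun P x) = length x"
  by (induction x arbitrary: P) auto

lemma pun_append: "pun P (p @ q) = pun P p @ pun (P \<union> \<Union>(set p)) q"
  by (induction p arbitrary: P) (auto simp: Un_assoc)

lemma pun_mem: "A \<in> set (pun P x) \<Longrightarrow> P \<subseteq> A \<and> A \<subseteq> P \<union> \<Union>(set x)"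
  by (induction x arbitrary: P) (simp, fastforce)

lemma gps_pun: "owp V x \<Longrightarrow> P \<inter> V = {} \<Longrightarrow> gps P (pun P x) = x"
proof (induction x arbitrary: V P)
  case (Cons B x)
  have "P \<union> B - P = B" using Cons.prems by auto
  moreover have "gps (P \<union> B) (pun (P \<union> B) x) = x" by (rule Cons.IH[of "V - B"]) (use Cons.prems in auto)
  ultimately show ?case by simp
qed simp

lemma sorted_wrt_psubset2: "sorted_wrt (\<subset>) (x # y # zs) \<longleftrightarrow> x \<subset> y \<and> sorted_wrt (\<subset>) (y # zs)"
  by (rule sorted_wrt2) (auto simp: transp_def)

lemma pun_gps: "sorted_wrt (\<subset>) (P # l) \<Longrightarrow> pun P (gps P l) = l"
proof (induction l arbitrary: P)
  case (Cons A l)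
  then have "P \<subset> A" "sorted_wrt (\<subset>) (A # l)" by (simp_all only: sorted_wrt_psubset2)
  moreover from this have "P \<union> (A - P) = A" by auto
  ultimately show ?case using Cons.IH by simp
qed simp

lemma sorted_last: "sorted_wrt (\<subset>) (P # l) \<Longrightarrow> A \<in> set (P # l) \<Longrightarrow> A \<subseteq> last (P # l)"
proof (induction l arbitrary: P A)
  case (Cons B l)
  then have s: "P \<subset> B" "sorted_wrt (\<subset>) (B # l)" by (simp_all only: sorted_wrt_psubset2)
  have "B \<subseteq> last (B # l)" by (rule Cons.IH[OF s(2)]) simp
  then have P: "P \<subseteq> last (B # l)" using s(1) by blast
  have l: "last (P # B # l) = last (B # l)" by simp
  show ?case unfolding l
  proof (cases "A = P")
    case False
    then have "A \<in> set (B # l)" using Cons.prems(2) by simp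
    then show "A \<subseteq> last (B # l)" by (rule Cons.IH[OF s(2)])
  qed (use P in simp)
qed simp

lemma owp_gps: "sorted_wrt (\<subset>) (P # l) \<Longrightarrow> owp (last (P # l) - P) (gps P l)"
proof (induction l arbitrary: P)
  case (Cons A l)
  then have s: "P \<subset> A" "sorted_wrt (\<subset>) (A # l)" by (simp_all only: sorted_wrt_psubset2)
  have A: "A \<subseteq> last (A # l)" by (rule sorted_last[OF s(2)]) simp
  have e: "last (A # l) - P - (A - P) = last (A # l) - A" using s(1) by auto
  have "owp (last (A # l) - P - (A - P)) (gps A l)" unfolding e by (rule Cons.IH[OF s(2)])
  then show ?case using s(1) A by auto
qed simp

lemma pun_sorted: "owp V x \<Longrightarrow> P \<inter> V = {} \<Longrightarrow> sorted_wrt (\<subset>) (P # pun P x) \<and> last (P # pun P x) = P \<union> V"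
proof (induction x arbitrary: V P)
  case (Cons B x)
  have "sorted_wrt (\<subset>) ((P \<union> B) # pun (P \<union> B) x) \<and> last ((P \<union> B) # pun (P \<union> B) x) = (P \<union> B) \<union> (V - B)"
    by (rule Cons.IH) (use Cons.prems in auto)
  moreover have "P \<subset> P \<union> B" "(P \<union> B) \<union> (V - B) = P \<union> V" using Cons.prems by auto
  ultimately show ?case unfolding pun.simps sorted_wrt_psubset2 by simp
qed simp

lemma pun_mrg:
  assumes "Suc k < length x"
  shows "pun P (mrg k x) = del k (pun P x)"
proof -
  define p B C q where "p = take k x" and "B = x ! k" and "C = x ! Suc k" and "q = drop (Suc (Suc k)) x"
  have x: "x = p @ B # C # q" unfolding p_def B_def C_def q_def by (rule nth_decomp2[OF assms])
  have k: "k = length p" using assms by (simp add: p_def)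
  have l: "length (pun P p) = length p" by simp
  show ?thesis unfolding k x mrg_append by (simp add: pun_append del_def Un_assoc)
qed

text \<open>Merging at \<open>k\<close> deletes the \<open>k\<close>-th partial union. The one
  deletion that is not a merge removes the last entry, the full set, and cannot give
  \<open>pun {} x\<close>, which contains it.\<close>

lemma wbd_pun:
  assumes x: "owp UNIV x" and y: "owp (UNIV :: 'n set) y"
  shows "ldel (pun {} y) (pun {} x) = (wbd y x :: 'k::field)"
proof -
  have inj: "pun {} u = pun {} v \<longleftrightarrow> u = v" if "owp UNIV u" "owp UNIV v" for u v :: "'n set list"
  proof
    assume e: "pun {} u = pun {} v"
    have "u = gps {} (pun {} u)" by (rule gps_pun[OF that(1), symmetric]) simp
    also have "\<dots> = v" unfolding e by (rule gps_pun[OF that(2)]) simp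
    finally show "u = v" .
  qed simp
  have sx: "sorted_wrt (\<subset>) ({} # pun {} x) \<and> last ({} # pun {} x) = {} \<union> UNIV" by (rule pun_sorted[OF x]) simp
  have sy: "sorted_wrt (\<subset>) ({} # pun {} y) \<and> last ({} # pun {} y) = {} \<union> UNIV" by (rule pun_sorted[OF y]) simp
  obtain n where n: "length y = Suc n" using y by (cases y) auto
  have ny: "pun {} y \<noteq> []" using n by (cases y) simp_all
  have "del n (pun {} y) \<noteq> pun {} x"
  proof
    assume e: "del n (pun {} y) = pun {} x"
    have d: "del n (pun {} y) = butlast (pun {} y)" using n by (simp add: del_def butlast_conv_take)
    have "last (pun {} y) = UNIV" using sy ny by simp
    moreover have "sorted_wrt (\<subset>) (butlast (pun {} y) @ [last (pun {} y)])"
      unfolding append_butlast_last_id[OF ny] using sy by simp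
    ultimately have "sorted_wrt (\<subset>) (butlast (pun {} y) @ [UNIV])" by simp
    then have "UNIV \<notin> set (pun {} x)" unfolding e[symmetric] d sorted_wrt_append by auto
    moreover have "pun {} x \<noteq> []" using x by (cases x) auto
    then have "UNIV \<in> set (pun {} x)" using sx last_in_set[of "pun {} x"] by simp
    ultimately show False by simp
  qed
  then have "ldel (pun {} y) (pun {} x) = (\<Sum>k<n. if del k (pun {} y) = pun {} x then (-1) ^ k else (0 :: 'k))"
    by (simp add: ldel_def fbd_apply n)
  also have "\<dots> = (\<Sum>k<n. if mrg k y = x then (-1) ^ k else 0)"
  proof (rule sum.cong[OF refl])
    fix k assume "k \<in> {..<n}"
    then have k: "Suc k < length y" using n by simp
    have "owp UNIV (mrg k y)"
      unfolding mrg_def by (rule owp_merge) (use nth_decomp2[OF k] y in simp)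
    then have "del k (pun {} y) = pun {} x \<longleftrightarrow> mrg k y = x" unfolding pun_mrg[OF k, symmetric] by (rule inj[OF _ x])
    then show "(if del k (pun {} y) = pun {} x then (-1) ^ k else 0) = (if mrg k y = x then (-1) ^ k else (0 :: 'k))" by simp
  qed
  also have "\<dots> = wbd y x" by (simp add: wbd_def fbd_apply n)
  finally show ?thesis .
qed

lemma facet_above:
  assumes "finite D" "G \<in> D"
  obtains F where "F \<in> facets D" "G \<subseteq> F"
proof -
  obtain F where "F \<in> D" "G \<subseteq> F" "\<forall>H\<in>D. F \<subseteq> H \<longrightarrow> F = H" using finite_has_maximal2[OF assms] by blast
  then show ?thesis by (intro that[of F]) (auto simp: facets_def)
qed

text \<open>The first member of the flag that meets \<open>C\<close> contains it, so all of
  \<open>C\<close> falls into the corresponding difference.\<close>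

lemma gps_letter:
  assumes "\<forall>A\<in>set l. C \<subseteq> A \<or> C \<inter> A = {}" "C \<inter> P = {}" "C \<subseteq> last (P # l)" "C \<noteq> {}"
  shows "\<exists>B\<in>set (gps P l). C \<subseteq> B"
  using assms
proof (induction l arbitrary: P)
  case (Cons A l)
  show ?case
  proof (cases "C \<subseteq> A")
    case True
    then have "C \<subseteq> A - P" using Cons.prems(2) by blast
    then show ?thesis by simp
  next
    case False
    then have "C \<inter> A = {}" using Cons.prems(1) by simp
    then have "\<exists>B\<in>set (gps A l). C \<subseteq> B" using Cons.prems by (intro Cons.IH) auto
    then show ?thesis by simp
  qed
qed auto

definition LK :: "'n::finite set set \<Rightarrow> 'n set list set" where
  "LK D = {l. set l \<in> Kc D \<and> sorted_wrt (\<subset>) l}"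

definition GG :: "'n::finite set set \<Rightarrow> 'n set list set" where
  "GG D = {x. owp UNIV x \<and> (\<exists>B\<in>set x. - B \<in> D)}"

lemma sorted_setchain: "sorted_wrt (\<subset>) l \<Longrightarrow> setchain (set l)"
  unfolding setchain_def by (induction l) auto

lemma finite_sorted_lists: "finite {l :: 'n::finite set list. sorted_wrt (\<subset>) l}"
proof (rule finite_subset)
  show "{l :: 'n set list. sorted_wrt (\<subset>) l} \<subseteq> {l. set l \<subseteq> UNIV \<and> length l \<le> CARD('n set)}"
  proof
    fix l :: "'n set list" assume "l \<in> {l. sorted_wrt (\<subset>) l}"
    then have "distinct l" by (induction l) auto
    then have "length l = card (set l)" by (simp add: distinct_card)
    also have "\<dots> \<le> CARD('n set)" by (rule card_mono) auto
    finally show "l \<in> {l. set l \<subseteq> UNIV \<and> length l \<le> CARD('n set)}" by simp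
  qed
qed (rule finite_lists_length_le, simp)

lemma Kc_sub: "facets D \<noteq> {} \<Longrightarrow> \<sigma> \<in> Kc D \<Longrightarrow> \<tau> \<subseteq> \<sigma> \<Longrightarrow> \<tau> \<in> Kc D"
  by (rule spx.down[OF spx_Kc])

text \<open>No member of the flag splits the complement of a facet exactly when a single block
  contains it. A flag with the full set does not contain the empty one, so all differences are
  nonempty; and complements of facets are nonempty because the full set is not a face.\<close>

lemma pun_bij:
  assumes D: "finite D" "\<And>F G. F \<in> D \<Longrightarrow> G \<subseteq> F \<Longrightarrow> G \<in> D" "UNIV \<notin> D"
  shows "bij_betw (pun {}) (GG D) {l \<in> LK D. UNIV \<in> set l}"
proof (rule bij_betw_byWitness[where f' = "gps {}"])
  show "\<forall>x\<in>GG D. gps {} (pun {} x) = x" using gps_pun[of UNIV _ "{}"] by (auto simp: GG_def)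
  have s0: "sorted_wrt (\<subset>) ({} # l) \<and> last ({} # l) = UNIV \<and> {} \<notin> set l" if l: "l \<in> LK D" "UNIV \<in> set l" for l
  proof -
    have k: "sorted_wrt (\<subset>) l" "{} \<notin> set l" using l by (auto simp: LK_def Kc_def)
    have "\<forall>A\<in>set l. {} \<subset> A"
    proof
      fix A assume "A \<in> set l"
      then show "{} \<subset> A" using k(2) by (cases "A = {}") auto
    qed
    then have s: "sorted_wrt (\<subset>) ({} # l)" using k(1) by simp
    have "UNIV \<subseteq> last ({} # l)" by (rule sorted_last[OF s]) (use l(2) in simp)
    then show ?thesis using s k by blast
  qed
  show "\<forall>l\<in>{l \<in> LK D. UNIV \<in> set l}. pun {} (gps {} l) = l" using s0 pun_gps by blast
  show "pun {} ` GG D \<subseteq> {l \<in> LK D. UNIV \<in> set l}"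
  proof (rule image_subsetI)
    fix x assume x: "x \<in> GG D"
    then obtain B where B: "B \<in> set x" "- B \<in> D" and ox: "owp UNIV x" by (auto simp: GG_def)
    obtain F where F: "F \<in> facets D" "- B \<subseteq> F" by (rule facet_above[OF D(1) B(2)])
    obtain p q where pq: "x = p @ B # q" using B(1) by (meson split_list)
    have dis: "B \<inter> \<Union>(set p) = {}" using owp_disj[of UNIV p B q] ox pq by simp
    have s: "sorted_wrt (\<subset>) ({} # pun {} x) \<and> last ({} # pun {} x) = {} \<union> UNIV" by (rule pun_sorted[OF ox]) simp
    have ne: "pun {} x \<noteq> []" using pq by (cases p) auto
    have U: "UNIV \<in> set (pun {} x)" using s ne last_in_set[OF ne] by simp
    have E: "{} \<notin> set (pun {} x)" using s by auto
    have FB: "- F \<subseteq> B" using F(2) by auto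
    have "\<forall>A\<in>set (pun {} x). - F \<subseteq> A \<or> - F \<inter> A = {}"
    proof
      fix A assume "A \<in> set (pun {} x)"
      then consider "A \<in> set (pun {} p)" | "A = \<Union>(set p) \<union> B" | "A \<in> set (pun (\<Union>(set p) \<union> B) q)"
        unfolding pq pun_append by auto
      then show "- F \<subseteq> A \<or> - F \<inter> A = {}"
      proof cases
        case 1
        then have "A \<subseteq> \<Union>(set p)" using pun_mem[of A "{}" p] by simp
        then show ?thesis using dis FB by auto
      next
        case 2
        then show ?thesis using FB by auto
      next
        case 3
        then have "\<Union>(set p) \<union> B \<subseteq> A" using pun_mem[of A "\<Union>(set p) \<union> B" q] by simp
        then show ?thesis using FB by auto
      qed
    qed
    then have "set (pun {} x) \<in> Kc D" using F(1) E sorted_setchain[of "pun {} x"] s unfolding Kc_def by auto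
    then show "pun {} x \<in> {l \<in> LK D. UNIV \<in> set l}" using U s by (simp add: LK_def)
  qed
  show "gps {} ` {l \<in> LK D. UNIV \<in> set l} \<subseteq> GG D"
  proof (rule image_subsetI)
    fix l assume l: "l \<in> {l \<in> LK D. UNIV \<in> set l}"
    then have m: "l \<in> LK D" "UNIV \<in> set l" by simp_all
    have s: "sorted_wrt (\<subset>) ({} # l)" "last ({} # l) = UNIV"
      by (rule conjunct1[OF s0[OF m]], rule conjunct1[OF conjunct2[OF s0[OF m]]])
    have "set l \<in> Kc D" using l by (simp add: LK_def)
    then obtain F where F: "F \<in> facets D" "\<forall>A\<in>set l. - F \<subseteq> A \<or> - F \<inter> A = {}" unfolding Kc_def mem_Collect_eq by (elim conjE bexE)
    have FD: "F \<in> D" using F(1) by (simp add: facets_def)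
    have "- F \<noteq> {}"
    proof
      assume "- F = {}"
      then have "F = UNIV" by (metis double_compl Compl_empty_eq)
      then show False using FD D(3) by simp
    qed
    then obtain B where B: "B \<in> set (gps {} l)" "- F \<subseteq> B" using gps_letter[of l "- F" "{}"] F(2) s(2) by auto
    have "- B \<in> D" by (rule D(2)[OF FD]) (use B(2) in blast)
    moreover have "owp UNIV (gps {} l)" using owp_gps[OF s(1)] s(2) by simp
    ultimately show "gps {} l \<in> GG D" using B(1) by (auto simp: GG_def)
  qed
qed

lemma del_LK:
  assumes "facets D \<noteq> {}" "l \<in> LK D"
  shows "del k l \<in> LK D"
proof -
  have "set l \<in> Kc D" "sorted_wrt (\<subset>) l" using assms(2) by (simp_all add: LK_def)
  then have "set (del k l) \<in> Kc D \<and> sorted_wrt (\<subset>) (del k l)"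
    by (intro conjI Kc_sub[OF assms(1) _ set_del] spx.sorted_del[OF spx_Kc[OF assms(1)]])
  then show ?thesis by (simp add: LK_def)
qed

text \<open>The matching removes the empty set, which always comes first. Each list with it has
  exactly one face without it, so the incidence matrix is the identity and the empty relation serves
  as order.\<close>

lemma no_top_acyc:
  assumes ne: "facets D \<noteq> {}"
  shows "acyc (ldel :: _ \<Rightarrow> _ \<Rightarrow> 'k::field) {l \<in> LK D. UNIV \<notin> set l}"
proof -
  let ?N = "{l \<in> LK D. UNIV \<notin> set l}"
  let ?A = "{l \<in> LK D. UNIV \<notin> set l \<and> {} \<notin> set l}" and ?B = "{l \<in> LK D. UNIV \<notin> set l \<and> {} \<in> set l}"
  have N: "?N = ?A \<union> ?B" by auto
  have hd: "\<exists>l'. b = {} # l' \<and> {} \<notin> set l'" if "b \<in> ?B" for b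
  proof -
    have s: "sorted_wrt (\<subset>) b" "{} \<in> set b" using that by (auto simp: LK_def)
    then obtain a l' where b: "b = a # l'" by (cases b) auto
    have "a = {}" "{} \<notin> set l'" using s unfolding b by auto
    then show ?thesis using b by simp
  qed
  have coef: "ldel ({} # l) l' = (if l' = l then 1 else 0 :: 'k)" if l': "{} \<notin> set l'" for l l' :: "'a set list"
  proof -
    have "ldel ({} # l) l' = (\<Sum>k<Suc (length l). if del k ({} # l) = l' then (-1) ^ k else (0 :: 'k))"
      by (simp add: ldel_def fbd_apply)
    also have "\<dots> = (if l = l' then 1 else 0) + (\<Sum>k<length l. if del (Suc k) ({} # l) = l' then (-1) ^ Suc k else 0)"
      unfolding sum.lessThan_Suc_shift by (simp add: del_def)
    also have "(\<Sum>k<length l. if del (Suc k) ({} # l) = l' then (-1) ^ Suc k else (0 :: 'k)) = 0"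
    proof (rule sum.neutral, rule ballI)
      fix k
      have "{} \<in> set (del (Suc k) ({} # l))" by (simp add: del_def)
      then show "(if del (Suc k) ({} # l) = l' then (-1) ^ Suc k else (0 :: 'k)) = 0" using l' by auto
    qed
    finally show ?thesis by auto
  qed
  show ?thesis unfolding N
  proof (rule acyc_matching[where \<mu> = tl and R = "{}"])
    have "subcplx (ldel :: _ \<Rightarrow> _ \<Rightarrow> 'k) ?N UNIV"
    proof (rule subcplx_ldelI)
      fix k l assume "l \<in> ?N"
      then show "del k l \<in> ?N" using del_LK[OF ne, of l k] set_del[of k l] by auto
    qed simp
    then show "cplx (ldel :: _ \<Rightarrow> _ \<Rightarrow> 'k) (?A \<union> ?B)" unfolding N[symmetric] by (rule cplx_sub[OF cplx_ldel])
    show "finite ?B" by (rule finite_subset[OF _ finite_sorted_lists]) (auto simp: LK_def)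
    show "bij_betw tl ?B ?A"
    proof (rule bij_betw_byWitness[where f' = "Cons {}"])
      show "\<forall>b\<in>?B. {} # tl b = b" using hd by fastforce
      show "tl ` ?B \<subseteq> ?A"
      proof (rule image_subsetI)
        fix b assume b: "b \<in> ?B"
        then obtain l' where l': "b = {} # l'" "{} \<notin> set l'" using hd by blast
        have "del 0 b \<in> LK D" using b by (intro del_LK[OF ne]) simp
        then show "tl b \<in> ?A" using b l' by (simp add: del_def)
      qed
      show "Cons {} ` ?A \<subseteq> ?B"
      proof (rule image_subsetI)
        fix l assume l: "l \<in> ?A"
        then have k: "set l \<in> Kc D" "sorted_wrt (\<subset>) l" "{} \<notin> set l" "UNIV \<notin> set l" by (auto simp: LK_def)
        have "\<forall>A\<in>set l. {} \<subset> A"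
        proof
          fix A assume "A \<in> set l"
          then show "{} \<subset> A" using k(3) by (cases "A = {}") auto
        qed
        then have s: "sorted_wrt (\<subset>) ({} # l)" using k(2) by simp
        obtain F where F: "F \<in> facets D" "\<forall>A\<in>set l. - F \<subseteq> A \<or> - F \<inter> A = {}"
          using k(1) unfolding Kc_def mem_Collect_eq by (elim conjE bexE)
        have U: "UNIV \<notin> set ({} # l)" using k(4) by auto
        have "\<forall>A\<in>set ({} # l). - F \<subseteq> A \<or> - F \<inter> A = {}" using F(2) by simp
        then have "set ({} # l) \<in> Kc D" unfolding Kc_def using sorted_setchain[OF s] U F(1) by (intro CollectI conjI bexI[of _ F]) simp_all
        then show "{} # l \<in> ?B" using s U by (simp add: LK_def)
      qed
    qed simp
    show "ldel b (tl b) \<noteq> (0 :: 'k)" if "b \<in> ?B" for b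
      using hd[OF that] coef by auto
    show "(b, b') \<in> {}" if bb: "b \<in> ?B" "b' \<in> ?B" "b \<noteq> b'" "ldel b' (tl b) \<noteq> (0 :: 'k)" for b b'
    proof -
      obtain l l' where l: "b = {} # l" "{} \<notin> set l" "b' = {} # l'" using hd[OF bb(1)] hd[OF bb(2)] by blast
      then have "l = l'" using that(4) coef[OF l(2), of l'] by (simp split: if_splits)
      then show ?thesis using that(3) l by simp
    qed
  qed auto
qed

text \<open>A partition and its flag have the same length, so the relabelling of the flags with the
  full set involves no shift of degree.\<close>

lemma link_hd_dim:
  assumes D: "finite D" "\<And>F G. F \<in> D \<Longrightarrow> G \<subseteq> F \<Longrightarrow> G \<in> D" "UNIV \<notin> D" and ne: "facets D \<noteq> {}"
    and h: "hd_dim (wbd :: _ \<Rightarrow> _ \<Rightarrow> 'k::field) (GG D) m n"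
  shows "hd_dim (ldel :: _ \<Rightarrow> _ \<Rightarrow> 'k) (LK D) m n"
proof (rule hd_dim_quot)
  let ?N = "{l \<in> LK D. UNIV \<notin> set l}"
  have "subcplx (ldel :: _ \<Rightarrow> _ \<Rightarrow> 'k) (LK D) UNIV" by (rule subcplx_ldelI) (auto intro: del_LK[OF ne])
  then show "cplx (ldel :: _ \<Rightarrow> _ \<Rightarrow> 'k) (LK D)" by (rule cplx_sub[OF cplx_ldel])
  show "subcplx (ldel :: _ \<Rightarrow> _ \<Rightarrow> 'k) ?N (LK D)"
  proof (rule subcplx_ldelI)
    fix k l assume "l \<in> ?N" "del k l \<in> LK D"
    then show "del k l \<in> ?N" using set_del[of k l] by auto
  qed auto
  show "acyc (ldel :: _ \<Rightarrow> _ \<Rightarrow> 'k) ?N" by (rule no_top_acyc[OF ne])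
  have e: "LK D - ?N = {l \<in> LK D. UNIV \<in> set l}" by auto
  have "hd_dim (ldel :: _ \<Rightarrow> _ \<Rightarrow> 'k) {l \<in> LK D. UNIV \<in> set l} (m + 0) n"
  proof (rule hd_dim_relabel[where f = "pun {}" and \<epsilon> = 1, OF pun_bij[OF D] _ _ _ h])
    show "ldel (pun {} y) (pun {} x) = 1 * (wbd y x :: 'k)" if "x \<in> GG D" "y \<in> GG D" for x y
      using wbd_pun[of x y] that by (simp add: GG_def)
  qed simp_all
  then show "hd_dim (ldel :: _ \<Rightarrow> _ \<Rightarrow> 'k) (LK D - ?N) m n" unfolding e by simp
qed

section \<open>Shellings\<close>

text \<open>The faces that are new with the facet \<open>Fs ! j\<close> are those between
  \<open>Fs ! j - shelling_G Fs j\<close>, the restriction of the facet, and \<open>Fs ! j\<close>.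
  Complements turn these into the intervals of the locale, and the least index picks the facet with
  which a face first appears.\<close>

lemma shelled_of_shelling:
  fixes D :: "'n::finite set set" and Fs :: "'n set list"
  assumes D: "simplicial_complex D" and dim: "\<forall>F\<in>D. card F + 2 \<le> CARD('n)" and sh: "shelling D Fs"
  shows "shelled {B. - B \<in> D} (length Fs) (\<lambda>j. - (Fs ! j)) (shelling_G Fs)
    (\<lambda>B. LEAST j. j < length Fs \<and> - B \<subseteq> Fs ! j)"
proof -
  let ?q = "length Fs"
  let ?J = "\<lambda>B. LEAST j. j < ?q \<and> - B \<subseteq> Fs ! j"
  have sub: "G \<in> D" if "F \<in> D" "G \<subseteq> F" for F G using D that by (auto simp: simplicial_complex_def)
  have fac: "Fs ! j \<in> facets D" if "j < ?q" for j using sh that unfolding shelling_def by (metis nth_mem)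
  have facD: "Fs ! j \<in> D" if "j < ?q" for j using fac[OF that] by (simp add: facets_def)
  have Gsub: "shelling_G Fs j \<subseteq> Fs ! j" for j by (auto simp: shelling_G_def)
  have least: "?J B < ?q \<and> - B \<subseteq> Fs ! (?J B)" if B: "- B \<in> D" for B
  proof -
    obtain F where F: "F \<in> facets D" "- B \<subseteq> F" by (rule facet_above[OF _ B]) simp
    then have "F \<in> set Fs" using sh by (simp add: shelling_def)
    then obtain j where "j < ?q" "F = Fs ! j" by (metis in_set_conv_nth)
    then have "j < ?q \<and> - B \<subseteq> Fs ! j" using F(2) by simp
    then show ?thesis by (rule LeastI)
  qed
  have le: "?J B \<le> j" if "j < ?q" "- B \<subseteq> Fs ! j" for B j by (rule Least_le) (use that in simp)
  \<comment> \<open>A vertex \<open>v\<close> of the facet outside \<open>shelling_G Fs j\<close> is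
    missing from some old wall, which must be \<open>Fs ! j - {v}\<close>. A new face is not
    contained in this wall and so contains \<open>v\<close>.\<close>
  have cov: "Fs ! j - shelling_G Fs j \<subseteq> t" if t: "t \<subseteq> Fs ! j" "\<And>i. i < j \<Longrightarrow> \<not> t \<subseteq> Fs ! i" for j t
  proof
    fix v assume v: "v \<in> Fs ! j - shelling_G Fs j"
    have "j \<noteq> 0"
    proof
      assume "j = 0"
      then show False using v by (simp add: shelling_G_def)
    qed
    then obtain W i where W: "W \<subseteq> Fs ! j" "card W + 1 = card (Fs ! j)" "i < j" "W \<subseteq> Fs ! i" "v \<notin> W"
      using v by (auto simp: shelling_G_def)
    have "W \<subseteq> Fs ! j - {v}" using W(1,5) by auto
    moreover have "card (Fs ! j - {v}) = card W" using W(2) v by simp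
    ultimately have "W = Fs ! j - {v}" by (intro card_subset_eq) simp_all
    then show "v \<in> t" using t(2)[OF W(3)] W(4) t(1) by blast
  qed
  \<comment> \<open>If \<open>t\<close> were old, purity would put it into an old wall
    \<open>H\<close>. This wall contains the intersection of all old walls and, through
    \<open>t\<close>, the rest of \<open>Fs ! j\<close>, hence the whole facet.\<close>
  have uniq: "\<not> t \<subseteq> Fs ! i" if j: "j < ?q" and i: "i < j" and t: "t \<subseteq> Fs ! j" "Fs ! j - shelling_G Fs j \<subseteq> t" for i j t
  proof
    assume ti: "t \<subseteq> Fs ! i"
    let ?C = "(\<Union>i<j. Pow (Fs ! i)) \<inter> Pow (Fs ! j)"
    have "t \<in> ?C" using ti t(1) i by auto
    then obtain H where H: "H \<in> facets ?C" "t \<subseteq> H" by (rule facet_above[of ?C t, rotated]) simp_all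
    have HC: "H \<in> ?C" using H(1) by (simp add: facets_def)
    then obtain i' where i': "i' < j" "H \<subseteq> Fs ! i'" "H \<subseteq> Fs ! j" by auto
    have "pure_card ?C (card (Fs ! j) - 1)" using sh i j by (simp add: shelling_def)
    then have cH: "card H = card (Fs ! j) - 1" using H(1) by (simp add: pure_card_def)
    \<comment> \<open>The cardinality of a wall is a truncated difference, so an empty facet has to
      be excluded; it would be contained in the other facet.\<close>
    have "Fs ! j \<noteq> {}"
    proof
      assume e: "Fs ! j = {}"
      then have "Fs ! i = Fs ! j" using fac[OF j] facD[of i] i j by (auto simp: facets_def)
      moreover have "distinct Fs" using sh by (simp add: shelling_def)
      ultimately show False using i j by (simp add: nth_eq_iff_index_eq)
    qed
    then have "0 < card (Fs ! j)" by (simp add: card_gt_0_iff)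
    then have w: "card H + 1 = card (Fs ! j)" using cH by simp
    have "shelling_G Fs j \<subseteq> H"
    proof
      fix v assume "v \<in> shelling_G Fs j"
      then show "v \<in> H" using i i' w by (auto simp: shelling_G_def)
    qed
    then have "Fs ! j \<subseteq> H" using t(2) H(2) by blast
    then have "card (Fs ! j) \<le> card H" by (intro card_mono) simp_all
    then show False using w by simp
  qed
  show ?thesis
  proof
    fix B assume "B \<in> {B. - B \<in> D}"
    then have l: "?J B < ?q" "- B \<subseteq> Fs ! (?J B)" using least[of B] by simp_all
    have nl: "\<not> - B \<subseteq> Fs ! i" if "i < ?J B" for i
    proof
      assume "- B \<subseteq> Fs ! i"
      then have "?J B \<le> i" using that l(1) by (intro le) simp_all
      then show False using that by simp
    qed
    have "Fs ! (?J B) - shelling_G Fs (?J B) \<subseteq> - B" by (rule cov[OF l(2) nl])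
    then show "?J B < ?q \<and> - (Fs ! (?J B)) \<subseteq> B \<and> B \<subseteq> - (Fs ! (?J B)) \<union> shelling_G Fs (?J B)"
      using l by blast
  next
    fix j B assume j: "j < ?q" and B: "- (Fs ! j) \<subseteq> B" "B \<subseteq> - (Fs ! j) \<union> shelling_G Fs j"
    have t: "- B \<subseteq> Fs ! j" "Fs ! j - shelling_G Fs j \<subseteq> - B" using B by blast+
    have BD: "- B \<in> D" by (rule sub[OF facD[OF j] t(1)])
    have "?J B = j"
    proof (rule antisym)
      show "?J B \<le> j" by (rule le[OF j t(1)])
      show "j \<le> ?J B" using uniq[OF j _ t, of "?J B"] least[OF BD] by (meson not_le)
    qed
    then show "B \<in> {B. - B \<in> D} \<and> ?J B = j" using BD by simp
  next
    fix j assume j: "j < ?q"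
    show "shelling_G Fs j \<inter> - (Fs ! j) = {}" using Gsub[of j] by blast
    have "card (Fs ! j) + 2 \<le> CARD('n)" using dim facD[OF j] by blast
    then show "2 \<le> card (- (Fs ! j))" by (simp add: Compl_eq_Diff_UNIV card_Diff_subset)
  next
    fix j B assume j: "j < ?q" and B: "B \<subset> - (Fs ! j)"
    show "B \<notin> {B. - B \<in> D}"
    proof
      assume "B \<in> {B. - B \<in> D}"
      moreover have "Fs ! j \<subseteq> - B" using B by blast
      ultimately have "- B = Fs ! j" using fac[OF j] by (simp add: facets_def)
      then show False using B by blast
    qed
  next
    fix B C assume "B \<in> {B. - B \<in> D}" and BC: "B \<subseteq> C"
    then show "C \<in> {B. - B \<in> D}" using sub[of "- B" "- C"] by auto
  next
    fix B C assume B: "B \<in> {B. - B \<in> D}" and BC: "B \<subseteq> C"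
    then have "?J B < ?q" "- B \<subseteq> Fs ! (?J B)" using least[of B] by simp_all
    then show "?J C \<le> ?J B" using BC by (intro le) auto
  qed
qed

context shelled
begin

lemma TT_Diff: "t \<in> TT (V - S) \<longleftrightarrow> t \<in> TT V \<and> S \<inter> fst t = {}"
  by (auto simp: TT_def)

lemma all_pairs_less_Suc:
  "(\<forall>a<Suc n. \<forall>b<Suc n. a \<noteq> b \<longrightarrow> Q a b) \<longleftrightarrow>
     (\<forall>b<n. Q 0 (Suc b)) \<and> (\<forall>b<n. Q (Suc b) 0) \<and> (\<forall>a<n. \<forall>b<n. a \<noteq> b \<longrightarrow> Q (Suc a) (Suc b))"
  by (auto simp: All_less_Suc2)

text \<open>Pairwise disjointness amounts to shrinking the ground set after each pair, by
  \<open>TT_Diff\<close>.\<close>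

lemma dcp_iff:
  "dcp V ds \<longleftrightarrow> (\<forall>a<length ds. \<forall>b<length ds. a \<noteq> b \<longrightarrow> fst (ds ! a) \<inter> fst (ds ! b) = {}) \<and> (\<forall>t\<in>set ds. t \<in> TT V)"
proof (induction ds arbitrary: V)
  case (Cons t ds)
  have 1: "(\<forall>t'\<in>set ds. fst t \<inter> fst t' = {}) \<longleftrightarrow> (\<forall>b<length ds. fst t \<inter> fst (ds ! b) = {})"
    by (rule all_set_conv_all_nth)
  have 2: "(\<forall>a<length (t # ds). \<forall>b<length (t # ds). a \<noteq> b \<longrightarrow> fst ((t # ds) ! a) \<inter> fst ((t # ds) ! b) = {}) \<longleftrightarrow>
      (\<forall>b<length ds. fst t \<inter> fst (ds ! b) = {}) \<and> (\<forall>a<length ds. \<forall>b<length ds. a \<noteq> b \<longrightarrow> fst (ds ! a) \<inter> fst (ds ! b) = {})"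
    unfolding length_Cons all_pairs_less_Suc nth_Cons_0 nth_Cons_Suc by (simp add: Int_commute[of _ "fst t"])
  show ?case unfolding dcp.simps Cons.IH 2 1[symmetric] using TT_Diff by auto
qed simp

end

theorem theorem5p4:
  fixes D :: "'n::finite set set" and Fs :: "'n set list" and i :: nat
  assumes "simplicial_complex D"
    and "\<forall>F\<in>D. card F + 2 \<le> CARD('n)"
    and "shelling D Fs"
  shows "reduced_homology_dim TYPE('k::field) (subtopology euclidean (singularity_link D)) i
           (card {ds. ds \<noteq> [] \<and> shelling_trapped_decomp Fs ds \<and>
              int i = int CARD('n) + int (length ds) * (2 - int CARD('n))
                      + (\<Sum>(S, j)\<leftarrow>ds. int (card (Fs ! j))) - 2})"
    (is "reduced_homology_dim _ _ _ (card ?X)")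
proof -
  have sub: "G \<in> D" if "F \<in> D" "G \<subseteq> F" for F G using assms(1) that by (auto simp: simplicial_complex_def)
  have U: "UNIV \<notin> D" using assms(2) by fastforce
  obtain F0 where "F0 \<in> D" using assms(1) by (auto simp: simplicial_complex_def)
  then have ne: "facets D \<noteq> {}" using facet_above[of D F0] by auto
  interpret shelled "{B. - B \<in> D}" "length Fs" "\<lambda>j. - (Fs ! j)" "shelling_G Fs"
    "\<lambda>B. LEAST j. j < length Fs \<and> - B \<subseteq> Fs ! j"
    by (rule shelled_of_shelling[OF assms])
  have wt: "wt ds = int (length ds) * (2 - int CARD('n)) + (\<Sum>(S, j)\<leftarrow>ds. int (card (Fs ! j)))" for ds
  proof (induction ds)
    case (Cons t ds)
    have "card (Fs ! snd t) \<le> CARD('n)" by (rule card_mono) auto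
    then have "int (card (- (Fs ! snd t))) = int CARD('n) - int (card (Fs ! snd t))" by (simp add: Compl_eq_Diff_UNIV card_Diff_subset of_nat_diff)
    then show ?case using Cons.IH by (simp add: split_def algebra_simps)
  qed simp
  have std: "shelling_trapped_decomp Fs ds \<longleftrightarrow> dcp UNIV ds" for ds
  proof -
    have "(case t of (S, j) \<Rightarrow> j < length Fs \<and> shelling_G Fs j \<subseteq> - S \<and> - S \<subseteq> Fs ! j) \<longleftrightarrow> t \<in> TT UNIV" for t
      by (cases t) (auto simp: TT_def)
    then show ?thesis unfolding shelling_trapped_decomp_def dcp_iff by simp
  qed
  \<comment> \<open>The \<open>- 2\<close> of the formula: one unit comes from \<open>NG\<close>,
    the other from words of length \<open>Suc i\<close> being simplices of dimension
    \<open>i\<close>.\<close>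
  have X: "card ?X = NG UNIV (Suc i)"
    unfolding NG_def by (rule arg_cong[where f = card]) (auto simp: std wt)
  have "hd_dim (wbd :: _ \<Rightarrow> _ \<Rightarrow> 'k) (Gam UNIV) (Suc i) (NG UNIV (Suc i))" by (rule hd_dim_Gam)
  moreover have "Gam UNIV = GG D" by (auto simp: Gam_def GG_def lam_def)
  ultimately have "hd_dim (wbd :: _ \<Rightarrow> _ \<Rightarrow> 'k) (GG D) (Suc i) (NG UNIV (Suc i))" by simp
  then have "hd_dim (ldel :: _ \<Rightarrow> _ \<Rightarrow> 'k) (LK D) (Suc i) (NG UNIV (Suc i))"
    by (rule link_hd_dim[OF _ sub U ne, rotated -1]) simp_all
  moreover have "LK D = spx.Ls (Kc D)" unfolding LK_def spx.Ls_def[OF spx_Kc[OF ne]] ..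
  ultimately have "hd_dim (ldel :: _ \<Rightarrow> _ \<Rightarrow> 'k) (spx.Ls (Kc D)) (Suc i) (NG UNIV (Suc i))" by simp
  from spx.simplicial_singular[OF spx_Kc[OF ne] this]
  have P: "reduced_homology_dim TYPE('k) (top_of_set (polyhedron_of (Kc D))) i (NG UNIV (Suc i))" .
  obtain g where "homeomorphic_maps (top_of_set (polyhedron_of (Kc D))) (top_of_set (singularity_link D)) gm g"
    using link_homeomorphic[OF ne] by (rule exE)
  from homeomorphic_reduced_homology[OF this P] show ?thesis unfolding X .
qed

end
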